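(* For any quantum automaton $\mathcal{A}$ and any $\lambda\in[0,1)$: (1) it is decidable whether $\mathcal{L}^{>\lambda}(\mathcal{A}|\mathrm{ND})=\emptyset$; (2) it is decidable whether $\mathcal{L}^{>\lambda}(\mathcal{A}|\mathrm{D})=\emptyset$.
   Context: A quantum automaton is a tuple $\mathcal{A}=(\mathcal{H},|s_0\rangle,\Sigma,\{U_\sigma:\sigma\in\Sigma\},F)$ where $\mathcal{H}$ is a finite-dimensional complex Hilbert space, $|s_0\rangle$ a unit vector, $\Sigma$ a finite alphabet, each $U_\sigma$ unitary, and $F$ a subspace. For decidability, the automaton (the vector $|s_0\rangle$, the matrices $U_\sigma$ and a basis of $F$) is given with algebraic-number entries, and $\lambda$ is given as part of the input. For $w=\sigma_1\sigma_2\cdots\in\Sigma^\omega$: Non-disturbing: run $|s_n\rangle=U_{\sigma_n}\cdots U_{\sigma_1}|s_0\rangle$, $f^{\mathrm{ND}}_{\mathcal{A}}(w)=\sup_{|\psi\rangle}\sup_{\{n_i\}}\inf_{i\ge1}|\langle\psi|s_{n_i}\rangle|^2$ (sup over unit $|\psi\rangle\in F$ and strictly increasing $0\le n_1<n_2<\cdots$). Disturbing: for unit $|\psi\rangle\in F$ and checkpoints $\{n_i\}$, run $|s_0\rangle$ and for $n\ge1$: $|s_n\rangle=U_{\sigma_n}|\psi\rangle$ if $n-1=n_i$ for some $i$, else $U_{\sigma_n}|s_{n-1}\rangle$; $f^{\mathrm{D}}_{\mathcal{A}}(w)=\sup_{|\psi\rangle}\sup_{\{n_i\}}\inf_{i\ge1}|\langle\psi|s_{n_i}\rangle|^2$.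 $\mathcal{L}^{>\lambda}(\mathcal{A}|X)=\{w\in\Sigma^\omega:f^X_{\mathcal{A}}(w)>\lambda\}$ for $X\in\{\mathrm{ND},\mathrm{D}\}$. *)

theory Defs
  imports Complex_Main "HOL-Library.Extended_Real" "HOL-Library.Nat_Bijection"
begin

section \<open>Quantum automata over C^d (vectors as nat => complex, only indices < d matter)\<close>

definition cinner :: "nat \<Rightarrow> (nat \<Rightarrow> complex) \<Rightarrow> (nat \<Rightarrow> complex) \<Rightarrow> complex" where
  "cinner d x y = (\<Sum>j<d. cnj (x j) * y j)"

definition unit_vec :: "nat \<Rightarrow> (nat \<Rightarrow> complex) \<Rightarrow> bool" where
  "unit_vec d x \<longleftrightarrow> (\<Sum>j<d. (cmod (x j))^2) = 1"

definition mat_vec :: "nat \<Rightarrow> (nat \<Rightarrow> nat \<Rightarrow> complex) \<Rightarrow> (nat \<Rightarrow> complex) \<Rightarrow> (nat \<Rightarrow> complex)" where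
  "mat_vec d A x = (\<lambda>i. \<Sum>j<d. A i j * x j)"

definition unitary_mat :: "nat \<Rightarrow> (nat \<Rightarrow> nat \<Rightarrow> complex) \<Rightarrow> bool" where
  "unitary_mat d A \<longleftrightarrow>
     (\<forall>i<d. \<forall>j<d. (\<Sum>l<d. cnj (A l i) * A l j) = (if i = j then 1 else 0))"

definition in_span :: "nat \<Rightarrow> (nat \<Rightarrow> complex) list \<Rightarrow> (nat \<Rightarrow> complex) \<Rightarrow> bool" where
  "in_span d B x \<longleftrightarrow> (\<exists>c. \<forall>j<d. x j = (\<Sum>l<length B. c l * (B ! l) j))"

text \<open>Words: w i is the (i+1)-th letter sigma_(i+1); U maps letters to matrices.\<close>
fun nd_run :: "nat \<Rightarrow> (nat \<Rightarrow> nat \<Rightarrow> nat \<Rightarrow> complex) \<Rightarrow> (nat \<Rightarrow> nat)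
    \<Rightarrow> (nat \<Rightarrow> complex) \<Rightarrow> nat \<Rightarrow> (nat \<Rightarrow> complex)" where
  "nd_run d U w s0 0 = s0"
| "nd_run d U w s0 (Suc m) = mat_vec d (U (w m)) (nd_run d U w s0 m)"

text \<open>Disturbing run: checkpoints are N 0 < N 1 < ... (N i is n_(i+1)).\<close>
fun d_run :: "nat \<Rightarrow> (nat \<Rightarrow> nat \<Rightarrow> nat \<Rightarrow> complex) \<Rightarrow> (nat \<Rightarrow> nat)
    \<Rightarrow> (nat \<Rightarrow> complex) \<Rightarrow> (nat \<Rightarrow> complex) \<Rightarrow> (nat \<Rightarrow> nat) \<Rightarrow> nat \<Rightarrow> (nat \<Rightarrow> complex)" where
  "d_run d U w s0 \<psi> N 0 = s0"
| "d_run d U w s0 \<psi> N (Suc m) =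
     mat_vec d (U (w m)) (if m \<in> range N then \<psi> else d_run d U w s0 \<psi> N m)"

definition f_ND :: "nat \<Rightarrow> (nat \<Rightarrow> nat \<Rightarrow> nat \<Rightarrow> complex) \<Rightarrow> (nat \<Rightarrow> complex) list
    \<Rightarrow> (nat \<Rightarrow> complex) \<Rightarrow> (nat \<Rightarrow> nat) \<Rightarrow> ereal" where
  "f_ND d U B s0 w =
     (SUP \<psi>\<in>{\<psi>. unit_vec d \<psi> \<and> in_span d B \<psi>}. SUP N\<in>{N::nat\<Rightarrow>nat. strict_mono N}.
        INF i. ereal ((cmod (cinner d \<psi> (nd_run d U w s0 (N i))))^2))"

definition f_D :: "nat \<Rightarrow> (nat \<Rightarrow> nat \<Rightarrow> nat \<Rightarrow> complex) \<Rightarrow> (nat \<Rightarrow> complex) list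
    \<Rightarrow> (nat \<Rightarrow> complex) \<Rightarrow> (nat \<Rightarrow> nat) \<Rightarrow> ereal" where
  "f_D d U B s0 w =
     (SUP \<psi>\<in>{\<psi>. unit_vec d \<psi> \<and> in_span d B \<psi>}. SUP N\<in>{N::nat\<Rightarrow>nat. strict_mono N}.
        INF i. ereal ((cmod (cinner d \<psi> (d_run d U w s0 \<psi> N (N i))))^2))"

definition lang_ND where
  "lang_ND d k U B s0 lam = {w. (\<forall>i. w i < k) \<and> f_ND d U B s0 w > ereal lam}"

definition lang_D where
  "lang_D d k U B s0 lam = {w. (\<forall>i. w i < k) \<and> f_D d U B s0 w > ereal lam}"

datatype recf = Zero | Succ | Proj nat | Comp recf "recf list" | Prim recf recf | Mn recf

inductive reval :: "recf \<Rightarrow> nat list \<Rightarrow> nat \<Rightarrow> bool" where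
  "reval Zero xs 0"
| "reval Succ (x # xs) (Suc x)"
| "i < length xs \<Longrightarrow> reval (Proj i) xs (xs ! i)"
| "length ys = length gs \<Longrightarrow> (\<forall>i<length gs. reval (gs ! i) xs (ys ! i))
     \<Longrightarrow> reval f ys z \<Longrightarrow> reval (Comp f gs) xs z"
| "reval f xs y \<Longrightarrow> reval (Prim f g) (0 # xs) y"
| "reval (Prim f g) (n # xs) y \<Longrightarrow> reval g (y # n # xs) z \<Longrightarrow> reval (Prim f g) (Suc n # xs) z"
| "reval f (n # xs) 0 \<Longrightarrow> (\<forall>m<n. \<exists>y. reval f (m # xs) (Suc y)) \<Longrightarrow> reval (Mn f) xs n"

definition decidable_on :: "nat set \<Rightarrow> (nat \<Rightarrow> bool) \<Rightarrow> bool" where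
  "decidable_on V P \<longleftrightarrow> (\<exists>f. \<forall>c\<in>V. reval f [c] (if P c then 1 else 0))"

definition rat_val :: "nat \<Rightarrow> real" where
  "rat_val c = (case prod_decode c of (a, b) \<Rightarrow> of_int (int_decode a) / of_int (int_decode b))"

text \<open>An algebraic number is coded by integer polynomial coefficients and a rational
  rectangle [re1,re2] x [im1,im2] isolating a unique root.\<close>
definition alg_coeffs :: "nat \<Rightarrow> int list" where
  "alg_coeffs c = map int_decode (list_decode (fst (prod_decode c)))"

definition alg_rect :: "nat \<Rightarrow> real list" where
  "alg_rect c = map rat_val (list_decode (snd (prod_decode c)))"

definition alg_prop :: "nat \<Rightarrow> complex \<Rightarrow> bool" where
  "alg_prop c z \<longleftrightarrow>
     (\<Sum>i<length (alg_coeffs c). of_int (alg_coeffs c ! i) * z ^ i) = 0 \<and>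
     alg_rect c ! 0 \<le> Re z \<and> Re z \<le> alg_rect c ! 1 \<and>
     alg_rect c ! 2 \<le> Im z \<and> Im z \<le> alg_rect c ! 3"

definition alg_ok :: "nat \<Rightarrow> bool" where
  "alg_ok c \<longleftrightarrow> length (alg_rect c) = 4 \<and> (\<exists>!z. alg_prop c z)"

definition alg_val :: "nat \<Rightarrow> complex" where
  "alg_val c = (THE z. alg_prop c z)"

definition inst :: "nat \<Rightarrow> nat list" where "inst c = list_decode c"
definition i_d where "i_d c = inst c ! 0"
definition i_k where "i_k c = inst c ! 1"
definition i_s0c where "i_s0c c = list_decode (inst c ! 2)"
definition i_Uc where "i_Uc c = map (\<lambda>m. map list_decode (list_decode m)) (list_decode (inst c ! 3))"
definition i_Bc where "i_Bc c = map list_decode (list_decode (inst c ! 4))"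
definition i_lc where "i_lc c = inst c ! 5"

definition i_s0 :: "nat \<Rightarrow> nat \<Rightarrow> complex" where
  "i_s0 c = (\<lambda>j. alg_val (i_s0c c ! j))"
definition i_U :: "nat \<Rightarrow> nat \<Rightarrow> nat \<Rightarrow> nat \<Rightarrow> complex" where
  "i_U c = (\<lambda>\<sigma> i j. alg_val (i_Uc c ! \<sigma> ! i ! j))"
definition i_B :: "nat \<Rightarrow> (nat \<Rightarrow> complex) list" where
  "i_B c = map (\<lambda>v j. alg_val (v ! j)) (i_Bc c)"
definition i_lambda :: "nat \<Rightarrow> real" where
  "i_lambda c = Re (alg_val (i_lc c))"

definition valid_inst :: "nat \<Rightarrow> bool" where
  "valid_inst c \<longleftrightarrow>
     length (inst c) = 6 \<and>
     length (i_s0c c) = i_d c \<and> (\<forall>x\<in>set (i_s0c c). alg_ok x) \<and>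
     length (i_Uc c) = i_k c \<and>
     (\<forall>M\<in>set (i_Uc c). length M = i_d c \<and>
        (\<forall>r\<in>set M. length r = i_d c \<and> (\<forall>x\<in>set r. alg_ok x))) \<and>
     (\<forall>v\<in>set (i_Bc c). length v = i_d c \<and> (\<forall>x\<in>set v. alg_ok x)) \<and>
     alg_ok (i_lc c) \<and> Im (alg_val (i_lc c)) = 0 \<and>
     0 \<le> i_lambda c \<and> i_lambda c < 1 \<and>
     unit_vec (i_d c) (i_s0 c) \<and>
     (\<forall>\<sigma><i_k c. unitary_mat (i_d c) (i_U c \<sigma>))"

definition inst_lang_ND :: "nat \<Rightarrow> (nat \<Rightarrow> nat) set" where
  "inst_lang_ND c = lang_ND (i_d c) (i_k c) (i_U c) (i_B c) (i_s0 c) (i_lambda c)"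
definition inst_lang_D :: "nat \<Rightarrow> (nat \<Rightarrow> nat) set" where
  "inst_lang_D c = lang_D (i_d c) (i_k c) (i_U c) (i_B c) (i_s0 c) (i_lambda c)"

end

theory Submission
  imports Defs "HOL-Analysis.Analysis" "Jordan_Normal_Form.Determinant"
begin

text \<open>
  Unitary maps are recurrent: powers of a letter bring any state back arbitrarily close to itself. Hence
  under both semantics the language is nonempty iff there is a letter and some finite word leads to a
  state whose squared projection onto the accepting subspace exceeds the threshold.

  If such a word exists, it is found by enumeration, because a strict inequality between algebraic numbers
  can be confirmed by approximation. Otherwise there is a polynomial certificate. The closure of the orbit
  of the initial state is a real variety: a point outside is separated from it by a polynomial
  (Stone-Weierstrass), and averaging this polynomial along the dynamics yields one that is constant on the
  orbit. Expanding its coefficients in a basis over the ring generated by the given algebraic numbers moves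
  them into that ring, and Hilbert's basis theorem makes the number of equations finite. So some variety contains
  the initial state, is invariant under all letters and satisfies the threshold inequality.

  Checking a certificate means checking \<open>h \<le> 0\<close> on a compact set \<open>p = 0\<close> for integer polynomials, the
  algebraic numbers being isolated by equations as well. This needs no quantifier elimination: the
  supremum of \<open>h\<close> on \<open>p = 0\<close> is a limit of minima of coercive polynomials, whose values are eigenvalues
  of explicit integer matrices. Hence the supremum is a root of an integer polynomial with computably
  bounded coefficients, so it is nonpositive as soon as it lies below an explicit positive gap, and that can be
  confirmed on a grid.
\<close>

hide_const (open) Matrix.unit_vec

section \<open>Cubes, digits and limits\<close>

definition coord_cube :: "nat \<Rightarrow> real \<Rightarrow> (nat \<Rightarrow> real) set" where
  "coord_cube n R = {z. (\<forall>i<n. \<bar>z i\<bar> \<le> R) \<and> (\<forall>i\<ge>n. z i = 0)}"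

lemma continuous_on_coord [continuous_intros]: "continuous_on S (\<lambda>z::'i \<Rightarrow> 'a::topological_space. z i)"
  by (rule continuous_on_subset[OF continuous_on_product_coordinates]) auto

lemma tendsto_coord: "(\<zeta> \<longlongrightarrow> z) F \<Longrightarrow> ((\<lambda>s. \<zeta> s i) \<longlongrightarrow> z i) F" for z :: "'i \<Rightarrow> 'a::topological_space"
  using continuous_on_tendsto_compose[OF continuous_on_coord[of UNIV i]] by fastforce

lemma compact_pointwise:
  fixes S :: "'i \<Rightarrow> 'a::topological_space set"
  assumes "\<And>i. compact (S i)"
  shows "compact {z. \<forall>i. z i \<in> S i}"
proof -
  have "compactin (product_topology (\<lambda>_. euclidean) UNIV) (Pi\<^sub>E UNIV S)"
    using assms by (auto simp: compactin_PiE)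
  moreover have "Pi\<^sub>E UNIV S = {z. \<forall>i. z i \<in> S i}" by (auto simp: PiE_def Pi_def)
  ultimately show ?thesis by (simp add: euclidean_product_topology)
qed

lemma compact_coord_cube: "compact (coord_cube n R)"
proof -
  have "coord_cube n R = {z. \<forall>i. z i \<in> (if i < n then {-R..R} else {0})}"
    by (auto simp: coord_cube_def abs_le_iff minus_le_iff not_less Ball_def all_conj_distrib imp_conjL
        intro!: Collect_cong split: if_split_asm)
  moreover have "compact \<dots>" by (rule compact_pointwise) auto
  ultimately show ?thesis by simp
qed

lemma coord_cube_subsequence:
  fixes \<zeta> :: "nat \<Rightarrow> nat \<Rightarrow> real"
  assumes "\<And>s. \<zeta> s \<in> coord_cube n R"
  obtains r z where "strict_mono r" "z \<in> coord_cube n R" "\<And>i. (\<lambda>s. \<zeta> (r s) i) \<longlonglongrightarrow> z i"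
proof -
  have "seq_compact (coord_cube n R)" by (rule compact_imp_seq_compact[OF compact_coord_cube])
  then obtain z r where "z \<in> coord_cube n R" "strict_mono r" and lim: "(\<zeta> \<circ> r) \<longlonglongrightarrow> z"
    using assms unfolding seq_compact_def by metis
  moreover have "(\<lambda>s. \<zeta> (r s) i) \<longlonglongrightarrow> z i" for i using tendsto_coord[OF lim] by (simp add: o_def)
  ultimately show ?thesis using that by blast
qed

lemma digits_exist:
  assumes "\<forall>i<n. f i < (b::nat)"
  shows "\<exists>N<b ^ n. \<forall>i<n. N div b ^ i mod b = f i"
  using assms
proof (induction n)
  case (Suc n)
  then obtain N where N: "N < b ^ n" "\<forall>i<n. N div b ^ i mod b = f i" by auto
  have top_digit: "f n < b" using Suc.prems by auto
  have "f n * b ^ n + N < Suc (f n) * b ^ n" using N by auto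
  also have "\<dots> \<le> b ^ Suc n" using top_digit by (simp only: power_Suc) (intro mult_right_mono, auto)
  finally have "f n * b ^ n + N < b ^ Suc n" .
  moreover have "(f n * b ^ n + N) div b ^ i mod b = f i" if "i < Suc n" for i
  proof (cases "i = n")
    case True
    then show ?thesis using N top_digit by simp
  next
    case False
    with that obtain j where j: "n = i + Suc j" by (metis add_Suc_right less_imp_Suc_add less_antisym)
    have "f n * b ^ n + N = N + b ^ i * (f n * b ^ j * b)" by (simp add: j power_add algebra_simps)
    moreover have "b ^ i > 0" using top_digit by simp
    ultimately have "(f n * b ^ n + N) div b ^ i = N div b ^ i + f n * b ^ j * b"
      by (metis add.commute div_mult_self2 less_not_refl2)
    then show ?thesis using N j by simp
  qed
  ultimately show ?case by blast
qed auto

lemma filterlim_real_subseq: "strict_mono r \<Longrightarrow> filterlim (\<lambda>s. real (r s)) at_top sequentially"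
  by (rule filterlim_compose[OF filterlim_real_sequentially filterlim_subseq])

lemma multiplier_limit_nonpos:
  fixes a b K :: "nat \<Rightarrow> real"
  assumes "filterlim K at_top sequentially" "a \<longlonglongrightarrow> a'" "b \<longlonglongrightarrow> b'" and le: "\<And>s. K s * a s \<le> b s"
  shows "a' \<le> 0"
proof (rule tendsto_le[OF sequentially_bot _ \<open>a \<longlonglongrightarrow> a'\<close>])
  have "(\<lambda>s. b s * inverse (K s)) \<longlonglongrightarrow> b' * 0"
    using assms by (intro tendsto_intros tendsto_inverse_0_at_top)
  then show "(\<lambda>s. b s * inverse (K s)) \<longlonglongrightarrow> 0" by simp
  have "\<forall>\<^sub>F s in sequentially. K s > 0" using assms(1) unfolding filterlim_at_top_dense by blast
  then show "\<forall>\<^sub>F s in sequentially. a s \<le> b s * inverse (K s)"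
  proof eventually_elim
    case (elim s)
    then show ?case using le[of s] by (simp add: field_simps)
  qed
qed

lemma leading_coefficient_limit_eq_0:
  fixes a :: "nat \<Rightarrow> nat \<Rightarrow> real"
  assumes coeffs: "\<And>j. a j \<longlonglongrightarrow> l j" and unbounded: "filterlim t at_top sequentially"
    and zero: "\<And>s. (\<Sum>j\<le>J. t s ^ j * a j s) = 0"
  shows "l J = 0"
proof -
  define g where "g s = (\<Sum>j<J. inverse (t s) ^ (J - j) * a j s) + a J s" for s
  have "g \<longlonglongrightarrow> (\<Sum>j<J. 0 ^ (J - j) * l j) + l J"
    unfolding g_def by (intro tendsto_intros coeffs tendsto_inverse_0_at_top[OF unbounded])
  moreover have "\<forall>\<^sub>F s in sequentially. g s = 0"
  proof -
    have "\<forall>\<^sub>F s in sequentially. t s > 0" using unbounded by (simp add: filterlim_at_top_dense)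
    then show ?thesis
    proof eventually_elim
      case (elim s)
      have "t s ^ J * g s = (\<Sum>j<J. t s ^ J * (inverse (t s) ^ (J - j) * a j s)) + t s ^ J * a J s"
        by (simp add: g_def distrib_left sum_distrib_left)
      also have "(\<Sum>j<J. t s ^ J * (inverse (t s) ^ (J - j) * a j s)) = (\<Sum>j<J. t s ^ j * a j s)"
      proof (rule sum.cong[OF refl])
        fix j assume "j \<in> {..<J}"
        then have "t s ^ J = t s ^ j * t s ^ (J - j)" by (simp flip: power_add)
        then show "t s ^ J * (inverse (t s) ^ (J - j) * a j s) = t s ^ j * a j s"
          using elim by (simp add: power_inverse)
      qed
      also have "\<dots> + t s ^ J * a J s = 0" using zero[of s] by (simp add: lessThan_Suc_atMost[symmetric])
      finally show ?case using elim by simp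
    qed
  qed
  ultimately have "(\<lambda>s::nat. 0::real) \<longlonglongrightarrow> (\<Sum>j<J. 0 ^ (J - j) * l j) + l J"
    by (rule Lim_transform_eventually)
  then have "(\<Sum>j<J. 0 ^ (J - j) * l j) + l J = 0" by (simp add: LIMSEQ_const_iff)
  moreover have "(\<Sum>j<J. 0 ^ (J - j) * l j) = 0" by (intro sum.neutral) auto
  ultimately show ?thesis by simp
qed

lemma small_integer_poly_root_eq_0:
  fixes a :: "nat \<Rightarrow> int" and t :: real
  assumes "\<exists>j\<le>d. a j \<noteq> 0" and root: "(\<Sum>j\<le>d. t ^ j * of_int (a j)) = 0"
    and small: "\<bar>t\<bar> * (\<Sum>j\<le>d. \<bar>of_int (a j)\<bar>) < 1"
  shows "t = 0"
proof (rule ccontr)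
  assume "t \<noteq> 0"
  obtain J where J: "J \<le> d" "a J \<noteq> 0" and least: "\<And>j. j < J \<Longrightarrow> a j = 0"
    using assms(1) exists_least_iff[of "\<lambda>j. j \<le> d \<and> a j \<noteq> 0"]
    by (metis (no_types, lifting) le_trans less_imp_le)
  have aJ: "1 \<le> \<bar>real_of_int (a J)\<bar>" using J(2) by linarith
  also have "\<dots> \<le> (\<Sum>j\<le>d. \<bar>of_int (a j)\<bar>)" using J(1) by (intro member_le_sum) auto
  finally have "\<bar>t\<bar> * 1 \<le> \<bar>t\<bar> * (\<Sum>j\<le>d. \<bar>of_int (a j)\<bar>)" by (intro mult_left_mono) auto
  with small have t_le_1: "\<bar>t\<bar> \<le> 1" by linarith
  have "0 = (\<Sum>j\<in>{J..d}. t ^ j * real_of_int (a j))"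
    unfolding root[symmetric] by (intro sum.mono_neutral_right) (auto simp: least)
  also have "\<dots> = t ^ J * (\<Sum>j\<in>{J..d}. t ^ (j - J) * real_of_int (a j))"
    unfolding sum_distrib_left
    by (intro sum.cong) (auto simp: power_add[symmetric] mult.assoc[symmetric])
  finally have "(\<Sum>j\<in>{J..d}. t ^ (j - J) * real_of_int (a j)) = 0" using \<open>t \<noteq> 0\<close> by simp
  then have "\<bar>real_of_int (a J)\<bar> = \<bar>\<Sum>j\<in>{Suc J..d}. t ^ (j - J) * real_of_int (a j)\<bar>"
    using J(1) by (simp add: sum.atLeast_Suc_atMost)
  also have "\<dots> \<le> (\<Sum>j\<in>{Suc J..d}. \<bar>t\<bar> * \<bar>of_int (a j)\<bar>)"
  proof (rule order_trans[OF sum_abs], rule sum_mono)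
    fix j assume "j \<in> {Suc J..d}"
    then have "1 \<le> j - J" by auto
    then have "\<bar>t ^ (j - J)\<bar> \<le> \<bar>t\<bar>"
      using power_decreasing[of 1 "j - J" "\<bar>t\<bar>"] t_le_1 by (simp add: power_abs)
    then show "\<bar>t ^ (j - J) * real_of_int (a j)\<bar> \<le> \<bar>t\<bar> * \<bar>of_int (a j)\<bar>"
      unfolding abs_mult by (rule mult_right_mono) simp
  qed
  also have "\<dots> \<le> (\<Sum>j\<le>d. \<bar>t\<bar> * \<bar>of_int (a j)\<bar>)" by (intro sum_mono2) auto
  also have "\<dots> < 1" using small by (simp add: sum_distrib_left)
  finally show False using aJ by simp
qed

section \<open>Integer polynomials as lists of terms\<close>

type_synonym ipoly = "(int \<times> nat list) list"

definition meval :: "nat list \<Rightarrow> (nat \<Rightarrow> real) \<Rightarrow> real" where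
  "meval m z = prod_list (map z m)"

definition peval :: "ipoly \<Rightarrow> (nat \<Rightarrow> real) \<Rightarrow> real" where
  "peval P z = (\<Sum>t\<leftarrow>P. real_of_int (fst t) * meval (snd t) z)"

definition vars_in :: "nat set \<Rightarrow> ipoly \<Rightarrow> bool" where
  "vars_in V P \<longleftrightarrow> (\<forall>t\<in>set P. set (snd t) \<subseteq> V)"

definition deg_bound :: "ipoly \<Rightarrow> nat" where
  "deg_bound P = (\<Sum>t\<leftarrow>P. length (snd t))"

definition degree_le :: "nat \<Rightarrow> ipoly \<Rightarrow> bool" where
  "degree_le E P \<longleftrightarrow> (\<forall>t\<in>set P. length (snd t) \<le> E)"

definition coeff_norm :: "ipoly \<Rightarrow> nat" where
  "coeff_norm P = (\<Sum>t\<leftarrow>P. nat \<bar>fst t\<bar>)"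

definition pscale :: "int \<Rightarrow> ipoly \<Rightarrow> ipoly" where
  "pscale a P = map (\<lambda>t. (a * fst t, snd t)) P"

definition pmult :: "ipoly \<Rightarrow> ipoly \<Rightarrow> ipoly" where
  "pmult P Q = concat (map (\<lambda>t. map (\<lambda>s. (fst t * fst s, snd t @ snd s)) Q) P)"

lemma meval_simps [simp]:
  "meval [] z = 1" "meval (i # m) z = z i * meval m z" "meval (m @ m') z = meval m z * meval m' z"
  by (simp_all add: meval_def)

lemma meval_replicate [simp]: "meval (replicate k i) z = z i ^ k"
  by (induction k) auto

lemma peval_simps [simp]:
  "peval [] z = 0" "peval (t # P) z = real_of_int (fst t) * meval (snd t) z + peval P z"
  "peval (P @ Q) z = peval P z + peval Q z"
  by (simp_all add: peval_def)

lemma peval_pscale [simp]: "peval (pscale a P) z = real_of_int a * peval P z"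
  by (induction P) (simp_all add: pscale_def algebra_simps)

lemma peval_pmult [simp]: "peval (pmult P Q) z = peval P z * peval Q z"
proof (induction P)
  case (Cons t P)
  have "peval (map (\<lambda>s. (a * fst s, m @ snd s)) Q) z = real_of_int a * meval m z * peval Q z" for a m
    by (induction Q) (simp_all add: algebra_simps)
  with Cons show ?case by (simp add: pmult_def distrib_right)
qed (simp add: pmult_def)

lemma peval_concat: "peval (concat Ps) z = (\<Sum>P\<leftarrow>Ps. peval P z)"
  by (induction Ps) auto

lemma peval_linear_combination:
  assumes "\<And>t. t \<in> set Q \<Longrightarrow> peval (f t) \<zeta> = meval (snd t) \<zeta> * c"
  shows "peval (concat (map (\<lambda>t. pscale (fst t) (f t)) Q)) \<zeta> = peval Q \<zeta> * c"
  using assms by (induction Q) (auto simp: algebra_simps)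

lemma vars_in_simps [simp]:
  "vars_in V []" "vars_in V (t # P) \<longleftrightarrow> set (snd t) \<subseteq> V \<and> vars_in V P"
  "vars_in V (P @ Q) \<longleftrightarrow> vars_in V P \<and> vars_in V Q"
  by (auto simp: vars_in_def)

lemma set_pscale: "set (pscale a P) = (\<lambda>t. (a * fst t, snd t)) ` set P"
  by (simp add: pscale_def)

lemma vars_in_pscale [simp]: "vars_in V P \<Longrightarrow> vars_in V (pscale a P)"
  by (auto simp: vars_in_def set_pscale)

lemma vars_in_pmult [simp]: "vars_in V P \<Longrightarrow> vars_in V Q \<Longrightarrow> vars_in V (pmult P Q)"
  by (fastforce simp: vars_in_def pmult_def)

lemma vars_in_concat: "vars_in V (concat Ps) \<longleftrightarrow> (\<forall>P\<in>set Ps. vars_in V P)"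
  by (auto simp: vars_in_def)

lemma vars_in_mono: "vars_in V P \<Longrightarrow> V \<subseteq> W \<Longrightarrow> vars_in W P"
  by (auto simp: vars_in_def)

lemma coeff_norm_simps [simp]:
  "coeff_norm [] = 0" "coeff_norm (t # P) = nat \<bar>fst t\<bar> + coeff_norm P"
  "coeff_norm (P @ Q) = coeff_norm P + coeff_norm Q"
  by (simp_all add: coeff_norm_def)

lemma coeff_norm_pscale [simp]: "coeff_norm (pscale a P) = nat \<bar>a\<bar> * coeff_norm P"
  by (induction P) (auto simp: pscale_def abs_mult nat_mult_distrib algebra_simps)

lemma coeff_norm_pmult [simp]: "coeff_norm (pmult P Q) = coeff_norm P * coeff_norm Q"
proof (induction P)
  case (Cons t P)
  have "coeff_norm (map (\<lambda>s. (fst t * fst s, snd t @ snd s)) Q) = nat \<bar>fst t\<bar> * coeff_norm Q"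
    for t :: "int \<times> nat list"
    by (induction Q) (auto simp: abs_mult nat_mult_distrib algebra_simps)
  with Cons show ?case by (simp add: pmult_def distrib_right)
qed (simp add: pmult_def)

lemma coeff_norm_linear_combination:
  assumes "\<And>t. t \<in> set Q \<Longrightarrow> coeff_norm (f t) \<le> K"
  shows "coeff_norm (concat (map (\<lambda>t. pscale (fst t) (f t)) Q)) \<le> coeff_norm Q * K"
  using assms by (induction Q) (auto simp: distrib_right add_mono)

lemma degree_le_deg_bound: "degree_le (deg_bound P) P"
  unfolding degree_le_def deg_bound_def by (intro ballI member_le_sum_list) auto

lemma degree_le_mono: "degree_le E P \<Longrightarrow> E \<le> E' \<Longrightarrow> degree_le E' P"
  by (force simp: degree_le_def)

lemma meval_cong: "(\<And>i. i \<in> set m \<Longrightarrow> z i = z' i) \<Longrightarrow> meval m z = meval m z'"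
  by (induction m) auto

lemma peval_cong: "vars_in V P \<Longrightarrow> (\<And>i. i \<in> V \<Longrightarrow> z i = z' i) \<Longrightarrow> peval P z = peval P z'"
proof (induction P)
  case (Cons t P)
  have "meval (snd t) z = meval (snd t) z'" using Cons.prems by (intro meval_cong) auto
  with Cons show ?case by auto
qed auto

lemma tendsto_meval:
  assumes "\<And>i. i \<in> set m \<Longrightarrow> ((\<lambda>s. \<zeta> s i) \<longlongrightarrow> z i) F"
  shows "((\<lambda>s. meval m (\<zeta> s)) \<longlongrightarrow> meval m z) F"
  using assms by (induction m) (auto intro!: tendsto_mult)

lemma tendsto_peval:
  assumes "\<And>i. i \<in> V \<Longrightarrow> ((\<lambda>s. \<zeta> s i) \<longlongrightarrow> z i) F" "vars_in V P"
  shows "((\<lambda>s. peval P (\<zeta> s)) \<longlongrightarrow> peval P z) F"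
  using assms(2)
proof (induction P)
  case (Cons t P)
  have "((\<lambda>s. meval (snd t) (\<zeta> s)) \<longlongrightarrow> meval (snd t) z) F"
    using Cons.prems assms(1) by (intro tendsto_meval) auto
  with Cons show ?case by (auto intro!: tendsto_intros)
qed auto

lemma vars_in_UNIV [simp]: "vars_in UNIV P"
  by (simp add: vars_in_def)

lemma continuous_on_meval [continuous_intros]: "continuous_on S (meval m)"
  unfolding continuous_on_def by (auto intro!: tendsto_meval tendsto_coord[OF tendsto_ident_at])

lemma continuous_on_peval [continuous_intros]: "continuous_on S (peval P)"
  unfolding continuous_on_def by (auto intro!: tendsto_peval[of UNIV] tendsto_coord[OF tendsto_ident_at])

lemma abs_meval_le:
  assumes "\<And>i. i \<in> set m \<Longrightarrow> \<bar>z i\<bar> \<le> W"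
  shows "\<bar>meval m z\<bar> \<le> W ^ length m"
  using assms
proof (induction m)
  case (Cons i m)
  have "0 \<le> W" using Cons.prems[of i] by (auto intro: order_trans[OF abs_ge_zero])
  with Cons show ?case by (auto simp: abs_mult intro!: mult_mono)
qed auto

lemma abs_peval_le:
  assumes "vars_in V P" "\<And>i. i \<in> V \<Longrightarrow> \<bar>z i\<bar> \<le> W" "W \<ge> 1" "degree_le E P"
  shows "\<bar>peval P z\<bar> \<le> real (coeff_norm P) * W ^ E"
  using assms(1,4)
proof (induction P)
  case (Cons t P)
  have "\<bar>meval (snd t) z\<bar> \<le> W ^ length (snd t)"
    using Cons.prems assms(2) by (intro abs_meval_le) auto
  also have "\<dots> \<le> W ^ E"
    using Cons.prems assms(3) by (intro power_increasing) (auto simp: degree_le_def)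
  finally have "\<bar>real_of_int (fst t) * meval (snd t) z\<bar> \<le> real (nat \<bar>fst t\<bar>) * W ^ E"
    by (auto simp: abs_mult intro!: mult_left_mono)
  with Cons show ?case by (auto simp: algebra_simps degree_le_def)
qed auto

lemma meval_eq_prod_count:
  assumes "set m \<subseteq> {..<k}"
  shows "meval m \<zeta> = (\<Prod>i<k. \<zeta> i ^ count_list m i)"
  using assms
proof (induction m)
  case (Cons j m)
  have "(\<Prod>i<k. \<zeta> i ^ count_list (j # m) i) = (\<Prod>i<k. (if i = j then \<zeta> j else 1) * \<zeta> i ^ count_list m i)"
    by (intro prod.cong) auto
  also have "\<dots> = \<zeta> j * meval m \<zeta>" using Cons by (auto simp: prod.distrib)
  finally show ?case by simp
qed auto

lemma meval_split_var: "meval m \<zeta> = \<zeta> v ^ count_list m v * meval (filter (\<lambda>i. i \<noteq> v) m) \<zeta>"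
  by (induction m) (auto simp: algebra_simps)

section \<open>Coefficients with respect to one variable\<close>

definition coeff_in :: "nat \<Rightarrow> nat \<Rightarrow> ipoly \<Rightarrow> ipoly" where
  "coeff_in v J P = map (\<lambda>t. (fst t, filter (\<lambda>i. i \<noteq> v) (snd t))) (filter (\<lambda>t. count_list (snd t) v = J) P)"

lemma coeff_in_simps [simp]:
  "coeff_in v J [] = []"
  "coeff_in v J (t # P) =
    (if count_list (snd t) v = J then [(fst t, filter (\<lambda>i. i \<noteq> v) (snd t))] else []) @ coeff_in v J P"
  by (simp_all add: coeff_in_def)

lemma peval_eq_sum_coeff_in:
  assumes "degree_le d P"
  shows "peval P \<zeta> = (\<Sum>J\<le>d. \<zeta> v ^ J * peval (coeff_in v J P) \<zeta>)"
  using assms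
proof (induction P)
  case (Cons t P)
  let ?rest = "real_of_int (fst t) * meval (filter (\<lambda>i. i \<noteq> v) (snd t)) \<zeta>"
  have count_le: "count_list (snd t) v \<le> d"
    using Cons.prems count_le_length[of "snd t" v] by (auto simp: degree_le_def)
  have "(\<Sum>J\<le>d. \<zeta> v ^ J * peval (coeff_in v J (t # P)) \<zeta>) =
    (\<Sum>J\<le>d. (if J = count_list (snd t) v then \<zeta> v ^ J * ?rest else 0) + \<zeta> v ^ J * peval (coeff_in v J P) \<zeta>)"
    by (intro sum.cong) (auto simp: algebra_simps)
  also have "\<dots> = \<zeta> v ^ count_list (snd t) v * ?rest + peval P \<zeta>"
    using Cons count_le by (simp add: sum.distrib degree_le_def)
  finally show ?case by (simp add: meval_split_var[of "snd t" \<zeta> v])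
qed auto

lemma coeff_norm_coeff_in: "coeff_norm (coeff_in v J P) \<le> coeff_norm P"
  by (induction P) auto

lemma sum_coeff_norm_coeff_in: "(\<Sum>J\<le>d. coeff_norm (coeff_in v J P)) \<le> coeff_norm P"
proof (induction P)
  case (Cons t P)
  have "(\<Sum>J\<le>d. coeff_norm (coeff_in v J (t # P))) =
    (\<Sum>J\<le>d. (if J = count_list (snd t) v then nat \<bar>fst t\<bar> else 0) + coeff_norm (coeff_in v J P))"
    by (intro sum.cong) auto
  also have "\<dots> \<le> nat \<bar>fst t\<bar> + coeff_norm P" using Cons by (simp add: sum.distrib)
  finally show ?case by simp
qed auto

lemma vars_in_coeff_in: "vars_in V P \<Longrightarrow> vars_in (V - {v}) (coeff_in v J P)"
  by (fastforce simp: vars_in_def coeff_in_def)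

lemma obtain_leading_coeff:
  assumes nz: "\<exists>\<zeta>. peval P \<zeta> \<noteq> 0"
  obtains J where "\<exists>\<zeta>. peval (coeff_in v J P) \<zeta> \<noteq> 0"
    "\<And>\<zeta>. peval P \<zeta> = (\<Sum>j\<le>J. \<zeta> v ^ j * peval (coeff_in v j P) \<zeta>)"
proof -
  note expansion = peval_eq_sum_coeff_in[OF degree_le_deg_bound[of P], where v = v]
  define S where "S = {J. J \<le> deg_bound P \<and> (\<exists>\<zeta>. peval (coeff_in v J P) \<zeta> \<noteq> 0)}"
  have "S \<noteq> {}"
  proof
    assume "S = {}"
    then have "peval (coeff_in v J P) \<zeta> = 0" if "J \<le> deg_bound P" for J \<zeta> using that by (auto simp: S_def)
    with nz show False by (simp add: expansion)
  qed
  moreover have "finite S" by (simp add: S_def)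
  ultimately have "Max S \<in> S" by (rule Max_in[rotated])
  then have top: "Max S \<le> deg_bound P" "\<exists>\<zeta>. peval (coeff_in v (Max S) P) \<zeta> \<noteq> 0"
    unfolding S_def by blast+
  have "peval (coeff_in v j P) \<zeta> = 0" if "j > Max S" "j \<le> deg_bound P" for j \<zeta>
  proof (rule ccontr)
    assume "\<not> ?thesis"
    then have "j \<in> S" using that by (auto simp: S_def)
    with \<open>j > Max S\<close> Max_ge[OF \<open>finite S\<close>, of j] show False by simp
  qed
  then have "peval P \<zeta> = (\<Sum>j\<le>Max S. \<zeta> v ^ j * peval (coeff_in v j P) \<zeta>)" for \<zeta>
    unfolding expansion using top(1) by (intro sum.mono_neutral_right) auto
  with top(2) show ?thesis by (rule that)
qed

text \<open>The witness \<open>P'\<close> is the leading coefficient of \<open>P\<close> in the variable \<open>v\<close>.\<close>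

lemma obtain_coeff_at_infinity:
  assumes nz: "\<exists>\<zeta>. peval P \<zeta> \<noteq> 0" and vars: "vars_in V P"
  obtains P' where "vars_in (V - {v}) P'" "coeff_norm P' \<le> coeff_norm P" "\<exists>\<zeta>. peval P' \<zeta> \<noteq> 0"
    "\<And>\<zeta>s \<zeta>. (\<And>s. peval P (\<zeta>s s) = 0) \<Longrightarrow> (\<And>i. i \<noteq> v \<Longrightarrow> (\<lambda>s::nat. \<zeta>s s i) \<longlonglongrightarrow> \<zeta> i) \<Longrightarrow>
        filterlim (\<lambda>s. \<zeta>s s v) at_top sequentially \<Longrightarrow> peval P' \<zeta> = 0"
proof -
  obtain J where nzJ: "\<exists>\<zeta>. peval (coeff_in v J P) \<zeta> \<noteq> 0"
    and expansion: "\<And>\<zeta>. peval P \<zeta> = (\<Sum>j\<le>J. \<zeta> v ^ j * peval (coeff_in v j P) \<zeta>)"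
    using obtain_leading_coeff[OF nz] by metis
  show ?thesis
  proof (rule that[OF vars_in_coeff_in[OF vars] coeff_norm_coeff_in nzJ])
    fix \<zeta>s :: "nat \<Rightarrow> nat \<Rightarrow> real" and \<zeta>
    assume zero: "\<And>s. peval P (\<zeta>s s) = 0" and lim: "\<And>i. i \<noteq> v \<Longrightarrow> (\<lambda>s. \<zeta>s s i) \<longlonglongrightarrow> \<zeta> i"
      and unbounded: "filterlim (\<lambda>s. \<zeta>s s v) at_top sequentially"
    have "(\<lambda>s. peval (coeff_in v j P) (\<zeta>s s)) \<longlonglongrightarrow> peval (coeff_in v j P) \<zeta>" for j
      by (rule tendsto_peval[OF _ vars_in_coeff_in[OF vars]]) (auto intro: lim)
    then show "peval (coeff_in v J P) \<zeta> = 0"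
      by (rule leading_coefficient_limit_eq_0[OF _ unbounded]) (simp add: zero flip: expansion)
  qed
qed

lemma peval_no_vars: "vars_in {} P \<Longrightarrow> \<exists>a::int. \<forall>\<zeta>. peval P \<zeta> = of_int a"
proof (induction P)
  case (Cons t P)
  then obtain a where "\<forall>\<zeta>. peval P \<zeta> = of_int a" by auto
  with Cons.prems show ?case by (intro exI[of _ "fst t + a"]) simp
qed (auto intro: exI[of _ 0])

lemma small_root_eq_0:
  assumes nz: "\<exists>\<zeta>. peval P \<zeta> \<noteq> 0" and vars: "vars_in {v} P" and root: "peval P \<zeta> = 0"
    and small: "\<bar>\<zeta> v\<bar> * real (coeff_norm P) < 1"
  shows "\<zeta> v = 0"
proof -
  let ?d = "deg_bound P"
  note expansion = peval_eq_sum_coeff_in[OF degree_le_deg_bound[of P], where v = v]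
  have "\<exists>a::int. \<forall>\<zeta>. peval (coeff_in v J P) \<zeta> = of_int a" for J
    using vars_in_coeff_in[OF vars, of v J] by (intro peval_no_vars) simp
  then obtain a where a: "\<And>J \<zeta>. peval (coeff_in v J P) \<zeta> = real_of_int (a J)" by metis
  have "\<exists>J\<le>?d. a J \<noteq> 0"
  proof (rule ccontr)
    assume "\<not> ?thesis"
    then have "peval P \<xi> = 0" for \<xi> by (simp add: expansion a)
    with nz show False by simp
  qed
  moreover have "(\<Sum>J\<le>?d. \<zeta> v ^ J * real_of_int (a J)) = 0" using root by (simp add: expansion a)
  moreover have "\<bar>\<zeta> v\<bar> * (\<Sum>J\<le>?d. \<bar>real_of_int (a J)\<bar>) < 1"
  proof -
    have "\<bar>peval Q (\<lambda>_. 1)\<bar> \<le> real (coeff_norm Q)" for Q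
      using abs_peval_le[of UNIV Q "\<lambda>_. 1" 1, OF _ _ _ degree_le_deg_bound] by simp
    then have "\<bar>real_of_int (a J)\<bar> \<le> real (coeff_norm (coeff_in v J P))" for J by (metis a)
    then have "(\<Sum>J\<le>?d. \<bar>real_of_int (a J)\<bar>) \<le> real (\<Sum>J\<le>?d. coeff_norm (coeff_in v J P))"
      by (simp add: sum_mono)
    also have "\<dots> \<le> real (coeff_norm P)" by (intro of_nat_mono sum_coeff_norm_coeff_in)
    finally have "\<bar>\<zeta> v\<bar> * (\<Sum>J\<le>?d. \<bar>real_of_int (a J)\<bar>) \<le> \<bar>\<zeta> v\<bar> * real (coeff_norm P)"
      by (rule mult_left_mono) simp
    with small show ?thesis by linarith
  qed
  ultimately show ?thesis by (rule small_integer_poly_root_eq_0)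
qed

section \<open>Integer polynomial functions of bounded norm\<close>

definition ipoly_fun :: "nat set \<Rightarrow> nat \<Rightarrow> ((nat \<Rightarrow> real) \<Rightarrow> real) \<Rightarrow> bool" where
  "ipoly_fun V K f \<longleftrightarrow> (\<exists>P. vars_in V P \<and> coeff_norm P \<le> K \<and> (\<forall>z. f z = peval P z))"

lemma ipoly_fun_peval: "vars_in V P \<Longrightarrow> coeff_norm P \<le> K \<Longrightarrow> ipoly_fun V K (peval P)"
  by (auto simp: ipoly_fun_def)

lemma ipoly_fun_const: "nat \<bar>a\<bar> \<le> K \<Longrightarrow> ipoly_fun V K (\<lambda>_. real_of_int a)"
  unfolding ipoly_fun_def by (intro exI[of _ "[(a, [])]"]) auto

lemma ipoly_fun_add:
  assumes "ipoly_fun V K f" "ipoly_fun V L g"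
  shows "ipoly_fun V (K + L) (\<lambda>z. f z + g z)"
proof -
  from assms obtain P Q where "vars_in V P" "coeff_norm P \<le> K" "\<forall>z. f z = peval P z"
    "vars_in V Q" "coeff_norm Q \<le> L" "\<forall>z. g z = peval Q z" by (auto simp: ipoly_fun_def)
  then show ?thesis unfolding ipoly_fun_def by (intro exI[of _ "P @ Q"]) auto
qed

lemma ipoly_fun_mult:
  assumes "ipoly_fun V K f" "ipoly_fun V L g"
  shows "ipoly_fun V (K * L) (\<lambda>z. f z * g z)"
proof -
  from assms obtain P Q where "vars_in V P" "coeff_norm P \<le> K" "\<forall>z. f z = peval P z"
    "vars_in V Q" "coeff_norm Q \<le> L" "\<forall>z. g z = peval Q z" by (auto simp: ipoly_fun_def)
  then show ?thesis unfolding ipoly_fun_def by (intro exI[of _ "pmult P Q"]) (auto intro: mult_le_mono)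
qed

lemma ipoly_fun_minus: "ipoly_fun V K f \<Longrightarrow> ipoly_fun V K (\<lambda>z. - f z)"
  using ipoly_fun_mult[OF ipoly_fun_const[of "-1" 1 V]] by simp

lemma ipoly_fun_sum:
  "finite S \<Longrightarrow> (\<And>x. x \<in> S \<Longrightarrow> ipoly_fun V K (f x)) \<Longrightarrow> ipoly_fun V (card S * K) (\<lambda>z. \<Sum>x\<in>S. f x z)"
proof (induction S rule: finite_induct)
  case empty
  then show ?case using ipoly_fun_const[of 0 0 V] by simp
next
  case (insert x S)
  have "ipoly_fun V (K + card S * K) (\<lambda>z. f x z + (\<Sum>x\<in>S. f x z))"
    using insert by (intro ipoly_fun_add) auto
  with insert show ?case by simp
qed

lemma ipoly_fun_prod:
  "finite S \<Longrightarrow> (\<And>x. x \<in> S \<Longrightarrow> ipoly_fun V K (f x)) \<Longrightarrow> ipoly_fun V (K ^ card S) (\<lambda>z. \<Prod>x\<in>S. f x z)"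
proof (induction S rule: finite_induct)
  case empty
  then show ?case using ipoly_fun_const[of 1 1 V] by simp
next
  case (insert x S)
  have "ipoly_fun V (K * K ^ card S) (\<lambda>z. f x z * (\<Prod>x\<in>S. f x z))"
    using insert by (intro ipoly_fun_mult) auto
  with insert show ?case by simp
qed

lemma ipoly_fun_det:
  assumes "\<And>i j. i < N \<Longrightarrow> j < N \<Longrightarrow> ipoly_fun V K (f i j)"
  shows "ipoly_fun V (fact N * K ^ N) (\<lambda>z. det (mat N N (\<lambda>(i, j). f i j z)))"
proof -
  let ?P = "{p. p permutes {0..<N}}"
  have "ipoly_fun V (card ?P * (1 * K ^ N)) (\<lambda>z. \<Sum>p\<in>?P. signof p * (\<Prod>i\<in>{0..<N}. f i (p i) z))"
  proof (rule ipoly_fun_sum)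
    fix p assume "p \<in> ?P"
    then have p: "p permutes {0..<N}" by simp
    have "ipoly_fun V 1 (\<lambda>_. real_of_int (sign p))" by (rule ipoly_fun_const) (auto simp: sign_def)
    moreover have "ipoly_fun V (K ^ card {0..<N}) (\<lambda>z. \<Prod>i\<in>{0..<N}. f i (p i) z)"
      using p by (intro ipoly_fun_prod assms) (auto dest: permutes_in_image)
    ultimately have
      "ipoly_fun V (1 * K ^ card {0..<N}) (\<lambda>z. real_of_int (sign p) * (\<Prod>i\<in>{0..<N}. f i (p i) z))"
      by (rule ipoly_fun_mult)
    then show "ipoly_fun V (1 * K ^ N) (\<lambda>z. signof p * (\<Prod>i\<in>{0..<N}. f i (p i) z))" by simp
  qed (simp add: finite_permutations)
  moreover have "det (mat N N (\<lambda>(i, j). f i j z)) = (\<Sum>p\<in>?P. signof p * (\<Prod>i\<in>{0..<N}. f i (p i) z))" for z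
    unfolding det_def by (auto intro!: sum.cong prod.cong dest: permutes_in_image)
  moreover have "card ?P = fact N" by (simp add: card_permutations)
  ultimately show ?thesis by simp
qed

section \<open>Partial derivatives\<close>

fun partial_deriv_mon :: "nat \<Rightarrow> nat list \<Rightarrow> nat list list" where
  "partial_deriv_mon i [] = []"
| "partial_deriv_mon i (j # m) = (if j = i then [m] else []) @ map ((#) j) (partial_deriv_mon i m)"

definition partial_deriv :: "nat \<Rightarrow> ipoly \<Rightarrow> ipoly" where
  "partial_deriv i P = concat (map (\<lambda>t. map (\<lambda>m. (fst t, m)) (partial_deriv_mon i (snd t))) P)"

lemma DERIV_meval:
  "((\<lambda>t. meval m (z(i := t))) has_real_derivative
     (\<Sum>m'\<leftarrow>partial_deriv_mon i m. meval m' (z(i := x)))) (at x)"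
proof (induction m)
  case (Cons j m)
  let ?D = "\<Sum>m'\<leftarrow>partial_deriv_mon i m. meval m' (z(i := x))"
  have tail: "(\<Sum>m'\<leftarrow>map ((#) j) (partial_deriv_mon i m). meval m' (z(i := x))) = (z(i := x)) j * ?D"
    by (induction "partial_deriv_mon i m") (auto simp: sum_list_const_mult o_def)
  have "((\<lambda>t. (z(i := t)) j) has_real_derivative (if j = i then 1 else 0)) (at x)"
    by (auto intro!: derivative_eq_intros)
  from DERIV_mult[OF this Cons]
  have "((\<lambda>t. (z(i := t)) j * meval m (z(i := t))) has_real_derivative
      (if j = i then 1 else 0) * meval m (z(i := x)) + ?D * (z(i := x)) j) (at x)" .
  moreover have "(if j = i then 1 else 0) * meval m (z(i := x)) + ?D * (z(i := x)) j
      = (\<Sum>m'\<leftarrow>partial_deriv_mon i (j # m). meval m' (z(i := x)))"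
    unfolding partial_deriv_mon.simps map_append sum_list_append tail by simp
  ultimately show ?case by (simp only: meval_simps)
qed simp

lemma DERIV_peval:
  "((\<lambda>t. peval P (z(i := t))) has_real_derivative peval (partial_deriv i P) (z(i := x))) (at x)"
proof (induction P)
  case (Cons t P)
  have common_coeff: "peval (map (\<lambda>m. (fst t, m)) ms) \<zeta> = real_of_int (fst t) * (\<Sum>m\<leftarrow>ms. meval m \<zeta>)" for ms \<zeta>
    by (induction ms) (auto simp: algebra_simps)
  have "((\<lambda>u. real_of_int (fst t) * meval (snd t) (z(i := u)) + peval P (z(i := u))) has_real_derivative
      real_of_int (fst t) * (\<Sum>m\<leftarrow>partial_deriv_mon i (snd t). meval m (z(i := x)))
        + peval (partial_deriv i P) (z(i := x))) (at x)"
    by (intro DERIV_add DERIV_cmult DERIV_meval Cons)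
  then show ?case
    by (simp only: peval_simps partial_deriv_def list.map concat.simps common_coeff)
qed (simp add: partial_deriv_def)

lemma length_partial_deriv_mon: "length (partial_deriv_mon i m) \<le> length m"
  by (induction m) auto

lemma partial_deriv_mon_mem:
  "m' \<in> set (partial_deriv_mon i m) \<Longrightarrow> Suc (length m') = length m \<and> set m' \<subseteq> set m"
  by (induction m arbitrary: m') (force split: if_splits)+

lemma coeff_norm_partial_deriv:
  assumes "degree_le E P"
  shows "coeff_norm (partial_deriv i P) \<le> E * coeff_norm P"
  using assms
proof (induction P)
  case (Cons t P)
  have "coeff_norm (map (\<lambda>m. (fst t, m)) ms) = length ms * nat \<bar>fst t\<bar>" for ms
    by (induction ms) auto
  moreover have "length (partial_deriv_mon i (snd t)) \<le> E"
    using length_partial_deriv_mon[of i "snd t"] Cons.prems by (auto simp: degree_le_def)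
  ultimately show ?case
    using Cons by (simp add: partial_deriv_def distrib_left degree_le_def add_mono)
qed (simp add: partial_deriv_def)

lemma length_partial_deriv:
  "degree_le E P \<Longrightarrow> t \<in> set (partial_deriv i P) \<Longrightarrow> length (snd t) < E"
  by (fastforce simp: partial_deriv_def degree_le_def dest: partial_deriv_mon_mem)

lemma vars_in_partial_deriv: "vars_in V P \<Longrightarrow> vars_in V (partial_deriv i P)"
  by (fastforce simp: partial_deriv_def vars_in_def dest: partial_deriv_mon_mem)

section \<open>Reduction modulo power relations\<close>

definition degree_below :: "nat \<Rightarrow> nat list \<Rightarrow> nat" where
  "degree_below n m = length (filter (\<lambda>j. j < n) m)"

lemma degree_below_append [simp]: "degree_below n (m @ m') = degree_below n m + degree_below n m'"
  by (simp add: degree_below_def)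

lemma degree_below_le_length: "degree_below n m \<le> length m" by (simp add: degree_below_def)

lemma degree_below_split_var:
  "i < n \<Longrightarrow> degree_below n m = count_list m i + degree_below n (filter (\<lambda>j. j \<noteq> i) m)"
  by (induction m) (auto simp: degree_below_def)

lemma meval_factor_power:
  assumes "i < n" "M \<le> count_list m i"
  shows "\<exists>m'. set m' \<subseteq> set m \<and> degree_below n m = M + degree_below n m' \<and> (\<forall>\<zeta>. meval m \<zeta> = \<zeta> i ^ M * meval m' \<zeta>)"
proof (intro exI conjI allI)
  let ?m = "filter (\<lambda>j. j \<noteq> i) m @ replicate (count_list m i - M) i"
  have "i \<in> set m" if "count_list m i - M \<noteq> 0"
    using that count_list_0_iff[of m i] by (cases "i \<in> set m") auto
  then show "set ?m \<subseteq> set m" by (auto simp: set_replicate_conv_if)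
  show "degree_below n m = M + degree_below n ?m"
    using degree_below_split_var[OF assms(1), of m] assms by simp (simp add: degree_below_def)
  fix \<zeta>
  have "meval m \<zeta> = \<zeta> i ^ (M + (count_list m i - M)) * meval (filter (\<lambda>j. j \<noteq> i) m) \<zeta>"
    using assms by (subst meval_split_var[of _ _ i]) simp
  then show "meval m \<zeta> = \<zeta> i ^ M * meval ?m \<zeta>" by (simp add: power_add)
qed

definition reduced :: "nat \<Rightarrow> nat \<Rightarrow> ipoly \<Rightarrow> bool" where
  "reduced n M P \<longleftrightarrow> (\<forall>t\<in>set P. \<forall>i<n. count_list (snd t) i < M)"

locale power_relations =
  fixes n M B :: nat and V :: "nat set" and r :: "nat \<Rightarrow> ipoly"
  assumes vars_rel: "\<And>i. i < n \<Longrightarrow> vars_in V (r i)"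
    and degree_rel: "\<And>i t. i < n \<Longrightarrow> t \<in> set (r i) \<Longrightarrow> degree_below n (snd t) < M"
    and norm_rel: "\<And>i. i < n \<Longrightarrow> coeff_norm (r i) \<le> B"
    and B_pos: "B \<ge> 1"
begin

definition solution :: "(nat \<Rightarrow> real) \<Rightarrow> bool" where
  "solution \<zeta> \<longleftrightarrow> (\<forall>i<n. \<zeta> i ^ M = peval (r i) \<zeta>)"

definition has_normal_form :: "nat \<Rightarrow> ((nat \<Rightarrow> real) \<Rightarrow> real) \<Rightarrow> bool" where
  "has_normal_form K f \<longleftrightarrow>
     (\<exists>R. vars_in V R \<and> reduced n M R \<and> coeff_norm R \<le> K \<and> (\<forall>\<zeta>. solution \<zeta> \<longrightarrow> peval R \<zeta> = f \<zeta>))"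

lemma has_normal_form_mono: "has_normal_form K f \<Longrightarrow> K \<le> L \<Longrightarrow> has_normal_form L f"
  unfolding has_normal_form_def by (meson le_trans)

lemma has_normal_form_cong:
  "has_normal_form K f \<Longrightarrow> (\<And>\<zeta>. solution \<zeta> \<Longrightarrow> f \<zeta> = g \<zeta>) \<Longrightarrow> has_normal_form K g"
  unfolding has_normal_form_def by metis

lemma has_normal_form_peval_mult:
  assumes "\<And>t. t \<in> set Q \<Longrightarrow> has_normal_form K (\<lambda>\<zeta>. meval (snd t) \<zeta> * g \<zeta>)"
  shows "has_normal_form (coeff_norm Q * K) (\<lambda>\<zeta>. peval Q \<zeta> * g \<zeta>)"
proof -
  obtain F where F: "\<And>t. t \<in> set Q \<Longrightarrow> vars_in V (F t) \<and> reduced n M (F t) \<and> coeff_norm (F t) \<le> K \<and>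
      (\<forall>\<zeta>. solution \<zeta> \<longrightarrow> peval (F t) \<zeta> = meval (snd t) \<zeta> * g \<zeta>)"
    using assms unfolding has_normal_form_def by metis
  define R where "R = concat (map (\<lambda>t. pscale (fst t) (F t)) Q)"
  have "vars_in V R" using F by (auto simp: R_def vars_in_concat)
  moreover have "reduced n M R" using F by (fastforce simp: R_def reduced_def set_pscale)
  moreover have "coeff_norm R \<le> coeff_norm Q * K"
    unfolding R_def by (rule coeff_norm_linear_combination) (use F in auto)
  moreover have "\<forall>\<zeta>. solution \<zeta> \<longrightarrow> peval R \<zeta> = peval Q \<zeta> * g \<zeta>"
    unfolding R_def by (intro allI impI peval_linear_combination) (use F in blast)
  ultimately show ?thesis unfolding has_normal_form_def by blast
qed

lemma has_normal_form_meval: "set m \<subseteq> V \<Longrightarrow> has_normal_form (B ^ degree_below n m) (meval m)"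
proof (induction "degree_below n m" arbitrary: m rule: less_induct)
  case less
  show ?case
  proof (cases "\<forall>i<n. count_list m i < M")
    case True
    then show ?thesis
      unfolding has_normal_form_def using less.prems B_pos
      by (intro exI[of _ "[(1, m)]"]) (auto simp: reduced_def)
  next
    case False
    then obtain i where i: "i < n" "M \<le> count_list m i" by (auto simp: not_less)
    from meval_factor_power[OF this] obtain m' where "set m' \<subseteq> set m"
      and degree_m: "degree_below n m = M + degree_below n m'"
      and meval_m: "\<forall>\<zeta>. meval m \<zeta> = \<zeta> i ^ M * meval m' \<zeta>" by (elim exE conjE)
    have "has_normal_form (B ^ (degree_below n m - 1)) (\<lambda>\<zeta>. meval (snd t) \<zeta> * meval m' \<zeta>)"
      if t: "t \<in> set (r i)" for t
    proof -
      have "degree_below n (snd t @ m') < degree_below n m" using degree_rel[OF i(1) t] degree_m by simp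
      moreover have "set (snd t @ m') \<subseteq> V"
        using vars_rel[OF i(1)] t \<open>set m' \<subseteq> set m\<close> less.prems by (auto simp: vars_in_def)
      ultimately have "has_normal_form (B ^ degree_below n (snd t @ m')) (meval (snd t @ m'))"
        by (rule less.hyps)
      moreover have "B ^ degree_below n (snd t @ m') \<le> B ^ (degree_below n m - 1)"
        using \<open>degree_below n (snd t @ m') < _\<close> B_pos by (intro power_increasing) auto
      ultimately show ?thesis by (rule has_normal_form_cong[OF has_normal_form_mono]) simp
    qed
    then have "has_normal_form (coeff_norm (r i) * B ^ (degree_below n m - 1)) (\<lambda>\<zeta>. peval (r i) \<zeta> * meval m' \<zeta>)"
      by (rule has_normal_form_peval_mult)
    moreover have "coeff_norm (r i) * B ^ (degree_below n m - 1) \<le> B ^ degree_below n m"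
    proof (cases "r i = []")
      case False
      then have "M > 0" using degree_rel[OF i(1)] by (metis gr0I last_in_set less_nat_zero_code)
      then have "B ^ degree_below n m = B * B ^ (degree_below n m - 1)"
        using degree_m by (metis Suc_diff_1 add_gr_0 power_Suc)
      then show ?thesis using norm_rel[OF i(1)] by simp
    qed simp
    ultimately show ?thesis
      by (rule has_normal_form_cong[OF has_normal_form_mono]) (simp add: meval_m solution_def i(1))
  qed
qed

end

definition digit_mon :: "nat \<Rightarrow> nat \<Rightarrow> nat \<Rightarrow> nat list" where
  "digit_mon n M \<beta> = concat (map (\<lambda>i. replicate (\<beta> div M ^ i mod M) i) [0..<n])"

lemma meval_digit_mon: "meval (digit_mon n M \<beta>) \<zeta> = (\<Prod>i<n. \<zeta> i ^ (\<beta> div M ^ i mod M))"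
proof -
  have "meval (concat (map (\<lambda>i. replicate (f i) i) [0..<k])) \<zeta> = (\<Prod>i<k. \<zeta> i ^ f i)" for f k
    by (induction k) auto
  then show ?thesis by (simp add: digit_mon_def)
qed

lemma set_digit_mon: "set (digit_mon n M \<beta>) \<subseteq> {..<n}"
  by (auto simp: digit_mon_def)

lemma length_digit_mon:
  assumes "M > 0"
  shows "length (digit_mon n M \<beta>) \<le> n * M"
proof (induction n)
  case (Suc n)
  have "\<beta> div M ^ n mod M \<le> M" using assms by (simp add: less_imp_le)
  with Suc show ?case by (simp add: digit_mon_def)
qed (simp add: digit_mon_def)

text \<open>The reduced monomials in the variables below \<open>n\<close> are numbered by the base-\<open>M\<close> digits of \<open>\<beta>\<close>; the
  variables \<open>n\<close> and \<open>n + 1\<close> are parameters and become \<open>0\<close> and \<open>1\<close> in the coefficients.\<close>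

lemma reduced_expansion:
  assumes R: "vars_in {..<n + 2} R" "reduced n M R"
  obtains C where "\<And>\<beta>. vars_in {0, 1} (C \<beta>)" "\<And>\<beta>. coeff_norm (C \<beta>) \<le> coeff_norm R"
    "\<And>\<zeta> \<eta>. \<eta> 0 = \<zeta> n \<Longrightarrow> \<eta> 1 = \<zeta> (n + 1) \<Longrightarrow>
      peval R \<zeta> = (\<Sum>\<beta><M ^ n. peval (C \<beta>) \<eta> * meval (digit_mon n M \<beta>) \<zeta>)"
proof -
  have "\<exists>\<beta><M ^ n. \<forall>i<n. \<beta> div M ^ i mod M = count_list (snd t) i" if "t \<in> set R" for t
    using R that by (intro digits_exist) (auto simp: reduced_def)
  then obtain code where code: "\<And>t. t \<in> set R \<Longrightarrow> code t < M ^ n"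
     "\<And>t i. t \<in> set R \<Longrightarrow> i < n \<Longrightarrow> code t div M ^ i mod M = count_list (snd t) i" by metis
  define params where "params m = replicate (count_list m n) (0::nat) @ replicate (count_list m (n + 1)) 1" for m
  define C where "C P \<beta> = map (\<lambda>t. (fst t, params (snd t))) (filter (\<lambda>t. code t = \<beta>) P)" for P \<beta>
  have "peval P \<zeta> = (\<Sum>\<beta><M ^ n. peval (C P \<beta>) \<eta> * meval (digit_mon n M \<beta>) \<zeta>)"
    if \<eta>: "\<eta> 0 = \<zeta> n" "\<eta> 1 = \<zeta> (n + 1)" and "set P \<subseteq> set R" for \<zeta> \<eta> P
    using that(3)
  proof (induction P)
    case (Cons t P)
    then have t: "t \<in> set R" by auto
    have "meval (snd t) \<zeta> = (\<Prod>i<n + 2. \<zeta> i ^ count_list (snd t) i)"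
      using R t by (intro meval_eq_prod_count) (auto simp: vars_in_def)
    also have "\<dots> = (\<Prod>i<n. \<zeta> i ^ count_list (snd t) i)
        * (\<zeta> n ^ count_list (snd t) n * \<zeta> (n + 1) ^ count_list (snd t) (n + 1))"
      by (simp add: numeral_2_eq_2 mult.assoc)
    also have "\<dots> = meval (digit_mon n M (code t)) \<zeta> * meval (params (snd t)) \<eta>"
      using \<eta> code(2)[OF t] by (simp add: meval_digit_mon params_def)
    finally have split_t: "meval (snd t) \<zeta> = meval (digit_mon n M (code t)) \<zeta> * meval (params (snd t)) \<eta>" .
    have "(\<Sum>\<beta><M ^ n. peval (C (t # P) \<beta>) \<eta> * meval (digit_mon n M \<beta>) \<zeta>) =
      (\<Sum>\<beta><M ^ n. (if \<beta> = code t then real_of_int (fst t) * meval (params (snd t)) \<eta> * meval (digit_mon n M \<beta>) \<zeta> else 0)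
        + peval (C P \<beta>) \<eta> * meval (digit_mon n M \<beta>) \<zeta>)"
      by (intro sum.cong) (auto simp: C_def algebra_simps)
    also have "\<dots> = peval (t # P) \<zeta>"
      using Cons code(1)[OF t] by (simp add: sum.distrib split_t)
    finally show ?case by simp
  qed (simp add: C_def)
  moreover have "vars_in {0, 1} (C R \<beta>)" for \<beta> by (auto simp: C_def params_def vars_in_def)
  moreover have "coeff_norm (C P \<beta>) \<le> coeff_norm P" for P \<beta> by (induction P) (auto simp: C_def)
  ultimately show ?thesis using that[of "C R"] by blast
qed

section \<open>Eigenvalues as roots of integer polynomials\<close>

lemma mat_mult_vec_index:
  "v \<in> carrier_vec N \<Longrightarrow> i < N \<Longrightarrow> (mat N N (\<lambda>(i, j). A i j) *\<^sub>v v) $ i = (\<Sum>j<N. A i j * v $ j)"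
  by (auto simp: scalar_prod_def atLeast0LessThan intro!: sum.cong)

lemma det_eq_0_if_kernel:
  fixes A :: "nat \<Rightarrow> nat \<Rightarrow> 'a::field"
  assumes kernel: "\<And>i. i < N \<Longrightarrow> (\<Sum>j<N. A i j * x j) = 0" and nonzero: "i < N" "x i \<noteq> 0"
  shows "det (mat N N (\<lambda>(i, j). A i j)) = 0"
proof -
  have "mat N N (\<lambda>(i, j). A i j) *\<^sub>v vec N x = 0\<^sub>v N"
    using kernel by (intro eq_vecI) (simp_all add: mat_mult_vec_index del: index_mult_mat_vec)
  moreover have "vec N x \<noteq> 0\<^sub>v N"
  proof
    assume "vec N x = 0\<^sub>v N"
    then have "vec N x $ i = 0" using nonzero(1) by simp
    with nonzero show False by simp
  qed
  ultimately show ?thesis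
    using det_0_iff_vec_prod_zero_field[OF mat_carrier] vec_carrier by blast
qed

lemma det_dominant_shift_nonzero:
  fixes C :: "nat \<Rightarrow> nat \<Rightarrow> real"
  assumes dominant: "(\<Sum>i<N. \<Sum>j<N. \<bar>C i j\<bar>) < \<bar>t\<bar>"
  shows "det (mat N N (\<lambda>(i, j). (if i = j then t else 0) - C i j)) \<noteq> 0"
proof
  let ?A = "mat N N (\<lambda>(i, j). (if i = j then t else 0) - C i j)"
  assume "det ?A = 0"
  then obtain v where v: "v \<in> carrier_vec N" "v \<noteq> 0\<^sub>v N" "?A *\<^sub>v v = 0\<^sub>v N"
    using det_0_iff_vec_prod_zero_field[of ?A N] by auto
  then obtain l where l: "l < N" "v $ l \<noteq> 0" by (metis carrier_vecD eq_vecI index_zero_vec)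
  define W where "W = Max ((\<lambda>j. \<bar>v $ j\<bar>) ` {..<N})"
  have "W \<in> (\<lambda>j. \<bar>v $ j\<bar>) ` {..<N}" unfolding W_def by (rule Max_in) (use l in auto)
  then obtain i where i: "i < N" "W = \<bar>v $ i\<bar>" by auto
  have le_W: "\<bar>v $ j\<bar> \<le> W" if "j < N" for j unfolding W_def using that by (intro Max_ge) auto
  have "W > 0" using le_W[OF l(1)] l(2) by linarith
  have "0 = (\<Sum>j<N. ((if i = j then t else 0) - C i j) * v $ j)"
    using v i(1) mat_mult_vec_index[OF v(1) i(1), of "\<lambda>i j. (if i = j then t else 0) - C i j"] by simp
  also have "\<dots> = (\<Sum>j<N. (if j = i then t * v $ j else 0) - C i j * v $ j)"
    by (intro sum.cong) (auto simp: left_diff_distrib)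
  also have "\<dots> = t * v $ i - (\<Sum>j<N. C i j * v $ j)" using i(1) by (simp add: sum_subtractf)
  finally have "t * v $ i = (\<Sum>j<N. C i j * v $ j)" by simp
  then have "\<bar>t\<bar> * W = \<bar>\<Sum>j<N. C i j * v $ j\<bar>" by (metis abs_mult i(2))
  also have "\<dots> \<le> (\<Sum>j<N. \<bar>C i j\<bar> * W)"
    by (rule order_trans[OF sum_abs], rule sum_mono) (auto simp: abs_mult intro!: mult_left_mono le_W)
  also have "\<dots> = (\<Sum>j<N. \<bar>C i j\<bar>) * W" by (simp add: sum_distrib_right)
  also have "\<dots> \<le> (\<Sum>i<N. \<Sum>j<N. \<bar>C i j\<bar>) * W"
    using \<open>W > 0\<close> i(1)
    by (intro mult_right_mono member_le_sum[of i "{..<N}" "\<lambda>i. \<Sum>j<N. \<bar>C i j\<bar>"]) (auto intro: sum_nonneg)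
  also have "\<dots> < \<bar>t\<bar> * W" using dominant \<open>W > 0\<close> by (rule mult_strict_right_mono)
  finally show False by simp
qed

text \<open>\<open>real D * \<eta> 0 * \<eta> 2\<close> is the prospective eigenvalue; in the application, \<open>\<eta>\<close> lists the two penalty
  parameters and the minimum.\<close>

definition shifted_matrix :: "nat \<Rightarrow> nat \<Rightarrow> (nat \<Rightarrow> nat \<Rightarrow> ipoly) \<Rightarrow> (nat \<Rightarrow> real) \<Rightarrow> real mat" where
  "shifted_matrix N D C \<eta> =
     mat N N (\<lambda>(\<alpha>, \<beta>). (if \<alpha> = \<beta> then real D * \<eta> 0 * \<eta> 2 else 0) - peval (C \<alpha> \<beta>) \<eta>)"

lemma ipoly_fun_det_shifted_matrix:
  assumes C: "\<And>\<alpha> \<beta>. vars_in {0, 1} (C \<alpha> \<beta>)" "\<And>\<alpha> \<beta>. coeff_norm (C \<alpha> \<beta>) \<le> L"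
  shows "ipoly_fun {0, 1, 2} (fact N * (D + L) ^ N) (\<lambda>\<eta>. det (shifted_matrix N D C \<eta>))"
proof -
  have "ipoly_fun {0, 1, 2} (D + L) (\<lambda>\<eta>. (if \<alpha> = \<beta> then real D * \<eta> 0 * \<eta> 2 else 0) + - peval (C \<alpha> \<beta>) \<eta>)" for \<alpha> \<beta>
  proof (intro ipoly_fun_add ipoly_fun_minus)
    show "ipoly_fun {0, 1, 2} L (peval (C \<alpha> \<beta>))"
      using C(2) by (intro ipoly_fun_peval vars_in_mono[OF C(1)]) auto
    show "ipoly_fun {0, 1, 2} D (\<lambda>\<eta>. if \<alpha> = \<beta> then real D * \<eta> 0 * \<eta> 2 else 0)"
      unfolding ipoly_fun_def
      by (rule exI[of _ "if \<alpha> = \<beta> then [(int D, [0, 2])] else []"]) auto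
  qed
  then show ?thesis unfolding shifted_matrix_def by (intro ipoly_fun_det) simp
qed

lemma det_shifted_matrix_not_always_0:
  assumes vars: "\<And>\<alpha> \<beta>. vars_in {0, 1} (C \<alpha> \<beta>)" and "D > 0"
  shows "\<exists>\<eta>. det (shifted_matrix N D C \<eta>) \<noteq> 0"
proof
  define \<eta>0 where "\<eta>0 = (\<lambda>i::nat. if i = 0 then 1 else 0 :: real)"
  define S where "S = (\<Sum>\<alpha><N. \<Sum>\<beta><N. \<bar>peval (C \<alpha> \<beta>) \<eta>0\<bar>)"
  let ?\<eta> = "\<eta>0(2 := S + 1)"
  have "peval (C \<alpha> \<beta>) ?\<eta> = peval (C \<alpha> \<beta>) \<eta>0" for \<alpha> \<beta>
    by (rule peval_cong[OF vars]) (auto simp: \<eta>0_def)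
  moreover have "0 \<le> S" by (auto simp: S_def intro!: sum_nonneg)
  then have "1 * (S + 1) \<le> real D * (S + 1)" using \<open>D > 0\<close> by (intro mult_right_mono) auto
  then have "S < \<bar>real D * ?\<eta> 0 * ?\<eta> 2\<bar>" by (simp add: \<eta>0_def)
  ultimately show "det (shifted_matrix N D C ?\<eta>) \<noteq> 0"
    unfolding shifted_matrix_def by (intro det_dominant_shift_nonzero) (simp add: S_def)
qed

lemma det_shifted_matrix_eq_0:
  assumes eigenvector: "\<And>\<alpha>. \<alpha> < N \<Longrightarrow> real D * \<eta> 0 * \<eta> 2 * x \<alpha> = (\<Sum>\<beta><N. peval (C \<alpha> \<beta>) \<eta> * x \<beta>)"
    and nonzero: "i < N" "x i \<noteq> 0"
  shows "det (shifted_matrix N D C \<eta>) = 0"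
proof -
  let ?A = "\<lambda>\<alpha> \<beta>. (if \<alpha> = \<beta> then real D * \<eta> 0 * \<eta> 2 else 0) - peval (C \<alpha> \<beta>) \<eta>"
  have "(\<Sum>\<beta><N. ?A \<alpha> \<beta> * x \<beta>) = 0" if "\<alpha> < N" for \<alpha>
  proof -
    have "(\<Sum>\<beta><N. ?A \<alpha> \<beta> * x \<beta>) = (\<Sum>\<beta><N. (if \<beta> = \<alpha> then real D * \<eta> 0 * \<eta> 2 * x \<beta> else 0) - peval (C \<alpha> \<beta>) \<eta> * x \<beta>)"
      by (intro sum.cong) (auto simp: left_diff_distrib)
    also have "\<dots> = 0" using that eigenvector[OF that] by (simp add: sum_subtractf)
    finally show ?thesis .
  qed
  then show ?thesis unfolding shifted_matrix_def using nonzero by (rule det_eq_0_if_kernel)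
qed

lemma eigenvalue_polynomial:
  fixes C :: "nat \<Rightarrow> nat \<Rightarrow> ipoly"
  assumes C: "\<And>\<alpha> \<beta>. vars_in {0, 1} (C \<alpha> \<beta>)" "\<And>\<alpha> \<beta>. coeff_norm (C \<alpha> \<beta>) \<le> L" and "D > 0"
  obtains Q where "vars_in {0, 1, 2} Q" "coeff_norm Q \<le> fact N * (D + L) ^ N" "\<exists>\<zeta>. peval Q \<zeta> \<noteq> 0"
    "\<And>\<eta> x i. (\<And>\<alpha>. \<alpha> < N \<Longrightarrow> real D * \<eta> 0 * \<eta> 2 * x \<alpha> = (\<Sum>\<beta><N. peval (C \<alpha> \<beta>) \<eta> * x \<beta>)) \<Longrightarrow>
      i < N \<Longrightarrow> x i \<noteq> 0 \<Longrightarrow> peval Q \<eta> = 0"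
proof -
  obtain Q where Q: "vars_in {0, 1, 2} Q" "coeff_norm Q \<le> fact N * (D + L) ^ N"
    and det: "\<And>\<eta>. det (shifted_matrix N D C \<eta>) = peval Q \<eta>"
    using ipoly_fun_det_shifted_matrix[of C L N D, OF C] by (auto simp: ipoly_fun_def)
  show ?thesis
    using det_shifted_matrix_not_always_0[of C D N, OF C(1) \<open>D > 0\<close>]
    by (intro that[OF Q]) (auto simp: det[symmetric] intro: det_shifted_matrix_eq_0)
qed

section \<open>A gap theorem for constrained minima\<close>

text \<open>Bounds the coefficients of the determinant in \<open>eigenvalue_polynomial\<close>: \<open>(2 * E + 1) ^ n\<close> is the
  number of reduced monomials, and the power of \<open>2 * E * H + 1\<close> bounds the growth under reduction.\<close>

definition gap_bound :: "nat \<Rightarrow> nat \<Rightarrow> nat \<Rightarrow> nat" where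
  "gap_bound n E H = fact ((2 * E + 1) ^ n) *
     (2 * E + 2 + (2 * (2 * E + 2) * H + n) * (2 * E * H + 1) ^ (2 * E + 2 + n * (2 * E + 1))) ^ ((2 * E + 1) ^ n)"

lemma gap_bound_pos: "gap_bound n E H > 0" by (simp add: gap_bound_def)

lemma coercive_bound:
  fixes c C H W :: real
  assumes "c > 0" "H \<ge> 0" and le: "c * W ^ (2 * E + 2) \<le> C + H * W ^ E"
  shows "W \<le> 1 + (H + \<bar>C\<bar>) / c"
proof (rule ccontr)
  assume "\<not> ?thesis"
  moreover have "(H + \<bar>C\<bar>) / c \<ge> 0" using assms by (intro divide_nonneg_pos) auto
  ultimately have "W > 1" "(H + \<bar>C\<bar>) / c < W" by linarith+
  then have "H + \<bar>C\<bar> < c * W" using \<open>c > 0\<close> by (simp add: divide_less_eq mult.commute)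
  have "C \<le> \<bar>C\<bar> * 1" by simp
  also have "\<dots> \<le> \<bar>C\<bar> * W ^ E" using \<open>W > 1\<close> by (intro mult_left_mono one_le_power) auto
  finally have "c * W ^ (2 * E + 2) \<le> (H + \<bar>C\<bar>) * W ^ E" using le by (simp add: algebra_simps)
  also have "\<dots> < c * W * W ^ E" using \<open>H + \<bar>C\<bar> < c * W\<close> \<open>W > 1\<close> by (intro mult_strict_right_mono) auto
  also have "\<dots> = c * W ^ (E + 1)" by simp
  also have "\<dots> \<le> c * W ^ (2 * E + 2)" using \<open>W > 1\<close> \<open>c > 0\<close> by (intro mult_left_mono power_increasing) auto
  finally show False by simp
qed

locale penalty =
  fixes n E H :: nat and p h :: ipoly
  assumes vars: "vars_in {..<n} p" "vars_in {..<n} h"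
    and deg: "degree_le E p" "degree_le E h"
    and norm: "coeff_norm p \<le> H" "coeff_norm h \<le> H"
    and nonneg: "\<And>z. 0 \<le> peval p z"
begin

text \<open>\<open>k\<close> weights the constraint \<open>p = 0\<close>; the even power makes the function coercive, and its exponent
  exceeds the degrees of \<open>p\<close> and \<open>h\<close>, so that the equations for a critical point express
  \<open>z i ^ (2 * E + 1)\<close> by lower terms. Letting first \<open>k\<close> and then \<open>e\<close> tend to infinity yields the
  infimum of \<open>h\<close> on \<open>p = 0\<close>.\<close>

definition penalized :: "real \<Rightarrow> real \<Rightarrow> (nat \<Rightarrow> real) \<Rightarrow> real" where
  "penalized e k z = k * peval p z + peval h z + (1 / (e * (2 * E + 2))) * (\<Sum>i<n. z i ^ (2 * E + 2))"

definition minimizer :: "real \<Rightarrow> real \<Rightarrow> (nat \<Rightarrow> real) \<Rightarrow> bool" where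
  "minimizer e k z \<longleftrightarrow> (\<forall>z'. penalized e k z \<le> penalized e k z')"

definition sublevel_radius :: "real \<Rightarrow> real \<Rightarrow> real" where
  "sublevel_radius e C = 1 + (real H + \<bar>C\<bar>) / (1 / (e * (2 * E + 2)))"

lemma sublevel_bounded:
  assumes e: "e > 0" and k: "k \<ge> 0" and le: "penalized e k z \<le> C" and i: "i < n"
  shows "\<bar>z i\<bar> \<le> sublevel_radius e C"
proof -
  define c where "c = 1 / (e * (2 * E + 2))"
  define W where "W = max 1 (Max ((\<lambda>j. \<bar>z j\<bar>) ` {..<n}))"
  have le_W: "\<bar>z j\<bar> \<le> W" if "j < n" for j
    unfolding W_def using that by (intro max.coboundedI2 Max_ge) auto
  have c: "c > 0" using e unfolding c_def by (intro divide_pos_pos mult_pos_pos) auto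
  show ?thesis
  proof (cases "W = 1")
    case True
    have "0 \<le> (H + \<bar>C\<bar>) / c" using c by (intro divide_nonneg_pos) auto
    then show ?thesis
      using le_W[OF i] True unfolding sublevel_radius_def c_def[symmetric] by simp
  next
    case False
    then have "W = Max ((\<lambda>j. \<bar>z j\<bar>) ` {..<n})" by (auto simp: W_def max_def split: if_splits)
    then have "W \<in> (\<lambda>j. \<bar>z j\<bar>) ` {..<n}"
      using i by (metis Max_in empty_iff finite_imageI finite_lessThan image_is_empty lessThan_iff)
    then obtain j where j: "j < n" "W = \<bar>z j\<bar>" by auto
    have "W ^ (2 * E + 2) = z j ^ (2 * E + 2)"
      by (simp only: j(2)) (rule power_even_abs, simp)
    also have "\<dots> \<le> (\<Sum>i<n. z i ^ (2 * E + 2))"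
      using j by (intro member_le_sum) (auto intro!: zero_le_even_power simp del: power_Suc power_add_numeral2)
    finally have "c * W ^ (2 * E + 2) \<le> c * (\<Sum>i<n. z i ^ (2 * E + 2))" using c by simp
    moreover have "\<bar>peval h z\<bar> \<le> real (coeff_norm h) * W ^ E"
      using vars(2) le_W deg(2) by (intro abs_peval_le) (auto simp: W_def)
    moreover have "\<dots> \<le> H * W ^ E" using norm by (intro mult_right_mono) (auto simp: W_def)
    moreover have "0 \<le> k * peval p z" using nonneg k by simp
    ultimately have "c * W ^ (2 * E + 2) \<le> C + H * W ^ E"
      using le unfolding penalized_def c_def[symmetric] by linarith
    then have "W \<le> sublevel_radius e C"
      unfolding sublevel_radius_def c_def[symmetric] using c by (intro coercive_bound) auto
    with le_W[OF i] show ?thesis by simp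
  qed
qed

lemma continuous_on_penalized: "continuous_on S (penalized e k)"
  unfolding penalized_def by (intro continuous_intros)

lemma minimizer_exists:
  assumes e: "e > 0" and k: "k \<ge> 0"
  obtains z where "\<forall>i\<ge>n. z i = 0" "minimizer e k z"
proof -
  define C where "C = penalized e k (\<lambda>_. 0)"
  define R where "R = sublevel_radius e C"
  have "R \<ge> 0"
    unfolding R_def sublevel_radius_def using e by (intro add_nonneg_nonneg divide_nonneg_nonneg) auto
  then have origin: "(\<lambda>_. 0) \<in> coord_cube n R" by (auto simp: coord_cube_def)
  then obtain z where z: "z \<in> coord_cube n R" "\<And>z'. z' \<in> coord_cube n R \<Longrightarrow> penalized e k z \<le> penalized e k z'"
    using continuous_attains_inf[OF compact_coord_cube _ continuous_on_penalized, of n R e k] by blast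
  have "penalized e k z \<le> penalized e k z'" for z'
  proof (cases "penalized e k z' \<le> C")
    case True
    define y where "y i = (if i < n then z' i else 0)" for i
    have "y \<in> coord_cube n R"
      using sublevel_bounded[OF e k True] by (auto simp: coord_cube_def y_def R_def)
    moreover have "penalized e k y = penalized e k z'"
      using peval_cong[OF vars(1), of y z'] peval_cong[OF vars(2), of y z'] by (simp add: penalized_def y_def)
    ultimately show ?thesis using z(2) by metis
  next
    case False
    with z(2)[OF origin] show ?thesis by (simp add: C_def)
  qed
  then show ?thesis using z(1) that by (auto simp: coord_cube_def minimizer_def)
qed

lemma minimizer_critical:
  assumes e: "e > 0" and min: "minimizer e k z" and i: "i < n"
  shows "z i ^ (2 * E + 1) = - e * (k * peval (partial_deriv i p) z + peval (partial_deriv i h) z)"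
proof -
  define c where "c = 1 / (e * (2 * E + 2))"
  define g where "g t = penalized e k (z(i := t))" for t
  have g: "g t = k * peval p (z(i := t)) + peval h (z(i := t))
      + c * (t ^ (2 * E + 2) + (\<Sum>j\<in>{..<n} - {i}. z j ^ (2 * E + 2)))" for t
  proof -
    have "(\<Sum>j<n. (z(i := t)) j ^ (2 * E + 2)) = t ^ (2 * E + 2) + (\<Sum>j\<in>{..<n} - {i}. (z(i := t)) j ^ (2 * E + 2))"
      using i by (subst sum.remove[of _ i]) auto
    also have "(\<Sum>j\<in>{..<n} - {i}. (z(i := t)) j ^ (2 * E + 2)) = (\<Sum>j\<in>{..<n} - {i}. z j ^ (2 * E + 2))"
      by (intro sum.cong) auto
    finally show ?thesis by (simp add: g_def penalized_def c_def)
  qed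
  have pow_deriv: "((\<lambda>t. t ^ (2 * E + 2)) has_real_derivative (2 * E + 2) * x ^ (2 * E + 1)) (at x)" for x :: real
    by (rule derivative_eq_intros refl)+ simp
  have "(g has_real_derivative k * peval (partial_deriv i p) (z(i := z i)) + peval (partial_deriv i h) (z(i := z i))
      + c * ((2 * E + 2) * z i ^ (2 * E + 1) + 0)) (at (z i))"
    unfolding g[abs_def]
    by (intro DERIV_add DERIV_cmult DERIV_peval DERIV_const pow_deriv)
  then have deriv: "(g has_real_derivative k * peval (partial_deriv i p) z + peval (partial_deriv i h) z
      + c * ((2 * E + 2) * z i ^ (2 * E + 1))) (at (z i))"
    by simp
  have "k * peval (partial_deriv i p) z + peval (partial_deriv i h) z + c * ((2 * E + 2) * z i ^ (2 * E + 1)) = 0"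
    by (rule DERIV_local_min[OF deriv, of 1]) (use min in \<open>simp_all add: g_def minimizer_def\<close>)
  moreover have "c * ((2 * E + 2) * z i ^ (2 * E + 1)) = z i ^ (2 * E + 1) / e"
  proof -
    have "1 / (e * d) * (d * y) = y / e" if "d > 0" for d y :: real
      using that e by (simp add: field_simps)
    then show ?thesis unfolding c_def by simp
  qed
  moreover have "Z = - e * A" if "A + Z / e = 0" for A Z
    using that e by (simp add: field_simps eq_neg_iff_add_eq_0)
  ultimately show ?thesis by metis
qed

text \<open>In the following polynomials, the variables \<open>n\<close> and \<open>n + 1\<close> stand for the parameters \<open>e\<close> and \<open>k\<close>.\<close>

definition critical_rhs :: "nat \<Rightarrow> ipoly" where
  "critical_rhs i =
     pscale (-1) (pmult [(1, [n])] (pmult [(1, [n + 1])] (partial_deriv i p) @ partial_deriv i h))"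

definition scaled_value :: ipoly where
  "scaled_value = pscale (int (2 * E + 2)) (pmult [(1, [n])] (pmult [(1, [n + 1])] p @ h))
     @ concat (map (\<lambda>i. [(1, replicate (2 * E + 2) i)]) [0..<n])"

lemma vars_in_params: "vars_in {..<n} q \<Longrightarrow> vars_in {..<n + 2} q"
  by (rule vars_in_mono) auto

sublocale power_relations n "2 * E + 1" "2 * E * H + 1" "{..<n + 2}" critical_rhs
proof
  fix i
  show "vars_in {..<n + 2} (critical_rhs i)"
    using vars_in_params[OF vars_in_partial_deriv[OF vars(1)]] vars_in_params[OF vars_in_partial_deriv[OF vars(2)]]
    unfolding critical_rhs_def by simp
  have "coeff_norm (critical_rhs i) = coeff_norm (partial_deriv i p) + coeff_norm (partial_deriv i h)"
    by (simp add: critical_rhs_def)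
  also have "\<dots> \<le> E * coeff_norm p + E * coeff_norm h" by (intro add_mono coeff_norm_partial_deriv deg)
  also have "\<dots> \<le> E * H + E * H" using norm by (intro add_mono mult_le_mono) auto
  finally show "coeff_norm (critical_rhs i) \<le> 2 * E * H + 1" by simp
  fix t assume "t \<in> set (critical_rhs i)"
  then obtain s where s: "s \<in> set (partial_deriv i p) \<or> s \<in> set (partial_deriv i h)"
    "degree_below n (snd t) = degree_below n (snd s)"
    by (auto simp: critical_rhs_def set_pscale pmult_def degree_below_def) blast+
  then have "length (snd s) < E" using length_partial_deriv deg by blast
  with s(2) degree_below_le_length[of n "snd s"] show "degree_below n (snd t) < 2 * E + 1" by simp
qed simp

lemma vars_in_scaled_value: "vars_in {..<n + 2} scaled_value"
proof -
  have "vars_in {..<n + 2} (concat (map (\<lambda>i. [(1, replicate (2 * E + 2) i)]) [0..<n]))"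
    by (auto simp: vars_in_def)
  then show ?thesis
    using vars_in_params[OF vars(1)] vars_in_params[OF vars(2)]
    unfolding scaled_value_def vars_in_simps by (intro conjI vars_in_pscale vars_in_pmult) auto
qed

lemma coeff_norm_scaled_value: "coeff_norm scaled_value \<le> 2 * (2 * E + 2) * H + n"
proof -
  have "coeff_norm (concat (map (\<lambda>i. [(1, replicate (2 * E + 2) i)]) is)) = length is" for "is"
    by (induction "is") auto
  then have "coeff_norm scaled_value = (2 * E + 2) * (coeff_norm p + coeff_norm h) + n"
    unfolding scaled_value_def coeff_norm_simps coeff_norm_pscale coeff_norm_pmult
    by (simp add: nat_add_distrib nat_mult_distrib algebra_simps)
  also have "\<dots> \<le> (2 * E + 2) * (H + H) + n" using norm by (intro add_mono mult_le_mono) auto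
  finally show ?thesis by (simp add: algebra_simps)
qed

lemma degree_below_scaled_value:
  assumes "t \<in> set scaled_value"
  shows "degree_below n (snd t) \<le> 2 * E + 2"
proof -
  from assms consider s where "s \<in> set p \<or> s \<in> set h" "degree_below n (snd t) = degree_below n (snd s)"
    | i where "snd t = replicate (2 * E + 2) i"
    by (auto simp: scaled_value_def set_pscale pmult_def degree_below_def) blast+
  then show ?thesis
  proof cases
    case 1
    then have "length (snd s) \<le> E" using deg by (auto simp: degree_le_def)
    with 1 degree_below_le_length[of n "snd s"] show ?thesis by simp
  next
    case 2
    then show ?thesis using degree_below_le_length[of n "snd t"] by simp
  qed
qed

definition at_params :: "real \<Rightarrow> real \<Rightarrow> (nat \<Rightarrow> real) \<Rightarrow> nat \<Rightarrow> real" where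
  "at_params e k z = z(n := e, n + 1 := k)"

lemma at_params_simps [simp]:
  "i < n \<Longrightarrow> at_params e k z i = z i" "at_params e k z n = e" "at_params e k z (Suc n) = k"
  by (auto simp: at_params_def)

lemma peval_at_params: "vars_in {..<n} q \<Longrightarrow> peval q (at_params e k z) = peval q z"
  by (rule peval_cong) auto

lemma solution_at_params:
  assumes "e > 0" "minimizer e k z"
  shows "solution (at_params e k z)"
  unfolding solution_def critical_rhs_def
  using minimizer_critical[OF assms] vars
  by (auto simp: peval_at_params vars_in_partial_deriv)

lemma peval_scaled_value_at_params:
  fixes e :: real
  assumes "e > 0"
  shows "peval scaled_value (at_params e k z) = (2 * E + 2) * e * penalized e k z"
proof -
  have power_sum: "peval (concat (map (\<lambda>i. [(1, replicate D i)]) [0..<j])) \<zeta> = (\<Sum>i<j. \<zeta> i ^ D)" for D j \<zeta>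
    by (induction j) auto
  have "peval scaled_value (at_params e k z) =
      (2 * E + 2) * (e * (k * peval p z + peval h z)) + (\<Sum>i<n. z i ^ (2 * E + 2))"
    unfolding scaled_value_def peval_simps peval_pscale peval_pmult power_sum
    by (simp add: peval_at_params vars)
  also have "\<dots> = (2 * E + 2) * e * penalized e k z"
  proof -
    have "d * (e * A) + S = d * e * (A + 1 / (e * d) * S)" if "d > 0" for d A S :: real
      using that assms by (simp add: field_simps)
    then show ?thesis unfolding penalized_def by simp
  qed
  finally show ?thesis .
qed

lemma scaled_value_mult_digit_mon_has_normal_form:
  "has_normal_form ((2 * (2 * E + 2) * H + n) * (2 * E * H + 1) ^ (2 * E + 2 + n * (2 * E + 1)))
    (\<lambda>\<zeta>. peval scaled_value \<zeta> * meval (digit_mon n (2 * E + 1) \<alpha>) \<zeta>)"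
proof -
  define M K where "M = 2 * E + 1" and "K = (2 * E * H + 1) ^ (2 * E + 2 + n * M)"
  have "has_normal_form K (\<lambda>\<zeta>. meval (snd t) \<zeta> * meval (digit_mon n M \<alpha>) \<zeta>)" if t: "t \<in> set scaled_value" for t
  proof -
    have "set (snd t @ digit_mon n M \<alpha>) \<subseteq> {..<n + 2}"
      using vars_in_scaled_value t set_digit_mon[of n M \<alpha>] by (auto simp: vars_in_def)
    from has_normal_form_meval[OF this]
    have "has_normal_form ((2 * E * H + 1) ^ degree_below n (snd t @ digit_mon n M \<alpha>))
      (\<lambda>\<zeta>. meval (snd t) \<zeta> * meval (digit_mon n M \<alpha>) \<zeta>)"
      by (rule has_normal_form_cong) simp
    moreover have "M > 0" by (simp add: M_def)
    then have "degree_below n (digit_mon n M \<alpha>) \<le> n * M"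
      by (rule order_trans[OF degree_below_le_length length_digit_mon])
    then have "(2 * E * H + 1) ^ degree_below n (snd t @ digit_mon n M \<alpha>) \<le> K"
      unfolding K_def using degree_below_scaled_value[OF t] by (intro power_increasing) auto
    ultimately show ?thesis by (rule has_normal_form_mono)
  qed
  then have "has_normal_form (coeff_norm scaled_value * K) (\<lambda>\<zeta>. peval scaled_value \<zeta> * meval (digit_mon n M \<alpha>) \<zeta>)"
    by (rule has_normal_form_peval_mult)
  then show ?thesis unfolding M_def K_def
    by (rule has_normal_form_mono) (intro mult_le_mono1 coeff_norm_scaled_value)
qed

lemma multiplication_matrix:
  obtains C where "\<And>\<alpha> \<beta>. vars_in {0, 1} (C \<alpha> \<beta>)"
    "\<And>\<alpha> \<beta>. coeff_norm (C \<alpha> \<beta>) \<le> (2 * (2 * E + 2) * H + n) * (2 * E * H + 1) ^ (2 * E + 2 + n * (2 * E + 1))"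
    "\<And>\<alpha> \<zeta> \<eta>. solution \<zeta> \<Longrightarrow> \<eta> 0 = \<zeta> n \<Longrightarrow> \<eta> 1 = \<zeta> (n + 1) \<Longrightarrow>
      peval scaled_value \<zeta> * meval (digit_mon n (2 * E + 1) \<alpha>) \<zeta> =
      (\<Sum>\<beta><(2 * E + 1) ^ n. peval (C \<alpha> \<beta>) \<eta> * meval (digit_mon n (2 * E + 1) \<beta>) \<zeta>)"
proof -
  define M where "M = 2 * E + 1"
  let ?L = "(2 * (2 * E + 2) * H + n) * (2 * E * H + 1) ^ (2 * E + 2 + n * M)"
  let ?row = "\<lambda>\<alpha> C. (\<forall>\<beta>. vars_in {0, 1} (C \<beta>)) \<and> (\<forall>\<beta>. coeff_norm (C \<beta>) \<le> ?L) \<and>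
     (\<forall>\<zeta> \<eta>. solution \<zeta> \<longrightarrow> \<eta> 0 = \<zeta> n \<longrightarrow> \<eta> 1 = \<zeta> (n + 1) \<longrightarrow>
       peval scaled_value \<zeta> * meval (digit_mon n M \<alpha>) \<zeta> = (\<Sum>\<beta><M ^ n. peval (C \<beta>) \<eta> * meval (digit_mon n M \<beta>) \<zeta>))"
  have "\<exists>C. ?row \<alpha> C" for \<alpha>
  proof -
    from scaled_value_mult_digit_mon_has_normal_form[of \<alpha>]
    obtain R where R: "vars_in {..<n + 2} R" "reduced n M R" "coeff_norm R \<le> ?L"
      "\<forall>\<zeta>. solution \<zeta> \<longrightarrow> peval R \<zeta> = peval scaled_value \<zeta> * meval (digit_mon n M \<alpha>) \<zeta>"
      unfolding has_normal_form_def M_def by (elim exE conjE)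
    obtain C where "\<And>\<beta>. vars_in {0, 1} (C \<beta>)" "\<And>\<beta>. coeff_norm (C \<beta>) \<le> coeff_norm R"
      "\<And>\<zeta> \<eta>. \<eta> 0 = \<zeta> n \<Longrightarrow> \<eta> 1 = \<zeta> (n + 1) \<Longrightarrow> peval R \<zeta> = (\<Sum>\<beta><M ^ n. peval (C \<beta>) \<eta> * meval (digit_mon n M \<beta>) \<zeta>)"
      using reduced_expansion[OF R(1,2)] by metis
    with R(3,4) show ?thesis by (intro exI[of _ C]) (auto intro: le_trans)
  qed
  then have "\<exists>C. \<forall>\<alpha>. ?row \<alpha> (C \<alpha>)" by (intro choice allI)
  then obtain C where C: "\<forall>\<alpha>. ?row \<alpha> (C \<alpha>)" ..
  show ?thesis by (rule that[of C]) (use C[unfolded M_def] in blast)+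
qed

lemma value_polynomial:
  obtains Q where "vars_in {0, 1, 2} Q" "coeff_norm Q \<le> gap_bound n E H" "\<exists>\<zeta>. peval Q \<zeta> \<noteq> 0"
    "\<And>e k z \<eta>. e > 0 \<Longrightarrow> minimizer e k z \<Longrightarrow> \<eta> 0 = e \<Longrightarrow> \<eta> 1 = k \<Longrightarrow> \<eta> 2 = penalized e k z \<Longrightarrow> peval Q \<eta> = 0"
proof -
  define M D where "M = 2 * E + 1" and "D = 2 * E + 2"
  define N L where "N = M ^ n" and "L = (2 * D * H + n) * (2 * E * H + 1) ^ (D + n * M)"
  have pos: "D > 0" "N > 0" by (simp_all add: D_def N_def M_def)
  obtain C where C: "\<And>\<alpha> \<beta>. vars_in {0, 1} (C \<alpha> \<beta>)" "\<And>\<alpha> \<beta>. coeff_norm (C \<alpha> \<beta>) \<le> L"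
    and mult: "\<And>\<alpha> \<zeta> \<eta>. solution \<zeta> \<Longrightarrow> \<eta> 0 = \<zeta> n \<Longrightarrow> \<eta> 1 = \<zeta> (n + 1) \<Longrightarrow>
      peval scaled_value \<zeta> * meval (digit_mon n M \<alpha>) \<zeta> =
      (\<Sum>\<beta><N. peval (C \<alpha> \<beta>) \<eta> * meval (digit_mon n M \<beta>) \<zeta>)"
    unfolding M_def D_def N_def L_def by (rule multiplication_matrix) blast
  obtain Q where Q: "vars_in {0, 1, 2} Q" "coeff_norm Q \<le> fact N * (D + L) ^ N" "\<exists>\<zeta>. peval Q \<zeta> \<noteq> 0"
    and eigenvalue: "\<And>\<eta> x i. (\<And>\<alpha>. \<alpha> < N \<Longrightarrow> real D * \<eta> 0 * \<eta> 2 * x \<alpha> = (\<Sum>\<beta><N. peval (C \<alpha> \<beta>) \<eta> * x \<beta>)) \<Longrightarrow>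
      i < N \<Longrightarrow> x i \<noteq> 0 \<Longrightarrow> peval Q \<eta> = 0"
    using eigenvalue_polynomial[of C L D N, OF C pos(1)] by blast
  show ?thesis
  proof (rule that[OF Q(1) _ Q(3)])
    show "coeff_norm Q \<le> gap_bound n E H"
      using Q(2) by (simp add: gap_bound_def N_def M_def D_def L_def)
    fix e k z and \<eta> :: "nat \<Rightarrow> real"
    assume e: "e > 0" and min: "minimizer e k z" and \<eta>: "\<eta> 0 = e" "\<eta> 1 = k" "\<eta> 2 = penalized e k z"
    let ?\<zeta> = "at_params e k z"
    show "peval Q \<eta> = 0"
    proof (rule eigenvalue[OF _ pos(2)])
      show "real D * \<eta> 0 * \<eta> 2 * meval (digit_mon n M \<alpha>) ?\<zeta> =
        (\<Sum>\<beta><N. peval (C \<alpha> \<beta>) \<eta> * meval (digit_mon n M \<beta>) ?\<zeta>)" for \<alpha>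
        using mult[OF solution_at_params[OF e min], of \<eta> \<alpha>] \<eta>
        by (simp add: peval_scaled_value_at_params[OF e] D_def)
    qed (simp add: meval_digit_mon)
  qed
qed

definition feasible_minimum :: "real \<Rightarrow> real \<Rightarrow> bool" where
  "feasible_minimum e \<tau> \<longleftrightarrow> (\<exists>z. peval p z = 0 \<and> \<tau> = penalized e 0 z) \<and>
     (\<forall>z. peval p z = 0 \<longrightarrow> \<tau> \<le> penalized e 0 z)"

lemma penalized_eq: "penalized e k z = k * peval p z + penalized e 0 z"
  by (simp add: penalized_def)

lemma minimizers_subsequence:
  assumes e: "e > 0" and feasible: "peval p z0 = 0"
  obtains r Z z where "strict_mono r" "\<And>s::nat. minimizer e (real (r s)) (Z s)" "\<And>i. (\<lambda>s. Z s i) \<longlonglongrightarrow> z i"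
proof -
  have "\<exists>z. (\<forall>i\<ge>n. z i = 0) \<and> minimizer e (real s) z" for s :: nat
    using minimizer_exists[OF e, of "real s"] by (metis of_nat_0_le_iff)
  then obtain Z where Z: "\<And>s i. i \<ge> n \<Longrightarrow> Z s i = 0" "\<And>s::nat. minimizer e (real s) (Z s)" by metis
  have upper: "penalized e (real s) (Z s) \<le> penalized e 0 z0" for s
    using Z(2)[of s] feasible unfolding minimizer_def by (metis penalized_eq add_0 mult_zero_right)
  then have "Z s \<in> coord_cube n (sublevel_radius e (penalized e 0 z0))" for s
    using Z(1) sublevel_bounded[OF e of_nat_0_le_iff upper] by (auto simp: coord_cube_def)
  then obtain r z where "strict_mono r" "\<And>i. (\<lambda>s. Z (r s) i) \<longlonglongrightarrow> z i"
    using coord_cube_subsequence[of Z] by metis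
  then show ?thesis using Z(2) that[of r "\<lambda>s. Z (r s)" z] by blast
qed

lemma penalized_minima_converge:
  assumes e: "e > 0" and feasible: "peval p z0 = 0"
  obtains \<tau> ks ts where "filterlim ks at_top sequentially" "ts \<longlonglongrightarrow> \<tau>" "feasible_minimum e \<tau>"
    "\<And>s::nat. \<exists>z. ts s = penalized e (ks s) z \<and> minimizer e (ks s) z"
proof -
  obtain r Z z where r: "strict_mono r" and min: "\<And>s::nat. minimizer e (real (r s)) (Z s)"
    and lim: "\<And>i. (\<lambda>s. Z s i) \<longlonglongrightarrow> z i"
    using minimizers_subsequence[OF assms] by metis
  define ts where "ts s = penalized e (real (r s)) (Z s)" for s
  have upper: "ts s \<le> penalized e 0 z'" if "peval p z' = 0" for s z'
    using min[of s] that unfolding minimizer_def ts_def by (metis penalized_eq add_0 mult_zero_right)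
  have lower: "penalized e 0 (Z s) \<le> ts s" for s
    using nonneg[of "Z s"] by (simp add: ts_def penalized_eq[of e "real (r s)"])
  have lim_eval: "(\<lambda>s. peval q (Z s)) \<longlonglongrightarrow> peval q z" for q
    by (rule tendsto_peval[of UNIV]) (auto intro: lim)
  have lim_0: "(\<lambda>s. penalized e 0 (Z s)) \<longlonglongrightarrow> penalized e 0 z"
    unfolding penalized_def by (intro tendsto_intros lim_eval lim)
  have "peval p z \<le> 0"
  proof (rule multiplier_limit_nonpos[OF filterlim_real_subseq[OF r] lim_eval])
    show "(\<lambda>s. penalized e 0 z0 - penalized e 0 (Z s)) \<longlonglongrightarrow> penalized e 0 z0 - penalized e 0 z"
      by (intro tendsto_intros lim_0)
    show "real (r s) * peval p (Z s) \<le> penalized e 0 z0 - penalized e 0 (Z s)" for s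
      using upper[OF feasible, of s] penalized_eq[of e "real (r s)" "Z s"] by (simp add: ts_def)
  qed
  with nonneg[of z] have z: "peval p z = 0" by simp
  have ts_lim: "ts \<longlonglongrightarrow> penalized e 0 z"
  proof (rule tendsto_sandwich[OF _ _ lim_0 tendsto_const])
    show "\<forall>\<^sub>F s in sequentially. penalized e 0 (Z s) \<le> ts s" using lower by simp
    show "\<forall>\<^sub>F s in sequentially. ts s \<le> penalized e 0 z" using upper[OF z] by simp
  qed
  have "penalized e 0 z \<le> penalized e 0 z'" if "peval p z' = 0" for z'
    by (rule LIMSEQ_le_const2[OF ts_lim]) (use upper[OF that] in auto)
  then have "feasible_minimum e (penalized e 0 z)" unfolding feasible_minimum_def using z by blast
  then show ?thesis
    using that[OF filterlim_real_subseq[OF r] ts_lim] min by (auto simp: ts_def)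
qed

lemma feasible_minimum_polynomial:
  obtains Q where "vars_in {0, 2} Q" "coeff_norm Q \<le> gap_bound n E H" "\<exists>\<zeta>. peval Q \<zeta> \<noteq> 0"
    "\<And>e. e > 0 \<Longrightarrow> \<exists>z. peval p z = 0 \<Longrightarrow> \<exists>\<tau>. feasible_minimum e \<tau> \<and> (\<forall>\<eta>. \<eta> 0 = e \<longrightarrow> \<eta> 2 = \<tau> \<longrightarrow> peval Q \<eta> = 0)"
proof -
  obtain Q' where Q': "vars_in {0, 1, 2} Q'" "coeff_norm Q' \<le> gap_bound n E H" "\<exists>\<zeta>. peval Q' \<zeta> \<noteq> 0"
    and min_root: "\<And>e k z \<eta>. e > 0 \<Longrightarrow> minimizer e k z \<Longrightarrow> \<eta> 0 = e \<Longrightarrow> \<eta> 1 = k \<Longrightarrow> \<eta> 2 = penalized e k z \<Longrightarrow> peval Q' \<eta> = 0"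
    using value_polynomial by metis
  obtain Q where Q: "vars_in ({0, 1, 2} - {1}) Q" "coeff_norm Q \<le> coeff_norm Q'" "\<exists>\<zeta>. peval Q \<zeta> \<noteq> 0"
    and limit_root: "\<And>\<zeta>s \<zeta>. (\<And>s. peval Q' (\<zeta>s s) = 0) \<Longrightarrow> (\<And>i. i \<noteq> 1 \<Longrightarrow> (\<lambda>s::nat. \<zeta>s s i) \<longlonglongrightarrow> \<zeta> i) \<Longrightarrow>
        filterlim (\<lambda>s. \<zeta>s s 1) at_top sequentially \<Longrightarrow> peval Q \<zeta> = 0"
    using obtain_coeff_at_infinity[OF Q'(3,1), of 1] by metis
  show ?thesis
  proof (rule that[OF _ _ Q(3)])
    show "vars_in {0, 2} Q" using Q(1) by (rule vars_in_mono) auto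
    show "coeff_norm Q \<le> gap_bound n E H" using Q(2) Q'(2) by simp
    fix e :: real assume e: "e > 0" and "\<exists>z. peval p z = 0"
    then obtain z0 where "peval p z0 = 0" by blast
    from penalized_minima_converge[OF e this] obtain \<tau> ks ts
      where unbounded: "filterlim ks at_top sequentially" and lim: "ts \<longlonglongrightarrow> \<tau>" and "feasible_minimum e \<tau>"
        and ts: "\<And>s::nat. \<exists>z. ts s = penalized e (ks s) z \<and> minimizer e (ks s) z" by metis
    moreover have "peval Q \<eta> = 0" if "\<eta> 0 = e" "\<eta> 2 = \<tau>" for \<eta>
    proof (rule limit_root[of "\<lambda>s. \<eta>(1 := ks s, 2 := ts s)"])
      show "peval Q' (\<eta>(1 := ks s, 2 := ts s)) = 0" for s
        using ts[of s] e that by (auto intro!: min_root)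
      show "(\<lambda>s. (\<eta>(1 := ks s, 2 := ts s)) i) \<longlonglongrightarrow> \<eta> i" if "i \<noteq> 1" for i
        using that lim \<open>\<eta> 2 = \<tau>\<close> by (cases "i = 2") auto
    qed (use unbounded in simp)
    ultimately show "\<exists>\<tau>. feasible_minimum e \<tau> \<and> (\<forall>\<eta>. \<eta> 0 = e \<longrightarrow> \<eta> 2 = \<tau> \<longrightarrow> peval Q \<eta> = 0)" by blast
  qed
qed

lemma feasible_minima_tendsto_infimum:
  assumes minima: "\<And>s::nat. feasible_minimum (real (Suc s)) (\<tau> s)"
    and bdd: "bdd_below {peval h z |z. peval p z = 0}"
  shows "\<tau> \<longlonglongrightarrow> Inf {peval h z |z. peval p z = 0}" (is "_ \<longlonglongrightarrow> Inf ?S")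
proof (rule order_tendstoI)
  fix a assume "a < Inf ?S"
  moreover have "Inf ?S \<le> \<tau> s" for s
  proof -
    obtain z where z: "peval p z = 0" "\<tau> s = penalized (real (Suc s)) 0 z"
      using minima[of s] unfolding feasible_minimum_def by blast
    have "0 \<le> (\<Sum>i<n. z i ^ (2 * E + 2))" by (intro sum_nonneg zero_le_even_power) auto
    then have "0 \<le> (1 / (real (Suc s) * (2 * E + 2))) * (\<Sum>i<n. z i ^ (2 * E + 2))"
      by (rule mult_nonneg_nonneg[rotated]) simp
    then have "peval h z \<le> \<tau> s" using z(2) by (simp add: penalized_def)
    moreover have "Inf ?S \<le> peval h z" using z(1) bdd by (intro cInf_lower) auto
    ultimately show ?thesis by simp
  qed
  ultimately show "\<forall>\<^sub>F s in sequentially. a < \<tau> s" by (intro always_eventually) (auto intro: less_le_trans)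
next
  fix a assume "Inf ?S < a"
  moreover have "?S \<noteq> {}" using minima[of 0] unfolding feasible_minimum_def by auto
  ultimately obtain z where z: "peval p z = 0" "peval h z < a"
    using cInf_less_iff[OF _ bdd, of a] by auto
  have "filterlim (\<lambda>s. real (Suc s)) at_top sequentially"
    by (rule filterlim_compose[OF filterlim_real_sequentially filterlim_Suc])
  then have "(\<lambda>s. peval h z + inverse (real (Suc s)) * ((\<Sum>i<n. z i ^ (2 * E + 2)) / (2 * E + 2)))
      \<longlonglongrightarrow> peval h z + 0 * ((\<Sum>i<n. z i ^ (2 * E + 2)) / (2 * E + 2))"
    by (intro tendsto_intros tendsto_inverse_0_at_top)
  moreover have "peval h z + inverse (real (Suc s)) * ((\<Sum>i<n. z i ^ (2 * E + 2)) / (2 * E + 2)) =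
      penalized (real (Suc s)) 0 z" for s
    by (simp add: penalized_def field_simps)
  ultimately have "(\<lambda>s. penalized (real (Suc s)) 0 z) \<longlonglongrightarrow> peval h z" by simp
  then have "\<forall>\<^sub>F s in sequentially. penalized (real (Suc s)) 0 z < a" using z(2) by (rule order_tendstoD)
  then show "\<forall>\<^sub>F s in sequentially. \<tau> s < a"
    by eventually_elim (use minima z(1) in \<open>auto simp: feasible_minimum_def intro: le_less_trans\<close>)
qed

lemma infimum_polynomial:
  assumes feasible: "\<exists>z. peval p z = 0" and bdd: "bdd_below {peval h z |z. peval p z = 0}"
  obtains Q where "vars_in {2} Q" "coeff_norm Q \<le> gap_bound n E H" "\<exists>\<zeta>. peval Q \<zeta> \<noteq> 0"
    "\<And>\<eta>. \<eta> 2 = Inf {peval h z |z. peval p z = 0} \<Longrightarrow> peval Q \<eta> = 0"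
proof -
  obtain Q' where Q': "vars_in {0, 2} Q'" "coeff_norm Q' \<le> gap_bound n E H" "\<exists>\<zeta>. peval Q' \<zeta> \<noteq> 0"
    and minimum_root: "\<And>e. e > 0 \<Longrightarrow> \<exists>\<tau>. feasible_minimum e \<tau> \<and> (\<forall>\<eta>. \<eta> 0 = e \<longrightarrow> \<eta> 2 = \<tau> \<longrightarrow> peval Q' \<eta> = 0)"
    using feasible_minimum_polynomial feasible by metis
  obtain Q where Q: "vars_in ({0, 2} - {0}) Q" "coeff_norm Q \<le> coeff_norm Q'" "\<exists>\<zeta>. peval Q \<zeta> \<noteq> 0"
    and limit_root: "\<And>\<zeta>s \<zeta>. (\<And>s. peval Q' (\<zeta>s s) = 0) \<Longrightarrow> (\<And>i. i \<noteq> 0 \<Longrightarrow> (\<lambda>s::nat. \<zeta>s s i) \<longlonglongrightarrow> \<zeta> i) \<Longrightarrow>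
        filterlim (\<lambda>s. \<zeta>s s 0) at_top sequentially \<Longrightarrow> peval Q \<zeta> = 0"
    using obtain_coeff_at_infinity[OF Q'(3,1), of 0] by metis
  have "\<exists>\<tau>. \<forall>s::nat. feasible_minimum (real (Suc s)) (\<tau> s) \<and>
      (\<forall>\<eta>. \<eta> 0 = real (Suc s) \<longrightarrow> \<eta> 2 = \<tau> s \<longrightarrow> peval Q' \<eta> = 0)"
    using minimum_root by (intro choice allI) simp
  then obtain \<tau> where \<tau>: "\<And>s::nat. feasible_minimum (real (Suc s)) (\<tau> s)"
    "\<And>s \<eta>. \<eta> 0 = real (Suc s) \<Longrightarrow> \<eta> 2 = \<tau> s \<Longrightarrow> peval Q' \<eta> = 0" by blast
  have root: "peval Q \<eta> = 0" if "\<eta> 2 = Inf {peval h z |z. peval p z = 0}" for \<eta>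
  proof (rule limit_root[of "\<lambda>s. \<eta>(0 := real (Suc s), 2 := \<tau> s)"])
    show "peval Q' (\<eta>(0 := real (Suc s), 2 := \<tau> s)) = 0" for s by (rule \<tau>(2)) auto
    show "(\<lambda>s. (\<eta>(0 := real (Suc s), 2 := \<tau> s)) i) \<longlonglongrightarrow> \<eta> i" if "i \<noteq> 0" for i
      using that feasible_minima_tendsto_infimum[OF \<tau>(1) bdd] \<open>\<eta> 2 = _\<close> by (cases "i = 2") auto
    have "filterlim (\<lambda>s. real (Suc s)) at_top sequentially"
      by (rule filterlim_compose[OF filterlim_real_sequentially filterlim_Suc])
    then show "filterlim (\<lambda>s. (\<eta>(0 := real (Suc s), 2 := \<tau> s)) 0) at_top sequentially" by simp
  qed
  show ?thesis
  proof (rule that[OF _ _ Q(3) root])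
    show "vars_in {2} Q" using Q(1) by (rule vars_in_mono) auto
    show "coeff_norm Q \<le> gap_bound n E H" using Q(2) Q'(2) by simp
  qed
qed

theorem nonneg_if_above_gap:
  assumes low: "\<And>z. peval p z = 0 \<Longrightarrow> peval h z > - 1 / (2 * real (gap_bound n E H))" and z1: "peval p z1 = 0"
  shows "peval h z1 \<ge> 0"
proof -
  let ?S = "{peval h z |z. peval p z = 0}"
  let ?G = "real (gap_bound n E H)"
  have bdd: "bdd_below ?S" using low by (intro bdd_belowI[of _ "- 1 / (2 * ?G)"]) (auto intro: less_imp_le)
  have Inf_le: "Inf ?S \<le> peval h z1" using z1 bdd by (intro cInf_lower) auto
  obtain Q where Q: "vars_in {2} Q" "coeff_norm Q \<le> gap_bound n E H" "\<exists>\<zeta>. peval Q \<zeta> \<noteq> 0"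
    and root: "\<And>\<eta>. \<eta> 2 = Inf ?S \<Longrightarrow> peval Q \<eta> = 0"
    by (rule infimum_polynomial[OF _ bdd]) (use z1 in blast)+
  show ?thesis
  proof (rule ccontr)
    assume "\<not> ?thesis"
    then have neg: "Inf ?S < 0" using Inf_le by simp
    moreover have "- 1 / (2 * ?G) \<le> Inf ?S"
      using z1 low by (intro cInf_greatest) (auto intro: less_imp_le)
    ultimately have "\<bar>Inf ?S\<bar> * real (coeff_norm Q) \<le> 1 / (2 * ?G) * ?G"
      using Q(2) by (intro mult_mono) auto
    also have "\<dots> < 1" using gap_bound_pos[of n E H] by simp
    finally have "Inf ?S = 0"
      using small_root_eq_0[OF Q(3,1) root, of "\<lambda>_. Inf ?S"] by simp
    with neg show False by simp
  qed
qed

end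

section \<open>Computable functions between coded types\<close>

definition recursive :: "nat \<Rightarrow> (nat list \<Rightarrow> nat) \<Rightarrow> bool" where
  "recursive k F \<longleftrightarrow> (\<exists>r. \<forall>xs. length xs = k \<longrightarrow> reval r xs (F xs))"

lemma recursive_nth: "i < k \<Longrightarrow> recursive k (\<lambda>xs. xs ! i)"
  unfolding recursive_def by (intro exI[of _ "Proj i"]) (auto intro: reval.intros)

lemma recursive_comp1:
  assumes "recursive 1 f" "recursive k g"
  shows "recursive k (\<lambda>xs. f [g xs])"
proof -
  from assms obtain r s where r: "\<And>xs. length xs = 1 \<Longrightarrow> reval r xs (f xs)"
    and s: "\<And>xs. length xs = k \<Longrightarrow> reval s xs (g xs)" by (auto simp: recursive_def)
  have "reval (Comp r [s]) xs (f [g xs])" if "length xs = k" for xs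
    by (rule reval.intros(4)[of "[g xs]"]) (auto simp: r s that)
  then show ?thesis unfolding recursive_def by blast
qed

lemma recursive_comp2:
  assumes "recursive 2 f" "recursive k g" "recursive k h"
  shows "recursive k (\<lambda>xs. f [g xs, h xs])"
proof -
  from assms obtain r s t where r: "\<And>xs. length xs = 2 \<Longrightarrow> reval r xs (f xs)"
    and s: "\<And>xs. length xs = k \<Longrightarrow> reval s xs (g xs)"
    and t: "\<And>xs. length xs = k \<Longrightarrow> reval t xs (h xs)" by (auto simp: recursive_def)
  have "reval (Comp r [s, t]) xs (f [g xs, h xs])" if "length xs = k" for xs
    by (rule reval.intros(4)[of "[g xs, h xs]"]) (auto simp: r s t that less_Suc_eq nth_Cons')
  then show ?thesis unfolding recursive_def by blast
qed

lemma recursive_Suc: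
  assumes "recursive k f"
  shows "recursive k (\<lambda>xs. Suc (f xs))"
proof -
  have "recursive 1 (\<lambda>xs. Suc (hd xs))"
    unfolding recursive_def by (intro exI[of _ Succ]) (auto simp: length_Suc_conv intro: reval.intros)
  from recursive_comp1[OF this assms] show ?thesis by simp
qed

lemma recursive_const: "recursive k (\<lambda>_. c)"
proof (induction c)
  case 0
  show ?case unfolding recursive_def by (intro exI[of _ Zero]) (auto intro: reval.intros)
qed (rule recursive_Suc)

lemma recursive_rec_nat:
  assumes "recursive k f" "recursive (k + 2) g"
  shows "recursive (Suc k) (\<lambda>xs. rec_nat (f (tl xs)) (\<lambda>n y. g (y # n # tl xs)) (hd xs))"
proof -
  from assms obtain r s where r: "\<And>xs. length xs = k \<Longrightarrow> reval r xs (f xs)"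
    and s: "\<And>xs. length xs = k + 2 \<Longrightarrow> reval s xs (g xs)" by (auto simp: recursive_def)
  have "reval (Prim r s) (n # xs) (rec_nat (f xs) (\<lambda>n y. g (y # n # xs)) n)" if "length xs = k" for n xs
  proof (induction n)
    case 0
    show ?case using r that by (auto intro: reval.intros)
  next
    case (Suc n)
    let ?y = "rec_nat (f xs) (\<lambda>n y. g (y # n # xs)) n"
    have "reval s (?y # n # xs) (g (?y # n # xs))" using s that by simp
    from reval.intros(6)[OF Suc this] show ?case by simp
  qed
  then show ?thesis unfolding recursive_def by (intro exI[of _ "Prim r s"]) (auto simp: length_Suc_conv)
qed

lemma recursive_cong: "recursive k f \<Longrightarrow> (\<And>xs. length xs = k \<Longrightarrow> f xs = g xs) \<Longrightarrow> recursive k g"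
  by (auto simp: recursive_def)

lemma recursive_add2: "recursive 2 (\<lambda>xs. xs ! 0 + xs ! 1)"
proof -
  have "recursive (Suc 1) (\<lambda>xs. rec_nat (tl xs ! 0) (\<lambda>n y. Suc ((y # n # tl xs) ! 0)) (hd xs))"
    by (intro recursive_rec_nat recursive_Suc recursive_nth) auto
  moreover have "rec_nat a (\<lambda>n. Suc) b = b + a" for a b :: nat by (induction b) auto
  ultimately have "recursive 2 (\<lambda>xs. hd xs + tl xs ! 0)" by (simp add: numeral_2_eq_2)
  then show ?thesis by (rule recursive_cong) (auto simp: numeral_2_eq_2 length_Suc_conv)
qed

lemma recursive_add: "recursive k f \<Longrightarrow> recursive k g \<Longrightarrow> recursive k (\<lambda>xs. f xs + g xs)"
  using recursive_comp2[OF recursive_add2] by simp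

lemma recursive_pred:
  assumes "recursive k f"
  shows "recursive k (\<lambda>xs. f xs - 1)"
proof -
  have "recursive (Suc 0) (\<lambda>xs. rec_nat 0 (\<lambda>n y. (y # n # tl xs) ! 1) (hd xs))"
    by (intro recursive_rec_nat recursive_const recursive_nth) auto
  moreover have "rec_nat 0 (\<lambda>n y. n) b = b - 1" for b :: nat by (cases b) auto
  ultimately have "recursive 1 (\<lambda>xs. hd xs - 1)" by simp
  from recursive_comp1[OF this assms] show ?thesis by simp
qed

lemma recursive_diff:
  assumes "recursive k f" "recursive k g"
  shows "recursive k (\<lambda>xs. f xs - g xs)"
proof -
  have "recursive (Suc 1) (\<lambda>xs. rec_nat (tl xs ! 0) (\<lambda>n y. (y # n # tl xs) ! 0 - 1) (hd xs))"
    by (intro recursive_rec_nat recursive_pred recursive_nth) auto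
  moreover have "rec_nat a (\<lambda>n y. y - 1) b = a - b" for a b :: nat by (induction b) auto
  ultimately have "recursive 2 (\<lambda>xs. tl xs ! 0 - hd xs)" by (simp add: numeral_2_eq_2)
  from recursive_comp2[OF this assms(2,1)] show ?thesis by simp
qed

lemma recursive_triangle:
  assumes "recursive k f"
  shows "recursive k (\<lambda>xs. triangle (f xs))"
proof -
  have "recursive (Suc 0) (\<lambda>xs. rec_nat 0 (\<lambda>n y. (y # n # tl xs) ! 0 + Suc ((y # n # tl xs) ! 1)) (hd xs))"
    by (intro recursive_rec_nat recursive_const recursive_add recursive_Suc recursive_nth) auto
  moreover have "rec_nat 0 (\<lambda>n y. Suc (y + n)) b = triangle b" for b :: nat by (induction b) auto
  ultimately have "recursive 1 (\<lambda>xs. triangle (hd xs))" by simp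
  from recursive_comp1[OF this assms] show ?thesis by simp
qed

lemma recursive_prod_encode: "recursive k f \<Longrightarrow> recursive k g \<Longrightarrow> recursive k (\<lambda>xs. prod_encode (f xs, g xs))"
  unfolding prod_encode_def by (simp add: recursive_add recursive_triangle)

definition triangle_root :: "nat \<Rightarrow> nat" where
  "triangle_root c = rec_nat 0 (\<lambda>n s. s + (1 - (triangle (Suc s) - Suc n))) c"

lemma triangle_root: "triangle (triangle_root c) \<le> c \<and> c < triangle (Suc (triangle_root c))"
proof (induction c)
  case (Suc c)
  have "triangle_root (Suc c) = triangle_root c + (1 - (triangle (Suc (triangle_root c)) - Suc c))"
    by (simp add: triangle_root_def)
  then have "triangle_root (Suc c) =
      (if triangle (Suc (triangle_root c)) \<le> Suc c then Suc (triangle_root c) else triangle_root c)"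
    by auto
  with Suc show ?case by auto
qed (simp add: triangle_root_def)

lemma triangle_mono: "a \<le> b \<Longrightarrow> triangle a \<le> triangle b"
  by (induction b) (auto simp: le_Suc_eq)

lemma triangle_root_prod_encode: "triangle_root (prod_encode (a, b)) = a + b"
proof -
  let ?c = "prod_encode (a, b)"
  have c: "triangle (a + b) \<le> ?c" "?c < triangle (Suc (a + b))" by (auto simp: prod_encode_def)
  have "\<not> triangle_root ?c < a + b"
    using triangle_mono[of "Suc (triangle_root ?c)" "a + b"] triangle_root[of ?c] c by linarith
  moreover have "\<not> triangle_root ?c > a + b"
    using triangle_mono[of "Suc (a + b)" "triangle_root ?c"] triangle_root[of ?c] c by linarith
  ultimately show ?thesis by simp
qed

lemma recursive_triangle_root:
  assumes "recursive k f"
  shows "recursive k (\<lambda>xs. triangle_root (f xs))"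
proof -
  have "recursive (Suc 0) (\<lambda>xs. rec_nat 0 (\<lambda>n y. (y # n # tl xs) ! 0 +
      (1 - (triangle (Suc ((y # n # tl xs) ! 0)) - Suc ((y # n # tl xs) ! 1)))) (hd xs))"
    by (intro recursive_rec_nat recursive_const recursive_add recursive_Suc recursive_diff recursive_triangle
        recursive_nth) auto
  then have "recursive 1 (\<lambda>xs. triangle_root (hd xs))" by (simp add: triangle_root_def)
  from recursive_comp1[OF this assms] show ?thesis by simp
qed

lemma recursive_fst_prod_decode:
  assumes "recursive k f"
  shows "recursive k (\<lambda>xs. fst (prod_decode (f xs)))"
proof -
  have "fst (prod_decode c) = c - triangle (triangle_root c)" for c
  proof -
    obtain a b where "c = prod_encode (a, b)" by (metis prod_decode_inverse surj_pair)
    then show ?thesis using triangle_root_prod_encode[of a b] by simp (simp add: prod_encode_def)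
  qed
  then show ?thesis by (simp add: recursive_diff recursive_triangle recursive_triangle_root assms)
qed

lemma recursive_snd_prod_decode:
  assumes "recursive k f"
  shows "recursive k (\<lambda>xs. snd (prod_decode (f xs)))"
proof -
  have "snd (prod_decode c) = triangle_root c - fst (prod_decode c)" for c
  proof -
    obtain a b where "c = prod_encode (a, b)" by (metis prod_decode_inverse surj_pair)
    then show ?thesis using triangle_root_prod_encode[of a b] by simp
  qed
  then show ?thesis by (simp add: recursive_diff recursive_fst_prod_decode recursive_triangle_root assms)
qed

class coded =
  fixes enc :: "'a \<Rightarrow> nat" and dec :: "nat \<Rightarrow> 'a"
  assumes dec_enc [simp]: "dec (enc x) = x" and enc_dec [simp]: "enc (dec n) = n"

instantiation nat :: coded
begin
definition enc_nat :: "nat \<Rightarrow> nat" where [simp]: "enc_nat n = n"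
definition dec_nat :: "nat \<Rightarrow> nat" where [simp]: "dec_nat n = n"
instance by standard auto
end

instantiation int :: coded
begin
definition enc_int :: "int \<Rightarrow> nat" where "enc_int = int_encode"
definition dec_int :: "nat \<Rightarrow> int" where "dec_int = int_decode"
instance by standard (auto simp: enc_int_def dec_int_def)
end

instantiation prod :: (coded, coded) coded
begin
definition enc_prod :: "'a \<times> 'b \<Rightarrow> nat" where "enc_prod p = prod_encode (enc (fst p), enc (snd p))"
definition dec_prod :: "nat \<Rightarrow> 'a \<times> 'b" where "dec_prod n = map_prod dec dec (prod_decode n)"
instance by standard (auto simp: enc_prod_def dec_prod_def)
end

instantiation list :: (coded) coded
begin
definition enc_list :: "'a list \<Rightarrow> nat" where "enc_list l = list_encode (map enc l)"
definition dec_list :: "nat \<Rightarrow> 'a list" where "dec_list n = map dec (list_decode n)"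
instance by standard (auto simp: enc_list_def dec_list_def o_def)
end

definition computable :: "('a::coded \<Rightarrow> 'b::coded) \<Rightarrow> bool" where
  "computable f \<longleftrightarrow> (\<exists>r. \<forall>x. reval r [enc x] (enc (f x)))"

lemma computable_iff_recursive: "computable f \<longleftrightarrow> recursive 1 (\<lambda>xs. enc (f (dec (xs ! 0))))"
proof
  assume "computable f"
  then obtain r where r: "\<And>x. reval r [enc x] (enc (f x))" by (auto simp: computable_def)
  show "recursive 1 (\<lambda>xs. enc (f (dec (xs ! 0))))"
    unfolding recursive_def
  proof (intro exI[of _ r] allI impI)
    fix xs :: "nat list" assume "length xs = 1"
    then obtain n where "xs = [n]" by (auto simp: length_Suc_conv)
    then show "reval r xs (enc (f (dec (xs ! 0))))" using r[of "dec n"] by simp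
  qed
next
  assume "recursive 1 (\<lambda>xs. enc (f (dec (xs ! 0))))"
  then obtain r where r: "\<And>xs. length xs = 1 \<Longrightarrow> reval r xs (enc (f (dec (xs ! 0))))" by (auto simp: recursive_def)
  show "computable f" unfolding computable_def
  proof (intro exI allI)
    fix x show "reval r [enc x] (enc (f x))" using r[of "[enc x]"] by simp
  qed
qed

named_theorems computable_intros

lemma computable_id [computable_intros]: "computable (\<lambda>x. x)"
  unfolding computable_iff_recursive by (simp add: recursive_nth)

lemma computable_const [computable_intros]: "computable (\<lambda>x. c)"
  unfolding computable_iff_recursive by (rule recursive_const)

lemma computable_compose:
  assumes "computable f" "computable g"
  shows "computable (\<lambda>x. f (g x))"
  using recursive_comp1[OF assms(1)[unfolded computable_iff_recursive] assms(2)[unfolded computable_iff_recursive]]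
  unfolding computable_iff_recursive by simp

lemma computable_Pair [computable_intros]: "computable f \<Longrightarrow> computable g \<Longrightarrow> computable (\<lambda>x. (f x, g x))"
  unfolding computable_iff_recursive enc_prod_def by (simp add: recursive_prod_encode)

lemma computable_fst [computable_intros]:
  assumes "computable f"
  shows "computable (\<lambda>x. fst (f x))"
proof -
  have "enc (fst p) = fst (prod_decode (enc p))" for p :: "'b \<times> 'c" by (simp add: enc_prod_def)
  then show ?thesis using assms unfolding computable_iff_recursive by (simp add: recursive_fst_prod_decode)
qed

lemma computable_snd [computable_intros]:
  assumes "computable f"
  shows "computable (\<lambda>x. snd (f x))"
proof -
  have "enc (snd p) = snd (prod_decode (enc p))" for p :: "'b \<times> 'c" by (simp add: enc_prod_def)
  then show ?thesis using assms unfolding computable_iff_recursive by (simp add: recursive_snd_prod_decode)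
qed

lemma computable_enc [computable_intros]: "computable f \<Longrightarrow> computable (\<lambda>x. enc (f x))"
  unfolding computable_iff_recursive by simp

lemma computable_dec [computable_intros]: "computable f \<Longrightarrow> computable (\<lambda>x. dec (f x))"
  unfolding computable_iff_recursive by simp

lemma computable_Suc [computable_intros]: "computable f \<Longrightarrow> computable (\<lambda>x. Suc (f x))"
  unfolding computable_iff_recursive by (simp add: recursive_Suc)

lemma computable_diff_nat [computable_intros]: "computable f \<Longrightarrow> computable g \<Longrightarrow> computable (\<lambda>x. f x - g x :: nat)"
  unfolding computable_iff_recursive by (simp add: recursive_diff)

lemma computable_add_nat [computable_intros]: "computable f \<Longrightarrow> computable g \<Longrightarrow> computable (\<lambda>x. f x + g x :: nat)"
  unfolding computable_iff_recursive by (simp add: recursive_add)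

lemma computable_rec_nat [computable_intros]:
  fixes b :: "'a::coded \<Rightarrow> nat \<Rightarrow> 'b::coded \<Rightarrow> 'b"
  assumes "computable a" "computable (\<lambda>p. b (fst p) (fst (snd p)) (snd (snd p)))" "computable n"
  shows "computable (\<lambda>x. rec_nat (a x) (b x) (n x))"
proof -
  define B where "B p = b (fst p) (fst (snd p)) (snd (snd p))" for p
  let ?step = "\<lambda>c m y. enc (B (dec (prod_encode (c, prod_encode (m, y)))))"
  have "recursive 1 (\<lambda>xs. enc (B (dec (xs ! 0))))"
    using assms(2) unfolding computable_iff_recursive B_def .
  then have "recursive (1 + 2) (\<lambda>ys. enc (B (dec ([prod_encode (ys ! 2, prod_encode (ys ! 1, ys ! 0))] ! 0))))"
    by (rule recursive_comp1) (intro recursive_prod_encode recursive_nth; simp)+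
  from recursive_rec_nat[OF assms(1)[unfolded computable_iff_recursive] this]
  have iteration: "recursive 2 (\<lambda>xs. rec_nat (enc (a (dec (tl xs ! 0)))) (?step (tl xs ! 0)) (hd xs))"
    by (simp add: numeral_2_eq_2)
  have "recursive 1 (\<lambda>xs. n (dec (xs ! 0)))" using assms(3) by (simp add: computable_iff_recursive)
  from recursive_comp2[OF iteration this recursive_nth]
  have "recursive 1 (\<lambda>xs. rec_nat (enc (a (dec (xs ! 0)))) (?step (xs ! 0)) (n (dec (xs ! 0))))" by simp
  moreover have "rec_nat (enc (a x)) (?step (enc x)) k = enc (rec_nat (a x) (b x) k)" for x k
    by (induction k) (auto simp: dec_prod_def B_def)
  from this[of "dec _"]
  have "rec_nat (enc (a (dec c))) (?step c) k = enc (rec_nat (a (dec c)) (b (dec c)) k)" for c k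
    by simp
  ultimately show ?thesis unfolding computable_iff_recursive by simp
qed

lemma computable_mult_nat [computable_intros]:
  fixes f g :: "'a::coded \<Rightarrow> nat"
  assumes "computable f" "computable g" shows "computable (\<lambda>x. f x * g x)"
proof -
  have "computable (\<lambda>x. rec_nat 0 (\<lambda>_ acc. acc + g x) (f x))"
    by (intro computable_intros assms computable_compose[OF assms(2)])
  moreover have "rec_nat 0 (\<lambda>_ acc. acc + b) a = a * b" for a b :: nat by (induction a) auto
  ultimately show ?thesis by simp
qed

lemma computable_power_nat [computable_intros]:
  fixes f g :: "'a::coded \<Rightarrow> nat"
  assumes "computable f" "computable g" shows "computable (\<lambda>x. f x ^ g x)"
proof -
  have "computable (\<lambda>x. rec_nat 1 (\<lambda>_ acc. acc * f x) (g x))"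
    by (intro computable_intros assms computable_compose[OF assms(1)])
  moreover have "rec_nat 1 (\<lambda>_ acc. acc * b) a = b ^ a" for a b :: nat by (induction a) auto
  ultimately show ?thesis by simp
qed

lemma computable_fact [computable_intros]:
  assumes "computable f" shows "computable (\<lambda>x. fact (f x) :: nat)"
proof -
  have "computable (\<lambda>x. rec_nat 1 (\<lambda>n acc. Suc n * acc) (f x))"
    by (intro computable_intros assms)
  moreover have "rec_nat 1 (\<lambda>n acc. Suc n * acc) a = fact a" for a :: nat by (induction a) auto
  ultimately show ?thesis by simp
qed

definition decidable :: "('a::coded \<Rightarrow> bool) \<Rightarrow> bool" where
  "decidable P \<longleftrightarrow> computable (\<lambda>x. of_bool (P x) :: nat)"

lemma computable_if [computable_intros]:
  assumes "decidable P" "computable f" "computable g"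
  shows "computable (\<lambda>x. if P x then f x else g x)"
proof -
  have "computable (\<lambda>x. rec_nat (g x) (\<lambda>_ _. f x) (of_bool (P x)))"
    using assms(1) unfolding decidable_def by (intro computable_intros assms computable_compose[OF assms(2)])
  moreover have "rec_nat (g x) (\<lambda>_ _. f x) (of_bool (P x)) = (if P x then f x else g x)" for x by simp
  ultimately show ?thesis by simp
qed

lemma decidable_le_nat [computable_intros]:
  fixes f g :: "'a::coded \<Rightarrow> nat"
  assumes "computable f" "computable g" shows "decidable (\<lambda>x. f x \<le> g x)"
proof -
  have "computable (\<lambda>x. 1 - (f x - g x))" by (intro computable_intros assms)
  moreover have "1 - (a - b) = of_bool (a \<le> b)" for a b :: nat by auto
  ultimately show ?thesis by (simp add: decidable_def)
qed

lemma decidable_not [computable_intros]: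
  assumes "decidable P"
  shows "decidable (\<lambda>x. \<not> P x)"
proof -
  have "computable (\<lambda>x. 1 - of_bool (P x) :: nat)" using assms unfolding decidable_def by (intro computable_intros)
  moreover have "1 - of_bool p = (of_bool (\<not> p) :: nat)" for p by simp
  ultimately show ?thesis by (simp only: decidable_def)
qed

lemma decidable_conj [computable_intros]:
  assumes "decidable P" "decidable Q"
  shows "decidable (\<lambda>x. P x \<and> Q x)"
proof -
  have "computable (\<lambda>x. of_bool (P x) * of_bool (Q x) :: nat)"
    using assms unfolding decidable_def by (intro computable_intros)
  then show ?thesis unfolding decidable_def of_bool_conj .
qed

lemma decidable_disj [computable_intros]:
  assumes "decidable P" "decidable Q"
  shows "decidable (\<lambda>x. P x \<or> Q x)"
  using decidable_not[OF decidable_conj[OF decidable_not[OF assms(1)] decidable_not[OF assms(2)]]] by simp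

lemma decidable_less_nat [computable_intros]:
  fixes f g :: "'a::coded \<Rightarrow> nat"
  shows "computable f \<Longrightarrow> computable g \<Longrightarrow> decidable (\<lambda>x. f x < g x)"
  using decidable_not[OF decidable_le_nat[of g f]] by (simp add: not_le)

lemma decidable_eq [computable_intros]:
  assumes "computable f" "computable g" shows "decidable (\<lambda>x. f x = g x)"
proof -
  have "decidable (\<lambda>x. enc (f x) \<le> enc (g x) \<and> enc (g x) \<le> enc (f x))" by (intro computable_intros assms)
  moreover have "(enc a \<le> enc b \<and> enc b \<le> enc a) = (a = b)" for a b :: 'b by (metis dec_enc order_antisym order_refl)
  ultimately show ?thesis by simp
qed

lemma decidable_bounded_all [computable_intros]:
  fixes n :: "'a::coded \<Rightarrow> nat"
  assumes "decidable (\<lambda>p. P (fst p) (snd p))" "computable n" shows "decidable (\<lambda>x. \<forall>i<n x. P x i)"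
proof -
  have c: "computable (\<lambda>p. of_bool (P (fst p) (snd p)) :: nat)" using assms(1) by (simp add: decidable_def)
  have "computable (\<lambda>x. rec_nat 1 (\<lambda>i acc. acc * of_bool (P x i) :: nat) (n x))"
    by (intro computable_intros assms computable_compose[OF c, where g = "\<lambda>q. (fst q, fst (snd q))", simplified])
  moreover have "rec_nat 1 (\<lambda>i acc. acc * of_bool (Q i)) k = (of_bool (\<forall>i<k. Q i) :: nat)" for Q k
    by (induction k) (auto simp: less_Suc_eq)
  ultimately show ?thesis by (simp add: decidable_def)
qed

lemma decidable_bounded_ex [computable_intros]:
  fixes n :: "'a::coded \<Rightarrow> nat"
  assumes "decidable (\<lambda>p. P (fst p) (snd p))" "computable n" shows "decidable (\<lambda>x. \<exists>i<n x. P x i)"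
  using decidable_not[OF decidable_bounded_all[OF decidable_not[OF assms(1)] assms(2)]] by simp

lemma decidable_compose:
  assumes "decidable P" "computable g"
  shows "decidable (\<lambda>x. P (g x))"
  using assms unfolding decidable_def by (rule computable_compose)

lemma computable_div_nat [computable_intros]:
  fixes f g :: "'a::coded \<Rightarrow> nat"
  assumes "computable f" "computable g" shows "computable (\<lambda>x. f x div g x)"
proof -
  have "computable (\<lambda>x. rec_nat 0 (\<lambda>n q. if Suc q * g x \<le> Suc n \<and> \<not> g x = 0 then Suc q else q) (f x))"
    by (intro computable_intros assms computable_compose[OF assms(2)])
  moreover have "rec_nat 0 (\<lambda>n q. if Suc q * b \<le> Suc n \<and> \<not> b = 0 then Suc q else q) a = a div b" for a b :: nat
  proof (cases "b = 0")
    case True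
    have "rec_nat 0 (\<lambda>n q. q) a = (0::nat)" by (induction a) auto
    with True show ?thesis by simp
  next
    case False
    show ?thesis
    proof (induction a)
      case (Suc a)
      have "(Suc (a div b) * b \<le> Suc a) = (Suc a div b \<noteq> a div b)"
        using False by (metis Suc_n_not_le_n div_Suc less_eq_div_iff_mult_less_eq neq0_conv order_refl)
      with Suc False show ?case by (auto simp: div_Suc)
    qed simp
  qed
  ultimately show ?thesis by simp
qed

lemma computable_mod_nat [computable_intros]:
  fixes f g :: "'a::coded \<Rightarrow> nat"
  shows "computable f \<Longrightarrow> computable g \<Longrightarrow> computable (\<lambda>x. f x mod g x)"
  unfolding minus_div_mult_eq_mod[symmetric] by (intro computable_intros)

lemma enc_Nil [simp]: "enc [] = 0" by (simp add: enc_list_def)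

lemma enc_Cons: "enc (x # l) = Suc (enc (x, l))" by (simp add: enc_list_def enc_prod_def)

lemma length_le_enc: "length l \<le> enc l" for l :: "'a::coded list"
proof (induction l)
  case (Cons x l)
  have "enc l \<le> enc (x, l)" by (simp add: enc_prod_def le_prod_encode_2)
  with Cons show ?case by (simp add: enc_Cons)
qed simp

lemma computable_Cons [computable_intros]:
  assumes "computable f" "computable g" shows "computable (\<lambda>x. f x # g x)"
proof -
  have "computable (\<lambda>x. dec (Suc (enc (f x, g x))) :: 'b list)" by (intro computable_intros assms)
  moreover have "dec (Suc (enc (a, l))) = a # l" for a :: 'b and l by (metis dec_enc enc_Cons)
  ultimately show ?thesis by simp
qed

definition uncons :: "'a::coded list \<Rightarrow> 'a \<times> 'a list" where
  "uncons l = dec (enc l - 1)"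

lemma uncons_Cons [simp]: "uncons (x # l) = (x, l)" by (simp add: uncons_def enc_Cons)

lemma computable_uncons [computable_intros]: "computable f \<Longrightarrow> computable (\<lambda>x. uncons (f x))"
  unfolding uncons_def by (intro computable_intros)

lemma computable_foldl [computable_intros]:
  fixes b :: "'a::coded \<Rightarrow> 'b::coded \<Rightarrow> 'c::coded \<Rightarrow> 'b"
  assumes b: "computable (\<lambda>p. b (fst p) (fst (snd p)) (snd (snd p)))" and "computable a" "computable l"
  shows "computable (\<lambda>x. foldl (b x) (a x) (l x))"
proof -
  define step where "step x s =
    (if enc (snd s) = 0 then s else (b x (fst s) (fst (uncons (snd s))), snd (uncons (snd s))))" for x s
  have step_Nil: "step x (acc, []) = (acc, [])"
    and step_Cons: "step x (acc, y # ys) = (b x acc y, ys)" for x acc y ys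
    by (simp_all add: step_def enc_Cons)
  have "computable (\<lambda>p. b (fst p) (fst (snd (snd p))) (fst (uncons (snd (snd (snd p))))))"
    using computable_compose[OF b, where g = "\<lambda>p. (fst p, fst (snd (snd p)), fst (uncons (snd (snd (snd p)))))"]
    by (simp add: computable_intros)
  then have "computable (\<lambda>x. fst (rec_nat (a x, l x) (\<lambda>_. step x) (enc (l x))))"
    unfolding step_def by (intro computable_intros assms)
  moreover have iterate: "rec_nat (acc, ys) (\<lambda>_. step x) k = (foldl (b x) acc ys, [])"
    if "length ys \<le> k" for x acc ys k
    using that
  proof (induction k arbitrary: acc ys)
    case (Suc k)
    have "rec_nat s (\<lambda>_. step x) (Suc k) = rec_nat (step x s) (\<lambda>_. step x) k" for s
      by (induction k) auto
    with Suc show ?case by (cases ys) (simp_all add: step_Nil step_Cons)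
  qed simp
  have "fst (rec_nat (a x, l x) (\<lambda>_. step x) (enc (l x))) = foldl (b x) (a x) (l x)" for x
    using iterate[OF length_le_enc] by simp
  ultimately show ?thesis by simp
qed

lemma computable_rev [computable_intros]:
  assumes "computable f"
  shows "computable (\<lambda>x. rev (f x))"
proof -
  have "computable (\<lambda>x. foldl (\<lambda>acc e. e # acc) [] (f x))" by (intro computable_intros assms)
  moreover have "foldl (\<lambda>acc e. e # acc) k l = rev l @ k" for l k :: "'b list"
    by (induction l arbitrary: k) auto
  ultimately show ?thesis by simp
qed

lemma computable_append [computable_intros]:
  assumes "computable f" "computable g"
  shows "computable (\<lambda>x. f x @ g x)"
proof -
  have "computable (\<lambda>x. foldl (\<lambda>acc e. e # acc) (g x) (rev (f x)))" by (intro computable_intros assms)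
  moreover have "foldl (\<lambda>acc e. e # acc) k l = rev l @ k" for l k :: "'b list"
    by (induction l arbitrary: k) auto
  ultimately show ?thesis by simp
qed

lemma computable_map [computable_intros]:
  fixes b :: "'a::coded \<Rightarrow> 'b::coded \<Rightarrow> 'c::coded"
  assumes b: "computable (\<lambda>p. b (fst p) (snd p))" and l: "computable l"
  shows "computable (\<lambda>x. map (b x) (l x))"
proof -
  have "computable (\<lambda>p. b (fst p) (snd (snd p)))"
    using computable_compose[OF b, where g = "\<lambda>p. (fst p, snd (snd p))"] by (simp add: computable_intros)
  then have "computable (\<lambda>x. rev (foldl (\<lambda>acc e. b x e # acc) [] (l x)))" by (intro computable_intros l)
  moreover have "foldl (\<lambda>acc e. b x e # acc) k l = rev (map (b x) l) @ k" for x k l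
    by (induction l arbitrary: k) auto
  ultimately show ?thesis by simp
qed

lemma computable_concat [computable_intros]:
  assumes "computable f"
  shows "computable (\<lambda>x. concat (f x))"
proof -
  have "computable (\<lambda>x. foldl (\<lambda>acc e. acc @ e) [] (f x))" by (intro computable_intros assms)
  moreover have "foldl (\<lambda>acc e. acc @ e) k l = k @ concat l" for l :: "'b list list" and k
    by (induction l arbitrary: k) auto
  ultimately show ?thesis by simp
qed

lemma computable_length [computable_intros]:
  assumes "computable f"
  shows "computable (\<lambda>x. length (f x))"
proof -
  have "computable (\<lambda>x. foldl (\<lambda>acc e. Suc acc) 0 (f x))" by (intro computable_intros assms)
  moreover have "foldl (\<lambda>acc e. Suc acc) k l = k + length l" for l :: "'b list" and k
    by (induction l arbitrary: k) auto
  ultimately show ?thesis by simp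
qed

lemma computable_sum_list:
  fixes f :: "'a::coded \<Rightarrow> 'b::{coded,comm_monoid_add} list"
  assumes "computable (\<lambda>p::'b \<times> 'b. fst p + snd p)" "computable f"
  shows "computable (\<lambda>x. sum_list (f x))"
proof -
  have "computable (\<lambda>p. fst (snd p) + snd (snd p) :: 'b)" for p :: 'a
    using computable_compose[OF assms(1) computable_snd[OF computable_id]] by simp
  then have "computable (\<lambda>x. foldl (\<lambda>acc e. acc + e) 0 (f x))"
    by (intro computable_intros assms(2))
  moreover have "foldl (\<lambda>acc e. acc + e) k l = k + sum_list l" for l and k :: 'b
    by (induction l arbitrary: k) (auto simp: add.assoc)
  ultimately show ?thesis by simp
qed

lemmas computable_sum_list_nat [computable_intros] =
  computable_sum_list[OF computable_add_nat[OF computable_fst[OF computable_id] computable_snd[OF computable_id]]]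

lemma computable_upt [computable_intros]:
  assumes "computable f"
  shows "computable (\<lambda>x. [0..<f x])"
proof -
  have "computable (\<lambda>x. rec_nat [] (\<lambda>n l. l @ [n]) (f x))" by (intro computable_intros assms)
  moreover have "rec_nat [] (\<lambda>n l. l @ [n]) k = [0..<k]" for k by (induction k) auto
  ultimately show ?thesis by simp
qed

definition total_nth :: "'a::coded list \<Rightarrow> nat \<Rightarrow> 'a" where
  "total_nth l i = (if i < length l then l ! i else dec 0)"

lemma computable_total_nth [computable_intros]:
  assumes "computable f" "computable g" shows "computable (\<lambda>x. total_nth (f x) (g x))"
proof -
  have "computable (\<lambda>x. if g x < length (f x)
      then fst (uncons (rec_nat (f x) (\<lambda>_ l. snd (uncons l)) (g x))) else dec 0)"
    by (intro computable_intros assms)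
  moreover have "fst (uncons (rec_nat l (\<lambda>_ l. snd (uncons l)) k)) = l ! k" if "k < length l" for l :: "'b list" and k
  proof -
    have "rec_nat l (\<lambda>_ l. snd (uncons l)) k = drop k l" using that
    proof (induction k)
      case (Suc k)
      then show ?case by (simp add: Cons_nth_drop_Suc[symmetric, of k l])
    qed simp
    then show ?thesis using that by (simp add: Cons_nth_drop_Suc[symmetric, of k l])
  qed
  then have "(if g x < length (f x) then fst (uncons (rec_nat (f x) (\<lambda>_ l. snd (uncons l)) (g x))) else dec 0)
      = total_nth (f x) (g x)" for x
    by (simp add: total_nth_def)
  ultimately show ?thesis by simp
qed

lemma decidable_list_all [computable_intros]:
  fixes P :: "'a::coded \<Rightarrow> 'b::coded \<Rightarrow> bool"
  assumes "decidable (\<lambda>p. P (fst p) (snd p))" "computable l" shows "decidable (\<lambda>x. \<forall>y\<in>set (l x). P x y)"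
proof -
  have "decidable (\<lambda>p. P (fst p) (total_nth (l (fst p)) (snd p)))"
    using decidable_compose[OF assms(1), where g = "\<lambda>p. (fst p, total_nth (l (fst p)) (snd p))"]
      computable_Pair[OF computable_fst[OF computable_id] computable_total_nth[OF
        computable_compose[OF assms(2) computable_fst[OF computable_id]] computable_snd[OF computable_id]]] by simp
  then have "decidable (\<lambda>x. \<forall>i<length (l x). P x (total_nth (l x) i))" by (intro computable_intros assms)
  moreover have "(\<forall>i<length (l x). P x (total_nth (l x) i)) = (\<forall>y\<in>set (l x). P x y)" for x
    by (simp add: total_nth_def all_set_conv_all_nth)
  ultimately show ?thesis by simp
qed

lemma decidable_member [computable_intros]:
  assumes f: "computable f" and l: "computable l" shows "decidable (\<lambda>x. f x \<in> set (l x))"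
proof -
  have "decidable (\<lambda>x. \<not> (\<forall>y\<in>set (l x). \<not> y = f x))" by (intro computable_intros l computable_compose[OF f])
  then show ?thesis by auto
qed

section \<open>Integers\<close>

lemma computable_nat [computable_intros]:
  assumes "computable f"
  shows "computable (\<lambda>x. nat (f x))"
proof -
  have "nat i = (if enc i mod 2 = 0 then enc i div 2 else 0)" for i
    by (auto simp: enc_int_def int_encode_def sum_encode_def)
  then show ?thesis by (simp only:) (intro computable_intros assms)
qed

lemma computable_nat_uminus [computable_intros]:
  assumes "computable f"
  shows "computable (\<lambda>x. nat (- f x))"
proof -
  have "nat (- i) = (if enc i mod 2 = 0 then 0 else Suc (enc i div 2))" for i
    by (auto simp: enc_int_def int_encode_def sum_encode_def)
  then show ?thesis by (simp only:) (intro computable_intros assms)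
qed

lemma computable_nat_abs [computable_intros]:
  assumes "computable f"
  shows "computable (\<lambda>x. nat \<bar>f x\<bar>)"
proof -
  have "nat \<bar>i\<bar> = nat i + nat (- i)" for i :: int by auto
  then show ?thesis by (simp add: computable_intros assms)
qed

lemma computable_int_diff:
  assumes "computable f" "computable g"
  shows "computable (\<lambda>x. int (f x) - int (g x))"
proof -
  have "int a - int b = dec (if b \<le> a then 2 * (a - b) else Suc (2 * (b - a - 1)))" for a b
    by (auto simp: dec_int_def int_decode_def sum_decode_def)
  then show ?thesis by (simp only:) (intro computable_intros assms)
qed

lemma computable_int_of_nat [computable_intros]: "computable f \<Longrightarrow> computable (\<lambda>x. int (f x))"
  using computable_int_diff[OF _ computable_const[of 0]] by simp

lemma computable_add_int [computable_intros]:
  assumes "computable f" "computable g"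
  shows "computable (\<lambda>x. f x + g x :: int)"
proof -
  have "i + j = int (nat i + nat j) - int (nat (- i) + nat (- j))" for i j by auto
  then show ?thesis by (simp only:) (intro computable_int_diff computable_intros assms)
qed

lemma computable_uminus_int [computable_intros]:
  assumes "computable f"
  shows "computable (\<lambda>x. - f x :: int)"
proof -
  have "- i = int (nat (- i)) - int (nat i)" for i by auto
  then have "(\<lambda>x. - f x) = (\<lambda>x. int (nat (- f x)) - int (nat (f x)))" by blast
  then show ?thesis by (simp only:) (intro computable_int_diff computable_intros assms)
qed

lemma computable_mult_int [computable_intros]:
  assumes "computable f" "computable g"
  shows "computable (\<lambda>x. f x * g x :: int)"
proof -
  have "i * j = int (nat i * nat j + nat (- i) * nat (- j)) - int (nat i * nat (- j) + nat (- i) * nat j)" for i j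
  proof -
    have "i * j = (int (nat i) - int (nat (- i))) * (int (nat j) - int (nat (- j)))" by auto
    then show ?thesis by (simp only: of_nat_add of_nat_mult) (simp only: algebra_simps)
  qed
  then show ?thesis by (simp only:) (intro computable_int_diff computable_intros assms)
qed

lemma decidable_less_int [computable_intros]:
  fixes f g :: "'a::coded \<Rightarrow> int"
  assumes "computable f" "computable g" shows "decidable (\<lambda>x. f x < g x)"
proof -
  have "(i < j) = (0 < nat (j + - i))" for i j :: int by auto
  then show ?thesis by (simp only:) (intro computable_intros assms)
qed

lemmas computable_sum_list_int [computable_intros] =
  computable_sum_list[OF computable_add_int[OF computable_fst[OF computable_id] computable_snd[OF computable_id]]]

lemma computable_prod_list_int [computable_intros]:
  assumes "computable f"
  shows "computable (\<lambda>x. prod_list (f x) :: int)"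
proof -
  have "computable (\<lambda>x. foldl (\<lambda>acc e. acc * e) 1 (f x))" by (intro computable_intros assms)
  moreover have "foldl (\<lambda>acc e. acc * e) k l = k * prod_list l" for l and k :: int
    by (induction l arbitrary: k) auto
  ultimately show ?thesis by simp
qed

lemma computable_int_decode [computable_intros]: "computable f \<Longrightarrow> computable (\<lambda>x. int_decode (f x))"
  using computable_dec[where 'b = int] by (simp add: dec_int_def)

lemma computable_list_decode [computable_intros]:
  assumes "computable f"
  shows "computable (\<lambda>x. list_decode (f x))"
proof -
  have "map dec l = l" for l :: "nat list" by (induction l) auto
  then show ?thesis using computable_dec[OF assms, where 'b = "nat list"] by (simp add: dec_list_def)
qed

lemma computable_prod_decode [computable_intros]: "computable f \<Longrightarrow> computable (\<lambda>x. prod_decode (f x))"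
  using computable_dec[where 'b = "nat \<times> nat"] by (simp add: dec_prod_def map_prod_def)

section \<open>Semi-decidable predicates\<close>

definition semidecidable :: "('a::coded \<Rightarrow> bool) \<Rightarrow> bool" where
  "semidecidable P \<longleftrightarrow> (\<exists>Q :: 'a \<times> nat \<Rightarrow> bool. decidable Q \<and> (\<forall>x. P x \<longleftrightarrow> (\<exists>n. Q (x, n))))"

lemma semidecidableE:
  fixes P :: "'a::coded \<Rightarrow> bool"
  assumes "semidecidable P"
  obtains Q :: "'a \<times> nat \<Rightarrow> bool" where "decidable Q" "\<And>x. P x = (\<exists>n. Q (x, n))"
proof -
  from assms obtain Q :: "'a \<times> nat \<Rightarrow> bool" where Q: "decidable Q" "\<forall>x. P x = (\<exists>n. Q (x, n))"
    unfolding semidecidable_def by (elim exE conjE)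
  show ?thesis by (rule that[OF Q(1)]) (rule Q(2)[rule_format])
qed

lemma semidecidable_if_decidable:
  assumes "decidable P"
  shows "semidecidable P"
  unfolding semidecidable_def using decidable_compose[OF assms computable_fst[OF computable_id]]
  by (intro exI[of _ "\<lambda>p. P (fst p)"]) auto

lemma semidecidable_ex:
  fixes P :: "'a::coded \<Rightarrow> 'b::coded \<Rightarrow> bool"
  assumes "semidecidable (\<lambda>p. P (fst p) (snd p))" shows "semidecidable (\<lambda>x. \<exists>y. P x y)"
proof -
  obtain Q :: "_ \<times> nat \<Rightarrow> bool" where Q: "decidable Q" "\<And>p. P (fst p) (snd p) = (\<exists>n. Q (p, n))"
    by (rule semidecidableE[OF assms(1)]) blast
  let ?Q = "\<lambda>p. Q ((fst p, fst (dec (snd p) :: 'b \<times> nat)), snd (dec (snd p) :: 'b \<times> nat))"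
  have "decidable ?Q" by (intro decidable_compose[OF Q(1)] computable_intros)
  moreover have "(\<exists>y. P x y) = (\<exists>n. ?Q (x, n))" for x
  proof
    assume "\<exists>y. P x y"
    then obtain y n where "Q ((x, y), n)" using Q(2)[of "(x, _)"] by auto
    then show "\<exists>n. ?Q (x, n)" by (intro exI[of _ "enc (y, n)"]) simp
  next
    assume "\<exists>n. ?Q (x, n)"
    then show "\<exists>y. P x y" using Q(2)[of "(x, _)"] by auto
  qed
  ultimately show ?thesis unfolding semidecidable_def by blast
qed

lemma semidecidable_conj:
  assumes "semidecidable P" "semidecidable P'"
  shows "semidecidable (\<lambda>x. P x \<and> P' x)"
proof -
  obtain Q :: "_ \<times> nat \<Rightarrow> bool" where Q: "decidable Q" "\<And>x. P x = (\<exists>n. Q (x, n))"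
    by (rule semidecidableE[OF assms(1)]) blast
  obtain Q' :: "_ \<times> nat \<Rightarrow> bool" where Q': "decidable Q'" "\<And>x. P' x = (\<exists>n. Q' (x, n))"
    by (rule semidecidableE[OF assms(2)]) blast
  let ?Q = "\<lambda>p. Q (fst p, fst (prod_decode (snd p))) \<and> Q' (fst p, snd (prod_decode (snd p)))"
  have "decidable ?Q"
    by (intro decidable_conj decidable_compose[OF Q(1)] decidable_compose[OF Q'(1)] computable_intros)
  moreover have "(P x \<and> P' x) = (\<exists>n. ?Q (x, n))" for x
  proof
    assume "P x \<and> P' x"
    then obtain n m where "Q (x, n)" "Q' (x, m)" using Q Q' by auto
    then show "\<exists>n. ?Q (x, n)" by (intro exI[of _ "prod_encode (n, m)"]) simp
  qed (use Q Q' in auto)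
  ultimately show ?thesis unfolding semidecidable_def by blast
qed

lemma semidecidable_disj:
  assumes "semidecidable P" "semidecidable P'"
  shows "semidecidable (\<lambda>x. P x \<or> P' x)"
proof -
  obtain Q :: "_ \<times> nat \<Rightarrow> bool" where Q: "decidable Q" "\<And>x. P x = (\<exists>n. Q (x, n))"
    by (rule semidecidableE[OF assms(1)]) blast
  obtain Q' :: "_ \<times> nat \<Rightarrow> bool" where Q': "decidable Q'" "\<And>x. P' x = (\<exists>n. Q' (x, n))"
    by (rule semidecidableE[OF assms(2)]) blast
  have "decidable (\<lambda>p. Q p \<or> Q' p)" by (intro decidable_disj Q Q')
  then show ?thesis unfolding semidecidable_def by (intro exI[of _ "\<lambda>p. Q p \<or> Q' p"]) (auto simp: Q Q')
qed

lemma common_search_bound: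
  fixes k :: nat
  assumes "\<forall>i<k. \<exists>m. Q i m"
  shows "\<exists>N. \<forall>i<k. \<exists>m<(N::nat). Q i m"
proof -
  from assms obtain f where f: "\<And>i. i < k \<Longrightarrow> Q i (f i)" by metis
  have "f i < Suc (\<Sum>i<k. f i)" if "i < k" for i
    using that by (intro le_imp_less_Suc member_le_sum) auto
  with f show ?thesis by blast
qed

lemma semidecidable_bounded_all:
  fixes n :: "'a::coded \<Rightarrow> nat"
  assumes "semidecidable (\<lambda>p. P (fst p) (snd p))" "computable n"
  shows "semidecidable (\<lambda>x. \<forall>i<n x. P x i)"
proof -
  obtain Q :: "_ \<times> nat \<Rightarrow> bool" where Q: "decidable Q" "\<And>p. P (fst p) (snd p) = (\<exists>n. Q (p, n))"
    by (rule semidecidableE[OF assms(1)]) blast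
  let ?Q = "\<lambda>p. \<forall>i<n (fst p). \<exists>m<snd p. Q ((fst p, i), m)"
  have "decidable (\<lambda>q. Q ((fst (fst (fst q)), snd (fst q)), snd q))"
    by (intro decidable_compose[OF Q(1)] computable_intros)
  then have "decidable ?Q" by (intro computable_intros computable_compose[OF assms(2)])
  moreover have "(\<forall>i<n x. P x i) = (\<exists>N. ?Q (x, N))" for x
    using common_search_bound[of "n x" "\<lambda>i m. Q ((x, i), m)"] Q(2)[of "(x, _)"] by auto
  ultimately show ?thesis unfolding semidecidable_def by blast
qed

lemma recursive_of_decidable:
  fixes Q :: "nat \<times> nat \<Rightarrow> bool"
  assumes "decidable Q"
  obtains r where "\<And>x y. reval r [x, y] (of_bool (Q (x, y)))"
proof -
  have "recursive 1 (\<lambda>xs. of_bool (Q (prod_decode (xs ! 0))))"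
    using assms unfolding decidable_def computable_iff_recursive by (simp add: dec_prod_def map_prod_def)
  from recursive_comp1[OF this recursive_prod_encode[OF recursive_nth[of 0 2] recursive_nth[of 1 2]]]
  have "recursive 2 (\<lambda>xs. of_bool (Q (xs ! 0, xs ! 1)))" by simp
  then obtain r where "\<And>xs. length xs = 2 \<Longrightarrow> reval r xs (of_bool (Q (xs ! 0, xs ! 1)))"
    unfolding recursive_def by blast
  from this[of "[_, _]"] show ?thesis using that[of r] by simp
qed

lemma reval_Mn_Least:
  assumes r: "\<And>n. reval r [n, x] (of_bool (\<not> F n))" and "\<exists>n. F n"
  shows "reval (Mn r) [x] (LEAST n. F n)"
proof (rule reval.intros(7))
  have "F (LEAST n. F n)" using assms(2) by (rule LeastI_ex)
  then show "reval r [LEAST n. F n, x] 0" using r[of "LEAST n. F n"] by simp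
  show "\<forall>m<LEAST n. F n. \<exists>y. reval r [m, x] (Suc y)"
  proof (intro allI impI)
    fix m assume "m < (LEAST n. F n)"
    then have "\<not> F m" by (rule not_less_Least)
    then show "\<exists>y. reval r [m, x] (Suc y)" using r[of m] by auto
  qed
qed

lemma decidable_on_if_semidecidable:
  fixes P N :: "nat \<Rightarrow> bool"
  assumes "semidecidable P" "semidecidable N" and complement: "\<And>x. x \<in> V \<Longrightarrow> P x \<longleftrightarrow> \<not> N x"
  shows "decidable_on V P"
proof -
  obtain Q :: "_ \<times> nat \<Rightarrow> bool" where Q: "decidable Q" "\<And>x. P x = (\<exists>n. Q (x, n))"
    by (rule semidecidableE[OF assms(1)]) blast
  obtain Q' :: "_ \<times> nat \<Rightarrow> bool" where Q': "decidable Q'" "\<And>x. N x = (\<exists>n. Q' (x, n))"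
    by (rule semidecidableE[OF assms(2)]) blast
  have "decidable (\<lambda>p. \<not> (Q (snd p, fst p) \<or> Q' (snd p, fst p)))"
    by (intro decidable_not decidable_disj decidable_compose[OF Q(1)] decidable_compose[OF Q'(1)] computable_intros)
  from recursive_of_decidable[OF this, unfolded fst_conv snd_conv]
  obtain r where r: "\<And>n x. reval r [n, x] (of_bool (\<not> (Q (x, n) \<or> Q' (x, n))))" by blast
  obtain t where t: "\<And>x n. reval t [x, n] (of_bool (Q (x, n)))"
    by (rule recursive_of_decidable[OF Q(1)]) blast
  have "reval (Comp t [Proj 0, Mn r]) [x] (if P x then 1 else 0)" if "x \<in> V" for x
  proof -
    let ?n = "LEAST n. Q (x, n) \<or> Q' (x, n)"
    have found: "\<exists>n. Q (x, n) \<or> Q' (x, n)" using complement[OF that] Q(2)[of x] Q'(2)[of x] by auto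
    have "reval (Mn r) [x] ?n" using r found by (rule reval_Mn_Least)
    moreover have "reval (Proj 0) [x] x" using reval.intros(3)[of 0 "[x]"] by simp
    ultimately have "reval (Comp t [Proj 0, Mn r]) [x] (of_bool (Q (x, ?n)))"
      using t by (intro reval.intros(4)[of "[x, ?n]"]) (auto simp: less_Suc_eq nth_Cons')
    moreover have "Q (x, ?n) \<longleftrightarrow> P x"
      using LeastI_ex[OF found] complement[OF that] Q(2)[of x] Q'(2)[of x] by auto
    ultimately show ?thesis by (simp add: of_bool_def)
  qed
  then show ?thesis unfolding decidable_on_def by blast
qed

section \<open>Positivity on a cube\<close>

lemma abs_mult_diff_le:
  fixes a b a' b' :: real
  shows "\<bar>a * b - a' * b'\<bar> \<le> \<bar>a\<bar> * \<bar>b - b'\<bar> + \<bar>a - a'\<bar> * \<bar>b'\<bar>"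
proof -
  have "a * b - a' * b' = a * (b - b') + (a - a') * b'" by (simp add: algebra_simps)
  then show ?thesis by (metis abs_mult abs_triangle_ineq)
qed

lemma abs_meval_diff_le:
  fixes R \<eta> :: real
  assumes close: "\<And>i. i \<in> set m \<Longrightarrow> \<bar>z i\<bar> \<le> R \<and> \<bar>w i\<bar> \<le> R \<and> \<bar>z i - w i\<bar> \<le> \<eta>" and "R \<ge> 1" "\<eta> \<ge> 0"
  shows "\<bar>meval m z - meval m w\<bar> \<le> length m * R ^ length m * \<eta>"
  using close
proof (induction m)
  case (Cons i m)
  have "\<bar>meval m w\<bar> \<le> R ^ length m" using Cons.prems by (intro abs_meval_le) auto
  have "\<bar>meval (i # m) z - meval (i # m) w\<bar> \<le>
      \<bar>z i\<bar> * \<bar>meval m z - meval m w\<bar> + \<bar>z i - w i\<bar> * \<bar>meval m w\<bar>"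
    by (simp only: meval_simps abs_mult_diff_le)
  also have "\<dots> \<le> R * (length m * R ^ length m * \<eta>) + \<eta> * R ^ length m"
    using \<open>\<bar>meval m w\<bar> \<le> _\<close> Cons assms(2,3) by (intro add_mono mult_mono) auto
  also have "\<dots> \<le> R * (length m * R ^ length m * \<eta>) + \<eta> * (R * R ^ length m)"
    using assms(2,3) by (intro add_mono mult_left_mono) (auto simp: mult_le_cancel_right1)
  also have "\<dots> = length (i # m) * R ^ length (i # m) * \<eta>" by (simp add: algebra_simps)
  finally show ?case .
qed simp

lemma abs_peval_diff_le:
  fixes R \<eta> :: real
  assumes vars: "vars_in V P" and close: "\<And>i. i \<in> V \<Longrightarrow> \<bar>z i\<bar> \<le> R \<and> \<bar>w i\<bar> \<le> R \<and> \<bar>z i - w i\<bar> \<le> \<eta>"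
    and "R \<ge> 1" "\<eta> \<ge> 0" and deg: "degree_le E P"
  shows "\<bar>peval P z - peval P w\<bar> \<le> coeff_norm P * E * R ^ E * \<eta>"
  using vars deg
proof (induction P)
  case (Cons t P)
  have "length (snd t) \<le> E" using Cons.prems by (auto simp: degree_le_def)
  have "\<bar>meval (snd t) z - meval (snd t) w\<bar> \<le> length (snd t) * R ^ length (snd t) * \<eta>"
    using Cons.prems close by (intro abs_meval_diff_le assms(3,4)) auto
  also have "\<dots> \<le> E * R ^ E * \<eta>"
    using \<open>length (snd t) \<le> E\<close> assms(3,4) by (intro mult_mono power_increasing) auto
  finally have monomial: "\<bar>meval (snd t) z - meval (snd t) w\<bar> \<le> E * R ^ E * \<eta>" .
  have "peval (t # P) z - peval (t # P) w =
      of_int (fst t) * (meval (snd t) z - meval (snd t) w) + (peval P z - peval P w)"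
    by (simp add: algebra_simps)
  then have "\<bar>peval (t # P) z - peval (t # P) w\<bar> \<le>
      \<bar>of_int (fst t)\<bar> * \<bar>meval (snd t) z - meval (snd t) w\<bar> + \<bar>peval P z - peval P w\<bar>"
    by (metis abs_mult abs_triangle_ineq)
  also have "\<dots> \<le> real (nat \<bar>fst t\<bar>) * (E * R ^ E * \<eta>) + coeff_norm P * E * R ^ E * \<eta>"
    using monomial Cons by (intro add_mono mult_mono) (auto simp: degree_le_def)
  finally show ?case by (simp add: algebra_simps)
qed simp

definition grid_coord :: "nat \<Rightarrow> nat \<Rightarrow> nat \<Rightarrow> nat \<Rightarrow> int" where
  "grid_coord R s N i = int (N div (2 * R * s + 1) ^ i mod (2 * R * s + 1)) + - int (R * s)"

definition homogenized :: "nat \<Rightarrow> nat \<Rightarrow> (nat \<Rightarrow> int) \<Rightarrow> ipoly \<Rightarrow> int" where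
  "homogenized E s f P = (\<Sum>t\<leftarrow>P. fst t * int (s ^ (E - length (snd t))) * prod_list (map f (snd t)))"

text \<open>The test bounds the variation of \<open>P\<close> between grid points of mesh \<open>1 / s\<close> by a Lipschitz constant on
  the cube; both sides are multiplied by a power of \<open>s\<close> to stay in the integers.\<close>

definition positive_on_grid :: "nat \<Rightarrow> nat \<Rightarrow> ipoly \<Rightarrow> nat \<Rightarrow> bool" where
  "positive_on_grid n R P s \<longleftrightarrow> 0 < s \<and> (\<forall>N<(2 * R * s + 1) ^ n.
     int (coeff_norm P * deg_bound P * R ^ deg_bound P * s ^ deg_bound P) <
     int s * homogenized (deg_bound P) s (grid_coord R s N) P)"

lemma abs_grid_coord_le: "\<bar>grid_coord R s N i\<bar> \<le> int (R * s)"
proof -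
  have "N div (2 * R * s + 1) ^ i mod (2 * R * s + 1) < 2 * R * s + 1" by simp
  then show ?thesis unfolding grid_coord_def by linarith
qed

lemma abs_grid_point_le: "s > 0 \<Longrightarrow> \<bar>real_of_int (grid_coord R s N i) / real s\<bar> \<le> real R"
proof -
  assume "s > 0"
  have "\<bar>real_of_int (grid_coord R s N i)\<bar> \<le> real (R * s)"
    using abs_grid_coord_le[of R s N i] by (metis of_int_abs of_int_le_iff of_int_of_nat_eq)
  then show ?thesis using \<open>s > 0\<close> by (simp add: abs_divide divide_le_eq)
qed

lemma grid_point_near:
  assumes s: "s > 0" and z: "\<And>i. i < n \<Longrightarrow> \<bar>z i\<bar> \<le> real R"
  shows "\<exists>N<(2 * R * s + 1) ^ n. \<forall>i<n. \<bar>z i - real_of_int (grid_coord R s N i) / real s\<bar> \<le> 1 / real s"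
proof -
  have floor_bounds: "- int (R * s) \<le> \<lfloor>z i * s\<rfloor> \<and> \<lfloor>z i * s\<rfloor> \<le> int (R * s)" if "i < n" for i
  proof -
    have "\<bar>z i * s\<bar> \<le> real R * s" using z[OF that] by (simp add: abs_mult mult_right_mono)
    then have "real_of_int (- int (R * s)) \<le> z i * s" "z i * s \<le> real_of_int (int (R * s))" by auto
    then show ?thesis unfolding le_floor_iff floor_le_iff by linarith
  qed
  have "\<forall>i<n. nat (\<lfloor>z i * s\<rfloor> + int (R * s)) < 2 * R * s + 1"
  proof (intro allI impI)
    fix i assume "i < n"
    from floor_bounds[OF this] have "\<lfloor>z i * s\<rfloor> + int (R * s) < int (2 * R * s + 1)" by simp
    then show "nat (\<lfloor>z i * s\<rfloor> + int (R * s)) < 2 * R * s + 1" by linarith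
  qed
  from digits_exist[OF this] obtain N where N: "N < (2 * R * s + 1) ^ n"
    "\<forall>i<n. N div (2 * R * s + 1) ^ i mod (2 * R * s + 1) = nat (\<lfloor>z i * s\<rfloor> + int (R * s))" by blast
  show ?thesis
  proof (intro exI[of _ N] conjI N(1) allI impI)
    fix i assume i: "i < n"
    then have "grid_coord R s N i = \<lfloor>z i * s\<rfloor>" using N(2) floor_bounds[OF i] by (simp add: grid_coord_def)
    moreover have "\<bar>z i * s - \<lfloor>z i * s\<rfloor>\<bar> \<le> 1" by linarith
    then have "\<bar>(z i * s - \<lfloor>z i * s\<rfloor>) / s\<bar> \<le> 1 / s" using s by (simp add: abs_divide divide_right_mono)
    ultimately show "\<bar>z i - real_of_int (grid_coord R s N i) / real s\<bar> \<le> 1 / real s"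
      using s by (simp add: diff_divide_distrib)
  qed
qed

lemma homogenized_eq:
  assumes s: "s > 0" and "degree_le E P"
  shows "real_of_int (homogenized E s f P) = real s ^ E * peval P (\<lambda>i. of_int (f i) / real s)"
  using assms(2)
proof (induction P)
  case (Cons t P)
  have monomial: "real_of_int (prod_list (map f m)) = real s ^ length m * meval m (\<lambda>i. of_int (f i) / real s)" for m
    using s by (induction m) auto
  have "length (snd t) \<le> E" using Cons.prems by (auto simp: degree_le_def)
  then have "real s ^ (E - length (snd t)) * real s ^ length (snd t) = real s ^ E"
    by (simp add: power_add[symmetric])
  then have "real_of_int (fst t * int (s ^ (E - length (snd t))) * prod_list (map f (snd t)))
     = real s ^ E * (of_int (fst t) * meval (snd t) (\<lambda>i. of_int (f i) / real s))"
    by (simp add: monomial algebra_simps)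
  with Cons show ?case by (simp add: homogenized_def degree_le_def distrib_left)
qed (simp add: homogenized_def)

lemma positive_on_grid_iff:
  "positive_on_grid n R P s \<longleftrightarrow> 0 < s \<and> (\<forall>N<(2 * R * s + 1) ^ n.
     real (coeff_norm P * deg_bound P * R ^ deg_bound P) <
     real s * peval P (\<lambda>i. of_int (grid_coord R s N i) / real s))"
proof (cases "s > 0")
  case s: True
  let ?E = "deg_bound P" and ?w = "\<lambda>N i. of_int (grid_coord R s N i) / real s"
  have "int (coeff_norm P * ?E * R ^ ?E * s ^ ?E) < int s * homogenized ?E s (grid_coord R s N) P \<longleftrightarrow>
      real (coeff_norm P * ?E * R ^ ?E) < real s * peval P (?w N)" for N
  proof -
    have "int (coeff_norm P * ?E * R ^ ?E * s ^ ?E) < int s * homogenized ?E s (grid_coord R s N) P \<longleftrightarrow>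
      real_of_int (int (coeff_norm P * ?E * R ^ ?E * s ^ ?E)) <
      real_of_int (int s * homogenized ?E s (grid_coord R s N) P)"
      by (simp only: of_int_less_iff)
    also have "\<dots> \<longleftrightarrow> real s ^ ?E * real (coeff_norm P * ?E * R ^ ?E) < real s ^ ?E * (real s * peval P (?w N))"
      unfolding of_int_mult of_int_of_nat_eq homogenized_eq[OF s degree_le_deg_bound]
      by (simp add: algebra_simps)
    also have "\<dots> \<longleftrightarrow> real (coeff_norm P * ?E * R ^ ?E) < real s * peval P (?w N)"
      using s by (intro mult_less_cancel_left_pos) simp
    finally show ?thesis .
  qed
  then show ?thesis by (simp add: positive_on_grid_def)
qed (simp add: positive_on_grid_def)

lemma positive_on_grid_sound:
  assumes vars: "vars_in {..<n} P" and R: "R \<ge> 1" and grid: "positive_on_grid n R P s"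
    and z: "\<And>i. i < n \<Longrightarrow> \<bar>z i\<bar> \<le> real R"
  shows "peval P z > 0"
proof -
  have s: "s > 0" using grid by (simp add: positive_on_grid_def)
  obtain N where N: "N < (2 * R * s + 1) ^ n"
    and near: "\<forall>i<n. \<bar>z i - real_of_int (grid_coord R s N i) / real s\<bar> \<le> 1 / real s"
    using grid_point_near[where s = s and z = z, OF s z] by blast
  let ?w = "\<lambda>i. real_of_int (grid_coord R s N i) / real s"
  let ?L = "real (coeff_norm P * deg_bound P * R ^ deg_bound P)"
  have "\<bar>peval P z - peval P ?w\<bar> \<le> coeff_norm P * deg_bound P * real R ^ deg_bound P * (1 / s)"
    using R z near abs_grid_point_le[OF s] degree_le_deg_bound
    by (intro abs_peval_diff_le[OF vars]) auto
  moreover have "?L < real s * peval P ?w" using grid N unfolding positive_on_grid_iff by blast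
  then have "?L * (1 / s) < peval P ?w" using s by (simp add: field_simps)
  ultimately show ?thesis by simp
qed

lemma positive_on_grid_complete:
  assumes vars: "vars_in {..<n} P"
    and pos: "\<And>z. (\<And>i. i < n \<Longrightarrow> \<bar>z i\<bar> \<le> real R) \<Longrightarrow> peval P z > 0"
  shows "\<exists>s. positive_on_grid n R P s"
proof -
  have "(\<lambda>_. 0) \<in> coord_cube n (real R)" by (auto simp: coord_cube_def)
  then obtain z0 where z0: "z0 \<in> coord_cube n (real R)"
    and min: "\<And>z. z \<in> coord_cube n (real R) \<Longrightarrow> peval P z0 \<le> peval P z"
    using continuous_attains_inf[OF compact_coord_cube _ continuous_on_peval, of n "real R" P] by blast
  have min_pos: "peval P z0 > 0" using z0 by (intro pos) (auto simp: coord_cube_def)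
  have min_le: "peval P z0 \<le> peval P w" if "\<And>i. i < n \<Longrightarrow> \<bar>w i\<bar> \<le> real R" for w
  proof -
    have "peval P w = peval P (\<lambda>i. if i < n then w i else 0)" by (rule peval_cong[OF vars]) auto
    moreover have "(\<lambda>i. if i < n then w i else 0) \<in> coord_cube n (real R)"
      using that by (auto simp: coord_cube_def)
    ultimately show ?thesis using min by simp
  qed
  let ?L = "real (coeff_norm P * deg_bound P * R ^ deg_bound P)"
  obtain s :: nat where "?L / peval P z0 < s" using reals_Archimedean2 by blast
  then have large: "?L < s * peval P z0" using min_pos by (simp add: divide_less_eq)
  have "s \<noteq> 0"
  proof
    assume "s = 0"
    with large have "?L < 0" by (simp only: of_nat_0 mult_zero_left)
    with of_nat_0_le_iff[of "coeff_norm P * deg_bound P * R ^ deg_bound P"] show False by linarith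
  qed
  then have s: "s > 0" by simp
  have "?L < real s * peval P (\<lambda>i. of_int (grid_coord R s N i) / real s)" for N
  proof -
    have "real s * peval P z0 \<le> real s * peval P (\<lambda>i. of_int (grid_coord R s N i) / real s)"
      using min_le abs_grid_point_le[OF s] by (intro mult_left_mono) auto
    with large show ?thesis by linarith
  qed
  then show ?thesis using s unfolding positive_on_grid_iff by blast
qed

section \<open>Certificates for inequalities on compact varieties\<close>

lemma penalized_positive_on_cube:
  assumes vars: "vars_in {..<n} p" "vars_in {..<n} g" and nonneg: "\<And>z. peval p z \<ge> 0"
    and pos: "\<And>z. peval p z = 0 \<Longrightarrow> peval g z > 0"
  shows "\<exists>K::nat. \<forall>z. (\<forall>i<n. \<bar>z i\<bar> \<le> R) \<longrightarrow> real K * peval p z + peval g z > 0"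
proof (rule ccontr)
  assume "\<not> ?thesis"
  then have "\<forall>K::nat. \<exists>z. (\<forall>i<n. \<bar>z i\<bar> \<le> R) \<and> real K * peval p z + peval g z \<le> 0" by (auto simp: not_less)
  then obtain Z where Z: "\<And>K i. i < n \<Longrightarrow> \<bar>Z K i\<bar> \<le> R"
    "\<And>K. real K * peval p (Z K) + peval g (Z K) \<le> 0" by metis
  define Y where "Y K i = (if i < n then Z K i else 0)" for K i
  have Y_eq: "peval p (Y K) = peval p (Z K)" "peval g (Y K) = peval g (Z K)" for K
    by (auto intro!: peval_cong[OF vars(1)] peval_cong[OF vars(2)] simp: Y_def)
  have "Y K \<in> coord_cube n R" for K using Z(1) by (auto simp: coord_cube_def Y_def)
  then obtain r y where r: "strict_mono r" and y: "\<And>i. (\<lambda>s. Y (r s) i) \<longlonglongrightarrow> y i"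
    using coord_cube_subsequence[of Y] by metis
  have lim: "(\<lambda>s. peval q (Y (r s))) \<longlonglongrightarrow> peval q y" for q
    by (rule tendsto_peval[of UNIV]) (auto intro: y)
  have le: "real (r s) * peval p (Y (r s)) \<le> - peval g (Y (r s))" for s using Z(2)[of "r s"] Y_eq by simp
  have "peval p y \<le> 0"
    by (rule multiplier_limit_nonpos[OF filterlim_real_subseq[OF r] lim tendsto_minus[OF lim] le])
  then have "peval g y > 0" using pos nonneg[of y] by simp
  moreover have "peval g (Y (r s)) \<le> 0" for s
    using le[of s] mult_nonneg_nonneg[OF of_nat_0_le_iff nonneg, of "r s" "Y (r s)"] by linarith
  then have "peval g y \<le> 0" by (intro LIMSEQ_le_const2[OF lim]) auto
  ultimately show False by simp
qed

definition gap_denominator :: "nat \<Rightarrow> ipoly \<Rightarrow> ipoly \<Rightarrow> nat" where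
  "gap_denominator n p h = 2 * gap_bound n (deg_bound p + deg_bound h) (coeff_norm p + coeff_norm h)"

definition gap_poly :: "nat \<Rightarrow> ipoly \<Rightarrow> ipoly \<Rightarrow> nat \<Rightarrow> ipoly" where
  "gap_poly n p h K = pscale (int (gap_denominator n p h * K)) p
     @ pscale (- int (gap_denominator n p h)) h @ [(1, [])]"

definition certified_nonpos :: "nat \<Rightarrow> nat \<Rightarrow> ipoly \<Rightarrow> ipoly \<Rightarrow> bool" where
  "certified_nonpos n R p h \<longleftrightarrow> (\<exists>K s. positive_on_grid n R (gap_poly n p h K) s)"

lemma gap_denominator_pos: "gap_denominator n p h > 0"
  by (simp add: gap_denominator_def gap_bound_pos)

lemma peval_gap_poly: "peval (gap_poly n p h K) z =
    real (gap_denominator n p h) * (real K * peval p z) - real (gap_denominator n p h) * peval h z + 1"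
  by (simp add: gap_poly_def)

lemma vars_in_gap_poly: "vars_in V p \<Longrightarrow> vars_in V h \<Longrightarrow> vars_in V (gap_poly n p h K)"
  by (simp add: gap_poly_def)

lemma certified_nonpos_sound:
  assumes vars: "vars_in {..<n} p" "vars_in {..<n} h" and nonneg: "\<And>z. peval p z \<ge> 0"
    and cube: "\<And>z i. peval p z = 0 \<Longrightarrow> i < n \<Longrightarrow> \<bar>z i\<bar> \<le> real R" and R: "R \<ge> 1"
    and cert: "certified_nonpos n R p h" and z: "peval p z = 0"
  shows "peval h z \<le> 0"
proof -
  let ?G = "gap_denominator n p h"
  obtain K s where grid: "positive_on_grid n R (gap_poly n p h K) s"
    using cert unfolding certified_nonpos_def by blast
  interpret constraint: penalty n "deg_bound p + deg_bound h" "coeff_norm p + coeff_norm h" p "pscale (-1) h"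
  proof
    show "vars_in {..<n} p" "vars_in {..<n} (pscale (-1) h)" using vars by auto
    show "degree_le (deg_bound p + deg_bound h) p" using degree_le_deg_bound[of p] by (rule degree_le_mono) simp
    have "degree_le (deg_bound p + deg_bound h) h" using degree_le_deg_bound[of h] by (rule degree_le_mono) simp
    then show "degree_le (deg_bound p + deg_bound h) (pscale (-1) h)" by (auto simp: degree_le_def set_pscale)
  qed (use nonneg in auto)
  have "0 \<le> peval (pscale (-1) h) z"
  proof (rule constraint.nonneg_if_above_gap[OF _ z])
    fix w assume w: "peval p w = 0"
    have "peval (gap_poly n p h K) w > 0"
      by (rule positive_on_grid_sound[OF vars_in_gap_poly[OF vars] R grid]) (use cube[OF w] in auto)
    then have "real ?G * peval h w < 1" using w by (simp add: peval_gap_poly)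
    then have "peval h w < 1 / ?G" using gap_denominator_pos[of n p h] by (simp add: field_simps)
    then show "peval (pscale (-1) h) w >
        - 1 / (2 * real (gap_bound n (deg_bound p + deg_bound h) (coeff_norm p + coeff_norm h)))"
      by (simp add: gap_denominator_def)
  qed
  then show ?thesis by simp
qed

lemma certified_nonpos_complete:
  assumes vars: "vars_in {..<n} p" "vars_in {..<n} h" and nonneg: "\<And>z. peval p z \<ge> 0"
    and nonpos: "\<And>z. peval p z = 0 \<Longrightarrow> peval h z \<le> 0"
  shows "certified_nonpos n R p h"
proof -
  define G where "G = gap_denominator n p h"
  have G: "G > 0" by (simp add: G_def gap_denominator_pos)
  have "\<exists>K::nat. \<forall>z. (\<forall>i<n. \<bar>z i\<bar> \<le> real R) \<longrightarrow> real K * peval p z + peval (pscale (- int G) h @ [(1, [])]) z > 0"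
  proof (rule penalized_positive_on_cube)
    fix z assume "peval p z = 0"
    then have "real G * peval h z \<le> 0" using nonpos by (simp add: mult_nonneg_nonpos)
    then show "0 < peval (pscale (- int G) h @ [(1, [])]) z" by simp
  qed (use vars nonneg in auto)
  then obtain K :: nat where K: "\<And>z. (\<forall>i<n. \<bar>z i\<bar> \<le> real R) \<Longrightarrow> real K * peval p z - real G * peval h z + 1 > 0"
    by (auto simp: algebra_simps)
  have "\<exists>s. positive_on_grid n R (gap_poly n p h K) s"
  proof (rule positive_on_grid_complete[OF vars_in_gap_poly[OF vars]])
    fix z assume "\<And>i. i < n \<Longrightarrow> \<bar>z i\<bar> \<le> real R"
    then have "real K * peval p z - real G * peval h z + 1 > 0" by (intro K) auto
    moreover have "1 * (real K * peval p z) \<le> real G * (real K * peval p z)"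
      using G nonneg[of z] by (intro mult_right_mono) auto
    ultimately show "peval (gap_poly n p h K) z > 0" by (simp add: peval_gap_poly G_def)
  qed
  then show ?thesis unfolding certified_nonpos_def by blast
qed

lemma certified_nonpos_iff:
  assumes "vars_in {..<n} p" "vars_in {..<n} h" "\<And>z. peval p z \<ge> 0"
    and "\<And>z i. peval p z = 0 \<Longrightarrow> i < n \<Longrightarrow> \<bar>z i\<bar> \<le> real R" "R \<ge> 1"
  shows "certified_nonpos n R p h \<longleftrightarrow> (\<forall>z. peval p z = 0 \<longrightarrow> peval h z \<le> 0)"
proof (intro iffI allI impI)
  fix z assume "certified_nonpos n R p h" "peval p z = 0"
  with assms show "peval h z \<le> 0" by (rule certified_nonpos_sound)
next
  assume "\<forall>z. peval p z = 0 \<longrightarrow> peval h z \<le> 0"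
  then have "\<And>z. peval p z = 0 \<Longrightarrow> peval h z \<le> 0" by blast
  with assms(1-3) show "certified_nonpos n R p h" by (rule certified_nonpos_complete)
qed

section \<open>Orbits of isometries\<close>

definition vnorm :: "nat \<Rightarrow> (nat \<Rightarrow> real) \<Rightarrow> real" where
  "vnorm n x = L2_set x {..<n}"

definition vdist :: "nat \<Rightarrow> (nat \<Rightarrow> real) \<Rightarrow> (nat \<Rightarrow> real) \<Rightarrow> real" where
  "vdist n x y = vnorm n (\<lambda>i. x i - y i)"

definition unit_sphere :: "nat \<Rightarrow> (nat \<Rightarrow> real) set" where
  "unit_sphere n = {x. (\<forall>i\<ge>n. x i = 0) \<and> vnorm n x = 1}"

lemma vnorm_cong: "(\<And>i. i < n \<Longrightarrow> x i = y i) \<Longrightarrow> vnorm n x = vnorm n y"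
  unfolding vnorm_def by (rule L2_set_cong) auto

lemma vdist_nonneg [simp]: "vdist n x y \<ge> 0" by (simp add: vdist_def vnorm_def)

lemma vdist_commute: "vdist n x y = vdist n y x"
  by (simp add: vdist_def vnorm_def L2_set_def power2_commute)

lemma vdist_self [simp]: "vdist n x x = 0" by (simp add: vdist_def vnorm_def L2_set_def)

lemma vdist_triangle: "vdist n x z \<le> vdist n x y + vdist n y z"
  using L2_set_triangle_ineq[of "\<lambda>i. x i - y i" "\<lambda>i. y i - z i" "{..<n}"] by (simp add: vdist_def vnorm_def)

lemma abs_coord_le_vnorm: "i < n \<Longrightarrow> \<bar>x i\<bar> \<le> vnorm n x"
  using member_le_L2_set[of "{..<n}" i "\<lambda>i. \<bar>x i\<bar>"] by (simp add: vnorm_def L2_set_def)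

lemma tendsto_vdist:
  assumes "\<And>i. i < n \<Longrightarrow> ((\<lambda>s. X s i) \<longlongrightarrow> x i) F"
  shows "((\<lambda>s. vdist n (X s) x) \<longlongrightarrow> 0) F"
proof -
  have "((\<lambda>s. sqrt (\<Sum>i<n. (X s i - x i)\<^sup>2)) \<longlongrightarrow> sqrt (\<Sum>i<n. (x i - x i)\<^sup>2)) F"
    by (intro tendsto_intros assms) auto
  then show ?thesis by (simp add: vdist_def vnorm_def L2_set_def)
qed

lemma tendsto_coord_if_vdist:
  assumes "((\<lambda>s. vdist n (X s) x) \<longlongrightarrow> 0) F" "i < n"
  shows "((\<lambda>s. X s i) \<longlongrightarrow> x i) F"
proof -
  have "norm (X s i - x i) \<le> vdist n (X s) x" for s
    using abs_coord_le_vnorm[OF assms(2), of "\<lambda>i. X s i - x i"] by (simp add: vdist_def)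
  then have "((\<lambda>s. X s i - x i) \<longlongrightarrow> 0) F"
    by (intro Lim_null_comparison[OF always_eventually assms(1)]) auto
  then show ?thesis by (simp add: LIM_zero_iff)
qed

lemma compact_unit_sphere: "compact (unit_sphere n)"
proof -
  have "continuous_on UNIV (\<lambda>x. vnorm n x)"
    unfolding vnorm_def L2_set_def by (intro continuous_intros)
  then have "closed {x. vnorm n x = 1}" by (intro closed_Collect_eq) auto
  then have "compact (coord_cube n 1 \<inter> {x. vnorm n x = 1})" by (intro compact_Int_closed compact_coord_cube)
  moreover have "coord_cube n 1 \<inter> {x. vnorm n x = 1} = unit_sphere n"
    using abs_coord_le_vnorm[of _ n] unfolding coord_cube_def unit_sphere_def by auto metis+
  ultimately show ?thesis by simp
qed

locale isometries =
  fixes n k :: nat and A :: "nat \<Rightarrow> nat \<Rightarrow> nat \<Rightarrow> real" and s0 :: "nat \<Rightarrow> real"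
  assumes isometry: "\<And>\<sigma> x. \<sigma> < k \<Longrightarrow> vnorm n (\<lambda>i. \<Sum>j<n. A \<sigma> i j * x j) = vnorm n x"
    and letters_exist: "k > 0" and s0: "s0 \<in> unit_sphere n"
begin

definition letter_map :: "nat \<Rightarrow> (nat \<Rightarrow> real) \<Rightarrow> nat \<Rightarrow> real" where
  "letter_map \<sigma> x = (\<lambda>i. if i < n then \<Sum>j<n. A \<sigma> i j * x j else 0)"

definition word_map :: "nat list \<Rightarrow> (nat \<Rightarrow> real) \<Rightarrow> nat \<Rightarrow> real" where
  "word_map u x = foldl (\<lambda>v \<sigma>. letter_map \<sigma> v) x u"

definition words :: "nat list set" where "words = {u. set u \<subseteq> {..<k}}"

definition word_power :: "nat \<Rightarrow> nat list \<Rightarrow> nat list" where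
  "word_power m u = concat (replicate m u)"

lemma words_simps [simp]:
  "[] \<in> words" "u @ v \<in> words \<longleftrightarrow> u \<in> words \<and> v \<in> words" "\<sigma> # u \<in> words \<longleftrightarrow> \<sigma> < k \<and> u \<in> words"
  by (auto simp: words_def)

lemma word_map_simps [simp]:
  "word_map [] x = x" "word_map (u @ v) x = word_map v (word_map u x)"
  "word_map (\<sigma> # u) x = word_map u (letter_map \<sigma> x)"
  by (simp_all add: word_map_def)

lemma word_power_simps [simp]: "word_power 0 u = []" "word_power (Suc m) u = u @ word_power m u"
  by (simp_all add: word_power_def)

lemma word_power_add: "word_power (m + l) u = word_power m u @ word_power l u"
  by (induction m) auto

lemma word_power_in_words [simp]: "u \<in> words \<Longrightarrow> word_power m u \<in> words"
  by (induction m) auto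

lemma vnorm_letter_map: "\<sigma> < k \<Longrightarrow> vnorm n (letter_map \<sigma> x) = vnorm n x"
  unfolding isometry[of \<sigma> x, symmetric] by (rule vnorm_cong) (simp add: letter_map_def)

lemma vdist_letter_map: "\<sigma> < k \<Longrightarrow> vdist n (letter_map \<sigma> x) (letter_map \<sigma> y) = vdist n x y"
proof -
  assume "\<sigma> < k"
  have "(\<lambda>i. letter_map \<sigma> x i - letter_map \<sigma> y i) = letter_map \<sigma> (\<lambda>i. x i - y i)"
    by (auto simp: letter_map_def right_diff_distrib sum_subtractf)
  with vnorm_letter_map[OF \<open>\<sigma> < k\<close>] show ?thesis by (simp add: vdist_def)
qed

lemma vdist_word_map: "u \<in> words \<Longrightarrow> vdist n (word_map u x) (word_map u y) = vdist n x y"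
  by (induction u arbitrary: x y) (auto simp: vdist_letter_map)

lemma vnorm_word_map: "u \<in> words \<Longrightarrow> vnorm n (word_map u x) = vnorm n x"
  by (induction u arbitrary: x) (auto simp: vnorm_letter_map)

lemma word_map_supported: "\<forall>i\<ge>n. x i = 0 \<Longrightarrow> i \<ge> n \<Longrightarrow> word_map u x i = 0"
  by (induction u arbitrary: x) (auto simp: letter_map_def)

lemma word_map_unit_sphere: "u \<in> words \<Longrightarrow> x \<in> unit_sphere n \<Longrightarrow> word_map u x \<in> unit_sphere n"
  by (auto simp: unit_sphere_def vnorm_word_map word_map_supported)

lemma recurrence:
  assumes u: "u \<in> words" and "\<epsilon> > 0" and x: "\<forall>i\<ge>n. x i = 0"
  obtains m where "m \<ge> 1" "vdist n (word_map (word_power m u) x) x < \<epsilon>"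
proof -
  let ?X = "\<lambda>m. word_map (word_power m u) x"
  have "?X m \<in> coord_cube n (vnorm n x)" for m
    using abs_coord_le_vnorm[of _ n "?X m"] vnorm_word_map[of "word_power m u" x] u word_map_supported[OF x]
    by (auto simp: coord_cube_def)
  then obtain r y where r: "strict_mono r" and y: "\<And>i. (\<lambda>s. ?X (r s) i) \<longlonglongrightarrow> y i"
    using coord_cube_subsequence[of ?X] by metis
  have "(\<lambda>s. vdist n (?X (r s)) y) \<longlonglongrightarrow> 0" by (intro tendsto_vdist y)
  then have "\<forall>\<^sub>F s in sequentially. vdist n (?X (r s)) y < \<epsilon> / 2" using \<open>\<epsilon> > 0\<close> by (intro order_tendstoD) auto
  then obtain s where s: "\<And>t. t \<ge> s \<Longrightarrow> vdist n (?X (r t)) y < \<epsilon> / 2" by (auto simp: eventually_sequentially)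
  have "r s < r (Suc s)" using r by (simp add: strict_mono_def)
  define m where "m = r (Suc s) - r s"
  have m: "m \<ge> 1" "r (Suc s) = m + r s" using \<open>r s < r (Suc s)\<close> by (auto simp: m_def)
  have "vdist n (?X m) x = vdist n (?X (r (Suc s))) (?X (r s))"
    using u by (simp add: m(2) word_power_add vdist_word_map)
  also have "\<dots> \<le> vdist n (?X (r (Suc s))) y + vdist n y (?X (r s))" by (rule vdist_triangle)
  also have "\<dots> < \<epsilon>" using s[of s] s[of "Suc s"] vdist_commute[of n y "?X (r s)"] by simp
  finally show ?thesis using m(1) that by blast
qed

text \<open>A power of \<open>v\<close> returns close to \<open>x\<close>, so the preceding power acts like the inverse of \<open>v\<close>.\<close>

lemma approx_inverse:
  assumes v: "v \<in> words" and "\<epsilon> > 0" "\<forall>i\<ge>n. x i = 0"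
  obtains v' where "v' \<in> words" "\<And>y. vdist n x (word_map v' y) < vdist n (word_map v x) y + \<epsilon>"
proof -
  obtain m where m: "m \<ge> 1" "vdist n (word_map (word_power m v) x) x < \<epsilon>" using recurrence[OF assms] by blast
  then obtain l where l: "m = Suc l" by (cases m) auto
  let ?v' = "word_power l v"
  have "vdist n x (word_map ?v' y) < vdist n (word_map v x) y + \<epsilon>" for y
  proof -
    have "vdist n x (word_map ?v' y) \<le>
        vdist n x (word_map ?v' (word_map v x)) + vdist n (word_map ?v' (word_map v x)) (word_map ?v' y)"
      by (rule vdist_triangle)
    also have "vdist n x (word_map ?v' (word_map v x)) = vdist n (word_map (word_power m v) x) x"
      by (simp add: l vdist_commute)
    also have "vdist n (word_map ?v' (word_map v x)) (word_map ?v' y) = vdist n (word_map v x) y"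
      using v by (simp add: vdist_word_map)
    finally show ?thesis using m(2) by simp
  qed
  then show ?thesis using that[of ?v'] v by auto
qed

definition orbit_dist :: "(nat \<Rightarrow> real) \<Rightarrow> real" where
  "orbit_dist x = (INF u\<in>words. vdist n x (word_map u s0))"

definition orbit_closure :: "(nat \<Rightarrow> real) set" where
  "orbit_closure = {x \<in> unit_sphere n. orbit_dist x = 0}"

lemma bdd_below_vdist: "bdd_below ((\<lambda>u. vdist n x (word_map u s0)) ` words)"
  by (rule bdd_belowI[of _ 0]) auto

lemma words_nonempty: "words \<noteq> {}" using words_simps(1) by blast

lemma orbit_dist_le: "u \<in> words \<Longrightarrow> orbit_dist x \<le> vdist n x (word_map u s0)"
  unfolding orbit_dist_def by (rule cINF_lower[OF bdd_below_vdist])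

lemma orbit_dist_nonneg: "orbit_dist x \<ge> 0"
  unfolding orbit_dist_def by (rule cINF_greatest[OF words_nonempty]) auto

lemma orbit_dist_lessE:
  assumes "orbit_dist x < t"
  obtains u where "u \<in> words" "vdist n x (word_map u s0) < t"
  using assms cINF_less_iff[OF words_nonempty bdd_below_vdist] unfolding orbit_dist_def by blast

lemma orbit_dist_lipschitz: "orbit_dist x \<le> orbit_dist y + vdist n x y"
proof -
  have "orbit_dist x - vdist n x y \<le> orbit_dist y"
    unfolding orbit_dist_def[of y]
  proof (rule cINF_greatest[OF words_nonempty])
    fix u assume "u \<in> words"
    then show "orbit_dist x - vdist n x y \<le> vdist n y (word_map u s0)"
      using orbit_dist_le[of u x] vdist_triangle[of n x "word_map u s0" y] by simp
  qed
  then show ?thesis by simp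
qed

lemma continuous_on_orbit_dist: "continuous_on S orbit_dist"
  unfolding continuous_on_def
proof
  fix x
  have "\<bar>orbit_dist y - orbit_dist x\<bar> \<le> vdist n y x" for y
    using orbit_dist_lipschitz[of x y] orbit_dist_lipschitz[of y x] vdist_commute[of n x y] by linarith
  then have "\<forall>\<^sub>F y in at x within S. norm (orbit_dist y - orbit_dist x) \<le> vdist n y x"
    by (intro always_eventually allI) simp
  moreover have "((\<lambda>y. vdist n y x) \<longlongrightarrow> 0) (at x within S)"
    by (intro tendsto_vdist tendsto_coord[OF tendsto_ident_at])
  ultimately have "((\<lambda>y. orbit_dist y - orbit_dist x) \<longlongrightarrow> 0) (at x within S)"
    by (rule Lim_null_comparison)
  then show "(orbit_dist \<longlongrightarrow> orbit_dist x) (at x within S)" by (simp add: LIM_zero_iff)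
qed

lemma orbit_dist_le_word_map:
  assumes "v \<in> words" "\<forall>i\<ge>n. x i = 0"
  shows "orbit_dist x \<le> orbit_dist (word_map v x)"
proof (rule field_le_epsilon)
  fix \<epsilon> :: real assume "\<epsilon> > 0"
  then have half: "\<epsilon> / 2 > 0" by simp
  then have "orbit_dist (word_map v x) < orbit_dist (word_map v x) + \<epsilon> / 2" by simp
  then obtain u where u: "u \<in> words" "vdist n (word_map v x) (word_map u s0) < orbit_dist (word_map v x) + \<epsilon> / 2"
    by (rule orbit_dist_lessE)
  obtain v' where v': "v' \<in> words" "\<And>y. vdist n x (word_map v' y) < vdist n (word_map v x) y + \<epsilon> / 2"
    using approx_inverse[OF assms(1) half assms(2)] by blast
  have "orbit_dist x \<le> vdist n x (word_map (u @ v') s0)" using u v' by (intro orbit_dist_le) auto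
  then show "orbit_dist x \<le> orbit_dist (word_map v x) + \<epsilon>" using u(2) v'(2)[of "word_map u s0"] by simp
qed

lemma compact_orbit_closure: "compact orbit_closure"
proof -
  have "closed {x. orbit_dist x = 0}" by (rule closed_Collect_eq[OF continuous_on_orbit_dist]) auto
  from compact_Int_closed[OF compact_unit_sphere[of n] this] show ?thesis
    by (simp add: orbit_closure_def Int_def)
qed

lemma s0_in_orbit_closure: "s0 \<in> orbit_closure"
  using s0 orbit_dist_le[of "[]" s0] orbit_dist_nonneg[of s0] by (auto simp: orbit_closure_def)

lemma letter_map_orbit_closure:
  assumes "\<sigma> < k" "z \<in> orbit_closure"
  shows "letter_map \<sigma> z \<in> orbit_closure"
proof -
  have "orbit_dist (letter_map \<sigma> z) \<le> 0 + \<epsilon>" if "\<epsilon> > 0" for \<epsilon>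
  proof -
    have "orbit_dist z < \<epsilon>" using assms(2) that by (simp add: orbit_closure_def)
    then obtain u where "u \<in> words" "vdist n z (word_map u s0) < \<epsilon>" by (rule orbit_dist_lessE)
    moreover have "vdist n (letter_map \<sigma> z) (word_map (u @ [\<sigma>]) s0) = vdist n z (word_map u s0)"
      using assms by (simp add: vdist_letter_map)
    ultimately show ?thesis using orbit_dist_le[of "u @ [\<sigma>]" "letter_map \<sigma> z"] assms by simp
  qed
  then have "orbit_dist (letter_map \<sigma> z) \<le> 0" by (rule field_le_epsilon)
  then show ?thesis
    using orbit_dist_nonneg[of "letter_map \<sigma> z"] word_map_unit_sphere[of "[\<sigma>]" z] assms
    by (auto simp: orbit_closure_def)
qed

lemma word_map_orbit_closure: "u \<in> words \<Longrightarrow> z \<in> orbit_closure \<Longrightarrow> word_map u z \<in> orbit_closure"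
  by (induction u arbitrary: z) (auto simp: letter_map_orbit_closure)

lemma orbit_closure_sequence:
  assumes "z \<in> orbit_closure"
  obtains us where "\<And>s::nat. us s \<in> words" "\<And>i. i < n \<Longrightarrow> (\<lambda>s. word_map (us s) s0 i) \<longlonglongrightarrow> z i"
proof -
  have "\<exists>u. u \<in> words \<and> vdist n z (word_map u s0) < inverse (real (Suc s))" for s
    using orbit_dist_lessE[of z "inverse (real (Suc s))"] assms by (auto simp: orbit_closure_def)
  then obtain us where us: "\<And>s. us s \<in> words" "\<And>s. vdist n z (word_map (us s) s0) < inverse (real (Suc s))"
    by metis
  have "(\<lambda>s. vdist n (word_map (us s) s0) z) \<longlonglongrightarrow> 0"
  proof (rule Lim_null_comparison[OF always_eventually LIMSEQ_inverse_real_of_nat], intro allI)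
    show "norm (vdist n (word_map (us s) s0) z) \<le> inverse (real (Suc s))" for s
      using us(2)[of s] by (simp add: vdist_commute)
  qed
  then show ?thesis using us(1) tendsto_coord_if_vdist by (intro that[of us]) auto
qed

text \<open>Together with \<open>word_map_orbit_closure\<close>: the orbit closure is minimal.\<close>

lemma s0_in_closure_of_orbit:
  assumes "z \<in> orbit_closure" and "\<epsilon> > 0"
  obtains v where "v \<in> words" "vdist n (word_map v z) s0 < \<epsilon>"
proof -
  have half: "\<epsilon> / 2 > 0" using \<open>\<epsilon> > 0\<close> by simp
  then have "orbit_dist z < \<epsilon> / 2" using assms(1) by (simp add: orbit_closure_def)
  then obtain u where u: "u \<in> words" "vdist n z (word_map u s0) < \<epsilon> / 2" by (rule orbit_dist_lessE)
  have "\<forall>i\<ge>n. s0 i = 0" using s0 by (simp add: unit_sphere_def)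
  then obtain v where v: "v \<in> words" "\<And>y. vdist n s0 (word_map v y) < vdist n (word_map u s0) y + \<epsilon> / 2"
    using approx_inverse[OF u(1) half] by blast
  have "vdist n (word_map v z) s0 < \<epsilon>"
    using v(2)[of z] u(2) vdist_commute[of n z "word_map u s0"] vdist_commute[of n s0 "word_map v z"] by simp
  with v(1) show ?thesis by (rule that)
qed

end

section \<open>Real polynomials of bounded degree\<close>

definition monomials :: "nat \<Rightarrow> nat \<Rightarrow> nat list set" where
  "monomials n D = {m. set m \<subseteq> {..<n} \<and> length m \<le> D}"

definition real_poly :: "nat \<Rightarrow> nat \<Rightarrow> (nat list \<Rightarrow> real) \<Rightarrow> (nat \<Rightarrow> real) \<Rightarrow> real" where
  "real_poly n D a x = (\<Sum>m\<in>monomials n D. a m * meval m x)"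

definition poly_functions :: "nat \<Rightarrow> ((nat \<Rightarrow> real) \<Rightarrow> real) set" where
  "poly_functions n = {f. \<exists>D a. f = real_poly n D a}"

lemma finite_monomials [simp]: "finite (monomials n D)"
  unfolding monomials_def by (rule finite_lists_length_le) auto

lemma continuous_on_real_poly: "continuous_on S (real_poly n D a)"
  unfolding real_poly_def by (intro continuous_intros)

lemma tendsto_real_poly:
  assumes "\<And>i. i < n \<Longrightarrow> ((\<lambda>s. X s i) \<longlongrightarrow> x i) F"
  shows "((\<lambda>s. real_poly n D a (X s)) \<longlongrightarrow> real_poly n D a x) F"
  unfolding real_poly_def by (intro tendsto_intros tendsto_meval assms) (auto simp: monomials_def)

lemma real_poly_cong: "(\<And>m. m \<in> monomials n D \<Longrightarrow> a m = b m) \<Longrightarrow> real_poly n D a = real_poly n D b"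
  unfolding real_poly_def by (intro ext sum.cong) auto

lemma real_poly_extend:
  assumes "D \<le> E"
  shows "real_poly n D a = real_poly n E (\<lambda>m. if m \<in> monomials n D then a m else 0)"
  unfolding real_poly_def
  by (intro ext sum.mono_neutral_cong_left finite_monomials) (use assms in \<open>auto simp: monomials_def\<close>)

lemma real_poly_minus_const: "real_poly n D (a([] := a [] - c)) x = real_poly n D a x - c"
proof -
  have "[] \<in> monomials n D" by (simp add: monomials_def)
  then have "real_poly n D b x = b [] + (\<Sum>m\<in>monomials n D - {[]}. b m * meval m x)" for b
    unfolding real_poly_def by (subst sum.remove[of _ "[]"]) auto
  then show ?thesis by simp
qed

lemma poly_functions_monomial: "set m \<subseteq> {..<n} \<Longrightarrow> (\<lambda>x. c * meval m x) \<in> poly_functions n"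
proof -
  assume "set m \<subseteq> {..<n}"
  then have "m \<in> monomials n (length m)" by (simp add: monomials_def)
  then have "(\<lambda>x. c * meval m x) = real_poly n (length m) (\<lambda>m'. if m' = m then c else 0)"
    by (simp add: real_poly_def fun_eq_iff if_distrib[of "\<lambda>c. c * _"] cong: if_cong)
  then show ?thesis unfolding poly_functions_def by blast
qed

lemma poly_functions_const: "(\<lambda>x. c) \<in> poly_functions n"
  using poly_functions_monomial[of "[]" n c] by simp

lemma poly_functions_add:
  assumes "f \<in> poly_functions n" "g \<in> poly_functions n"
  shows "(\<lambda>x. f x + g x) \<in> poly_functions n"
proof -
  obtain D a E b where fg: "f = real_poly n D a" "g = real_poly n E b"
    using assms by (auto simp: poly_functions_def)
  obtain a' b' where "f = real_poly n (max D E) a'" "g = real_poly n (max D E) b'"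
    using fg real_poly_extend[of D "max D E"] real_poly_extend[of E "max D E"] by auto
  then have "(\<lambda>x. f x + g x) = real_poly n (max D E) (\<lambda>m. a' m + b' m)"
    by (simp add: real_poly_def fun_eq_iff distrib_right sum.distrib)
  then show ?thesis unfolding poly_functions_def by blast
qed

lemma poly_functions_sum:
  "finite I \<Longrightarrow> (\<And>i. i \<in> I \<Longrightarrow> f i \<in> poly_functions n) \<Longrightarrow> (\<lambda>x. \<Sum>i\<in>I. f i x) \<in> poly_functions n"
  by (induction I rule: finite_induct) (auto intro: poly_functions_const poly_functions_add)

lemma poly_functions_mult:
  assumes "f \<in> poly_functions n" "g \<in> poly_functions n"
  shows "(\<lambda>x. f x * g x) \<in> poly_functions n"
proof -
  obtain D a E b where fg: "f = real_poly n D a" "g = real_poly n E b"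
    using assms by (auto simp: poly_functions_def)
  have "(\<lambda>x. f x * g x) = (\<lambda>x. \<Sum>m\<in>monomials n D. \<Sum>m'\<in>monomials n E. (a m * b m') * meval (m @ m') x)"
    by (simp add: fg real_poly_def sum_product algebra_simps)
  moreover have "\<dots> \<in> poly_functions n"
    by (intro poly_functions_sum finite_monomials poly_functions_monomial) (auto simp: monomials_def)
  ultimately show ?thesis by simp
qed

lemma poly_approximation:
  assumes "continuous_on (unit_sphere n) f" and "\<epsilon> > 0"
  obtains D a where "\<And>x. x \<in> unit_sphere n \<Longrightarrow> \<bar>f x - real_poly n D a x\<bar> < \<epsilon>"
proof -
  have "\<exists>g. g \<in> poly_functions n \<and> (\<forall>x\<in>unit_sphere n. \<bar>f x - g x\<bar> < \<epsilon>)"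
  proof (rule Stone_Weierstrass_HOL[OF compact_unit_sphere _ _ _ _ _ assms])
    show "\<exists>f. f \<in> poly_functions n \<and> f x \<noteq> f y" if "x \<in> unit_sphere n \<and> y \<in> unit_sphere n \<and> x \<noteq> y" for x y
    proof -
      from that obtain i where i: "x i \<noteq> y i" by auto
      then have "i < n" using that by (auto simp: unit_sphere_def not_less[symmetric])
      then have "(\<lambda>x. 1 * meval [i] x) \<in> poly_functions n" by (intro poly_functions_monomial) simp
      with i show ?thesis by (intro exI[of _ "\<lambda>x. 1 * meval [i] x"]) simp
    qed
    show "continuous_on (unit_sphere n) f" if "f \<in> poly_functions n" for f
      using that continuous_on_real_poly by (auto simp: poly_functions_def)
  qed (auto intro: poly_functions_const poly_functions_add poly_functions_mult)
  then show ?thesis using that by (auto simp: poly_functions_def)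
qed

fun subst_coeff :: "(nat \<Rightarrow> nat \<Rightarrow> real) \<Rightarrow> nat list \<Rightarrow> nat list \<Rightarrow> real" where
  "subst_coeff M (i # m) (j # m') = M i j * subst_coeff M m m'"
| "subst_coeff M _ _ = 1"

lemma abs_subst_coeff_le:
  assumes M: "\<And>i j. i < n \<Longrightarrow> j < n \<Longrightarrow> \<bar>M i j\<bar> \<le> 1"
  shows "set m \<subseteq> {..<n} \<Longrightarrow> set m' \<subseteq> {..<n} \<Longrightarrow> \<bar>subst_coeff M m m'\<bar> \<le> 1"
proof (induction m arbitrary: m')
  case (Cons i m)
  show ?case
  proof (cases m')
    case m': (Cons j l)
    have "\<bar>M i j\<bar> * \<bar>subst_coeff M m l\<bar> \<le> 1 * 1" using Cons.IH[of l] Cons.prems m' by (intro mult_mono M) auto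
    then show ?thesis by (simp add: m' abs_mult)
  qed simp
qed simp

lemma meval_linear_subst:
  assumes y: "\<And>i. i < n \<Longrightarrow> y i = (\<Sum>j<n. M i j * x j)" and "set m \<subseteq> {..<n}"
  shows "meval m y =
    (\<Sum>m'\<in>{m'. set m' \<subseteq> {..<n} \<and> length m' = length m}. subst_coeff M m m' * meval m' x)"
  using assms(2)
proof (induction m)
  case Nil
  have "{m'. set m' \<subseteq> {..<n} \<and> length m' = length ([]::nat list)} = {[]}" by auto
  then show ?case by simp
next
  case (Cons i m)
  let ?L = "{m'. set m' \<subseteq> {..<n} \<and> length m' = length m}"
  have lists_Suc: "{m'. set m' \<subseteq> {..<n} \<and> length m' = length (i # m)} = (\<lambda>(j, m'). j # m') ` ({..<n} \<times> ?L)"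
    by (auto simp: length_Suc_conv image_iff)
  have inj: "inj_on (\<lambda>(j, m'). j # m') ({..<n} \<times> ?L)" by (auto simp: inj_on_def)
  have "meval (i # m) y = (\<Sum>j<n. M i j * x j) * (\<Sum>m'\<in>?L. subst_coeff M m m' * meval m' x)"
    using Cons y by simp
  also have "\<dots> = (\<Sum>(j, m')\<in>{..<n} \<times> ?L. subst_coeff M (i # m) (j # m') * meval (j # m') x)"
    unfolding sum_product sum.cartesian_product by (intro sum.cong) (auto simp: algebra_simps)
  also have "\<dots> = (\<Sum>m'\<in>{m'. set m' \<subseteq> {..<n} \<and> length m' = length (i # m)}. subst_coeff M (i # m) m' * meval m' x)"
    unfolding lists_Suc sum.reindex[OF inj] by (simp add: case_prod_unfold)
  finally show ?case .
qed

lemma real_poly_linear_subst: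
  assumes y: "\<And>i. i < n \<Longrightarrow> y i = (\<Sum>j<n. M i j * x j)"
  shows "real_poly n D a y =
    real_poly n D (\<lambda>m'. \<Sum>m\<in>monomials n D. if length m = length m' then a m * subst_coeff M m m' else 0) x"
proof -
  have "real_poly n D a y =
      (\<Sum>m\<in>monomials n D. \<Sum>m'\<in>monomials n D. if length m = length m' then a m * subst_coeff M m m' * meval m' x else 0)"
    unfolding real_poly_def
  proof (rule sum.cong[OF refl])
    fix m assume m: "m \<in> monomials n D"
    then have "a m * meval m y =
        (\<Sum>m'\<in>{m'. set m' \<subseteq> {..<n} \<and> length m' = length m}. a m * subst_coeff M m m' * meval m' x)"
      by (subst meval_linear_subst[OF y]) (auto simp: monomials_def sum_distrib_left mult.assoc)
    also have "\<dots> = (\<Sum>m'\<in>monomials n D. if length m = length m' then a m * subst_coeff M m m' * meval m' x else 0)"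
      by (intro sum.mono_neutral_cong_left finite_monomials) (use m in \<open>auto simp: monomials_def\<close>)
    finally show "a m * meval m y = \<dots>" .
  qed
  also have "\<dots> = (\<Sum>m'\<in>monomials n D. \<Sum>m\<in>monomials n D. if length m = length m' then a m * subst_coeff M m m' * meval m' x else 0)"
    by (rule sum.swap)
  finally show ?thesis
    by (simp add: real_poly_def sum_distrib_right if_distrib[of "\<lambda>c. c * _"] cong: if_cong)
qed

definition bounded_polys :: "nat \<Rightarrow> nat \<Rightarrow> real \<Rightarrow> ((nat \<Rightarrow> real) \<Rightarrow> real) set" where
  "bounded_polys n D C = {w. \<exists>a. (\<forall>m\<in>monomials n D. \<bar>a m\<bar> \<le> C) \<and> w = real_poly n D a}"

lemma bounded_polys_average:
  assumes I: "finite I" "I \<noteq> {}" and w: "\<And>i. i \<in> I \<Longrightarrow> w i \<in> bounded_polys n D C"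
  shows "(\<lambda>x. (\<Sum>i\<in>I. w i x) / real (card I)) \<in> bounded_polys n D C"
proof -
  have "\<forall>i\<in>I. \<exists>a. (\<forall>m\<in>monomials n D. \<bar>a m\<bar> \<le> C) \<and> w i = real_poly n D a"
    using w by (auto simp: bounded_polys_def)
  then obtain a where a: "\<And>i m. i \<in> I \<Longrightarrow> m \<in> monomials n D \<Longrightarrow> \<bar>a i m\<bar> \<le> C"
    "\<And>i. i \<in> I \<Longrightarrow> w i = real_poly n D (a i)" by metis
  define b where "b m = (\<Sum>i\<in>I. a i m) / real (card I)" for m
  have card: "real (card I) > 0" using I by (simp add: card_gt_0_iff)
  have "\<bar>b m\<bar> \<le> C" if "m \<in> monomials n D" for m
  proof -
    have "\<bar>\<Sum>i\<in>I. a i m\<bar> \<le> (\<Sum>i\<in>I. C)"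
      by (rule order_trans[OF sum_abs], rule sum_mono) (auto intro: a that)
    then show ?thesis using card by (simp add: b_def abs_divide divide_le_eq mult.commute)
  qed
  moreover have "(\<Sum>i\<in>I. w i x) / real (card I) = real_poly n D b x" for x
  proof -
    have "(\<Sum>i\<in>I. w i x) = (\<Sum>i\<in>I. \<Sum>m\<in>monomials n D. a i m * meval m x)" using a(2) by (simp add: real_poly_def)
    also have "\<dots> = (\<Sum>m\<in>monomials n D. (\<Sum>i\<in>I. a i m) * meval m x)"
      by (subst sum.swap) (simp add: sum_distrib_right)
    finally have "(\<Sum>i\<in>I. w i x) / real (card I) = (\<Sum>m\<in>monomials n D. (\<Sum>i\<in>I. a i m) * meval m x / real (card I))"
      by (simp only: sum_divide_distrib)
    then show ?thesis by (simp add: real_poly_def b_def)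
  qed
  ultimately show ?thesis unfolding bounded_polys_def by blast
qed

lemma bounded_polys_subsequence:
  fixes w :: "nat \<Rightarrow> (nat \<Rightarrow> real) \<Rightarrow> real"
  assumes "\<And>N. w N \<in> bounded_polys n D C"
  obtains r b where "strict_mono r" "\<And>x. (\<lambda>N. w (r N) x) \<longlonglongrightarrow> real_poly n D b x"
proof -
  have "\<forall>N. \<exists>a. (\<forall>m. \<bar>a m\<bar> \<le> \<bar>C\<bar>) \<and> w N = real_poly n D a"
  proof
    fix N
    obtain a where a: "\<forall>m\<in>monomials n D. \<bar>a m\<bar> \<le> C" "w N = real_poly n D a"
      using assms[of N] by (auto simp: bounded_polys_def)
    let ?a = "\<lambda>m. if m \<in> monomials n D then a m else 0"
    have "w N = real_poly n D ?a" unfolding a(2) by (rule real_poly_cong) simp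
    moreover have "\<bar>?a m\<bar> \<le> \<bar>C\<bar>" for m using a(1) by (auto intro: order_trans[OF _ abs_ge_self])
    ultimately show "\<exists>a. (\<forall>m. \<bar>a m\<bar> \<le> \<bar>C\<bar>) \<and> w N = real_poly n D a" by (intro exI[of _ ?a]) simp
  qed
  then obtain a where a: "\<And>N m. \<bar>a N m\<bar> \<le> \<bar>C\<bar>" "\<And>N. w N = real_poly n D (a N)" by metis
  have "seq_compact {z :: nat list \<Rightarrow> real. \<forall>m. z m \<in> {-\<bar>C\<bar>..\<bar>C\<bar>}}"
    by (intro compact_imp_seq_compact compact_pointwise) auto
  moreover have "\<forall>N. a N \<in> {z. \<forall>m. z m \<in> {-\<bar>C\<bar>..\<bar>C\<bar>}}" using a(1) by (auto simp: abs_le_iff minus_le_iff)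
  ultimately obtain b r where r: "strict_mono r" and lim: "(a \<circ> r) \<longlonglongrightarrow> b"
    unfolding seq_compact_def by metis
  have "(\<lambda>N. a (r N) m) \<longlonglongrightarrow> b m" for m using tendsto_coord[OF lim] by (simp add: o_def)
  then have "(\<lambda>N. w (r N) x) \<longlonglongrightarrow> real_poly n D b x" for x
    unfolding a(2) real_poly_def by (intro tendsto_intros)
  with r show ?thesis by (rule that)
qed

section \<open>Separating an orbit closure by polynomials\<close>

context isometries
begin

lemma word_map_linear: "\<exists>M. \<forall>x. \<forall>i<n. word_map u x i = (\<Sum>j<n. M i j * x j)"
proof (induction u rule: rev_induct)
  case Nil
  show ?case
    by (rule exI[of _ "\<lambda>i j. if j = i then 1 else 0"]) (auto simp: if_distrib[of "\<lambda>c. c * _"] cong: if_cong)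
next
  case (snoc \<sigma> u)
  then obtain M where M: "\<And>x i. i < n \<Longrightarrow> word_map u x i = (\<Sum>j<n. M i j * x j)" by blast
  have "word_map (u @ [\<sigma>]) x i = (\<Sum>j<n. (\<Sum>l<n. A \<sigma> i l * M l j) * x j)" if "i < n" for x i
  proof -
    have "word_map (u @ [\<sigma>]) x i = (\<Sum>l<n. \<Sum>j<n. A \<sigma> i l * (M l j * x j))"
      using that M by (simp add: letter_map_def sum_distrib_left)
    also have "\<dots> = (\<Sum>j<n. (\<Sum>l<n. A \<sigma> i l * M l j) * x j)"
      by (subst sum.swap) (simp add: sum_distrib_right mult.assoc)
    finally show ?thesis .
  qed
  then show ?case by (intro exI[of _ "\<lambda>i j. \<Sum>l<n. A \<sigma> i l * M l j"]) simp
qed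

lemma word_map_matrix:
  assumes u: "u \<in> words"
  obtains M where "\<And>x i. i < n \<Longrightarrow> word_map u x i = (\<Sum>j<n. M i j * x j)" "\<And>i j. i < n \<Longrightarrow> j < n \<Longrightarrow> \<bar>M i j\<bar> \<le> 1"
proof -
  obtain M where M: "\<And>x i. i < n \<Longrightarrow> word_map u x i = (\<Sum>j<n. M i j * x j)" using word_map_linear by blast
  have "\<bar>M i j\<bar> \<le> 1" if "i < n" "j < n" for i j
  proof -
    define e where "e l = (if l = j then 1 else 0 :: real)" for l
    have "word_map u e i = M i j"
      using M[OF that(1), of e] that by (simp add: e_def if_distrib[of "\<lambda>c. _ * c"] cong: if_cong)
    moreover have "vnorm n e = 1"
      using that by (simp add: vnorm_def L2_set_def e_def if_distrib[of "\<lambda>c. c\<^sup>2"] cong: if_cong)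
    ultimately show ?thesis
      using abs_coord_le_vnorm[OF that(1), of "word_map u e"] vnorm_word_map[OF u, of e] by simp
  qed
  with M show ?thesis by (rule that)
qed

lemma real_poly_word_map_bounded:
  assumes "u \<in> words"
  shows "(\<lambda>x. real_poly n D a (word_map u x)) \<in> bounded_polys n D (\<Sum>m\<in>monomials n D. \<bar>a m\<bar>)"
proof -
  obtain M where M: "\<And>x i. i < n \<Longrightarrow> word_map u x i = (\<Sum>j<n. M i j * x j)"
    and M_le: "\<And>i j. i < n \<Longrightarrow> j < n \<Longrightarrow> \<bar>M i j\<bar> \<le> 1"
    using word_map_matrix[OF assms] by metis
  define b where "b m' = (\<Sum>m\<in>monomials n D. if length m = length m' then a m * subst_coeff M m m' else 0)" for m'
  have "real_poly n D a (word_map u x) = real_poly n D b x" for x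
    unfolding b_def using M by (rule real_poly_linear_subst)
  moreover have "\<bar>b m'\<bar> \<le> (\<Sum>m\<in>monomials n D. \<bar>a m\<bar>)" if m': "m' \<in> monomials n D" for m'
    unfolding b_def
  proof (rule order_trans[OF sum_abs], rule sum_mono)
    fix m assume "m \<in> monomials n D"
    then have "\<bar>subst_coeff M m m'\<bar> \<le> 1" using m' M_le by (intro abs_subst_coeff_le[of n]) (auto simp: monomials_def)
    then have "\<bar>a m\<bar> * \<bar>subst_coeff M m m'\<bar> \<le> \<bar>a m\<bar> * 1" by (intro mult_left_mono) auto
    then show "\<bar>if length m = length m' then a m * subst_coeff M m m' else 0\<bar> \<le> \<bar>a m\<bar>" by (simp add: abs_mult)
  qed
  ultimately show ?thesis unfolding bounded_polys_def by blast
qed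

definition mean_op :: "((nat \<Rightarrow> real) \<Rightarrow> real) \<Rightarrow> (nat \<Rightarrow> real) \<Rightarrow> real" where
  "mean_op w x = (\<Sum>\<sigma><k. w (letter_map \<sigma> x)) / real k"

lemma mean_op_iterate_Suc: "(mean_op ^^ Suc j) w x = (\<Sum>\<sigma><k. (mean_op ^^ j) w (letter_map \<sigma> x)) / real k"
  by (simp add: mean_op_def[of "(mean_op ^^ j) w"])

lemma mean_op_iterate_between:
  assumes "\<And>v. v \<in> words \<Longrightarrow> lo \<le> w (word_map v x) \<and> w (word_map v x) \<le> hi" "v \<in> words"
  shows "lo \<le> (mean_op ^^ j) w (word_map v x) \<and> (mean_op ^^ j) w (word_map v x) \<le> hi"
  using assms(2)
proof (induction j arbitrary: v)
  case 0
  then show ?case using assms(1) by simp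
next
  case (Suc j)
  let ?y = "\<lambda>\<sigma>. (mean_op ^^ j) w (letter_map \<sigma> (word_map v x))"
  have "lo \<le> ?y \<sigma> \<and> ?y \<sigma> \<le> hi" if "\<sigma> < k" for \<sigma>
    using Suc.IH[of "v @ [\<sigma>]"] Suc.prems that by simp
  then have "real k * lo \<le> (\<Sum>\<sigma><k. ?y \<sigma>)" "(\<Sum>\<sigma><k. ?y \<sigma>) \<le> real k * hi"
    using sum_mono[of "{..<k}" "\<lambda>_. lo" ?y] sum_mono[of "{..<k}" ?y "\<lambda>_. hi"] by auto
  then show ?case using letters_exist unfolding mean_op_iterate_Suc by (simp add: field_simps)
qed

lemma mean_op_iterate_bounded:
  assumes "\<And>v. v \<in> words \<Longrightarrow> (\<lambda>x. w (word_map v x)) \<in> bounded_polys n D C" "v \<in> words"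
  shows "(\<lambda>x. (mean_op ^^ j) w (word_map v x)) \<in> bounded_polys n D C"
  using assms(2)
proof (induction j arbitrary: v)
  case 0
  then show ?case using assms(1) by simp
next
  case (Suc j)
  have "(\<lambda>x. (\<Sum>\<sigma>\<in>{..<k}. (mean_op ^^ j) w (word_map (v @ [\<sigma>]) x)) / real (card {..<k})) \<in> bounded_polys n D C"
    using Suc letters_exist by (intro bounded_polys_average) (auto simp del: word_map_simps)
  then show ?case unfolding mean_op_iterate_Suc by simp
qed

definition cesaro_mean :: "((nat \<Rightarrow> real) \<Rightarrow> real) \<Rightarrow> nat \<Rightarrow> (nat \<Rightarrow> real) \<Rightarrow> real" where
  "cesaro_mean w N x = (\<Sum>j<Suc N. (mean_op ^^ j) w x) / real (Suc N)"

lemma cesaro_mean_between: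
  assumes "\<And>v. v \<in> words \<Longrightarrow> lo \<le> w (word_map v x) \<and> w (word_map v x) \<le> hi"
  shows "lo \<le> cesaro_mean w N x" "cesaro_mean w N x \<le> hi"
proof -
  have "lo \<le> (mean_op ^^ j) w x" "(mean_op ^^ j) w x \<le> hi" for j
    using mean_op_iterate_between[of lo w x hi "[]" j] assms by auto
  then have "real (Suc N) * lo \<le> (\<Sum>j<Suc N. (mean_op ^^ j) w x)" "(\<Sum>j<Suc N. (mean_op ^^ j) w x) \<le> real (Suc N) * hi"
    using sum_mono[of "{..<Suc N}" "\<lambda>_. lo" "\<lambda>j. (mean_op ^^ j) w x"]
      sum_mono[of "{..<Suc N}" "\<lambda>j. (mean_op ^^ j) w x" "\<lambda>_. hi"] by auto
  then show "lo \<le> cesaro_mean w N x" "cesaro_mean w N x \<le> hi"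
    unfolding cesaro_mean_def by (simp_all add: field_simps)
qed

lemma mean_op_cesaro_mean:
  "mean_op (cesaro_mean w N) x - cesaro_mean w N x = ((mean_op ^^ Suc N) w x - w x) / real (Suc N)"
proof -
  let ?w = "\<lambda>j. (mean_op ^^ j) w"
  have "mean_op (cesaro_mean w N) x = (\<Sum>\<sigma><k. \<Sum>j<Suc N. ?w j (letter_map \<sigma> x)) / real (Suc N) / real k"
    by (simp add: mean_op_def cesaro_mean_def sum_divide_distrib[symmetric])
  also have "\<dots> = (\<Sum>j<Suc N. \<Sum>\<sigma><k. ?w j (letter_map \<sigma> x)) / real k / real (Suc N)"
    by (subst sum.swap) (simp only: divide_divide_eq_left mult.commute)
  also have "\<dots> = (\<Sum>j<Suc N. ?w (Suc j) x) / real (Suc N)"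
    by (simp only: mean_op_iterate_Suc sum_divide_distrib[of _ "{..<Suc N}" "real k"])
  finally have "mean_op (cesaro_mean w N) x - cesaro_mean w N x = (\<Sum>j<Suc N. ?w (Suc j) x - ?w j x) / real (Suc N)"
    by (simp add: cesaro_mean_def sum_subtractf diff_divide_distrib)
  then show ?thesis by (simp only: sum_lessThan_telescope[of "\<lambda>j. ?w j x" "Suc N"] funpow_0)
qed

lemma cesaro_mean_almost_fixed:
  assumes bound: "\<And>y. y \<in> unit_sphere n \<Longrightarrow> \<bar>w y\<bar> \<le> K" and x: "x \<in> unit_sphere n"
  shows "(\<lambda>N. mean_op (cesaro_mean w N) x - cesaro_mean w N x) \<longlonglongrightarrow> 0"
proof (rule Lim_null_comparison)
  have "- K \<le> w (word_map v x) \<and> w (word_map v x) \<le> K" if "v \<in> words" for v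
    using bound[OF word_map_unit_sphere[OF that x]] by (simp add: abs_le_iff)
  then have iterate_le: "\<bar>(mean_op ^^ j) w x\<bar> \<le> K" for j
    using mean_op_iterate_between[of "-K" w x K "[]" j] by (simp add: abs_le_iff minus_le_iff)
  show "\<forall>\<^sub>F N in sequentially. norm (mean_op (cesaro_mean w N) x - cesaro_mean w N x) \<le> 2 * K * inverse (real (Suc N))"
  proof (intro always_eventually allI)
    fix N
    have "\<bar>(mean_op ^^ Suc N) w x - w x\<bar> \<le> 2 * K" using iterate_le[of "Suc N"] iterate_le[of 0] by auto
    then show "norm (mean_op (cesaro_mean w N) x - cesaro_mean w N x) \<le> 2 * K * inverse (real (Suc N))"
      unfolding mean_op_cesaro_mean real_norm_def divide_inverse abs_mult by (intro mult_mono) auto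
  qed
  have "(\<lambda>N. 2 * K * inverse (real (Suc N))) \<longlonglongrightarrow> 2 * K * 0"
    by (intro tendsto_intros LIMSEQ_inverse_real_of_nat)
  then show "(\<lambda>N. 2 * K * inverse (real (Suc N))) \<longlonglongrightarrow> 0" by simp
qed

lemma real_poly_bounded_on_sphere:
  obtains K where "\<And>y. y \<in> unit_sphere n \<Longrightarrow> \<bar>real_poly n D a y\<bar> \<le> K"
proof -
  have "compact (real_poly n D a ` unit_sphere n)"
    by (intro compact_continuous_image continuous_on_real_poly compact_unit_sphere)
  then show ?thesis using that compact_imp_bounded bounded_iff by (metis imageI real_norm_def)
qed

lemma cesaro_limit:
  obtains b where "\<And>x. x \<in> unit_sphere n \<Longrightarrow> mean_op (real_poly n D b) x = real_poly n D b x"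
    "\<And>x lo hi. (\<And>v. v \<in> words \<Longrightarrow> lo \<le> real_poly n D a (word_map v x) \<and> real_poly n D a (word_map v x) \<le> hi) \<Longrightarrow>
       lo \<le> real_poly n D b x \<and> real_poly n D b x \<le> hi"
proof -
  let ?f = "real_poly n D a"
  have "(mean_op ^^ j) ?f \<in> bounded_polys n D (\<Sum>m\<in>monomials n D. \<bar>a m\<bar>)" for j
    using mean_op_iterate_bounded[where w = ?f and v = "[]", OF real_poly_word_map_bounded] by simp
  then have "cesaro_mean ?f N \<in> bounded_polys n D (\<Sum>m\<in>monomials n D. \<bar>a m\<bar>)" for N
    using bounded_polys_average[of "{..<Suc N}" "\<lambda>j. (mean_op ^^ j) ?f"]
    unfolding cesaro_mean_def[abs_def] by (simp add: lessThan_empty_iff del: sum.lessThan_Suc)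
  then obtain r b where r: "strict_mono r" and lim: "\<And>x. (\<lambda>N. cesaro_mean ?f (r N) x) \<longlonglongrightarrow> real_poly n D b x"
    using bounded_polys_subsequence[of "cesaro_mean ?f"] by metis
  obtain K where K: "\<And>y. y \<in> unit_sphere n \<Longrightarrow> \<bar>?f y\<bar> \<le> K" using real_poly_bounded_on_sphere by blast
  show ?thesis
  proof (rule that[of b])
    fix x assume x: "x \<in> unit_sphere n"
    have "(\<lambda>N. mean_op (cesaro_mean ?f (r N)) x - cesaro_mean ?f (r N) x) \<longlonglongrightarrow> mean_op (real_poly n D b) x - real_poly n D b x"
      unfolding mean_op_def using letters_exist by (intro tendsto_intros lim) auto
    moreover have "(\<lambda>N. mean_op (cesaro_mean ?f (r N)) x - cesaro_mean ?f (r N) x) \<longlonglongrightarrow> 0"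
      using LIMSEQ_subseq_LIMSEQ[OF cesaro_mean_almost_fixed[OF K x] r] by (simp add: o_def)
    ultimately have "mean_op (real_poly n D b) x - real_poly n D b x = 0" by (rule LIMSEQ_unique)
    then show "mean_op (real_poly n D b) x = real_poly n D b x" by simp
  next
    fix x lo hi assume "\<And>v. v \<in> words \<Longrightarrow> lo \<le> ?f (word_map v x) \<and> ?f (word_map v x) \<le> hi"
    from cesaro_mean_between[of lo ?f x hi, OF this]
    show "lo \<le> real_poly n D b x \<and> real_poly n D b x \<le> hi"
      using LIMSEQ_le_const[OF lim, of lo] LIMSEQ_le_const2[OF lim, of _ hi] by blast
  qed
qed

text \<open>The maximum principle on the minimal set \<open>orbit_closure\<close>.\<close>

lemma fixed_by_mean_op_imp_const_on_orbit:
  assumes fixed: "\<And>x. x \<in> unit_sphere n \<Longrightarrow> mean_op (real_poly n D a) x = real_poly n D a x"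
    and u: "u \<in> words"
  shows "real_poly n D a (word_map u s0) = real_poly n D a s0"
proof -
  let ?f = "real_poly n D a"
  obtain z where z: "z \<in> orbit_closure" and max: "\<And>y. y \<in> orbit_closure \<Longrightarrow> ?f y \<le> ?f z"
    using continuous_attains_sup[OF compact_orbit_closure _ continuous_on_real_poly[of orbit_closure n D a]]
      s0_in_orbit_closure by blast
  have letter: "?f (letter_map \<sigma> y) = ?f z" if y: "y \<in> orbit_closure" "?f y = ?f z" and \<sigma>: "\<sigma> < k" for y \<sigma>
  proof (rule ccontr)
    assume "?f (letter_map \<sigma> y) \<noteq> ?f z"
    moreover have le: "?f (letter_map \<tau> y) \<le> ?f z" if "\<tau> < k" for \<tau>
      using max letter_map_orbit_closure[OF that y(1)] by blast
    ultimately have "?f (letter_map \<sigma> y) < ?f z" using \<sigma> by force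
    then have "(\<Sum>\<tau><k. ?f (letter_map \<tau> y)) < (\<Sum>\<tau><k. ?f z)" using le \<sigma> by (intro sum_strict_mono_ex1) auto
    moreover have "(\<Sum>\<tau><k. ?f (letter_map \<tau> y)) = real k * ?f y"
      using fixed[of y] y(1) letters_exist by (auto simp: orbit_closure_def mean_op_def field_simps)
    ultimately show False using y(2) by simp
  qed
  have word: "?f (word_map v y) = ?f z" if "y \<in> orbit_closure" "?f y = ?f z" "v \<in> words" for y v
    using that by (induction v arbitrary: y) (auto simp: letter letter_map_orbit_closure)
  have "?f s0 = ?f z"
  proof -
    have "\<exists>v. v \<in> words \<and> vdist n (word_map v z) s0 < inverse (real (Suc N))" for N
      using s0_in_closure_of_orbit[OF z, of "inverse (real (Suc N))"]
      by (metis inverse_positive_iff_positive of_nat_0_less_iff zero_less_Suc)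
    then obtain v where v: "\<And>N. v N \<in> words" "\<And>N. vdist n (word_map (v N) z) s0 < inverse (real (Suc N))" by metis
    have "(\<lambda>N. vdist n (word_map (v N) z) s0) \<longlonglongrightarrow> 0"
      by (rule Lim_null_comparison[OF _ LIMSEQ_inverse_real_of_nat])
         (use v(2) in \<open>auto intro!: always_eventually less_imp_le\<close>)
    then have "(\<lambda>N. ?f (word_map (v N) z)) \<longlonglongrightarrow> ?f s0" by (intro tendsto_real_poly tendsto_coord_if_vdist)
    moreover have "?f (word_map (v N) z) = ?f z" for N using word[OF z refl v(1)] .
    ultimately show ?thesis by (simp add: LIMSEQ_const_iff)
  qed
  then show ?thesis using word[OF s0_in_orbit_closure _ u] by simp
qed

theorem orbit_separation:
  assumes x: "x \<in> unit_sphere n" and out: "x \<notin> orbit_closure"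
  obtains D a where "\<And>u. u \<in> words \<Longrightarrow> real_poly n D a (word_map u s0) = 0" "real_poly n D a x \<noteq> 0"
proof -
  define \<eta> where "\<eta> = orbit_dist x"
  have "\<eta> > 0" using x out orbit_dist_nonneg[of x] by (auto simp: orbit_closure_def \<eta>_def)
  then obtain D a where approx: "\<And>y. y \<in> unit_sphere n \<Longrightarrow> \<bar>orbit_dist y - real_poly n D a y\<bar> < \<eta> / 3"
    using poly_approximation[OF continuous_on_orbit_dist, of "\<eta> / 3" n] by auto
  obtain b where fixed: "\<And>x. x \<in> unit_sphere n \<Longrightarrow> mean_op (real_poly n D b) x = real_poly n D b x"
    and between: "\<And>x lo hi. (\<And>v. v \<in> words \<Longrightarrow> lo \<le> real_poly n D a (word_map v x) \<and> real_poly n D a (word_map v x) \<le> hi)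
      \<Longrightarrow> lo \<le> real_poly n D b x \<and> real_poly n D b x \<le> hi"
    using cesaro_limit by metis
  obtain K where K: "\<And>y. y \<in> unit_sphere n \<Longrightarrow> \<bar>real_poly n D a y\<bar> \<le> K" using real_poly_bounded_on_sphere by blast
  have "- K \<le> real_poly n D a (word_map v s0) \<and> real_poly n D a (word_map v s0) \<le> \<eta> / 3" if "v \<in> words" for v
    using approx[OF word_map_unit_sphere[OF that s0]] K[OF word_map_unit_sphere[OF that s0]]
      word_map_orbit_closure[OF that s0_in_orbit_closure] by (auto simp: orbit_closure_def)
  from between[OF this] have "real_poly n D b s0 \<le> \<eta> / 3" by simp
  moreover have "2 * \<eta> / 3 \<le> real_poly n D a (word_map v x) \<and> real_poly n D a (word_map v x) \<le> K" if v: "v \<in> words" for v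
  proof -
    have "\<eta> \<le> orbit_dist (word_map v x)"
      using orbit_dist_le_word_map[OF v, of x] x by (auto simp: \<eta>_def unit_sphere_def)
    then show ?thesis using approx[OF word_map_unit_sphere[OF v x]] K[OF word_map_unit_sphere[OF v x]] by linarith
  qed
  from between[OF this] have "2 * \<eta> / 3 \<le> real_poly n D b x" by simp
  ultimately have "real_poly n D b x \<noteq> real_poly n D b s0" using \<open>\<eta> > 0\<close> by linarith
  moreover have "real_poly n D b (word_map u s0) = real_poly n D b s0" if "u \<in> words" for u
    using fixed that by (rule fixed_by_mean_op_imp_const_on_orbit)
  ultimately show ?thesis
    using that[of D "b([] := b [] - real_poly n D b s0)"] by (simp add: real_poly_minus_const)
qed

end

section \<open>Hilbert's basis theorem for rings of functions\<close>

locale function_ring =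
  fixes Q :: "('x \<Rightarrow> 'r::comm_ring_1) set"
  assumes const: "(\<lambda>_. c) \<in> Q"
    and add: "f \<in> Q \<Longrightarrow> g \<in> Q \<Longrightarrow> (\<lambda>x. f x + g x) \<in> Q"
    and mult: "f \<in> Q \<Longrightarrow> g \<in> Q \<Longrightarrow> (\<lambda>x. f x * g x) \<in> Q"

definition poly_less :: "('x \<Rightarrow> 'r::comm_ring_1) set \<Rightarrow> ('x \<Rightarrow> 'r) \<Rightarrow> nat \<Rightarrow> ('x \<Rightarrow> 'r) set" where
  "poly_less Q t d = {f. \<exists>a. (\<forall>j. a j \<in> Q) \<and> f = (\<lambda>x. \<Sum>j<d. a j x * t x ^ j)}"

definition adjoin :: "('x \<Rightarrow> 'r::comm_ring_1) set \<Rightarrow> ('x \<Rightarrow> 'r) \<Rightarrow> ('x \<Rightarrow> 'r) set" where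
  "adjoin Q t = (\<Union>d. poly_less Q t d)"

inductive_set generated_ideal :: "('x \<Rightarrow> 'r::comm_ring_1) set \<Rightarrow> ('x \<Rightarrow> 'r) set \<Rightarrow> ('x \<Rightarrow> 'r) set"
  for Q J where
  zero: "(\<lambda>_. 0) \<in> generated_ideal Q J"
| step: "a \<in> Q \<Longrightarrow> f \<in> J \<Longrightarrow> g \<in> generated_ideal Q J \<Longrightarrow> (\<lambda>x. a x * f x + g x) \<in> generated_ideal Q J"

definition noetherian :: "('x \<Rightarrow> 'r::comm_ring_1) set \<Rightarrow> bool" where
  "noetherian Q \<longleftrightarrow> (\<forall>I\<subseteq>Q. \<exists>J. finite J \<and> J \<subseteq> I \<and> I \<subseteq> generated_ideal Q J)"

lemma generated_ideal_mono: "f \<in> generated_ideal Q J \<Longrightarrow> J \<subseteq> J' \<Longrightarrow> f \<in> generated_ideal Q J'"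
  by (induction rule: generated_ideal.induct) (auto intro: generated_ideal.intros)

lemma generated_ideal_add:
  "f \<in> generated_ideal Q J \<Longrightarrow> g \<in> generated_ideal Q J \<Longrightarrow> (\<lambda>x. f x + g x) \<in> generated_ideal Q J"
proof (induction rule: generated_ideal.induct)
  case (step a f h)
  then have "(\<lambda>x. a x * f x + (h x + g x)) \<in> generated_ideal Q J" by (intro generated_ideal.step) auto
  then show ?case by (simp add: add.assoc)
qed simp

lemma generated_ideal_zeros: "f \<in> generated_ideal Q J \<Longrightarrow> (\<And>g. g \<in> J \<Longrightarrow> g x = 0) \<Longrightarrow> f x = 0"
proof (induction rule: generated_ideal.induct)
  case (step a f g)
  then have "f x = 0" "g x = 0" by blast+
  then show ?case by simp
qed simp

lemma generated_ideal_finite_support: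
  "f \<in> generated_ideal Q I \<Longrightarrow> \<exists>J. finite J \<and> J \<subseteq> I \<and> f \<in> generated_ideal Q J"
proof (induction rule: generated_ideal.induct)
  case zero
  show ?case by (intro exI[of _ "{}"]) (auto intro: generated_ideal.zero)
next
  case (step a f g)
  then obtain J where J: "finite J" "J \<subseteq> I" "g \<in> generated_ideal Q J" by blast
  then have "g \<in> generated_ideal Q (insert f J)" by (auto intro: generated_ideal_mono)
  with step J show ?case by (intro exI[of _ "insert f J"]) (auto intro: generated_ideal.step)
qed

lemma generated_ideal_finite_support_set:
  assumes "finite G" "G \<subseteq> generated_ideal Q I"
  shows "\<exists>J. finite J \<and> J \<subseteq> I \<and> G \<subseteq> generated_ideal Q J"
proof -
  have "\<forall>g\<in>G. \<exists>J. finite J \<and> J \<subseteq> I \<and> g \<in> generated_ideal Q J"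
    using assms(2) generated_ideal_finite_support by blast
  then obtain J where J: "\<And>g. g \<in> G \<Longrightarrow> finite (J g) \<and> J g \<subseteq> I \<and> g \<in> generated_ideal Q (J g)" by metis
  then have "g \<in> generated_ideal Q (\<Union>g\<in>G. J g)" if "g \<in> G" for g
    using that by (auto intro: generated_ideal_mono)
  then show ?thesis using assms(1) J by (intro exI[of _ "\<Union>g\<in>G. J g"]) auto
qed

context function_ring
begin

lemma generated_ideal_mult:
  assumes "b \<in> Q" "f \<in> generated_ideal Q J"
  shows "(\<lambda>x. b x * f x) \<in> generated_ideal Q J"
  using assms(2)
proof (induction rule: generated_ideal.induct)
  case (step a f h)
  then have "(\<lambda>x. (b x * a x) * f x + b x * h x) \<in> generated_ideal Q J"
    using assms by (intro generated_ideal.step mult) auto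
  then show ?case by (simp add: algebra_simps)
qed (simp add: generated_ideal.zero)

lemma generated_ideal_diff:
  assumes "f \<in> generated_ideal Q J" "g \<in> generated_ideal Q J"
  shows "(\<lambda>x. f x - g x) \<in> generated_ideal Q J"
  using generated_ideal_add[OF assms(1) generated_ideal_mult[OF const[of "-1"] assms(2)]] by simp

lemma generated_ideal_base: "f \<in> J \<Longrightarrow> f \<in> generated_ideal Q J"
  using generated_ideal.step[of "\<lambda>_. 1" Q f J "\<lambda>_. 0"] const[of 1] generated_ideal.zero by auto

lemma generated_ideal_trans:
  assumes "f \<in> generated_ideal Q J'" "J' \<subseteq> generated_ideal Q J"
  shows "f \<in> generated_ideal Q J"
  using assms(1)
proof (induction rule: generated_ideal.induct)
  case (step a f g)
  then show ?case
    using assms(2) generated_ideal_add[of "\<lambda>x. a x * f x" Q J g] generated_ideal_mult[of a f J] by auto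
qed (rule generated_ideal.zero)

lemma poly_less_mono:
  assumes "f \<in> poly_less Q t d" "d \<le> e"
  shows "f \<in> poly_less Q t e"
proof -
  from assms(1) obtain a where a: "\<forall>j. a j \<in> Q" "f = (\<lambda>x. \<Sum>j<d. a j x * t x ^ j)" by (auto simp: poly_less_def)
  have "f = (\<lambda>x. \<Sum>j<e. (if j < d then a j else (\<lambda>_. 0)) x * t x ^ j)"
    unfolding a(2) using assms(2) by (intro ext sum.mono_neutral_cong_left) auto
  then show ?thesis unfolding poly_less_def
    using a(1) const by (intro CollectI exI[of _ "\<lambda>j. if j < d then a j else (\<lambda>_. 0)"]) auto
qed

lemma poly_less_zero: "(\<lambda>_. 0) \<in> poly_less Q t d"
  unfolding poly_less_def using const[of 0] by (intro CollectI exI[of _ "\<lambda>_ _. 0"]) auto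

lemma poly_less_add:
  assumes "f \<in> poly_less Q t d" "g \<in> poly_less Q t d"
  shows "(\<lambda>x. f x + g x) \<in> poly_less Q t d"
proof -
  from assms obtain a b where "\<forall>j. a j \<in> Q" "f = (\<lambda>x. \<Sum>j<d. a j x * t x ^ j)"
    "\<forall>j. b j \<in> Q" "g = (\<lambda>x. \<Sum>j<d. b j x * t x ^ j)" by (auto simp: poly_less_def)
  then show ?thesis unfolding poly_less_def using add
    by (intro CollectI exI[of _ "\<lambda>j x. a j x + b j x"]) (auto simp: sum.distrib distrib_right)
qed

lemma poly_less_scale:
  assumes "f \<in> poly_less Q t d" "b \<in> Q"
  shows "(\<lambda>x. b x * f x) \<in> poly_less Q t d"
proof -
  from assms obtain a where "\<forall>j. a j \<in> Q" "f = (\<lambda>x. \<Sum>j<d. a j x * t x ^ j)" by (auto simp: poly_less_def)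
  then show ?thesis unfolding poly_less_def using mult[OF assms(2)]
    by (intro CollectI exI[of _ "\<lambda>j x. b x * a j x"]) (auto simp: sum_distrib_left mult.assoc)
qed

lemma poly_less_diff:
  assumes "f \<in> poly_less Q t d" "g \<in> poly_less Q t d"
  shows "(\<lambda>x. f x - g x) \<in> poly_less Q t d"
  using poly_less_add[OF assms(1) poly_less_scale[OF assms(2) const[of "-1"]]] by simp

lemma poly_less_shift:
  assumes "f \<in> poly_less Q t d"
  shows "(\<lambda>x. t x ^ e * f x) \<in> poly_less Q t (d + e)"
proof (induction e)
  case (Suc e)
  then obtain a where a: "\<forall>j. a j \<in> Q" "(\<lambda>x. t x ^ e * f x) = (\<lambda>x. \<Sum>j<d + e. a j x * t x ^ j)"
    by (auto simp: poly_less_def)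
  have "(\<lambda>x. t x ^ Suc e * f x) = (\<lambda>x. t x * (\<Sum>j<d + e. a j x * t x ^ j))"
    using fun_cong[OF a(2)] by (simp add: mult.assoc)
  also have "\<dots> = (\<lambda>x. \<Sum>j<Suc (d + e). (case j of 0 \<Rightarrow> (\<lambda>_. 0) | Suc i \<Rightarrow> a i) x * t x ^ j)"
    unfolding sum.lessThan_Suc_shift by (simp add: sum_distrib_left algebra_simps)
  finally show ?case unfolding poly_less_def using a(1) const[of 0]
    by (intro CollectI exI[of _ "\<lambda>j. case j of 0 \<Rightarrow> (\<lambda>_. 0) | Suc i \<Rightarrow> a i"]) (auto split: nat.splits)
qed (use assms in simp)

lemma subset_adjoin: "Q \<subseteq> adjoin Q t"
proof
  fix f assume "f \<in> Q"
  then have "f \<in> poly_less Q t 1" unfolding poly_less_def by (intro CollectI exI[of _ "\<lambda>_. f"]) auto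
  then show "f \<in> adjoin Q t" by (auto simp: adjoin_def)
qed

lemma power_in_adjoin: "(\<lambda>x. t x ^ e) \<in> adjoin Q t"
proof -
  have "(\<lambda>_. 1) \<in> poly_less Q t 1"
    unfolding poly_less_def using const by (intro CollectI exI[of _ "\<lambda>_ _. 1"]) auto
  from poly_less_shift[OF this, of e] show ?thesis by (auto simp: adjoin_def)
qed

lemma adjoin_add:
  assumes "f \<in> adjoin Q t" "g \<in> adjoin Q t"
  shows "(\<lambda>x. f x + g x) \<in> adjoin Q t"
proof -
  obtain d e where "f \<in> poly_less Q t d" "g \<in> poly_less Q t e" using assms by (auto simp: adjoin_def)
  then have "(\<lambda>x. f x + g x) \<in> poly_less Q t (max d e)" by (intro poly_less_add) (auto intro: poly_less_mono)
  then show ?thesis by (auto simp: adjoin_def)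
qed

lemma function_ring_adjoin: "function_ring (adjoin Q t)"
proof
  show "(\<lambda>_. c) \<in> adjoin Q t" for c using const subset_adjoin by blast
  fix f g assume f: "f \<in> adjoin Q t" and "g \<in> adjoin Q t"
  then show "(\<lambda>x. f x + g x) \<in> adjoin Q t" by (rule adjoin_add)
  obtain d a where a: "\<forall>j. a j \<in> Q" "f = (\<lambda>x. \<Sum>j<d. a j x * t x ^ j)"
    using f by (auto simp: adjoin_def poly_less_def)
  obtain e where e: "g \<in> poly_less Q t e" using \<open>g \<in> adjoin Q t\<close> by (auto simp: adjoin_def)
  have "(\<lambda>x. \<Sum>j<l. a j x * (t x ^ j * g x)) \<in> adjoin Q t" for l
  proof (induction l)
    case 0
    then show ?case using const subset_adjoin by auto
  next
    case (Suc l)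
    have "(\<lambda>x. a l x * (t x ^ l * g x)) \<in> poly_less Q t (e + l)"
      using a(1) by (intro poly_less_scale poly_less_shift e) auto
    then have "(\<lambda>x. a l x * (t x ^ l * g x)) \<in> adjoin Q t" by (auto simp: adjoin_def)
    from adjoin_add[OF Suc this] show ?case by simp
  qed
  from this[of d] show "(\<lambda>x. f x * g x) \<in> adjoin Q t" by (simp add: a(2) sum_distrib_right mult.assoc)
qed

definition leading_coeffs :: "('x \<Rightarrow> 'r) \<Rightarrow> ('x \<Rightarrow> 'r) set \<Rightarrow> nat \<Rightarrow> ('x \<Rightarrow> 'r) set" where
  "leading_coeffs t I d = {b \<in> Q. \<exists>l\<in>poly_less Q t d. (\<lambda>x. b x * t x ^ d + l x) \<in> I}"

definition lifts_leading_coeffs :: "('x \<Rightarrow> 'r) \<Rightarrow> ('x \<Rightarrow> 'r) set \<Rightarrow> ('x \<Rightarrow> 'r) set \<Rightarrow> nat \<Rightarrow> bool" where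
  "lifts_leading_coeffs t I G d \<longleftrightarrow> (\<forall>b\<in>leading_coeffs t I d.
     \<exists>h\<in>generated_ideal (adjoin Q t) G. \<exists>r\<in>poly_less Q t d. h = (\<lambda>x. b x * t x ^ d + r x))"

lemma lifts_leading_coeffs_mono: "lifts_leading_coeffs t I G d \<Longrightarrow> G \<subseteq> H \<Longrightarrow> lifts_leading_coeffs t I H d"
  using generated_ideal_mono unfolding lifts_leading_coeffs_def by blast

lemma lift_leading_combination:
  assumes "\<beta> \<in> generated_ideal Q B"
    and lifts: "\<And>b. b \<in> B \<Longrightarrow> \<exists>g\<in>G. \<exists>e\<le>d. \<exists>l\<in>poly_less Q t e. g = (\<lambda>x. b x * t x ^ e + l x)"
  shows "\<exists>h\<in>generated_ideal (adjoin Q t) G. \<exists>r\<in>poly_less Q t d. h = (\<lambda>x. \<beta> x * t x ^ d + r x)"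
  using assms(1)
proof (induction rule: generated_ideal.induct)
  case zero
  show ?case
    using generated_ideal.zero[of "adjoin Q t" G] poly_less_zero[of t d] by (intro bexI[of _ "\<lambda>_. 0"]) auto
next
  case (step a b \<beta>)
  obtain h r where h: "h \<in> generated_ideal (adjoin Q t) G" "r \<in> poly_less Q t d" "h = (\<lambda>x. \<beta> x * t x ^ d + r x)"
    using step.IH by blast
  obtain g e l where g: "g \<in> G" "e \<le> d" "l \<in> poly_less Q t e" "g = (\<lambda>x. b x * t x ^ e + l x)"
    using lifts[OF step.hyps(2)] by blast
  obtain q where q: "d = e + q" using \<open>e \<le> d\<close> le_Suc_ex by blast
  interpret adjoined: function_ring "adjoin Q t" by (rule function_ring_adjoin)
  let ?h = "\<lambda>x. (a x * t x ^ q) * g x + h x" and ?r = "\<lambda>x. a x * (t x ^ q * l x) + r x"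
  have "?h \<in> generated_ideal (adjoin Q t) G"
    using step.hyps(1) subset_adjoin g(1) h(1)
    by (intro generated_ideal.step adjoined.mult power_in_adjoin) auto
  moreover have "?r \<in> poly_less Q t d"
    using step.hyps(1) h(2) g(3) unfolding q by (intro poly_less_add poly_less_scale poly_less_shift) auto
  moreover have "?h = (\<lambda>x. (a x * b x + \<beta> x) * t x ^ d + ?r x)"
    unfolding g(4) h(3) by (rule ext) (simp add: q power_add algebra_simps)
  ultimately show ?case by (intro bexI[of _ ?h] bexI[of _ ?r])
qed

lemma noetherian_lift_leading_coeffs:
  assumes "noetherian Q"
  shows "\<exists>G E. finite G \<and> G \<subseteq> I \<and> finite E \<and> E \<subseteq> S \<and>
    (\<forall>d\<in>S. (\<forall>e\<in>E. e \<le> d) \<longrightarrow> lifts_leading_coeffs t I G d)"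
proof -
  let ?L = "\<Union>e\<in>S. leading_coeffs t I e"
  have "?L \<subseteq> Q" by (auto simp: leading_coeffs_def)
  then obtain B where B: "finite B" "B \<subseteq> ?L" "?L \<subseteq> generated_ideal Q B"
    using assms unfolding noetherian_def by metis
  have "\<forall>b\<in>B. \<exists>e g. e \<in> S \<and> g \<in> I \<and> (\<exists>l\<in>poly_less Q t e. g = (\<lambda>x. b x * t x ^ e + l x))"
    using B(2) unfolding leading_coeffs_def by fast
  then obtain e g where eg: "\<And>b. b \<in> B \<Longrightarrow> e b \<in> S \<and> g b \<in> I \<and>
      (\<exists>l\<in>poly_less Q t (e b). g b = (\<lambda>x. b x * t x ^ e b + l x))"
    by metis
  have "lifts_leading_coeffs t I (g ` B) d" if d: "d \<in> S" "\<forall>e'\<in>e ` B. e' \<le> d" for d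
    unfolding lifts_leading_coeffs_def
  proof
    fix b assume "b \<in> leading_coeffs t I d"
    then have "b \<in> generated_ideal Q B" using B(3) d(1) by blast
    then show "\<exists>h\<in>generated_ideal (adjoin Q t) (g ` B). \<exists>r\<in>poly_less Q t d. h = (\<lambda>x. b x * t x ^ d + r x)"
      by (rule lift_leading_combination) (use eg d(2) in blast)
  qed
  then show ?thesis using B(1) eg by (intro exI[of _ "g ` B"] exI[of _ "e ` B"]) auto
qed

lemma noetherian_finite_lifting_set:
  assumes noeth: "noetherian Q"
  shows "\<exists>J. finite J \<and> J \<subseteq> I \<and> (\<forall>d. lifts_leading_coeffs t I J d)"
proof -
  obtain G E where G: "finite G" "G \<subseteq> I" "finite E"
    and high: "\<forall>d\<in>UNIV. (\<forall>e\<in>E. e \<le> d) \<longrightarrow> lifts_leading_coeffs t I G d"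
    using noetherian_lift_leading_coeffs[OF noeth, of I UNIV t] by (elim exE conjE)
  obtain D where D: "\<forall>e\<in>E. e < D" using G(3) finite_nat_set_iff_bounded by blast
  have "\<exists>H. finite H \<and> H \<subseteq> I \<and> lifts_leading_coeffs t I H d" for d
  proof -
    obtain H E' where "finite H" "H \<subseteq> I" "E' \<subseteq> {d}"
      and "\<forall>d'\<in>{d}. (\<forall>e\<in>E'. e \<le> d') \<longrightarrow> lifts_leading_coeffs t I H d'"
      using noetherian_lift_leading_coeffs[OF noeth, of I "{d}" t] by (elim exE conjE)
    then show ?thesis by (intro exI[of _ H]) auto
  qed
  then obtain H where H: "\<And>d. finite (H d) \<and> H d \<subseteq> I \<and> lifts_leading_coeffs t I (H d) d" by metis
  let ?J = "G \<union> (\<Union>d<D. H d)"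
  have "lifts_leading_coeffs t I ?J d" for d
  proof (cases "d < D")
    case True
    then have "H d \<subseteq> ?J" by auto
    with H show ?thesis using lifts_leading_coeffs_mono by blast
  next
    case False
    then have "\<forall>e\<in>E. e \<le> d" using D by force
    then have "lifts_leading_coeffs t I G d" using high by blast
    then show ?thesis by (rule lifts_leading_coeffs_mono) simp
  qed
  then show ?thesis using G H by (intro exI[of _ ?J]) auto
qed

lemma generated_by_lifting_set:
  assumes lifts: "\<And>d. lifts_leading_coeffs t I J d"
    and diff: "\<And>f h. f \<in> I \<Longrightarrow> h \<in> generated_ideal (adjoin Q t) J \<Longrightarrow> (\<lambda>x. f x - h x) \<in> I"
    and "f \<in> I" "f \<in> poly_less Q t d"
  shows "f \<in> generated_ideal (adjoin Q t) J"
  using assms(3,4)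
proof (induction d arbitrary: f)
  case 0
  then show ?case using generated_ideal.zero by (simp add: poly_less_def)
next
  case (Suc d)
  from Suc.prems(2) obtain a where a: "\<forall>j. a j \<in> Q" "f = (\<lambda>x. \<Sum>j<Suc d. a j x * t x ^ j)"
    by (auto simp: poly_less_def)
  define l where "l = (\<lambda>x. \<Sum>j<d. a j x * t x ^ j)"
  have l: "l \<in> poly_less Q t d" "f = (\<lambda>x. a d x * t x ^ d + l x)"
    using a by (auto simp: l_def poly_less_def)
  then have "a d \<in> leading_coeffs t I d" using a(1) Suc.prems(1) by (auto simp: leading_coeffs_def)
  then obtain h r where h: "h \<in> generated_ideal (adjoin Q t) J" "r \<in> poly_less Q t d" "h = (\<lambda>x. a d x * t x ^ d + r x)"
    using lifts[of d] unfolding lifts_leading_coeffs_def by blast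
  have "(\<lambda>x. f x - h x) \<in> poly_less Q t d" using poly_less_diff[OF l(1) h(2)] by (simp add: l(2) h(3))
  with diff[OF Suc.prems(1) h(1)] have "(\<lambda>x. f x - h x) \<in> generated_ideal (adjoin Q t) J" by (rule Suc.IH)
  from generated_ideal_add[OF this h(1)] show ?case by simp
qed

theorem noetherian_adjoin:
  assumes "noetherian Q"
  shows "noetherian (adjoin Q t)"
  unfolding noetherian_def
proof (intro allI impI)
  fix I assume I: "I \<subseteq> adjoin Q t"
  interpret adjoined: function_ring "adjoin Q t" by (rule function_ring_adjoin)
  let ?ideal = "generated_ideal (adjoin Q t)"
  obtain J where J: "finite J" "J \<subseteq> ?ideal I" and lifts: "\<And>d. lifts_leading_coeffs t (?ideal I) J d"
    using noetherian_finite_lifting_set[OF assms] by metis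
  have "(\<lambda>x. f x - h x) \<in> ?ideal I" if "f \<in> ?ideal I" "h \<in> ?ideal J" for f h
    using that(1) adjoined.generated_ideal_trans[OF that(2) J(2)] by (rule adjoined.generated_ideal_diff)
  then have "f \<in> ?ideal J" if "f \<in> I" for f
    using that I adjoined.generated_ideal_base generated_by_lifting_set[OF lifts] unfolding adjoin_def by blast
  moreover obtain J' where J': "finite J'" "J' \<subseteq> I" "J \<subseteq> ?ideal J'"
    using generated_ideal_finite_support_set[OF J] by metis
  ultimately have "I \<subseteq> ?ideal J'" using adjoined.generated_ideal_trans by blast
  with J' show "\<exists>J. finite J \<and> J \<subseteq> I \<and> I \<subseteq> ?ideal J" by blast
qed

end

lemma noetherian_constants: "noetherian (range (\<lambda>(c::'r::field) (_::'x). c))"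
  unfolding noetherian_def
proof (intro allI impI)
  fix I :: "('x \<Rightarrow> 'r) set" assume I: "I \<subseteq> range (\<lambda>c _. c)"
  show "\<exists>J. finite J \<and> J \<subseteq> I \<and> I \<subseteq> generated_ideal (range (\<lambda>c _. c)) J"
  proof (cases "I \<subseteq> {\<lambda>_. 0}")
    case True
    then show ?thesis using generated_ideal.zero by (intro exI[of _ "{}"]) auto
  next
    case False
    then obtain b where b: "(\<lambda>_. b) \<in> I" "b \<noteq> 0" using I by fastforce
    have "(\<lambda>_. c) \<in> generated_ideal (range (\<lambda>c _. c)) {\<lambda>_. b}" for c :: 'r
      using generated_ideal.step[of "\<lambda>_. c / b" "range (\<lambda>c _. c)" "\<lambda>_. b" "{\<lambda>_. b}" "\<lambda>_. 0"] b(2) generated_ideal.zero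
      by auto
    then show ?thesis using b(1) I by (intro exI[of _ "{\<lambda>_. b}"]) auto
  qed
qed

primrec poly_ring :: "nat \<Rightarrow> ((nat \<Rightarrow> real) \<Rightarrow> real) set" where
  "poly_ring 0 = range (\<lambda>c _. c)"
| "poly_ring (Suc n) = adjoin (poly_ring n) (\<lambda>x. x n)"

lemma function_ring_poly_ring: "function_ring (poly_ring n)"
proof (induction n)
  case 0
  show ?case by unfold_locales auto
next
  case (Suc n)
  then show ?case by (simp add: function_ring.function_ring_adjoin)
qed

lemma noetherian_poly_ring: "noetherian (poly_ring n)"
  by (induction n) (simp_all add: noetherian_constants function_ring.noetherian_adjoin function_ring_poly_ring)

lemma coord_in_poly_ring: "i < n \<Longrightarrow> (\<lambda>x. x i) \<in> poly_ring n"
proof (induction n)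
  case (Suc n)
  interpret function_ring "poly_ring n" by (rule function_ring_poly_ring)
  show ?case
  proof (cases "i = n")
    case True
    then show ?thesis using power_in_adjoin[of "\<lambda>x. x n" 1] by simp
  next
    case False
    then show ?thesis using Suc subset_adjoin[of "\<lambda>x. x n"] by auto
  qed
qed simp

lemma poly_functions_subset_poly_ring: "poly_functions n \<subseteq> poly_ring n"
proof
  interpret function_ring "poly_ring n" by (rule function_ring_poly_ring)
  have "meval [] = (\<lambda>_. 1)" "meval (i # m) = (\<lambda>x. x i * meval m x)" for i m
    by (simp_all add: fun_eq_iff)
  then have meval: "meval m \<in> poly_ring n" if "set m \<subseteq> {..<n}" for m
    using that by (induction m) (auto intro: const mult coord_in_poly_ring)
  have sum: "(\<lambda>x. \<Sum>i\<in>I. f i x) \<in> poly_ring n" if "finite I" "\<And>i. i \<in> I \<Longrightarrow> f i \<in> poly_ring n"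
    for I :: "nat list set" and f
    using that by (induction I rule: finite_induct) (auto intro: const add)
  fix f assume "f \<in> poly_functions n"
  then obtain D a where f: "f = real_poly n D a" by (auto simp: poly_functions_def)
  have "(\<lambda>x. \<Sum>m\<in>monomials n D. a m * meval m x) \<in> poly_ring n"
    by (intro sum finite_monomials mult const meval) (auto simp: monomials_def)
  then show "f \<in> poly_ring n" by (simp add: f real_poly_def[abs_def])
qed

theorem finitely_many_equations:
  assumes "I \<subseteq> poly_functions n"
  obtains J where "finite J" "J \<subseteq> I" "\<And>x f. (\<forall>g\<in>J. g x = 0) \<Longrightarrow> f \<in> I \<Longrightarrow> f x = 0"
proof -
  have "I \<subseteq> poly_ring n" using assms poly_functions_subset_poly_ring by blast
  then obtain J where "finite J" "J \<subseteq> I" "I \<subseteq> generated_ideal (poly_ring n) J"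
    using noetherian_poly_ring unfolding noetherian_def by metis
  show ?thesis
  proof (rule that[OF \<open>finite J\<close> \<open>J \<subseteq> I\<close>])
    fix x f assume "\<forall>g\<in>J. g x = 0" "f \<in> I"
    then show "f x = 0" using \<open>I \<subseteq> generated_ideal (poly_ring n) J\<close>
      by (intro generated_ideal_zeros[of f "poly_ring n" J x]) auto
  qed
qed

section \<open>Descent to a subring of the reals\<close>

locale real_subring =
  fixes K :: "real set"
  assumes one: "1 \<in> K" and add: "a \<in> K \<Longrightarrow> b \<in> K \<Longrightarrow> a + b \<in> K"
    and mult: "a \<in> K \<Longrightarrow> b \<in> K \<Longrightarrow> a * b \<in> K" and uminus: "a \<in> K \<Longrightarrow> - a \<in> K"
begin

lemma zero: "0 \<in> K"
  using add[OF one uminus[OF one]] by simp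

lemma sum: "(\<And>i. i \<in> I \<Longrightarrow> f i \<in> K) \<Longrightarrow> (\<Sum>i\<in>I. f i) \<in> K"
  by (induction I rule: infinite_finite_induct) (auto intro: zero add)

lemma meval: "(\<And>i. i \<in> set m \<Longrightarrow> x i \<in> K) \<Longrightarrow> meval m x \<in> K"
  by (induction m) (auto intro: one mult)

definition combinations :: "real set \<Rightarrow> real set" where
  "combinations J = {y. \<exists>q. (\<forall>e\<in>J. q e \<in> K) \<and> y = (\<Sum>e\<in>J. q e * e)}"

definition independent :: "real set \<Rightarrow> bool" where
  "independent J \<longleftrightarrow> (\<forall>q. (\<forall>e\<in>J. q e \<in> K) \<longrightarrow> (\<Sum>e\<in>J. q e * e) = 0 \<longrightarrow> (\<forall>e\<in>J. q e = 0))"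

lemma scale_combinations:
  assumes "y \<in> combinations J" "b \<in> K"
  shows "b * y \<in> combinations J"
proof -
  obtain q where "\<forall>e\<in>J. q e \<in> K" "y = (\<Sum>e\<in>J. q e * e)" using assms(1) unfolding combinations_def by blast
  then show ?thesis unfolding combinations_def using assms(2)
    by (intro CollectI exI[of _ "\<lambda>e. b * q e"]) (simp add: sum_distrib_left mult.assoc mult)
qed

lemma zero_in_combinations: "0 \<in> combinations J"
  unfolding combinations_def by (intro CollectI exI[of _ "\<lambda>_. 0"]) (simp add: zero)

lemma element_in_combinations:
  assumes "finite J" "x \<in> J"
  shows "x \<in> combinations J"
  unfolding combinations_def using assms
  by (intro CollectI exI[of _ "\<lambda>e. if e = x then 1 else 0"])
    (simp add: zero one if_distrib[of "\<lambda>t. t * _"] cong: if_cong)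

lemma combinations_insert:
  assumes "finite J" "e0 \<notin> J"
  shows "combinations (insert e0 J) = {b * e0 + y | b y. b \<in> K \<and> y \<in> combinations J}"
proof (intro equalityI subsetI)
  fix z assume "z \<in> combinations (insert e0 J)"
  then obtain q where "\<forall>e\<in>insert e0 J. q e \<in> K" "z = (\<Sum>e\<in>insert e0 J. q e * e)" unfolding combinations_def by blast
  then show "z \<in> {b * e0 + y | b y. b \<in> K \<and> y \<in> combinations J}" using assms
    unfolding combinations_def by auto
next
  fix z assume "z \<in> {b * e0 + y | b y. b \<in> K \<and> y \<in> combinations J}"
  then obtain b q where bq: "b \<in> K" "\<forall>e\<in>J. q e \<in> K" "z = b * e0 + (\<Sum>e\<in>J. q e * e)"
    unfolding combinations_def by blast
  have "(\<Sum>e\<in>J. (q(e0 := b)) e * e) = (\<Sum>e\<in>J. q e * e)" using assms by (intro sum.cong) auto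
  then show "z \<in> combinations (insert e0 J)" unfolding combinations_def
    using assms bq by (intro CollectI exI[of _ "q(e0 := b)"]) simp
qed

lemma independent_insert:
  assumes "finite J" "e0 \<notin> J" "independent J" and avoid: "\<And>b. b \<in> K \<Longrightarrow> b \<noteq> 0 \<Longrightarrow> b * e0 \<notin> combinations J"
  shows "independent (insert e0 J)"
  unfolding independent_def
proof (intro allI impI)
  fix q assume q: "\<forall>e\<in>insert e0 J. q e \<in> K" "(\<Sum>e\<in>insert e0 J. q e * e) = 0"
  then have "q e0 * e0 = (\<Sum>e\<in>J. (- q e) * e)" using assms(1,2) by (simp add: sum_negf)
  then have "q e0 * e0 \<in> combinations J" unfolding combinations_def using q(1)
    by (intro CollectI exI[of _ "\<lambda>e. - q e"]) (auto intro: uminus)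
  then have "q e0 = 0" using avoid q(1) by blast
  then show "\<forall>e\<in>insert e0 J. q e = 0"
    using q assms(1-3) unfolding independent_def by simp
qed

lemma basis_up_to_denominator:
  assumes "finite X"
  shows "\<exists>J b. finite J \<and> independent J \<and> b \<in> K \<and> b \<noteq> 0 \<and> (\<forall>x\<in>X. b * x \<in> combinations J)"
  using assms
proof (induction X rule: finite_induct)
  case empty
  show ?case by (intro exI[of _ "{}"] exI[of _ 1]) (auto simp: independent_def one)
next
  case (insert x X)
  then obtain J b where J: "finite J" "independent J" and b: "b \<in> K" "b \<noteq> 0"
    and X: "\<forall>x\<in>X. b * x \<in> combinations J" by (elim exE conjE)
  show ?case
  proof (cases "\<exists>a\<in>K. a \<noteq> 0 \<and> a * x \<in> combinations J")
    case True
    then obtain a where a: "a \<in> K" "a \<noteq> 0" "a * x \<in> combinations J" by (elim bexE conjE)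
    have "a * b * y \<in> combinations J" if "y \<in> insert x X" for y
      using that scale_combinations[OF a(3) b(1)] scale_combinations[OF _ a(1), of "b * y"] X
      by (auto simp: ac_simps)
    then show ?thesis using J a b by (intro exI[of _ J] exI[of _ "a * b"]) (simp add: mult)
  next
    case False
    have "x \<notin> J" using False one element_in_combinations[OF J(1), of x] by force
    have "b * y \<in> combinations (insert x J)" if "y \<in> insert x X" for y
    proof (cases "y = x")
      case True
      then show ?thesis unfolding combinations_insert[OF J(1) \<open>x \<notin> J\<close>] using b(1) zero_in_combinations by force
    next
      case neq: False
      then have "b * y = 0 * x + b * y \<and> 0 \<in> K \<and> b * y \<in> combinations J" using that X zero by simp
      then show ?thesis unfolding combinations_insert[OF J(1) \<open>x \<notin> J\<close>] by blast
    qed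
    moreover have "independent (insert x J)" using False by (intro independent_insert[OF J(1) \<open>x \<notin> J\<close> J(2)]) blast
    ultimately show ?thesis using J(1) b by (intro exI[of _ "insert x J"] exI[of _ b]) simp
  qed
qed

text \<open>The form is expanded in a basis of the span of its coefficients; one of the coordinates works.\<close>

lemma linear_form_descent:
  fixes w x :: "'i \<Rightarrow> real"
  assumes "finite I" and S: "\<And>s i. s \<in> S \<Longrightarrow> i \<in> I \<Longrightarrow> s i \<in> K"
    and w: "\<And>s. s \<in> S \<Longrightarrow> (\<Sum>i\<in>I. w i * s i) = 0" "(\<Sum>i\<in>I. w i * x i) \<noteq> 0"
  obtains q where "\<And>i. i \<in> I \<Longrightarrow> q i \<in> K" "\<And>s. s \<in> S \<Longrightarrow> (\<Sum>i\<in>I. q i * s i) = 0" "(\<Sum>i\<in>I. q i * x i) \<noteq> 0"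
proof -
  obtain J b where J: "independent J" and "b \<noteq> 0" and "\<forall>y\<in>w ` I. b * y \<in> combinations J"
    using basis_up_to_denominator[of "w ` I"] \<open>finite I\<close> by blast
  then have "\<forall>i\<in>I. \<exists>q. (\<forall>e\<in>J. q e \<in> K) \<and> b * w i = (\<Sum>e\<in>J. q e * e)" unfolding combinations_def by blast
  then obtain q where q: "\<And>i e. i \<in> I \<Longrightarrow> e \<in> J \<Longrightarrow> q i e \<in> K" "\<And>i. i \<in> I \<Longrightarrow> b * w i = (\<Sum>e\<in>J. q i e * e)"
    unfolding bchoice_iff by (elim exE) blast
  have expand: "b * (\<Sum>i\<in>I. w i * y i) = (\<Sum>e\<in>J. (\<Sum>i\<in>I. q i e * y i) * e)" for y
  proof -
    have "b * (\<Sum>i\<in>I. w i * y i) = (\<Sum>i\<in>I. (\<Sum>e\<in>J. q i e * e) * y i)"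
      unfolding sum_distrib_left by (intro sum.cong refl) (simp add: q(2)[symmetric])
    also have "\<dots> = (\<Sum>i\<in>I. \<Sum>e\<in>J. q i e * y i * e)"
      unfolding sum_distrib_right by (intro sum.cong refl) (simp add: ac_simps)
    also have "\<dots> = (\<Sum>e\<in>J. (\<Sum>i\<in>I. q i e * y i) * e)" unfolding sum_distrib_right by (rule sum.swap)
    finally show ?thesis .
  qed
  have "(\<Sum>e\<in>J. (\<Sum>i\<in>I. q i e * x i) * e) \<noteq> 0" using w(2) \<open>b \<noteq> 0\<close> by (simp add: expand[symmetric])
  then obtain e where e: "e \<in> J" "(\<Sum>i\<in>I. q i e * x i) \<noteq> 0"
    using sum.not_neutral_contains_not_neutral by force
  show ?thesis
  proof (rule that[of "\<lambda>i. q i e"])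
    fix s assume s: "s \<in> S"
    have "\<forall>e\<in>J. (\<Sum>i\<in>I. q i e * s i) \<in> K" using s by (auto intro: sum mult q(1) S)
    moreover have "(\<Sum>e\<in>J. (\<Sum>i\<in>I. q i e * s i) * e) = 0" unfolding expand[symmetric] w(1)[OF s] by (rule mult_zero_right)
    ultimately have "\<forall>e\<in>J. (\<Sum>i\<in>I. q i e * s i) = 0" using J[unfolded independent_def] by (elim allE impE)
    then show "(\<Sum>i\<in>I. q i e * s i) = 0" using e(1) by (rule bspec)
  qed (use q(1) e in auto)
qed

end

context isometries
begin

lemma orbit_separation_over_subring:
  assumes "real_subring K" and orbit: "\<forall>u\<in>words. \<forall>i<n. word_map u s0 i \<in> K"
    and x: "x \<in> unit_sphere n" "x \<notin> orbit_closure"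
  shows "\<exists>D a. (\<forall>m. a m \<in> K) \<and> (\<forall>u\<in>words. real_poly n D a (word_map u s0) = 0) \<and> real_poly n D a x \<noteq> 0"
proof -
  interpret real_subring K by fact
  obtain D w where w: "\<And>u. u \<in> words \<Longrightarrow> real_poly n D w (word_map u s0) = 0" "real_poly n D w x \<noteq> 0"
    using orbit_separation[OF x] by blast
  have coords: "s m \<in> K" if "s \<in> (\<lambda>u m. meval m (word_map u s0)) ` words" "m \<in> monomials n D" for s m
    using that orbit by (force simp: monomials_def intro!: meval)
  obtain q where q: "\<And>m. m \<in> monomials n D \<Longrightarrow> q m \<in> K"
    "\<And>s. s \<in> (\<lambda>u m. meval m (word_map u s0)) ` words \<Longrightarrow> (\<Sum>m\<in>monomials n D. q m * s m) = 0"
    "(\<Sum>m\<in>monomials n D. q m * meval m x) \<noteq> 0"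
    by (rule linear_form_descent[of "monomials n D" "(\<lambda>u m. meval m (word_map u s0)) ` words" w "\<lambda>m. meval m x"])
      (use coords w in \<open>auto simp: real_poly_def\<close>)
  define a where "a m = (if m \<in> monomials n D then q m else 0)" for m
  have "real_poly n D a y = (\<Sum>m\<in>monomials n D. q m * meval m y)" for y
    unfolding real_poly_def by (intro sum.cong) (auto simp: a_def)
  then show ?thesis using q zero by (intro exI[of _ D] exI[of _ a]) (auto simp: a_def)
qed

theorem orbit_equations:
  assumes K: "real_subring K" and orbit: "\<forall>u\<in>words. \<forall>i<n. word_map u s0 i \<in> K"
  shows "\<exists>E. finite E \<and> (\<forall>(D, a)\<in>E. \<forall>m. a m \<in> K) \<and>
    (\<forall>(D, a)\<in>E. \<forall>u\<in>words. real_poly n D a (word_map u s0) = 0) \<and>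
    (\<forall>x\<in>unit_sphere n. (\<forall>(D, a)\<in>E. real_poly n D a x = 0) \<longrightarrow> x \<in> orbit_closure)"
proof -
  define G where "G = {(D, a). (\<forall>m. a m \<in> K) \<and> (\<forall>u\<in>words. real_poly n D a (word_map u s0) = 0)}"
  define I where "I = (\<lambda>(D, a). real_poly n D a) ` G"
  have "I \<subseteq> poly_functions n" by (auto simp: I_def poly_functions_def)
  then obtain J where J: "finite J" "J \<subseteq> I" "\<And>x f. (\<forall>g\<in>J. g x = 0) \<Longrightarrow> f \<in> I \<Longrightarrow> f x = 0"
    by (rule finitely_many_equations) blast
  obtain E where E: "finite E" "E \<subseteq> G" "J = (\<lambda>(D, a). real_poly n D a) ` E"
    using finite_subset_image[OF J(1) J(2)[unfolded I_def]] by blast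
  show ?thesis
  proof (intro exI[of _ E] conjI E(1) ballI impI)
    show "case e of (D, a) \<Rightarrow> \<forall>m. a m \<in> K"
      "case e of (D, a) \<Rightarrow> \<forall>u\<in>words. real_poly n D a (word_map u s0) = 0" if "e \<in> E" for e
      using that E(2) by (auto simp: G_def)
    fix x assume x: "x \<in> unit_sphere n" and zero: "\<forall>(D, a)\<in>E. real_poly n D a x = 0"
    show "x \<in> orbit_closure"
    proof (rule ccontr)
      assume "x \<notin> orbit_closure"
      from orbit_separation_over_subring[OF K orbit x this]
      obtain D a where a: "\<forall>m. a m \<in> K" "\<forall>u\<in>words. real_poly n D a (word_map u s0) = 0" "real_poly n D a x \<noteq> 0"
        by (elim exE conjE)
      then have "(D, a) \<in> G" by (simp add: G_def)
      then have "real_poly n D a \<in> I" by (force simp: I_def)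
      moreover have "\<forall>g\<in>J. g x = 0" using zero unfolding E(3) by auto
      ultimately show False using J(3) a(3) by blast
    qed
  qed
qed

end

section \<open>Quantum automata as real isometries\<close>

definition realify :: "nat \<Rightarrow> (nat \<Rightarrow> complex) \<Rightarrow> nat \<Rightarrow> real" where
  "realify d v i = (if i < 2 * d then (if even i then Re (v (i div 2)) else Im (v (i div 2))) else 0)"

definition complexify :: "(nat \<Rightarrow> real) \<Rightarrow> nat \<Rightarrow> complex" where
  "complexify x j = Complex (x (2 * j)) (x (2 * j + 1))"

definition real_matrix :: "(nat \<Rightarrow> nat \<Rightarrow> complex) \<Rightarrow> nat \<Rightarrow> nat \<Rightarrow> real" where
  "real_matrix U i j = (if even i
     then (if even j then Re (U (i div 2) (j div 2)) else - Im (U (i div 2) (j div 2)))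
     else (if even j then Im (U (i div 2) (j div 2)) else Re (U (i div 2) (j div 2))))"

lemma sum_lessThan_double: "(\<Sum>j<2 * d. f j) = (\<Sum>q<d. f (2 * q) + f (2 * q + 1 :: nat) :: 'a::comm_monoid_add)"
  by (induction d) (auto simp: add.assoc)

lemma realify_simps [simp]:
  "q < d \<Longrightarrow> realify d v (2 * q) = Re (v q)" "q < d \<Longrightarrow> realify d v (Suc (2 * q)) = Im (v q)"
  "i \<ge> 2 * d \<Longrightarrow> realify d v i = 0"
  by (auto simp: realify_def)

lemma realify_complexify: "i < 2 * d \<Longrightarrow> realify d (complexify x) i = x i"
  by (auto simp: realify_def complexify_def elim!: evenE oddE)

lemma realify_mat_vec:
  assumes "i < 2 * d"
  shows "(\<Sum>j<2 * d. real_matrix U i j * realify d v j) = realify d (mat_vec d U v) i"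
proof -
  have "(\<Sum>j<2 * d. real_matrix U i j * realify d v j)
      = (\<Sum>q<d. real_matrix U i (2 * q) * Re (v q) + real_matrix U i (2 * q + 1) * Im (v q))"
    unfolding sum_lessThan_double by (intro sum.cong) auto
  also have "\<dots> = realify d (mat_vec d U v) i"
    using assms by (auto simp: real_matrix_def realify_def mat_vec_def Re_sum Im_sum intro!: sum.cong)
  finally show ?thesis .
qed

lemma vnorm_realify: "vnorm (2 * d) (realify d v) = sqrt (\<Sum>q<d. (cmod (v q))\<^sup>2)"
  unfolding vnorm_def L2_set_def sum_lessThan_double
  by (auto simp: cmod_power2 intro!: arg_cong[where f = sqrt] sum.cong)

lemma vdist_realify: "vdist (2 * d) (realify d x) (realify d y) = sqrt (\<Sum>q<d. (cmod (x q - y q))\<^sup>2)"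
proof -
  have "(\<lambda>i. realify d x i - realify d y i) = realify d (\<lambda>q. x q - y q)" by (auto simp: realify_def)
  then show ?thesis by (simp add: vdist_def vnorm_realify)
qed

lemma realify_in_unit_sphere_iff: "realify d v \<in> unit_sphere (2 * d) \<longleftrightarrow> unit_vec d v"
  by (auto simp: unit_sphere_def vnorm_realify Defs.unit_vec_def)

lemma unitary_mat_norm:
  assumes "unitary_mat d U"
  shows "(\<Sum>i<d. (cmod (mat_vec d U v i))\<^sup>2) = (\<Sum>i<d. (cmod (v i))\<^sup>2)"
proof -
  have square: "complex_of_real ((cmod z)\<^sup>2) = cnj z * z" for z
    unfolding complex_norm_square by (rule mult.commute)
  have "complex_of_real (\<Sum>i<d. (cmod (mat_vec d U v i))\<^sup>2)
      = (\<Sum>i<d. \<Sum>j<d. \<Sum>l<d. (cnj (v j) * v l) * (cnj (U i j) * U i l))"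
    unfolding of_real_sum square mat_vec_def cnj_sum sum_product by (intro sum.cong) (auto simp: algebra_simps)
  also have "\<dots> = (\<Sum>j<d. \<Sum>i<d. \<Sum>l<d. (cnj (v j) * v l) * (cnj (U i j) * U i l))" by (rule sum.swap)
  also have "\<dots> = (\<Sum>j<d. \<Sum>l<d. \<Sum>i<d. (cnj (v j) * v l) * (cnj (U i j) * U i l))"
    by (intro sum.cong refl sum.swap)
  also have "\<dots> = (\<Sum>j<d. \<Sum>l<d. (cnj (v j) * v l) * (\<Sum>i<d. cnj (U i j) * U i l))" by (simp add: sum_distrib_left)
  also have "\<dots> = (\<Sum>j<d. \<Sum>l<d. if l = j then cnj (v j) * v l else 0)"
    using assms unfolding unitary_mat_def by (intro sum.cong) auto
  also have "\<dots> = complex_of_real (\<Sum>j<d. (cmod (v j))\<^sup>2)" unfolding of_real_sum square by simp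
  finally show ?thesis by (simp only: of_real_eq_iff)
qed

lemma cmod_cinner_le: "cmod (cinner d \<psi> v) \<le> sqrt (\<Sum>j<d. (cmod (\<psi> j))\<^sup>2) * sqrt (\<Sum>j<d. (cmod (v j))\<^sup>2)"
proof -
  have "cmod (cinner d \<psi> v) \<le> (\<Sum>j<d. \<bar>cmod (\<psi> j)\<bar> * \<bar>cmod (v j)\<bar>)"
    unfolding cinner_def by (rule order_trans[OF norm_sum]) (simp add: norm_mult)
  also have "\<dots> \<le> L2_set (\<lambda>j. cmod (\<psi> j)) {..<d} * L2_set (\<lambda>j. cmod (v j)) {..<d}" by (rule L2_set_mult_ineq)
  finally show ?thesis by (simp add: L2_set_def)
qed

lemma cinner_diff: "cinner d \<psi> (\<lambda>j. x j - y j) = cinner d \<psi> x - cinner d \<psi> y"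
  by (simp add: cinner_def right_diff_distrib sum_subtractf)

lemma cinner_self:
  assumes "unit_vec d \<psi>"
  shows "cinner d \<psi> \<psi> = 1"
proof -
  have "cinner d \<psi> \<psi> = complex_of_real (\<Sum>j<d. (cmod (\<psi> j))\<^sup>2)"
    unfolding cinner_def of_real_sum complex_norm_square by (simp add: mult.commute)
  also have "\<dots> = 1" using assms by (simp only: Defs.unit_vec_def of_real_1)
  finally show ?thesis .
qed

lemma cinner_exceeds_near:
  assumes \<psi>: "unit_vec d \<psi>" and exceeds: "(cmod (cinner d \<psi> x))\<^sup>2 > lam" and "lam \<ge> 0"
  obtains \<epsilon> \<mu> where "\<epsilon> > 0" "\<mu> > lam"
    "\<And>y. vdist (2 * d) (realify d y) (realify d x) < \<epsilon> \<Longrightarrow> (cmod (cinner d \<psi> y))\<^sup>2 \<ge> \<mu>"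
proof -
  define b where "b = (cmod (cinner d \<psi> x) + sqrt lam) / 2"
  have "sqrt lam < sqrt ((cmod (cinner d \<psi> x))\<^sup>2)" using exceeds by (rule real_sqrt_less_mono)
  then have "sqrt lam < cmod (cinner d \<psi> x)" by simp
  moreover have "sqrt lam \<ge> 0" using \<open>lam \<ge> 0\<close> by simp
  ultimately have b: "sqrt lam < b" "b < cmod (cinner d \<psi> x)" "b \<ge> 0" by (simp_all add: b_def)
  show ?thesis
  proof (rule that[of "cmod (cinner d \<psi> x) - b" "b\<^sup>2"])
    show "cmod (cinner d \<psi> x) - b > 0" using b by simp
    have "(sqrt lam)\<^sup>2 < b\<^sup>2" using b \<open>sqrt lam \<ge> 0\<close> by (intro power_strict_mono) auto
    then show "b\<^sup>2 > lam" using \<open>lam \<ge> 0\<close> by simp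
    fix y assume near: "vdist (2 * d) (realify d y) (realify d x) < cmod (cinner d \<psi> x) - b"
    have "cmod (cinner d \<psi> y - cinner d \<psi> x) \<le> vdist (2 * d) (realify d y) (realify d x)"
      using cmod_cinner_le[of d \<psi> "\<lambda>j. y j - x j"] \<psi> unfolding cinner_diff vdist_realify Defs.unit_vec_def by simp
    then have "cmod (cinner d \<psi> y) \<ge> b"
      using near norm_triangle_ineq2[of "cinner d \<psi> x" "cinner d \<psi> y"] by (simp add: norm_minus_commute)
    then show "(cmod (cinner d \<psi> y))\<^sup>2 \<ge> b\<^sup>2" using b by (intro power_mono) auto
  qed
qed

lemma less_SUP_SUP_INF_iff:
  fixes g :: "'a \<Rightarrow> 'b \<Rightarrow> nat \<Rightarrow> real"
  shows "ereal lam < (SUP \<psi>\<in>P. SUP N\<in>M. INF i. ereal (g \<psi> N i)) \<longleftrightarrow> (\<exists>\<psi>\<in>P. \<exists>N\<in>M. \<exists>\<mu>>lam. \<forall>i. \<mu> \<le> g \<psi> N i)"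
proof -
  have "ereal lam < (INF i. ereal (h i)) \<longleftrightarrow> (\<exists>\<mu>>lam. \<forall>i. \<mu> \<le> h i)" for h :: "nat \<Rightarrow> real"
  proof
    assume "ereal lam < (INF i. ereal (h i))"
    then obtain \<mu> where \<mu>: "ereal lam < ereal \<mu>" "ereal \<mu> < (INF i. ereal (h i))" using ereal_dense2 by blast
    have "ereal \<mu> \<le> ereal (h i)" for i by (rule order_trans[OF less_imp_le[OF \<mu>(2)]]) (rule INF_lower, simp)
    then show "\<exists>\<mu>>lam. \<forall>i. \<mu> \<le> h i" using \<mu>(1) by auto
  next
    assume "\<exists>\<mu>>lam. \<forall>i. \<mu> \<le> h i"
    then obtain \<mu> where "lam < \<mu>" "\<forall>i. \<mu> \<le> h i" by blast
    then have "ereal lam < ereal \<mu>" "ereal \<mu> \<le> (INF i. ereal (h i))" by (auto intro: INF_greatest)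
    then show "ereal lam < (INF i. ereal (h i))" by (rule less_le_trans)
  qed
  then show ?thesis by (simp add: less_SUP_iff)
qed

lemma d_run_before_checkpoints: "(\<And>i. n \<le> N i) \<Longrightarrow> d_run d U w s0 \<psi> N n = nd_run d U w s0 n"
proof (induction n)
  case (Suc n)
  then have "n \<notin> range N" "\<And>i. n \<le> N i" by (auto simp: Suc_le_eq dest: less_imp_le)
  then show ?case using Suc.IH by simp
qed simp

lemma d_run_after_checkpoint:
  assumes "n \<in> range N" "\<And>r. 0 < r \<Longrightarrow> r \<le> l \<Longrightarrow> n + r \<notin> range N"
  shows "d_run d U w s0 \<psi> N (n + Suc l) = nd_run d U (\<lambda>i. w (n + i)) \<psi> (Suc l)"
  using assms(2)
proof (induction l)
  case 0
  then show ?case using assms(1) by simp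
next
  case (Suc l)
  then have "n + Suc l \<notin> range N" by blast
  then show ?case using Suc by simp
qed

definition padded_word :: "nat list \<Rightarrow> nat \<Rightarrow> nat" where
  "padded_word u i = (if i < length u then u ! i else 0)"

lemma map_padded_word: "map (padded_word u) [0..<length u + l] = u @ replicate l 0"
  by (rule nth_equalityI) (auto simp: padded_word_def nth_append)

lemma concat_replicate_replicate: "concat (replicate m (replicate l x)) = replicate (m * l) x"
  by (induction m) (auto simp: replicate_add)

locale qautomaton =
  fixes d k :: nat and U :: "nat \<Rightarrow> nat \<Rightarrow> nat \<Rightarrow> complex" and s0 :: "nat \<Rightarrow> complex"
  assumes unitary: "\<And>\<sigma>. \<sigma> < k \<Longrightarrow> unitary_mat d (U \<sigma>)" and unit: "unit_vec d s0" and letters: "k > 0"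
begin

sublocale isometries "2 * d" k "\<lambda>\<sigma>. real_matrix (U \<sigma>)" "realify d s0"
proof
  fix \<sigma> x assume "\<sigma> < k"
  have vnorm_eq: "vnorm (2 * d) x = vnorm (2 * d) (realify d (complexify x))" for x
    by (rule vnorm_cong) (simp add: realify_complexify)
  have "vnorm (2 * d) (\<lambda>i. \<Sum>j<2 * d. real_matrix (U \<sigma>) i j * x j)
      = vnorm (2 * d) (realify d (mat_vec d (U \<sigma>) (complexify x)))"
    by (rule vnorm_cong) (simp add: realify_mat_vec[symmetric] realify_complexify)
  then show "vnorm (2 * d) (\<lambda>i. \<Sum>j<2 * d. real_matrix (U \<sigma>) i j * x j) = vnorm (2 * d) x"
    by (simp add: vnorm_eq[of x] vnorm_realify unitary_mat_norm[OF unitary[OF \<open>\<sigma> < k\<close>]])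
next
  show "realify d s0 \<in> unit_sphere (2 * d)" using unit by (simp add: realify_in_unit_sphere_iff)
qed (rule letters)

definition run_word :: "nat list \<Rightarrow> (nat \<Rightarrow> complex) \<Rightarrow> nat \<Rightarrow> complex" where
  "run_word u v = foldl (\<lambda>v \<sigma>. mat_vec d (U \<sigma>) v) v u"

lemma run_word_simps [simp]:
  "run_word [] v = v" "run_word (\<sigma> # u) v = run_word u (mat_vec d (U \<sigma>) v)"
  "run_word (u @ w) v = run_word w (run_word u v)"
  by (simp_all add: run_word_def)

lemma letter_map_realify: "letter_map \<sigma> (realify d v) = realify d (mat_vec d (U \<sigma>) v)"
  by (rule ext) (auto simp: letter_map_def realify_mat_vec)

lemma word_map_realify: "word_map u (realify d v) = realify d (run_word u v)"
  by (induction u arbitrary: v) (auto simp: letter_map_realify)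

lemma unit_vec_run_word:
  assumes "u \<in> words"
  shows "unit_vec d (run_word u s0)"
  using word_map_unit_sphere[OF assms s0] by (simp add: word_map_realify realify_in_unit_sphere_iff)

lemma nd_run_eq_run_word: "nd_run d U w v n = run_word (map w [0..<n]) v"
  by (induction n) auto

lemma map_word_in_words: "(\<And>i. w i < k) \<Longrightarrow> map w [0..<n] \<in> words"
  by (auto simp: words_def)

lemma padded_word_less: "u \<in> words \<Longrightarrow> padded_word u i < k"
  using letters by (auto simp: padded_word_def words_def subset_iff)

lemma infinite_returns:
  assumes "\<sigma> < k" "\<epsilon> > 0"
  shows "infinite {l. vdist (2 * d) (realify d (run_word (replicate l \<sigma>) x)) (realify d x) < \<epsilon>}"
  unfolding infinite_nat_iff_unbounded
proof (intro allI)
  fix M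
  have "replicate (Suc M) \<sigma> \<in> words" using assms(1) by (auto simp: words_def)
  then obtain m where "m \<ge> 1"
    and m: "vdist (2 * d) (word_map (word_power m (replicate (Suc M) \<sigma>)) (realify d x)) (realify d x) < \<epsilon>"
    using recurrence[OF _ assms(2), of "replicate (Suc M) \<sigma>" "realify d x"] by auto
  have "m * Suc M > M" using \<open>m \<ge> 1\<close> by (cases m) auto
  moreover have "word_power m (replicate (Suc M) \<sigma>) = replicate (m * Suc M) \<sigma>"
    unfolding word_power_def by (rule concat_replicate_replicate)
  ultimately show "\<exists>l>M. l \<in> {l. vdist (2 * d) (realify d (run_word (replicate l \<sigma>) x)) (realify d x) < \<epsilon>}"
    using m by (intro exI[of _ "m * Suc M"]) (simp only: word_map_realify mem_Collect_eq simp_thms)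
qed

definition accepts :: "(nat \<Rightarrow> complex) list \<Rightarrow> real \<Rightarrow> bool" where
  "accepts B lam \<longleftrightarrow>
    (\<exists>u\<in>words. \<exists>\<psi>. unit_vec d \<psi> \<and> in_span d B \<psi> \<and> (cmod (cinner d \<psi> (run_word u s0)))\<^sup>2 > lam)"

lemma accepts_if_nd_run_exceeds:
  assumes "\<forall>i. w i < k" "unit_vec d \<psi>" "in_span d B \<psi>" "lam < (cmod (cinner d \<psi> (nd_run d U w s0 n)))\<^sup>2"
  shows "accepts B lam"
  unfolding accepts_def using assms map_word_in_words[of w n]
  by (intro bexI[of _ "map w [0..<n]"] exI[of _ \<psi>]) (simp_all add: nd_run_eq_run_word)

lemma accepts_if_lang_ND_nonempty:
  assumes "lang_ND d k U B s0 lam \<noteq> {}"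
  shows "accepts B lam"
proof -
  from assms obtain w \<psi> and N :: "nat \<Rightarrow> nat" and \<mu> where w: "\<forall>i. w i < k" and \<psi>: "unit_vec d \<psi>" "in_span d B \<psi>"
    and "lam < \<mu>" "\<forall>i. \<mu> \<le> (cmod (cinner d \<psi> (nd_run d U w s0 (N i))))\<^sup>2"
    unfolding lang_ND_def f_ND_def less_SUP_SUP_INF_iff by blast
  then have "lam < (cmod (cinner d \<psi> (nd_run d U w s0 (N 0))))\<^sup>2" by (blast intro: less_le_trans)
  with w \<psi> show ?thesis by (rule accepts_if_nd_run_exceeds)
qed

lemma accepts_if_lang_D_nonempty:
  assumes "lang_D d k U B s0 lam \<noteq> {}"
  shows "accepts B lam"
proof -
  from assms obtain w \<psi> N \<mu> where w: "\<forall>i. w i < k" and \<psi>: "unit_vec d \<psi>" "in_span d B \<psi>" and "strict_mono N"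
    and "lam < \<mu>" "\<forall>i. \<mu> \<le> (cmod (cinner d \<psi> (d_run d U w s0 \<psi> N (N i))))\<^sup>2"
    unfolding lang_D_def f_D_def less_SUP_SUP_INF_iff by blast
  then have "lam < (cmod (cinner d \<psi> (d_run d U w s0 \<psi> N (N 0))))\<^sup>2" by (blast intro: less_le_trans)
  moreover have "d_run d U w s0 \<psi> N (N 0) = nd_run d U w s0 (N 0)"
    using \<open>strict_mono N\<close> by (intro d_run_before_checkpoints) (simp add: strict_mono_less_eq)
  ultimately have "lam < (cmod (cinner d \<psi> (nd_run d U w s0 (N 0))))\<^sup>2" by simp
  with w \<psi> show ?thesis by (rule accepts_if_nd_run_exceeds)
qed

lemma lang_ND_nonempty_if_accepts:
  assumes "accepts B lam" "lam \<ge> 0"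
  shows "lang_ND d k U B s0 lam \<noteq> {}"
proof -
  obtain u \<psi> where u: "u \<in> words" and \<psi>: "unit_vec d \<psi>" "in_span d B \<psi>"
    and exceeds: "(cmod (cinner d \<psi> (run_word u s0)))\<^sup>2 > lam" using assms(1) by (auto simp: accepts_def)
  obtain \<epsilon> \<mu> where "\<epsilon> > 0" "\<mu> > lam" and near:
    "\<And>y. vdist (2 * d) (realify d y) (realify d (run_word u s0)) < \<epsilon> \<Longrightarrow> (cmod (cinner d \<psi> y))\<^sup>2 \<ge> \<mu>"
    using \<psi>(1) exceeds assms(2) by (rule cinner_exceeds_near) blast
  define S where "S = {l. vdist (2 * d) (realify d (run_word (replicate l 0) (run_word u s0)))
    (realify d (run_word u s0)) < \<epsilon>}"
  have S: "infinite S" unfolding S_def by (rule infinite_returns[OF letters \<open>\<epsilon> > 0\<close>])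
  define N where "N i = length u + enumerate S i" for i
  have N: "strict_mono N" using strict_mono_enumerate[OF S] by (auto simp: strict_mono_def N_def)
  have "\<mu> \<le> (cmod (cinner d \<psi> (nd_run d U (padded_word u) s0 (N i))))\<^sup>2" for i
    using enumerate_in_set[OF S, of i] unfolding nd_run_eq_run_word N_def map_padded_word
    by (intro near) (simp add: S_def)
  then have "ereal lam < f_ND d U B s0 (padded_word u)"
    unfolding f_ND_def less_SUP_SUP_INF_iff using \<psi> N \<open>\<mu> > lam\<close> by blast
  then show ?thesis using padded_word_less[OF u] by (auto simp: lang_ND_def)
qed

lemma d_run_periodic_checkpoints:
  assumes "m > 0"
  shows "d_run d U (padded_word u) v \<psi> (\<lambda>i. length u + i * m) (length u + i * m) =
    (if i = 0 then run_word u v else run_word (replicate m 0) \<psi>)"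
proof (cases i)
  case 0
  have "map (padded_word u) [0..<length u] = u" using map_padded_word[of u 0] by simp
  then show ?thesis using 0 by (simp add: d_run_before_checkpoints nd_run_eq_run_word)
next
  case (Suc j)
  let ?N = "\<lambda>i. length u + i * m"
  obtain l where l: "m = Suc l" using assms gr0_implies_Suc by blast
  have avoid: "?N j + r \<notin> range ?N" if "0 < r" "r \<le> l" for r
  proof
    assume "?N j + r \<in> range ?N"
    then obtain i where "length u + j * m + r = length u + i * m" by blast
    then have "j * m + r = i * m" by simp
    then have "(j * m + r) mod m = i * m mod m" by (rule arg_cong)
    then have "r mod m = 0" by simp
    then show False using that l by simp
  qed
  have "d_run d U (padded_word u) v \<psi> ?N (?N j + m) = nd_run d U (\<lambda>i. padded_word u (?N j + i)) \<psi> m"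
    unfolding l by (rule d_run_after_checkpoint) (use avoid l in auto)
  also have "\<dots> = run_word (map (\<lambda>i. padded_word u (?N j + i)) [0..<m]) \<psi>" by (rule nd_run_eq_run_word)
  also have "map (\<lambda>i. padded_word u (?N j + i)) [0..<m] = replicate m 0"
    by (rule nth_equalityI) (auto simp: padded_word_def)
  finally show ?thesis using assms Suc by (simp add: add.commute[of m] add.assoc)
qed

lemma lang_D_nonempty_if_accepts:
  assumes "accepts B lam" and lam: "0 \<le> lam" "lam < 1"
  shows "lang_D d k U B s0 lam \<noteq> {}"
proof -
  obtain u \<psi> where u: "u \<in> words" and \<psi>: "unit_vec d \<psi>" "in_span d B \<psi>"
    and exceeds: "(cmod (cinner d \<psi> (run_word u s0)))\<^sup>2 > lam" using assms(1) by (auto simp: accepts_def)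
  have "(cmod (cinner d \<psi> \<psi>))\<^sup>2 > lam" using lam(2) by (simp add: cinner_self[OF \<psi>(1)])
  then obtain \<epsilon> \<mu> where "\<epsilon> > 0" "\<mu> > lam"
    and near: "\<And>y. vdist (2 * d) (realify d y) (realify d \<psi>) < \<epsilon> \<Longrightarrow> (cmod (cinner d \<psi> y))\<^sup>2 \<ge> \<mu>"
    using lam(1) by (rule cinner_exceeds_near[OF \<psi>(1)]) blast
  obtain m where m: "m > 0" "vdist (2 * d) (realify d (run_word (replicate m 0) \<psi>)) (realify d \<psi>) < \<epsilon>"
    using infinite_returns[OF letters \<open>\<epsilon> > 0\<close>, of \<psi>] unfolding infinite_nat_iff_unbounded by blast
  define N where "N i = length u + i * m" for i
  define \<nu> where "\<nu> = min \<mu> ((cmod (cinner d \<psi> (run_word u s0)))\<^sup>2)"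
  have N: "strict_mono N" using m(1) by (auto simp: strict_mono_def N_def)
  have "\<nu> \<le> (cmod (cinner d \<psi> (d_run d U (padded_word u) s0 \<psi> N (N i))))\<^sup>2" for i
    using near[OF m(2)] unfolding N_def[abs_def] d_run_periodic_checkpoints[OF m(1)] \<nu>_def
    by (simp add: min.coboundedI1)
  moreover have "\<nu> > lam" using \<open>\<mu> > lam\<close> exceeds by (simp add: \<nu>_def)
  ultimately have "ereal lam < f_D d U B s0 (padded_word u)"
    unfolding f_D_def less_SUP_SUP_INF_iff using \<psi> N by blast
  then show ?thesis using padded_word_less[OF u] by (auto simp: lang_D_def)
qed

end

section \<open>Complex polynomials with integer coefficients\<close>

type_synonym cpoly = "ipoly \<times> ipoly"

definition cpeval :: "cpoly \<Rightarrow> (nat \<Rightarrow> real) \<Rightarrow> complex" where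
  "cpeval p z = Complex (peval (fst p) z) (peval (snd p) z)"

definition cpoly_vars_in :: "nat set \<Rightarrow> cpoly \<Rightarrow> bool" where
  "cpoly_vars_in V p \<longleftrightarrow> vars_in V (fst p) \<and> vars_in V (snd p)"

definition psquare :: "ipoly \<Rightarrow> ipoly" where
  "psquare p = pmult p p"

definition cpoly_add :: "cpoly \<Rightarrow> cpoly \<Rightarrow> cpoly" where
  "cpoly_add p q = (fst p @ fst q, snd p @ snd q)"

definition cpoly_mult :: "cpoly \<Rightarrow> cpoly \<Rightarrow> cpoly" where
  "cpoly_mult p q = (pmult (fst p) (fst q) @ pscale (-1) (pmult (snd p) (snd q)),
    pmult (fst p) (snd q) @ pmult (snd p) (fst q))"

definition cpoly_cnj :: "cpoly \<Rightarrow> cpoly" where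
  "cpoly_cnj p = (fst p, pscale (-1) (snd p))"

definition cpoly_norm_sq :: "cpoly \<Rightarrow> ipoly" where
  "cpoly_norm_sq p = psquare (fst p) @ psquare (snd p)"

definition cpoly_sum :: "cpoly list \<Rightarrow> cpoly" where
  "cpoly_sum l = (concat (map fst l), concat (map snd l))"

definition cpoly_var :: "nat \<Rightarrow> cpoly" where
  "cpoly_var i = ([(1, [i])], [(1, [Suc i])])"

definition cpoly_const :: "int \<Rightarrow> int \<Rightarrow> cpoly" where
  "cpoly_const a b = ([(a, [])], [(b, [])])"

definition cpoly_horner :: "int list \<Rightarrow> cpoly \<Rightarrow> cpoly" where
  "cpoly_horner l w = foldl (\<lambda>acc a. cpoly_add (cpoly_const a 0) (cpoly_mult w acc)) ([], []) (rev l)"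

definition sphere_poly :: "cpoly list \<Rightarrow> ipoly" where
  "sphere_poly vs = psquare ((-1, []) # concat (map cpoly_norm_sq vs))"

definition psubst :: "(nat \<Rightarrow> ipoly) \<Rightarrow> ipoly \<Rightarrow> ipoly" where
  "psubst f q = concat (map (\<lambda>t. pscale (fst t) (foldl (\<lambda>acc i. pmult acc (f i)) [(1, [])] (snd t))) q)"

lemma peval_psquare [simp]: "peval (psquare p) z = (peval p z)\<^sup>2"
  by (simp add: psquare_def power2_eq_square)

lemma cpeval_simps [simp]:
  "cpeval (cpoly_add p q) z = cpeval p z + cpeval q z"
  "cpeval (cpoly_mult p q) z = cpeval p z * cpeval q z"
  "cpeval (cpoly_cnj p) z = cnj (cpeval p z)"
  "cpeval (cpoly_var i) z = Complex (z i) (z (Suc i))"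
  "cpeval (cpoly_const a b) z = Complex (of_int a) (of_int b)"
  by (auto simp: cpeval_def cpoly_add_def cpoly_mult_def cpoly_cnj_def cpoly_var_def cpoly_const_def complex_eq_iff)

lemma peval_cpoly_norm_sq [simp]: "peval (cpoly_norm_sq p) z = (cmod (cpeval p z))\<^sup>2"
  by (simp add: cpoly_norm_sq_def cpeval_def cmod_power2)

lemma peval_concat_upt: "peval (concat (map f [0..<n])) z = (\<Sum>j<n. peval (f j) z)"
  by (induction n) (auto simp: add.commute)

lemma cpeval_sum_upt: "cpeval (cpoly_sum (map f [0..<n])) z = (\<Sum>j<n. cpeval (f j) z)"
  unfolding cpeval_def cpoly_sum_def
  by (induction n) (auto simp: complex_eq_iff Re_sum Im_sum add.commute)

lemma cpeval_horner: "cpeval (cpoly_horner l w) z = (\<Sum>i<length l. of_int (l ! i) * cpeval w z ^ i)"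
proof (induction l)
  case Nil
  then show ?case by (simp add: cpoly_horner_def cpeval_def complex_eq_iff)
next
  case (Cons a l)
  have "cpeval (cpoly_horner (a # l) w) z = of_int a + cpeval w z * cpeval (cpoly_horner l w) z"
    by (simp add: cpoly_horner_def complex_eq_iff)
  also have "\<dots> = (\<Sum>i<length (a # l). of_int ((a # l) ! i) * cpeval w z ^ i)"
    unfolding Cons length_Cons sum.lessThan_Suc_shift by (simp add: sum_distrib_left algebra_simps)
  finally show ?case .
qed

lemma peval_sphere_poly:
  "peval (sphere_poly (map f [0..<n])) z = ((\<Sum>j<n. (cmod (cpeval (f j) z))\<^sup>2) - 1)\<^sup>2"
  using peval_concat_upt[of "cpoly_norm_sq \<circ> f" n z] by (simp add: sphere_poly_def o_def)

lemma peval_psubst: "peval (psubst f q) z = peval q (\<lambda>i. peval (f i) z)"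
proof -
  have "peval (foldl (\<lambda>acc i. pmult acc (f i)) P m) z = peval P z * meval m (\<lambda>i. peval (f i) z)" for m P
    by (induction m arbitrary: P) auto
  then show ?thesis by (induction q) (auto simp: psubst_def)
qed

lemma vars_in_psquare [simp]: "vars_in V p \<Longrightarrow> vars_in V (psquare p)"
  by (simp add: psquare_def)

lemma cpoly_vars_in_intros:
  "cpoly_vars_in V p \<Longrightarrow> cpoly_vars_in V q \<Longrightarrow> cpoly_vars_in V (cpoly_mult p q)"
  "cpoly_vars_in V p \<Longrightarrow> cpoly_vars_in V q \<Longrightarrow> cpoly_vars_in V (cpoly_add p q)"
  "cpoly_vars_in V p \<Longrightarrow> cpoly_vars_in V (cpoly_cnj p)"
  "(\<And>p. p \<in> set l \<Longrightarrow> cpoly_vars_in V p) \<Longrightarrow> cpoly_vars_in V (cpoly_sum l)"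
  "i \<in> V \<Longrightarrow> Suc i \<in> V \<Longrightarrow> cpoly_vars_in V (cpoly_var i)"
  "cpoly_vars_in V (cpoly_const a b)"
  by (auto simp: cpoly_vars_in_def cpoly_mult_def cpoly_add_def cpoly_cnj_def cpoly_sum_def cpoly_var_def
      cpoly_const_def vars_in_concat)

lemma vars_in_cpoly_norm_sq: "cpoly_vars_in V p \<Longrightarrow> vars_in V (cpoly_norm_sq p)"
  by (simp add: cpoly_vars_in_def cpoly_norm_sq_def)

lemma cpoly_vars_in_mono: "cpoly_vars_in V p \<Longrightarrow> V \<subseteq> W \<Longrightarrow> cpoly_vars_in W p"
  by (auto simp: cpoly_vars_in_def intro: vars_in_mono)

lemma cpoly_vars_in_horner: "cpoly_vars_in V w \<Longrightarrow> cpoly_vars_in V (cpoly_horner l w)"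
proof (induction l)
  case (Cons a l)
  have "cpoly_horner (a # l) w = cpoly_add (cpoly_const a 0) (cpoly_mult w (cpoly_horner l w))"
    by (simp add: cpoly_horner_def)
  with Cons show ?case by (auto intro!: cpoly_vars_in_intros)
qed (simp add: cpoly_horner_def cpoly_vars_in_def)

lemma vars_in_sphere_poly: "(\<And>p. p \<in> set vs \<Longrightarrow> cpoly_vars_in V p) \<Longrightarrow> vars_in V (sphere_poly vs)"
  by (auto simp: sphere_poly_def vars_in_concat intro!: vars_in_psquare vars_in_cpoly_norm_sq)

lemma vars_in_psubst:
  assumes "vars_in W q" "\<And>i. i \<in> W \<Longrightarrow> vars_in V (f i)"
  shows "vars_in V (psubst f q)"
proof -
  have "vars_in V (foldl (\<lambda>acc i. pmult acc (f i)) P m)"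
    if "vars_in V P" "\<And>i. i \<in> set m \<Longrightarrow> vars_in V (f i)" for m P
    using that by (induction m arbitrary: P) auto
  moreover have "i \<in> W" if "t \<in> set q" "i \<in> set (snd t)" for t i
    using assms(1) that by (auto simp: vars_in_def)
  ultimately show ?thesis using assms(2) by (auto simp: psubst_def vars_in_concat intro!: vars_in_pscale)
qed

section \<open>Equations for algebraic numbers\<close>

text \<open>A zero denominator in a rational code means the value 0, hence the case distinctions;
  squaring the denominator makes \<open>rat_den\<close> positive.\<close>

definition rat_den :: "nat \<Rightarrow> int" where
  "rat_den r = (if int_decode (snd (prod_decode r)) = 0 then 1
     else int_decode (snd (prod_decode r)) * int_decode (snd (prod_decode r)))"

definition rat_num :: "nat \<Rightarrow> int" where
  "rat_num r = (if int_decode (snd (prod_decode r)) = 0 then 0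
     else int_decode (fst (prod_decode r)) * int_decode (snd (prod_decode r)))"

text \<open>The slack variable \<open>s\<close> turns an inequality between \<open>z v\<close> and the rational \<open>r\<close> (lower bound for
  \<open>b = 1\<close>, upper bound for \<open>b = -1\<close>) into an equation.\<close>

definition slack_poly :: "int \<Rightarrow> nat \<Rightarrow> nat \<Rightarrow> nat \<Rightarrow> ipoly" where
  "slack_poly b r v s = [(b * rat_den r, [v]), (- (b * rat_num r), []), (-1, [s, s])]"

definition rect_code :: "nat \<Rightarrow> nat \<Rightarrow> nat" where
  "rect_code a j = total_nth (list_decode (snd (prod_decode a))) j"

definition side_sign :: "nat \<Rightarrow> int" where
  "side_sign j = (if j mod 2 = 0 then 1 else -1)"

text \<open>The algebraic number with code \<open>a\<close> occupies the variables \<open>6 * a\<close> (real part) and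
  \<open>6 * a + 1\<close> (imaginary part); \<open>6 * a + 2\<close> to \<open>6 * a + 5\<close> are slacks for its rectangle.\<close>

definition algebraic_constraint :: "nat \<Rightarrow> ipoly" where
  "algebraic_constraint a =
     cpoly_norm_sq (cpoly_horner (map int_decode (list_decode (fst (prod_decode a)))) (cpoly_var (6 * a)))
     @ concat (map (\<lambda>j. psquare (slack_poly (side_sign j) (rect_code a j) (6 * a + j div 2) (6 * a + 2 + j))) [0..<4])"

lemma rat_den_pos: "rat_den r > 0"
  by (auto simp: rat_den_def zero_less_mult_iff)

lemma rat_val_eq: "rat_val r = of_int (rat_num r) / of_int (rat_den r)"
  by (auto simp: rat_val_def rat_num_def rat_den_def split: prod.splits)

lemma abs_int_decode_le: "\<bar>int_decode x\<bar> \<le> int x"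
  by (auto simp: int_decode_def sum_decode_def) presburger

lemma prod_decode_le: "fst (prod_decode r) \<le> r" "snd (prod_decode r) \<le> r"
  by (metis le_prod_encode_1 prod.collapse prod_decode_inverse)
     (metis le_prod_encode_2 prod.collapse prod_decode_inverse)

lemma list_decode_less: "x \<in> set (list_decode n) \<Longrightarrow> x < n"
proof (induction n rule: list_decode.induct)
  case (2 n)
  obtain a b where decode: "prod_decode n = (a, b)" by (cases "prod_decode n")
  have "a \<le> n" "b \<le> n" using prod_decode_le[of n] by (auto simp: decode)
  moreover have "x = a \<or> x \<in> set (list_decode b)" using 2(2) by (simp add: decode)
  ultimately show ?case using 2(1)[OF decode[symmetric]] by auto
qed simp

lemma total_nth_eq_nth [simp]: "i < length l \<Longrightarrow> total_nth l i = l ! i"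
  by (simp add: total_nth_def)

lemma total_nth_list_decode_le: "total_nth (list_decode n) i \<le> n"
  by (auto simp: total_nth_def dest: nth_mem intro!: less_imp_le[OF list_decode_less])

lemma rect_code_le: "rect_code a j \<le> a"
  using total_nth_list_decode_le[of "snd (prod_decode a)" j] prod_decode_le(2)[of a] by (simp add: rect_code_def)

lemma abs_rational_parts_le:
  "\<bar>int_decode (fst (prod_decode r))\<bar> \<le> int r" "\<bar>int_decode (snd (prod_decode r))\<bar> \<le> int r"
  using abs_int_decode_le[of "fst (prod_decode r)"] abs_int_decode_le[of "snd (prod_decode r)"]
    prod_decode_le[of r] by linarith+

lemma rat_den_le: "rat_den r \<le> int r * int r + 1"
  using mult_mono[OF abs_rational_parts_le(2)[of r] abs_rational_parts_le(2)[of r]]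
  by (simp add: rat_den_def abs_mult_self_eq)

lemma abs_rat_num_le: "\<bar>rat_num r\<bar> \<le> int r * int r"
  using mult_mono[OF abs_rational_parts_le[of r]] by (simp add: rat_num_def abs_mult)

lemma abs_rat_val_le: "\<bar>rat_val r\<bar> \<le> real r"
proof (cases "int_decode (snd (prod_decode r)) = 0")
  case False
  let ?d = "int_decode (snd (prod_decode r))" and ?n = "int_decode (fst (prod_decode r))"
  have "\<bar>rat_val r\<bar> = \<bar>real_of_int ?n\<bar> / \<bar>real_of_int ?d\<bar>" by (simp add: rat_val_def split: prod.splits)
  also have "\<dots> \<le> \<bar>real_of_int ?n\<bar> / 1" using False by (intro divide_left_mono) auto
  also have "\<dots> \<le> real r" using abs_rational_parts_le(1)[of r] by linarith
  finally show ?thesis .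
qed (auto simp: rat_val_def split: prod.splits)

lemma rat_val_le_iff: "rat_val r \<le> x \<longleftrightarrow> of_int (rat_num r) \<le> of_int (rat_den r) * x"
  and le_rat_val_iff: "x \<le> rat_val r \<longleftrightarrow> of_int (rat_den r) * x \<le> of_int (rat_num r)"
  using rat_den_pos[of r] by (auto simp: rat_val_eq field_simps)

lemma peval_slack_poly:
  "peval (slack_poly b r v s) z = of_int b * (of_int (rat_den r) * z v - of_int (rat_num r)) - (z s)\<^sup>2"
  by (simp add: slack_poly_def algebra_simps power2_eq_square)

lemma peval_algebraic_constraint:
  "peval (algebraic_constraint a) z =
     (cmod (\<Sum>i<length (alg_coeffs a). of_int (alg_coeffs a ! i) * Complex (z (6 * a)) (z (6 * a + 1)) ^ i))\<^sup>2 +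
     (\<Sum>j<4. (peval (slack_poly (side_sign j) (rect_code a j) (6 * a + j div 2) (6 * a + 2 + j)) z)\<^sup>2)"
  unfolding algebraic_constraint_def
  by (simp add: peval_concat_upt cpeval_horner alg_coeffs_def)

lemma peval_algebraic_constraint_nonneg: "peval (algebraic_constraint a) z \<ge> 0"
  unfolding peval_algebraic_constraint by (simp add: sum_nonneg)

lemma vars_in_algebraic_constraint: "vars_in {6 * a..<6 * a + 6} (algebraic_constraint a)"
  unfolding algebraic_constraint_def vars_in_simps vars_in_concat
  by (auto simp: slack_poly_def intro!: vars_in_psquare vars_in_cpoly_norm_sq cpoly_vars_in_horner cpoly_vars_in_intros)

lemma algebraic_constraint_eq_0_iff:
  "peval (algebraic_constraint a) z = 0 \<longleftrightarrow>
     (\<Sum>i<length (alg_coeffs a). of_int (alg_coeffs a ! i) * Complex (z (6 * a)) (z (6 * a + 1)) ^ i) = 0 \<and>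
     (\<forall>j<4. peval (slack_poly (side_sign j) (rect_code a j) (6 * a + j div 2) (6 * a + 2 + j)) z = 0)"
  unfolding peval_algebraic_constraint
  by (subst add_nonneg_eq_0_iff) (auto simp: sum_nonneg sum_nonneg_eq_0_iff)

definition rect_coord :: "complex \<Rightarrow> nat \<Rightarrow> real" where
  "rect_coord w j = (if j < 2 then Re w else Im w)"

lemma rect_coord_Complex:
  assumes "j < 4"
  shows "rect_coord (Complex (z i) (z (Suc i))) j = z (i + j div 2)"
proof (cases "j < 2")
  case False
  then have "j div 2 = 1" using assms by presburger
  then show ?thesis using False by (simp add: rect_coord_def)
qed (simp add: rect_coord_def)

lemma all_less_4_iff: "(\<forall>j<4::nat. P j) \<longleftrightarrow> P 0 \<and> P 1 \<and> P 2 \<and> P 3"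
  by (auto simp: numeral_eq_Suc less_Suc_eq)

lemma alg_prop_iff:
  assumes "length (alg_rect a) = 4"
  shows "alg_prop a w \<longleftrightarrow> (\<Sum>i<length (alg_coeffs a). of_int (alg_coeffs a ! i) * w ^ i) = 0 \<and>
    (\<forall>j<4. 0 \<le> of_int (side_sign j) *
      (of_int (rat_den (rect_code a j)) * rect_coord w j - of_int (rat_num (rect_code a j))))"
proof -
  have "alg_rect a ! j = rat_val (rect_code a j)" if "j < 4" for j
    using assms that by (simp add: alg_rect_def rect_code_def)
  then show ?thesis unfolding alg_prop_def all_less_4_iff
    by (simp add: rat_val_le_iff le_rat_val_iff side_sign_def rect_coord_def)
qed

lemma abs_le_square_add_1: "\<bar>x\<bar> \<le> x\<^sup>2 + 1" for x :: real
  using zero_le_power2[of "\<bar>x\<bar> - 1 / 2"] by (simp add: power2_eq_square algebra_simps)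

lemma abs_slack_le:
  assumes zero: "peval (slack_poly b r v s) z = 0" and "\<bar>b\<bar> = 1" "r \<le> a" and v: "\<bar>z v\<bar> \<le> real a"
  shows "\<bar>z s\<bar> \<le> real ((a + 2) ^ 3 + 1)"
proof -
  have "int r * int r \<le> int a * int a" using \<open>r \<le> a\<close> by (intro mult_mono) auto
  then have "rat_den r \<le> int (a * a + 1)" "\<bar>rat_num r\<bar> \<le> int (a * a)"
    using rat_den_le[of r] abs_rat_num_le[of r] by simp_all
  then have "real_of_int (rat_den r) \<le> real_of_int (int (a * a + 1))"
    "real_of_int \<bar>rat_num r\<bar> \<le> real_of_int (int (a * a))"
    by (simp_all only: of_int_le_iff)
  then have den: "real_of_int (rat_den r) \<le> real (a * a + 1)" and num: "\<bar>real_of_int (rat_num r)\<bar> \<le> real (a * a)"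
    by (simp_all only: of_int_of_nat_eq of_int_abs)
  have "\<bar>real_of_int b\<bar> = 1" using \<open>\<bar>b\<bar> = 1\<close> by (metis of_int_1 of_int_abs)
  moreover have "(z s)\<^sup>2 = of_int b * (of_int (rat_den r) * z v - of_int (rat_num r))"
    using zero by (simp add: peval_slack_poly)
  ultimately have "(z s)\<^sup>2 \<le> \<bar>of_int (rat_den r) * z v - of_int (rat_num r)\<bar>"
    by (metis abs_ge_self abs_mult mult_1)
  also have "\<dots> \<le> \<bar>of_int (rat_den r) * z v\<bar> + \<bar>of_int (rat_num r)\<bar>" by (rule abs_triangle_ineq4)
  also have "\<dots> \<le> real (a * a + 1) * real a + real (a * a)"
    using den num v rat_den_pos[of r] by (intro add_mono) (auto simp: abs_mult intro!: mult_mono)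
  also have "\<dots> \<le> (real a + 2) ^ 3" by (simp add: power3_eq_cube algebra_simps)
  finally have "(z s)\<^sup>2 \<le> (real a + 2) ^ 3" .
  moreover have "real ((a + 2) ^ 3 + 1) = (real a + 2) ^ 3 + 1" by (simp add: add.commute)
  ultimately show ?thesis using abs_le_square_add_1[of "z s"] by linarith
qed

context
  fixes a :: nat
  assumes ok: "alg_ok a"
begin

lemma length_alg_rect: "length (alg_rect a) = 4"
  using ok by (simp add: alg_ok_def)

lemma alg_prop_iff_eq_alg_val: "alg_prop a w \<longleftrightarrow> w = alg_val a"
proof -
  have unique: "\<exists>!w. alg_prop a w" using ok by (simp add: alg_ok_def)
  from theI'[OF this] show ?thesis using unique unfolding alg_val_def by blast
qed

lemma algebraic_constraint_value:
  assumes "peval (algebraic_constraint a) z = 0"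
  shows "Complex (z (6 * a)) (z (6 * a + 1)) = alg_val a"
proof -
  have "alg_prop a (Complex (z (6 * a)) (z (6 * a + 1)))"
    using assms unfolding alg_prop_iff[OF length_alg_rect] algebraic_constraint_eq_0_iff peval_slack_poly
    by (simp add: rect_coord_Complex)
  then show ?thesis by (simp only: alg_prop_iff_eq_alg_val)
qed

lemma abs_alg_val_parts_le: "\<bar>Re (alg_val a)\<bar> \<le> real a" "\<bar>Im (alg_val a)\<bar> \<le> real a"
proof -
  have "\<forall>j<4. \<bar>alg_rect a ! j\<bar> \<le> real a"
  proof (intro allI impI)
    fix j :: nat assume "j < 4"
    then have "alg_rect a ! j = rat_val (rect_code a j)"
      using length_alg_rect by (simp add: alg_rect_def rect_code_def)
    then show "\<bar>alg_rect a ! j\<bar> \<le> real a"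
      using abs_rat_val_le[of "rect_code a j"] rect_code_le[of a j] by linarith
  qed
  moreover have "alg_prop a (alg_val a)" by (simp add: alg_prop_iff_eq_alg_val)
  ultimately show "\<bar>Re (alg_val a)\<bar> \<le> real a" "\<bar>Im (alg_val a)\<bar> \<le> real a"
    unfolding all_less_4_iff alg_prop_def by linarith+
qed

lemma algebraic_constraint_bound:
  assumes zero: "peval (algebraic_constraint a) z = 0" and "r < 6"
  shows "\<bar>z (6 * a + r)\<bar> \<le> real ((a + 2) ^ 3 + 1)"
proof -
  have parts: "\<bar>z (6 * a + r)\<bar> \<le> real a" if "r < 2" for r
    using that abs_alg_val_parts_le arg_cong[OF algebraic_constraint_value[OF zero], of Re]
      arg_cong[OF algebraic_constraint_value[OF zero], of Im] by (auto simp: numeral_2_eq_2 less_Suc_eq)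
  show ?thesis
  proof (cases "r < 2")
    case True
    have "a * 1 \<le> (a + 2) * ((a + 2) * (a + 2))" by (intro mult_mono) auto
    then have "real a \<le> real ((a + 2) ^ 3 + 1)" by (simp add: power3_eq_cube)
    with parts[OF True] show ?thesis by linarith
  next
    case False
    then obtain j where j: "r = 2 + j" "j < 4" using \<open>r < 6\<close> le_Suc_ex[of 2 r] by auto
    have "\<bar>z (6 * a + 2 + j)\<bar> \<le> real ((a + 2) ^ 3 + 1)"
    proof (rule abs_slack_le)
      show "peval (slack_poly (side_sign j) (rect_code a j) (6 * a + j div 2) (6 * a + 2 + j)) z = 0"
        using zero j(2) by (simp add: algebraic_constraint_eq_0_iff)
      show "\<bar>z (6 * a + j div 2)\<bar> \<le> real a" using j(2) by (intro parts) auto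
    qed (auto simp: side_sign_def rect_code_le)
    then show ?thesis by (simp add: j add.assoc)
  qed
qed

definition algebraic_solution :: "nat \<Rightarrow> real" where
  "algebraic_solution r = (if r = 0 then Re (alg_val a) else if r = 1 then Im (alg_val a)
     else sqrt (of_int (side_sign (r - 2)) * (of_int (rat_den (rect_code a (r - 2))) * rect_coord (alg_val a) (r - 2)
       - of_int (rat_num (rect_code a (r - 2))))))"

lemma algebraic_constraint_solution:
  assumes z: "\<And>r. r < 6 \<Longrightarrow> z (6 * a + r) = algebraic_solution r"
  shows "peval (algebraic_constraint a) z = 0"
proof -
  have parts: "z (6 * a) = Re (alg_val a)" "z (Suc (6 * a)) = Im (alg_val a)"
    using z[of 0] z[of 1] by (simp_all add: algebraic_solution_def)
  have "alg_prop a (alg_val a)" by (simp add: alg_prop_iff_eq_alg_val)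
  note inside = this[unfolded alg_prop_iff[OF length_alg_rect]]
  have "peval (slack_poly (side_sign j) (rect_code a j) (6 * a + j div 2) (6 * a + 2 + j)) z = 0" if "j < 4" for j
  proof -
    have "z (6 * a + j div 2) = rect_coord (alg_val a) j"
      using rect_coord_Complex[OF that, of z "6 * a"] by (simp only: parts complex.collapse)
    moreover have "z (6 * a + 2 + j) = algebraic_solution (2 + j)" using z[of "2 + j"] that by (simp add: add.assoc)
    ultimately show ?thesis using inside that by (simp add: peval_slack_poly algebraic_solution_def)
  qed
  then show ?thesis using inside by (simp add: algebraic_constraint_eq_0_iff parts)
qed

end

section \<open>The polynomials attached to an instance\<close>

definition dimension :: "nat \<Rightarrow> nat" where "dimension c = total_nth (list_decode c) 0"
definition letter_count :: "nat \<Rightarrow> nat" where "letter_count c = total_nth (list_decode c) 1"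

definition initial_codes :: "nat \<Rightarrow> nat list" where
  "initial_codes c = list_decode (total_nth (list_decode c) 2)"

definition matrix_codes :: "nat \<Rightarrow> nat list list list" where
  "matrix_codes c = map (\<lambda>m. map list_decode (list_decode m)) (list_decode (total_nth (list_decode c) 3))"

definition span_codes :: "nat \<Rightarrow> nat list list" where
  "span_codes c = map list_decode (list_decode (total_nth (list_decode c) 4))"

definition threshold_code :: "nat \<Rightarrow> nat" where "threshold_code c = total_nth (list_decode c) 5"

definition number_codes :: "nat \<Rightarrow> nat list" where
  "number_codes c = initial_codes c @ concat (concat (matrix_codes c)) @ concat (span_codes c) @ [threshold_code c]"

text \<open>The variables of unused codes are set to 0, to keep the zero set bounded.\<close>

definition code_constraints :: "nat \<Rightarrow> ipoly" where
  "code_constraints c = concat (map (\<lambda>a. if a \<in> set (number_codes c) then algebraic_constraint a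
      else concat (map (\<lambda>r. [(1, [6 * a + r, 6 * a + r])]) [0..<6])) [0..<Suc c])"

definition box_radius :: "nat \<Rightarrow> nat" where "box_radius c = (c + 2) ^ 3 + 1"

text \<open>From \<open>state_base c\<close> on, the variables hold the real and imaginary parts of a state, followed by those
  of the coefficients of a vector in the accepting subspace.\<close>

definition state_base :: "nat \<Rightarrow> nat" where "state_base c = 6 * Suc c"
definition coeff_base :: "nat \<Rightarrow> nat" where "coeff_base c = state_base c + 2 * dimension c"
definition var_count :: "nat \<Rightarrow> nat" where "var_count c = coeff_base c + 2 * length (span_codes c)"

definition state_vars :: "nat \<Rightarrow> cpoly list" where
  "state_vars c = map (\<lambda>j. cpoly_var (state_base c + 2 * j)) [0..<dimension c]"

definition coeff_vars :: "nat \<Rightarrow> cpoly list" where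
  "coeff_vars c = map (\<lambda>l. cpoly_var (coeff_base c + 2 * l)) [0..<length (span_codes c)]"

definition initial_polys :: "nat \<Rightarrow> cpoly list" where
  "initial_polys c = map (\<lambda>a. cpoly_var (6 * a)) (initial_codes c)"

definition step_polys :: "nat \<Rightarrow> nat \<Rightarrow> cpoly list \<Rightarrow> cpoly list" where
  "step_polys c \<sigma> xs = map (\<lambda>i. cpoly_sum (map (\<lambda>j. cpoly_mult
     (cpoly_var (6 * total_nth (total_nth (total_nth (matrix_codes c) \<sigma>) i) j)) (total_nth xs j)) [0..<dimension c]))
     [0..<dimension c]"

definition run_polys :: "nat \<Rightarrow> nat list \<Rightarrow> cpoly list" where
  "run_polys c u = foldl (\<lambda>xs \<sigma>. step_polys c \<sigma> xs) (initial_polys c) u"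

definition span_polys :: "nat \<Rightarrow> cpoly list \<Rightarrow> cpoly list" where
  "span_polys c \<gamma>s = map (\<lambda>j. cpoly_sum (map (\<lambda>l. cpoly_mult
     (total_nth \<gamma>s l) (cpoly_var (6 * total_nth (total_nth (span_codes c) l) j))) [0..<length (span_codes c)]))
     [0..<dimension c]"

definition excess_poly :: "nat \<Rightarrow> cpoly list \<Rightarrow> cpoly list \<Rightarrow> ipoly" where
  "excess_poly c \<gamma>s xs =
     cpoly_norm_sq (cpoly_sum (map (\<lambda>j. cpoly_mult (cpoly_cnj (total_nth (span_polys c \<gamma>s) j)) (total_nth xs j))
       [0..<dimension c]))
     @ pscale (-1) (pmult [(1, [6 * threshold_code c])]
         (concat (map (\<lambda>j. cpoly_norm_sq (total_nth (span_polys c \<gamma>s) j)) [0..<dimension c])))"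

definition state_subst :: "nat \<Rightarrow> cpoly list \<Rightarrow> nat \<Rightarrow> ipoly" where
  "state_subst c xs i = (if i < state_base c then [(1, [i])]
     else if (i - state_base c) mod 2 = 0 then fst (total_nth xs ((i - state_base c) div 2))
     else snd (total_nth xs ((i - state_base c) div 2)))"

definition state_variety :: "nat \<Rightarrow> ipoly \<Rightarrow> ipoly" where
  "state_variety c q = code_constraints c @ psquare q @ sphere_poly (state_vars c)"

definition accepting_run_certificate :: "nat \<Rightarrow> nat list \<Rightarrow> (int \<times> int) list \<Rightarrow> nat \<Rightarrow> nat \<Rightarrow> bool" where
  "accepting_run_certificate c u \<gamma> K s \<longleftrightarrow> positive_on_grid (state_base c) (box_radius c)
     (pscale (int K) (code_constraints c)
       @ excess_poly c (map (\<lambda>p. cpoly_const (fst p) (snd p)) \<gamma>) (run_polys c u)) s"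

definition certified_nonempty :: "nat \<Rightarrow> bool" where
  "certified_nonempty c \<longleftrightarrow> 0 < letter_count c \<and>
     (\<exists>u \<gamma> K s. (\<forall>\<sigma>\<in>set u. \<sigma> < letter_count c) \<and> accepting_run_certificate c u \<gamma> K s)"

text \<open>The zero set of \<open>q\<close> contains the initial state, is invariant under all letters
  within the unit sphere, and the acceptance condition fails on it; vectors of the accepting
  subspace are parametrised by coefficient vectors of norm 1.\<close>

definition invariant_certificate :: "nat \<Rightarrow> ipoly \<Rightarrow> bool" where
  "invariant_certificate c q \<longleftrightarrow> (\<forall>t\<in>set q. \<forall>i\<in>set (snd t). i < coeff_base c) \<and>
     certified_nonpos (state_base c) (box_radius c) (code_constraints c)
       (psquare (psubst (state_subst c (initial_polys c)) q)) \<and>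
     (\<forall>\<sigma><letter_count c. certified_nonpos (coeff_base c) (box_radius c) (state_variety c q)
       (psquare (psubst (state_subst c (step_polys c \<sigma> (state_vars c))) q))) \<and>
     certified_nonpos (var_count c) (box_radius c) (state_variety c q @ sphere_poly (coeff_vars c))
       (excess_poly c (coeff_vars c) (state_vars c))"

definition certified_empty :: "nat \<Rightarrow> bool" where
  "certified_empty c \<longleftrightarrow> letter_count c = 0 \<or> (\<exists>q. invariant_certificate c q)"

section \<open>Computability of the searches\<close>

lemma computable_lift2:
  assumes "computable (\<lambda>p. f (fst p) (snd p))" "computable a" "computable b"
  shows "computable (\<lambda>x. f (a x) (b x))"
  using computable_compose[OF assms(1) computable_Pair[OF assms(2,3)]] by simp

lemma computable_lift3:
  assumes "computable (\<lambda>p. f (fst p) (fst (snd p)) (snd (snd p)))" "computable a" "computable b" "computable d"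
  shows "computable (\<lambda>x. f (a x) (b x) (d x))"
  using computable_compose[OF assms(1) computable_Pair[OF assms(2) computable_Pair[OF assms(3,4)]]] by simp

lemma computable_lift4:
  assumes "computable (\<lambda>p. f (fst p) (fst (snd p)) (fst (snd (snd p))) (snd (snd (snd p))))"
    "computable a" "computable b" "computable d" "computable e"
  shows "computable (\<lambda>x. f (a x) (b x) (d x) (e x))"
  using computable_compose[OF assms(1)
      computable_Pair[OF assms(2) computable_Pair[OF assms(3) computable_Pair[OF assms(4,5)]]]] by simp

lemma computable_pscale [THEN computable_lift2, computable_intros]: "computable (\<lambda>p. pscale (fst p) (snd p))"
  unfolding pscale_def by (intro computable_intros)

lemma computable_pmult [THEN computable_lift2, computable_intros]: "computable (\<lambda>p. pmult (fst p) (snd p))"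
  unfolding pmult_def by (intro computable_intros)

lemma computable_deg_bound [THEN computable_compose, computable_intros]: "computable deg_bound"
  unfolding deg_bound_def by (intro computable_intros)

lemma computable_coeff_norm [THEN computable_compose, computable_intros]: "computable coeff_norm"
  unfolding coeff_norm_def by (intro computable_intros)

lemma computable_psquare [THEN computable_compose, computable_intros]: "computable psquare"
  unfolding psquare_def by (intro computable_intros)

lemma computable_cpoly_add [THEN computable_lift2, computable_intros]: "computable (\<lambda>p. cpoly_add (fst p) (snd p))"
  unfolding cpoly_add_def by (intro computable_intros)

lemma computable_cpoly_mult [THEN computable_lift2, computable_intros]: "computable (\<lambda>p. cpoly_mult (fst p) (snd p))"
  unfolding cpoly_mult_def by (intro computable_intros)

lemma computable_cpoly_cnj [THEN computable_compose, computable_intros]: "computable cpoly_cnj"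
  unfolding cpoly_cnj_def by (intro computable_intros)

lemma computable_cpoly_norm_sq [THEN computable_compose, computable_intros]: "computable cpoly_norm_sq"
  unfolding cpoly_norm_sq_def by (intro computable_intros)

lemma computable_cpoly_sum [THEN computable_compose, computable_intros]: "computable cpoly_sum"
  unfolding cpoly_sum_def by (intro computable_intros)

lemma computable_cpoly_var [THEN computable_compose, computable_intros]: "computable cpoly_var"
  unfolding cpoly_var_def by (intro computable_intros)

lemma computable_cpoly_const [THEN computable_lift2, computable_intros]: "computable (\<lambda>p. cpoly_const (fst p) (snd p))"
  unfolding cpoly_const_def by (intro computable_intros)

lemma computable_cpoly_horner [THEN computable_lift2, computable_intros]:
  "computable (\<lambda>p. cpoly_horner (fst p) (snd p))"
  unfolding cpoly_horner_def by (intro computable_intros)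

lemma computable_sphere_poly [THEN computable_compose, computable_intros]: "computable sphere_poly"
  unfolding sphere_poly_def by (intro computable_intros)

lemma computable_psubst [computable_intros]:
  assumes f: "computable (\<lambda>p. f (fst p) (snd p))" and q: "computable q"
  shows "computable (\<lambda>x. psubst (f x) (q x))"
  unfolding psubst_def by (intro computable_intros q computable_lift2[OF f])

lemma computable_rat_den [THEN computable_compose, computable_intros]: "computable rat_den"
  unfolding rat_den_def by (intro computable_intros)

lemma computable_rat_num [THEN computable_compose, computable_intros]: "computable rat_num"
  unfolding rat_num_def by (intro computable_intros)

lemma computable_slack_poly [THEN computable_lift4, computable_intros]:
  "computable (\<lambda>p. slack_poly (fst p) (fst (snd p)) (fst (snd (snd p))) (snd (snd (snd p))))"
  unfolding slack_poly_def by (intro computable_intros)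

lemma computable_rect_code [THEN computable_lift2, computable_intros]: "computable (\<lambda>p. rect_code (fst p) (snd p))"
  unfolding rect_code_def by (intro computable_intros)

lemma computable_side_sign [THEN computable_compose, computable_intros]: "computable side_sign"
  unfolding side_sign_def by (intro computable_intros)

lemma computable_algebraic_constraint [THEN computable_compose, computable_intros]: "computable algebraic_constraint"
  unfolding algebraic_constraint_def by (intro computable_intros)

lemma computable_dimension [THEN computable_compose, computable_intros]: "computable dimension"
  unfolding dimension_def by (intro computable_intros)

lemma computable_letter_count [THEN computable_compose, computable_intros]: "computable letter_count"
  unfolding letter_count_def by (intro computable_intros)

lemma computable_initial_codes [THEN computable_compose, computable_intros]: "computable initial_codes"
  unfolding initial_codes_def by (intro computable_intros)

lemma computable_matrix_codes [THEN computable_compose, computable_intros]: "computable matrix_codes"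
  unfolding matrix_codes_def by (intro computable_intros)

lemma computable_span_codes [THEN computable_compose, computable_intros]: "computable span_codes"
  unfolding span_codes_def by (intro computable_intros)

lemma computable_threshold_code [THEN computable_compose, computable_intros]: "computable threshold_code"
  unfolding threshold_code_def by (intro computable_intros)

lemma computable_number_codes [THEN computable_compose, computable_intros]: "computable number_codes"
  unfolding number_codes_def by (intro computable_intros)

lemma computable_code_constraints [THEN computable_compose, computable_intros]: "computable code_constraints"
  unfolding code_constraints_def by (intro computable_intros)

lemma computable_box_radius [THEN computable_compose, computable_intros]: "computable box_radius"
  unfolding box_radius_def by (intro computable_intros)

lemma computable_state_base [THEN computable_compose, computable_intros]: "computable state_base"
  unfolding state_base_def by (intro computable_intros)

lemma computable_coeff_base [THEN computable_compose, computable_intros]: "computable coeff_base"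
  unfolding coeff_base_def by (intro computable_intros)

lemma computable_var_count [THEN computable_compose, computable_intros]: "computable var_count"
  unfolding var_count_def by (intro computable_intros)

lemma computable_state_vars [THEN computable_compose, computable_intros]: "computable state_vars"
  unfolding state_vars_def by (intro computable_intros)

lemma computable_coeff_vars [THEN computable_compose, computable_intros]: "computable coeff_vars"
  unfolding coeff_vars_def by (intro computable_intros)

lemma computable_initial_polys [THEN computable_compose, computable_intros]: "computable initial_polys"
  unfolding initial_polys_def by (intro computable_intros)

lemma computable_step_polys [THEN computable_lift3, computable_intros]:
  "computable (\<lambda>p. step_polys (fst p) (fst (snd p)) (snd (snd p)))"
  unfolding step_polys_def by (intro computable_intros)

lemma computable_run_polys [THEN computable_lift2, computable_intros]: "computable (\<lambda>p. run_polys (fst p) (snd p))"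
  unfolding run_polys_def by (intro computable_intros)

lemma computable_span_polys [THEN computable_lift2, computable_intros]: "computable (\<lambda>p. span_polys (fst p) (snd p))"
  unfolding span_polys_def by (intro computable_intros)

lemma computable_excess_poly [THEN computable_lift3, computable_intros]:
  "computable (\<lambda>p. excess_poly (fst p) (fst (snd p)) (snd (snd p)))"
  unfolding excess_poly_def by (intro computable_intros)

lemma computable_state_subst [THEN computable_lift3, computable_intros]:
  "computable (\<lambda>p. state_subst (fst p) (fst (snd p)) (snd (snd p)))"
  unfolding state_subst_def by (intro computable_intros)

lemma computable_state_variety [THEN computable_lift2, computable_intros]:
  "computable (\<lambda>p. state_variety (fst p) (snd p))"
  unfolding state_variety_def by (intro computable_intros)

lemma computable_gap_denominator [THEN computable_lift3, computable_intros]: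
  "computable (\<lambda>p. gap_denominator (fst p) (fst (snd p)) (snd (snd p)))"
  unfolding gap_denominator_def gap_bound_def by (intro computable_intros)

lemma computable_gap_poly [THEN computable_lift4, computable_intros]:
  "computable (\<lambda>p. gap_poly (fst p) (fst (snd p)) (fst (snd (snd p))) (snd (snd (snd p))))"
  unfolding gap_poly_def by (intro computable_intros)

lemma computable_grid_coord [THEN computable_lift4, computable_intros]:
  "computable (\<lambda>p. grid_coord (fst p) (fst (snd p)) (fst (snd (snd p))) (snd (snd (snd p))))"
  unfolding grid_coord_def by (intro computable_intros)

lemma computable_homogenized [computable_intros]:
  assumes "computable E" "computable s" and f: "computable (\<lambda>p. f (fst p) (snd p))" and P: "computable P"
  shows "computable (\<lambda>x. homogenized (E x) (s x) (f x) (P x))"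
  unfolding homogenized_def
  by (intro computable_intros P computable_compose[OF assms(1)] computable_compose[OF assms(2)] computable_lift2[OF f])

lemma decidable_positive_on_grid [computable_intros]:
  assumes n: "computable n" and R: "computable R" and P: "computable P" and s: "computable s"
  shows "decidable (\<lambda>x. positive_on_grid (n x) (R x) (P x) (s x))"
  unfolding positive_on_grid_def
  by (intro computable_intros n R P s computable_compose[OF R] computable_compose[OF P] computable_compose[OF s])

lemma semidecidable_certified_nonpos:
  assumes n: "computable n" and R: "computable R" and p: "computable p" and h: "computable h"
  shows "semidecidable (\<lambda>x. certified_nonpos (n x) (R x) (p x) (h x))"
  unfolding certified_nonpos_def
  by (intro semidecidable_ex semidecidable_if_decidable computable_intros
      computable_compose[OF n] computable_compose[OF R] computable_compose[OF p] computable_compose[OF h])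

lemma semidecidable_certified_nonempty: "semidecidable certified_nonempty"
  unfolding certified_nonempty_def accepting_run_certificate_def
  by (intro semidecidable_conj semidecidable_ex semidecidable_if_decidable computable_intros)

lemma semidecidable_certified_empty: "semidecidable certified_empty"
  unfolding certified_empty_def invariant_certificate_def
  by (intro semidecidable_conj semidecidable_disj semidecidable_ex semidecidable_bounded_all
      semidecidable_certified_nonpos; (intro semidecidable_if_decidable)?; intro computable_intros)

section \<open>Meaning of the polynomials of a valid instance\<close>

definition gaussian_coeffs :: "(int \<times> int) list \<Rightarrow> nat \<Rightarrow> complex" where
  "gaussian_coeffs \<gamma> l = (if l < length \<gamma> then Complex (of_int (fst (\<gamma> ! l))) (of_int (snd (\<gamma> ! l))) else 0)"

lemma dec_0_cpoly [simp]: "(dec 0 :: cpoly) = ([], [])"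
  by (simp add: dec_prod_def dec_list_def prod_decode_def prod_decode_aux.simps)

lemma cpeval_cpoly_const_list:
  "cpeval (total_nth (map (\<lambda>p. cpoly_const (fst p) (snd p)) \<gamma>) l) z = gaussian_coeffs \<gamma> l"
  by (auto simp: total_nth_def gaussian_coeffs_def cpeval_def cpoly_const_def complex_eq_iff)

lemma cpoly_vars_in_cpoly_const_list:
  "cpoly_vars_in V (total_nth (map (\<lambda>p. cpoly_const (fst p) (snd p)) \<gamma>) l)"
  by (auto simp: total_nth_def cpoly_vars_in_def cpoly_const_def)

lemma unit_multiple:
  assumes "\<exists>j<n. v j \<noteq> 0"
  obtains t :: real where "t > 0" "unit_vec n (\<lambda>j. complex_of_real t * v j)"
proof
  let ?G = "\<Sum>j<n. (cmod (v j))\<^sup>2"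
  have "?G > 0" using assms by (auto intro!: sum_pos2)
  then show "1 / sqrt ?G > 0" by simp
  have "(\<Sum>j<n. (cmod (complex_of_real (1 / sqrt ?G) * v j))\<^sup>2) = (1 / sqrt ?G)\<^sup>2 * ?G"
    by (simp only: norm_mult power_mult_distrib sum_distrib_left norm_of_real power2_abs)
  then show "unit_vec n (\<lambda>j. complex_of_real (1 / sqrt ?G) * v j)"
    using \<open>?G > 0\<close> by (simp only: Defs.unit_vec_def) (simp add: power_divide)
qed

lemma abs_realify_le_1: "unit_vec n v \<Longrightarrow> \<bar>realify n v i\<bar> \<le> 1"
  using abs_coord_le_vnorm[of i "2 * n" "realify n v"]
  by (cases "i < 2 * n") (auto simp: vnorm_realify Defs.unit_vec_def)

lemma floor_multiple_div_tendsto: "(\<lambda>N. real_of_int \<lfloor>real N * r\<rfloor> / real N) \<longlonglongrightarrow> r"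
proof -
  have "(\<lambda>N. real_of_int \<lfloor>real N * r\<rfloor> / real N - r) \<longlonglongrightarrow> 0"
  proof (rule Lim_null_comparison[OF _ lim_1_over_n])
    show "\<forall>\<^sub>F N in sequentially. norm (real_of_int \<lfloor>real N * r\<rfloor> / real N - r) \<le> 1 / of_nat N"
      using eventually_gt_at_top[of 0]
    proof eventually_elim
      case (elim N)
      have "\<bar>real_of_int \<lfloor>real N * r\<rfloor> - real N * r\<bar> \<le> 1" by linarith
      then have "\<bar>(real_of_int \<lfloor>real N * r\<rfloor> - real N * r) / real N\<bar> \<le> 1 / real N"
        using elim by (simp add: abs_divide divide_right_mono)
      then show ?case using elim by (simp add: diff_divide_distrib)
    qed
  qed
  then show ?thesis by (simp add: LIM_zero_iff)
qed

locale valid_instance =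
  fixes c :: nat
  assumes valid: "valid_inst c"
begin

abbreviation d :: nat where "d \<equiv> i_d c"
abbreviation k :: nat where "k \<equiv> i_k c"
abbreviation m :: nat where "m \<equiv> length (i_Bc c)"

lemma accessors:
  "dimension c = d" "letter_count c = k" "initial_codes c = i_s0c c" "matrix_codes c = i_Uc c"
  "span_codes c = i_Bc c" "threshold_code c = i_lc c"
  using valid
  by (simp_all add: valid_inst_def dimension_def letter_count_def initial_codes_def matrix_codes_def span_codes_def
      threshold_code_def i_d_def i_k_def i_s0c_def i_Uc_def i_Bc_def i_lc_def inst_def)

lemma code_lengths:
  "length (i_s0c c) = d" "length (i_Uc c) = k" "\<sigma> < k \<Longrightarrow> length (i_Uc c ! \<sigma>) = d"
  "\<sigma> < k \<Longrightarrow> i < d \<Longrightarrow> length (i_Uc c ! \<sigma> ! i) = d" "l < m \<Longrightarrow> length (i_Bc c ! l) = d"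
proof -
  note spec = valid[unfolded valid_inst_def]
  show "length (i_s0c c) = d" and k: "length (i_Uc c) = k" using spec by auto
  show matrix: "length (i_Uc c ! \<sigma>) = d" if "\<sigma> < k" for \<sigma> using spec nth_mem[of \<sigma> "i_Uc c"] k that by auto
  show "length (i_Uc c ! \<sigma> ! i) = d" if "\<sigma> < k" "i < d"
  proof -
    have "i_Uc c ! \<sigma> \<in> set (i_Uc c)" "i_Uc c ! \<sigma> ! i \<in> set (i_Uc c ! \<sigma>)"
      using k matrix[OF that(1)] that by auto
    then show ?thesis using spec by blast
  qed
  show "length (i_Bc c ! l) = d" if "l < m" using spec nth_mem[of l "i_Bc c"] that by auto
qed

lemma set_number_codes: "set (number_codes c) =
    set (i_s0c c) \<union> (\<Union>M\<in>set (i_Uc c). \<Union>r\<in>set M. set r) \<union> (\<Union>v\<in>set (i_Bc c). set v) \<union> {i_lc c}"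
  by (auto simp: number_codes_def accessors)

lemma number_codes_ok: "a \<in> set (number_codes c) \<Longrightarrow> alg_ok a"
  using valid unfolding valid_inst_def set_number_codes by blast

lemma number_codes_le:
  assumes "a \<in> set (number_codes c)"
  shows "a \<le> c"
proof -
  have le: "x \<le> c" if "x \<in> set (list_decode (total_nth (list_decode c) i))" for x i
    using list_decode_less[OF that] total_nth_list_decode_le[of c i] by linarith
  from assms consider
      (initial) "a \<in> set (initial_codes c)"
    | (letter) M r where "M \<in> set (matrix_codes c)" "r \<in> set M" "a \<in> set r"
    | (span) v where "v \<in> set (span_codes c)" "a \<in> set v"
    | (threshold) "a = threshold_code c"
    by (auto simp: number_codes_def)
  then show ?thesis
  proof cases
    case initial
    then show ?thesis using le[of a 2] by (simp add: initial_codes_def)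
  next
    case letter
    then obtain x y where "x \<in> set (list_decode (total_nth (list_decode c) 3))" "y \<in> set (list_decode x)"
      "a \<in> set (list_decode y)" by (auto simp: matrix_codes_def)
    then show ?thesis using le[of x 3] list_decode_less[of y x] list_decode_less[of a y] by linarith
  next
    case span
    then obtain y where "y \<in> set (list_decode (total_nth (list_decode c) 4))" "a \<in> set (list_decode y)"
      by (auto simp: span_codes_def)
    then show ?thesis using le[of y 4] list_decode_less[of a y] by linarith
  next
    case threshold
    then show ?thesis using total_nth_list_decode_le[of c 5] by (simp add: threshold_code_def)
  qed
qed

lemma codes_in_number_codes:
  "j < d \<Longrightarrow> i_s0c c ! j \<in> set (number_codes c)"
  "\<sigma> < k \<Longrightarrow> i < d \<Longrightarrow> j < d \<Longrightarrow> i_Uc c ! \<sigma> ! i ! j \<in> set (number_codes c)"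
  "l < m \<Longrightarrow> j < d \<Longrightarrow> i_Bc c ! l ! j \<in> set (number_codes c)"
  "i_lc c \<in> set (number_codes c)"
proof -
  show "j < d \<Longrightarrow> i_s0c c ! j \<in> set (number_codes c)" using code_lengths by (auto simp: set_number_codes)
  show "i_Uc c ! \<sigma> ! i ! j \<in> set (number_codes c)" if "\<sigma> < k" "i < d" "j < d"
  proof -
    have "i_Uc c ! \<sigma> \<in> set (i_Uc c)" "i_Uc c ! \<sigma> ! i \<in> set (i_Uc c ! \<sigma>)" "i_Uc c ! \<sigma> ! i ! j \<in> set (i_Uc c ! \<sigma> ! i)"
      using that code_lengths by auto
    then show ?thesis unfolding set_number_codes by blast
  qed
  show "i_Bc c ! l ! j \<in> set (number_codes c)" if "l < m" "j < d"
  proof -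
    have "i_Bc c ! l \<in> set (i_Bc c)" "i_Bc c ! l ! j \<in> set (i_Bc c ! l)" using that code_lengths by auto
    then show ?thesis unfolding set_number_codes by blast
  qed
  show "i_lc c \<in> set (number_codes c)" by (simp add: set_number_codes)
qed

definition code_point :: "(nat \<Rightarrow> real) \<Rightarrow> bool" where
  "code_point z \<longleftrightarrow> peval (code_constraints c) z = 0"

lemma peval_code_constraints: "peval (code_constraints c) z =
    (\<Sum>a<Suc c. if a \<in> set (number_codes c) then peval (algebraic_constraint a) z else (\<Sum>r<6. (z (6 * a + r))\<^sup>2))"
  unfolding code_constraints_def peval_concat_upt
  by (intro sum.cong refl) (simp only: if_distrib[of "\<lambda>p. peval p z"] peval_concat_upt peval_simps meval_simps
      fst_conv snd_conv of_int_1 mult_1 mult_1_right add_0_right power2_eq_square)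

lemma code_constraints_nonneg: "peval (code_constraints c) z \<ge> 0"
  unfolding peval_code_constraints by (intro sum_nonneg) (auto intro: peval_algebraic_constraint_nonneg sum_nonneg)

lemma code_point_iff: "code_point z \<longleftrightarrow> (\<forall>a\<le>c. if a \<in> set (number_codes c)
    then peval (algebraic_constraint a) z = 0 else \<forall>r<6. z (6 * a + r) = 0)"
proof -
  have "code_point z \<longleftrightarrow> (\<forall>a\<in>{..<Suc c}. (if a \<in> set (number_codes c) then peval (algebraic_constraint a) z
      else (\<Sum>r<6. (z (6 * a + r))\<^sup>2)) = 0)"
    unfolding code_point_def peval_code_constraints
    by (rule sum_nonneg_eq_0_iff) (auto intro: peval_algebraic_constraint_nonneg sum_nonneg)
  moreover have "(\<Sum>r<6. (z (6 * a + r))\<^sup>2) = 0 \<longleftrightarrow> (\<forall>r<6. z (6 * a + r) = 0)" for a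
    by (subst sum_nonneg_eq_0_iff) auto
  ultimately show ?thesis by (auto simp: less_Suc_eq_le)
qed

lemma code_point_value:
  assumes "code_point z" "a \<in> set (number_codes c)"
  shows "Complex (z (6 * a)) (z (Suc (6 * a))) = alg_val a"
  using assms algebraic_constraint_value[OF number_codes_ok[OF assms(2)], of z] number_codes_le[OF assms(2)]
  by (simp add: code_point_iff)

lemma code_point_bound:
  assumes z: "code_point z" and "i < state_base c"
  shows "\<bar>z i\<bar> \<le> real (box_radius c)"
proof -
  define a r where "a = i div 6" and "r = i mod 6"
  have i: "i = 6 * a + r" "r < 6" and a: "a \<le> c" using assms(2) by (auto simp: a_def r_def state_base_def)
  show ?thesis
  proof (cases "a \<in> set (number_codes c)")
    case True
    then have "peval (algebraic_constraint a) z = 0" using z a by (simp add: code_point_iff)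
    then have "\<bar>z i\<bar> \<le> real ((a + 2) ^ 3 + 1)"
      unfolding i(1) using i(2) by (rule algebraic_constraint_bound[OF number_codes_ok[OF True]])
    also have "\<dots> \<le> real (box_radius c)" using a unfolding box_radius_def by (intro of_nat_mono add_mono power_mono) auto
    finally show ?thesis .
  next
    case False
    then have "z i = 0" using z a i by (simp add: code_point_iff)
    then show ?thesis by simp
  qed
qed

lemma code_point_exists: "\<exists>z. code_point z"
proof
  let ?z = "\<lambda>i. if i div 6 \<in> set (number_codes c) then algebraic_solution (i div 6) (i mod 6) else 0"
  have index: "(6 * a + r) div 6 = a" "(6 * a + r) mod 6 = r" if "r < 6" for a r :: nat using that by auto
  show "code_point ?z" unfolding code_point_iff
  proof (intro allI impI)
    fix a
    show "if a \<in> set (number_codes c) then peval (algebraic_constraint a) ?z = 0 else \<forall>r<6. ?z (6 * a + r) = 0"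
      using index algebraic_constraint_solution[OF number_codes_ok, of a ?z] by simp
  qed
qed

definition code_vars :: "nat set" where
  "code_vars = (\<Union>a\<in>set (number_codes c). {6 * a, Suc (6 * a)})"

lemma code_vars_subset: "code_vars \<subseteq> {..<state_base c}"
  using number_codes_le by (fastforce simp: code_vars_def state_base_def)

lemma bases_le: "state_base c \<le> coeff_base c" "coeff_base c \<le> var_count c"
  by (simp_all add: coeff_base_def var_count_def)

lemma code_vars_subset_lessThan: "state_base c \<le> n \<Longrightarrow> code_vars \<subseteq> {..<n}"
  using code_vars_subset by auto

lemma vars_in_code_constraints: "vars_in {..<state_base c} (code_constraints c)"
proof -
  have "vars_in {..<state_base c} (algebraic_constraint a)" if "a \<le> c" for a
    using vars_in_algebraic_constraint by (rule vars_in_mono) (use that in \<open>auto simp: state_base_def\<close>)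
  moreover have "vars_in {..<state_base c} (concat (map (\<lambda>r. [(1, [6 * a + r, 6 * a + r])]) [0..<6]))" if "a \<le> c" for a
    using that by (auto simp: vars_in_def state_base_def)
  ultimately show ?thesis unfolding code_constraints_def vars_in_concat[of _ "map _ [0..<Suc c]"]
    by (auto simp del: upt_Suc simp: less_Suc_eq_le)
qed

lemma cpoly_vars_in_code: "code_vars \<subseteq> V \<Longrightarrow> a \<in> set (number_codes c) \<Longrightarrow> cpoly_vars_in V (cpoly_var (6 * a))"
  by (intro cpoly_vars_in_intros) (auto simp: code_vars_def)

lemma cpoly_vars_in_initial_polys: "code_vars \<subseteq> V \<Longrightarrow> j < d \<Longrightarrow> cpoly_vars_in V (total_nth (initial_polys c) j)"
  using code_lengths by (auto simp: initial_polys_def accessors intro!: cpoly_vars_in_code codes_in_number_codes)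

lemma cpeval_initial_polys: "code_point z \<Longrightarrow> j < d \<Longrightarrow> cpeval (total_nth (initial_polys c) j) z = i_s0 c j"
  using code_lengths by (auto simp: initial_polys_def accessors i_s0_def intro!: code_point_value codes_in_number_codes)

lemma cpoly_vars_in_step_polys:
  assumes "code_vars \<subseteq> V" "\<sigma> < k" "\<And>j. j < d \<Longrightarrow> cpoly_vars_in V (total_nth xs j)" "i < d"
  shows "cpoly_vars_in V (total_nth (step_polys c \<sigma> xs) i)"
  using assms code_lengths
  by (auto simp: step_polys_def accessors intro!: cpoly_vars_in_intros(1,4) cpoly_vars_in_code codes_in_number_codes)

lemma cpeval_step_polys:
  assumes "code_point z" "\<sigma> < k" "\<And>j. j < d \<Longrightarrow> cpeval (total_nth xs j) z = x j" "i < d"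
  shows "cpeval (total_nth (step_polys c \<sigma> xs) i) z = mat_vec d (i_U c \<sigma>) x i"
  using assms code_lengths unfolding mat_vec_def i_U_def
  by (simp add: step_polys_def accessors cpeval_sum_upt code_point_value[OF assms(1) codes_in_number_codes(2)])

definition span_vec :: "(nat \<Rightarrow> complex) \<Rightarrow> nat \<Rightarrow> complex" where
  "span_vec \<gamma> j = (\<Sum>l<m. \<gamma> l * (i_B c ! l) j)"

text \<open>Positive iff the normalised vector \<open>span_vec \<gamma>\<close> witnesses acceptance of the state \<open>x\<close>.\<close>

definition excess :: "(nat \<Rightarrow> complex) \<Rightarrow> (nat \<Rightarrow> complex) \<Rightarrow> real" where
  "excess \<gamma> x = (cmod (cinner d (span_vec \<gamma>) x))\<^sup>2 - i_lambda c * (\<Sum>j<d. (cmod (span_vec \<gamma> j))\<^sup>2)"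

lemma cpoly_vars_in_span_polys:
  assumes "code_vars \<subseteq> V" "\<And>l. l < m \<Longrightarrow> cpoly_vars_in V (total_nth \<gamma>s l)" "j < d"
  shows "cpoly_vars_in V (total_nth (span_polys c \<gamma>s) j)"
  using assms code_lengths
  by (auto simp: span_polys_def accessors intro!: cpoly_vars_in_intros(1,4) cpoly_vars_in_code codes_in_number_codes)

lemma cpeval_span_polys:
  assumes "code_point z" "\<And>l. l < m \<Longrightarrow> cpeval (total_nth \<gamma>s l) z = \<gamma> l" "j < d"
  shows "cpeval (total_nth (span_polys c \<gamma>s) j) z = span_vec \<gamma> j"
  using assms code_lengths unfolding span_vec_def i_B_def
  by (simp add: span_polys_def accessors cpeval_sum_upt code_point_value[OF assms(1) codes_in_number_codes(3)])

lemma peval_excess_poly: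
  assumes z: "code_point z" and \<gamma>: "\<And>l. l < m \<Longrightarrow> cpeval (total_nth \<gamma>s l) z = \<gamma> l"
    and x: "\<And>j. j < d \<Longrightarrow> cpeval (total_nth xs j) z = x j"
  shows "peval (excess_poly c \<gamma>s xs) z = excess \<gamma> x"
proof -
  have "z (6 * i_lc c) = i_lambda c"
    using code_point_value[OF z codes_in_number_codes(4)] by (simp add: i_lambda_def complex_eq_iff)
  then show ?thesis unfolding excess_poly_def excess_def cinner_def accessors
    by (simp add: peval_concat_upt cpeval_sum_upt cpeval_span_polys[OF z \<gamma>] x)
qed

lemma vars_in_excess_poly:
  assumes V: "code_vars \<subseteq> V" and "\<And>l. l < m \<Longrightarrow> cpoly_vars_in V (total_nth \<gamma>s l)"
    "\<And>j. j < d \<Longrightarrow> cpoly_vars_in V (total_nth xs j)"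
  shows "vars_in V (excess_poly c \<gamma>s xs)"
proof -
  have span: "cpoly_vars_in V (total_nth (span_polys c \<gamma>s) j)" if "j < d" for j
    using assms(1,2) that by (rule cpoly_vars_in_span_polys)
  have "6 * i_lc c \<in> V"
    using cpoly_vars_in_code[OF V codes_in_number_codes(4)] by (simp add: cpoly_vars_in_def cpoly_var_def)
  then show ?thesis unfolding excess_poly_def accessors vars_in_simps using span assms(3)
    by (intro conjI vars_in_cpoly_norm_sq vars_in_pscale vars_in_pmult)
      (auto simp: vars_in_concat intro!: vars_in_cpoly_norm_sq cpoly_vars_in_intros(1,3,4))
qed

lemma span_vec_scale: "span_vec (\<lambda>l. complex_of_real t * \<gamma> l) = (\<lambda>j. complex_of_real t * span_vec \<gamma> j)"
  by (simp add: span_vec_def fun_eq_iff sum_distrib_left mult.assoc)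

lemma excess_scale: "excess (\<lambda>l. complex_of_real t * \<gamma> l) x = t\<^sup>2 * excess \<gamma> x"
proof -
  have "cinner d (\<lambda>j. complex_of_real t * span_vec \<gamma> j) x = complex_of_real t * cinner d (span_vec \<gamma>) x"
    by (simp add: cinner_def sum_distrib_left mult.assoc)
  moreover have "(\<Sum>j<d. (cmod (complex_of_real t * span_vec \<gamma> j))\<^sup>2) = t\<^sup>2 * (\<Sum>j<d. (cmod (span_vec \<gamma> j))\<^sup>2)"
    by (simp add: norm_mult power_mult_distrib sum_distrib_left)
  ultimately show ?thesis by (simp add: excess_def span_vec_scale norm_mult power_mult_distrib algebra_simps)
qed

lemma excess_cong:
  assumes "\<And>l. l < m \<Longrightarrow> \<gamma> l = \<gamma>' l" "\<And>j. j < d \<Longrightarrow> x j = x' j"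
  shows "excess \<gamma> x = excess \<gamma>' x'"
proof -
  have "span_vec \<gamma> = span_vec \<gamma>'" unfolding span_vec_def using assms(1) by (intro ext sum.cong) auto
  moreover have "cinner d (span_vec \<gamma>') x = cinner d (span_vec \<gamma>') x'"
    unfolding cinner_def using assms(2) by (intro sum.cong) auto
  ultimately show ?thesis by (simp add: excess_def)
qed

lemma tendsto_excess:
  assumes "\<And>l. l < m \<Longrightarrow> ((\<lambda>s. \<gamma>s s l) \<longlongrightarrow> \<gamma> l) F" "\<And>j. j < d \<Longrightarrow> ((\<lambda>s. xs s j) \<longlongrightarrow> x j) F"
  shows "((\<lambda>s. excess (\<gamma>s s) (xs s)) \<longlongrightarrow> excess \<gamma> x) F"
  unfolding excess_def cinner_def span_vec_def by (intro tendsto_intros assms) auto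

lemma excess_unit_span:
  "unit_vec d (span_vec \<gamma>) \<Longrightarrow> excess \<gamma> x = (cmod (cinner d (span_vec \<gamma>) x))\<^sup>2 - i_lambda c"
  by (simp add: excess_def Defs.unit_vec_def)

lemma accepting_vector_iff_excess_pos:
  "(\<exists>\<psi>. unit_vec d \<psi> \<and> in_span d (i_B c) \<psi> \<and> (cmod (cinner d \<psi> x))\<^sup>2 > i_lambda c) \<longleftrightarrow> (\<exists>\<gamma>. excess \<gamma> x > 0)"
proof
  assume "\<exists>\<psi>. unit_vec d \<psi> \<and> in_span d (i_B c) \<psi> \<and> (cmod (cinner d \<psi> x))\<^sup>2 > i_lambda c"
  then obtain \<psi> \<gamma> where \<psi>: "unit_vec d \<psi>" "(cmod (cinner d \<psi> x))\<^sup>2 > i_lambda c"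
    and "\<forall>j<d. \<psi> j = (\<Sum>l<m. \<gamma> l * (i_B c ! l) j)" by (auto simp: in_span_def i_B_def)
  then have eq: "span_vec \<gamma> j = \<psi> j" if "j < d" for j using that by (simp add: span_vec_def)
  have "cinner d (span_vec \<gamma>) x = cinner d \<psi> x" unfolding cinner_def using eq by (intro sum.cong) auto
  moreover have "unit_vec d (span_vec \<gamma>)" using eq \<psi>(1) by (simp add: Defs.unit_vec_def)
  ultimately show "\<exists>\<gamma>. excess \<gamma> x > 0" using \<psi>(2) by (intro exI[of _ \<gamma>]) (simp add: excess_unit_span)
next
  assume "\<exists>\<gamma>. excess \<gamma> x > 0"
  then obtain \<gamma> where pos: "excess \<gamma> x > 0" by blast
  have "\<exists>j<d. span_vec \<gamma> j \<noteq> 0"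
  proof (rule ccontr)
    assume "\<not> (\<exists>j<d. span_vec \<gamma> j \<noteq> 0)"
    then have "excess \<gamma> x = 0" by (simp add: excess_def cinner_def)
    with pos show False by simp
  qed
  then obtain t where "t > 0" and unit: "unit_vec d (\<lambda>j. complex_of_real t * span_vec \<gamma> j)" by (rule unit_multiple)
  let ?\<gamma> = "\<lambda>l. complex_of_real t * \<gamma> l"
  have "excess ?\<gamma> x > 0" using pos \<open>t > 0\<close> by (simp add: excess_scale)
  then have "(cmod (cinner d (span_vec ?\<gamma>) x))\<^sup>2 > i_lambda c" using unit by (simp add: excess_unit_span span_vec_scale)
  moreover have "in_span d (i_B c) (span_vec ?\<gamma>)"
    unfolding in_span_def span_vec_def by (intro exI[of _ ?\<gamma>]) (simp add: i_B_def)
  ultimately show "\<exists>\<psi>. unit_vec d \<psi> \<and> in_span d (i_B c) \<psi> \<and> (cmod (cinner d \<psi> x))\<^sup>2 > i_lambda c"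
    using unit unfolding span_vec_scale[symmetric] by (intro exI[of _ "span_vec ?\<gamma>"] conjI)
qed

lemma excess_nonpos_if_unit:
  assumes "\<And>\<gamma>. unit_vec m \<gamma> \<Longrightarrow> excess \<gamma> x \<le> 0"
  shows "excess \<gamma> x \<le> 0"
proof (cases "\<exists>l<m. \<gamma> l \<noteq> 0")
  case True
  then obtain t where "t > 0" "unit_vec m (\<lambda>l. complex_of_real t * \<gamma> l)" by (rule unit_multiple)
  then have "t\<^sup>2 * excess \<gamma> x \<le> 0" using assms by (simp only: excess_scale[symmetric])
  then show ?thesis using \<open>t > 0\<close> by (simp add: mult_le_0_iff)
next
  case False
  then have "excess \<gamma> x = excess (\<lambda>l. complex_of_real 0 * \<gamma> l) x" by (intro excess_cong) auto
  also have "\<dots> = 0" unfolding excess_scale by simp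
  finally show ?thesis by simp
qed

lemma excess_pos_gaussian_coeffs:
  assumes "excess \<gamma> x > 0"
  shows "\<exists>\<gamma>'. excess (gaussian_coeffs \<gamma>') x > 0"
proof -
  define f where "f N l = Complex (of_int \<lfloor>real N * Re (\<gamma> l)\<rfloor>) (of_int \<lfloor>real N * Im (\<gamma> l)\<rfloor>)" for N l
  have "(\<lambda>N. complex_of_real (1 / real N) * f N l) \<longlonglongrightarrow> \<gamma> l" for l
  proof -
    have "complex_of_real (1 / real N) * f N l
      = Complex (of_int \<lfloor>real N * Re (\<gamma> l)\<rfloor> / real N) (of_int \<lfloor>real N * Im (\<gamma> l)\<rfloor> / real N)" for N
      by (simp add: f_def complex_eq_iff)
    then show ?thesis
      using tendsto_Complex[OF floor_multiple_div_tendsto[of "Re (\<gamma> l)"] floor_multiple_div_tendsto[of "Im (\<gamma> l)"]]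
      by simp
  qed
  then have "(\<lambda>N. excess (\<lambda>l. complex_of_real (1 / real N) * f N l) x) \<longlonglongrightarrow> excess \<gamma> x"
    by (intro tendsto_excess) auto
  then have "\<forall>\<^sub>F N in sequentially. excess (\<lambda>l. complex_of_real (1 / real N) * f N l) x > 0"
    using assms by (rule order_tendstoD)
  then obtain N where "excess (\<lambda>l. complex_of_real (1 / real N) * f N l) x > 0"
    using eventually_happens[of _ sequentially] by auto
  then have "excess (f N) x > 0" unfolding excess_scale by (simp add: zero_less_mult_iff)
  moreover define \<gamma>' where "\<gamma>' = map (\<lambda>l. (\<lfloor>real N * Re (\<gamma> l)\<rfloor>, \<lfloor>real N * Im (\<gamma> l)\<rfloor>)) [0..<m]"
  have "excess (gaussian_coeffs \<gamma>') x = excess (f N) x"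
    by (rule excess_cong) (auto simp: gaussian_coeffs_def f_def \<gamma>'_def)
  ultimately show ?thesis by (intro exI[of _ \<gamma>']) simp
qed

end

section \<open>Correctness of the two searches\<close>

context valid_instance
begin

definition with_state :: "(nat \<Rightarrow> real) \<Rightarrow> (nat \<Rightarrow> complex) \<Rightarrow> (nat \<Rightarrow> complex) \<Rightarrow> nat \<Rightarrow> real" where
  "with_state z x \<gamma> i = (if i < state_base c then z i
     else if i < coeff_base c then realify d x (i - state_base c) else realify m \<gamma> (i - coeff_base c))"

lemma coeff_base_eq: "coeff_base c = state_base c + 2 * d"
  by (simp add: coeff_base_def accessors)

lemma var_count_eq: "var_count c = state_base c + 2 * d + 2 * m"
  by (simp add: var_count_def coeff_base_def accessors)

lemma peval_code_constraints_with_state [simp]: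
  "peval (code_constraints c) (with_state z x \<gamma>) = peval (code_constraints c) z"
  by (rule peval_cong[OF vars_in_code_constraints]) (simp add: with_state_def)

lemma code_point_with_state [simp]: "code_point (with_state z x \<gamma>) \<longleftrightarrow> code_point z"
  by (simp add: code_point_def)

lemma with_state_with_state [simp]: "with_state (with_state z x \<gamma>) x' \<gamma>' = with_state z x' \<gamma>'"
  by (auto simp: with_state_def fun_eq_iff)

lemma cpeval_state_vars_with_state: "j < d \<Longrightarrow> cpeval (total_nth (state_vars c) j) (with_state z x \<gamma>) = x j"
  by (simp add: state_vars_def accessors with_state_def coeff_base_eq)

lemma cpeval_coeff_vars_with_state: "l < m \<Longrightarrow> cpeval (total_nth (coeff_vars c) l) (with_state z x \<gamma>) = \<gamma> l"
  by (simp add: coeff_vars_def accessors with_state_def coeff_base_eq)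

lemma ex_with_state: "\<exists>x \<gamma>. \<forall>i<var_count c. z i = with_state z x \<gamma> i"
proof (intro exI allI impI)
  fix i assume "i < var_count c"
  then show "z i = with_state z (complexify (\<lambda>i. z (state_base c + i))) (complexify (\<lambda>i. z (coeff_base c + i))) i"
    by (auto simp: with_state_def var_count_eq coeff_base_eq realify_complexify)
qed

lemma cpoly_vars_in_state_vars: "j < d \<Longrightarrow> cpoly_vars_in {..<coeff_base c} (total_nth (state_vars c) j)"
  by (auto simp: state_vars_def accessors coeff_base_eq intro!: cpoly_vars_in_intros)

lemma cpoly_vars_in_coeff_vars: "l < m \<Longrightarrow> cpoly_vars_in {..<var_count c} (total_nth (coeff_vars c) l)"
  by (auto simp: coeff_vars_def accessors coeff_base_eq var_count_eq intro!: cpoly_vars_in_intros)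

definition vanishes :: "ipoly \<Rightarrow> (nat \<Rightarrow> real) \<Rightarrow> (nat \<Rightarrow> complex) \<Rightarrow> bool" where
  "vanishes q z x \<longleftrightarrow> peval q (with_state z x (\<lambda>_. 0)) = 0"

lemma peval_with_state_cong:
  assumes "vars_in {..<coeff_base c} q" "\<And>j. j < d \<Longrightarrow> x j = x' j"
  shows "peval q (with_state z x \<gamma>) = peval q (with_state z x' \<gamma>')"
  using assms(1) by (rule peval_cong) (auto simp: with_state_def realify_def assms(2) coeff_base_eq)

lemma peval_state_subst:
  assumes q: "vars_in {..<coeff_base c} q" and xs: "\<And>j. j < d \<Longrightarrow> cpeval (total_nth xs j) z = x j"
  shows "peval (psubst (state_subst c xs) q) z = peval q (with_state z x \<gamma>)"
  unfolding peval_psubst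
proof (rule peval_cong[OF q])
  fix i assume "i \<in> {..<coeff_base c}"
  then have "i < state_base c \<or> (i - state_base c) div 2 < d" by (auto simp: coeff_base_eq)
  then show "peval (state_subst c xs i) z = with_state z x \<gamma> i"
    using \<open>i \<in> _\<close> xs[of "(i - state_base c) div 2"]
    by (auto simp: state_subst_def with_state_def realify_def cpeval_def coeff_base_eq even_iff_mod_2_eq_zero
        complex_eq_iff)
qed

lemma vars_in_state_subst:
  assumes q: "vars_in {..<coeff_base c} q" and "state_base c \<le> n"
    and xs: "\<And>j. j < d \<Longrightarrow> cpoly_vars_in {..<n} (total_nth xs j)"
  shows "vars_in {..<n} (psubst (state_subst c xs) q)"
proof (rule vars_in_psubst[OF q])
  fix i assume "i \<in> {..<coeff_base c}"
  then have "i < state_base c \<or> (i - state_base c) div 2 < d" by (auto simp: coeff_base_eq)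
  then show "vars_in {..<n} (state_subst c xs i)"
    using \<open>state_base c \<le> n\<close> xs[of "(i - state_base c) div 2"] by (auto simp: state_subst_def cpoly_vars_in_def)
qed

lemma peval_state_variety: "peval (state_variety c q) (with_state z x \<gamma>) =
    peval (code_constraints c) z + ((peval q (with_state z x \<gamma>))\<^sup>2 + ((\<Sum>j<d. (cmod (x j))\<^sup>2) - 1)\<^sup>2)"
proof -
  have "state_vars c = map (\<lambda>j. total_nth (state_vars c) j) [0..<d]"
    by (rule nth_equalityI) (simp_all add: state_vars_def accessors)
  then have "peval (sphere_poly (state_vars c)) (with_state z x \<gamma>) = ((\<Sum>j<d. (cmod (x j))\<^sup>2) - 1)\<^sup>2"
    using peval_sphere_poly[of "\<lambda>j. total_nth (state_vars c) j" d "with_state z x \<gamma>"]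
    by (simp add: cpeval_state_vars_with_state)
  then show ?thesis by (simp add: state_variety_def)
qed

lemma peval_coeff_sphere:
  "peval (sphere_poly (coeff_vars c)) (with_state z x \<gamma>) = ((\<Sum>l<m. (cmod (\<gamma> l))\<^sup>2) - 1)\<^sup>2"
proof -
  have "coeff_vars c = map (\<lambda>l. total_nth (coeff_vars c) l) [0..<m]"
    by (rule nth_equalityI) (simp_all add: coeff_vars_def accessors)
  then show ?thesis
    using peval_sphere_poly[of "\<lambda>l. total_nth (coeff_vars c) l" m "with_state z x \<gamma>"]
    by (simp add: cpeval_coeff_vars_with_state)
qed

lemma state_variety_eq_0_iff:
  assumes "vars_in {..<coeff_base c} q"
  shows "peval (state_variety c q) (with_state z x \<gamma>) = 0 \<longleftrightarrow> code_point z \<and> vanishes q z x \<and> unit_vec d x"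
proof -
  have "peval (code_constraints c) z + ((peval q (with_state z x \<gamma>))\<^sup>2 + ((\<Sum>j<d. (cmod (x j))\<^sup>2) - 1)\<^sup>2) = 0 \<longleftrightarrow>
      peval (code_constraints c) z = 0 \<and> peval q (with_state z x \<gamma>) = 0 \<and> (\<Sum>j<d. (cmod (x j))\<^sup>2) = 1"
    by (subst add_nonneg_eq_0_iff) (auto simp: code_constraints_nonneg add_nonneg_eq_0_iff)
  moreover have "peval q (with_state z x \<gamma>) = peval q (with_state z x (\<lambda>_. 0))"
    by (rule peval_with_state_cong[OF assms refl])
  ultimately show ?thesis
    by (simp only: peval_state_variety vanishes_def code_point_def Defs.unit_vec_def)
qed

lemma state_variety_nonneg: "peval (state_variety c q) z \<ge> 0"
  using code_constraints_nonneg[of z] by (simp add: state_variety_def sphere_poly_def)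

lemma full_variety_nonneg: "peval (state_variety c q @ sphere_poly (coeff_vars c)) z \<ge> 0"
  unfolding peval_simps sphere_poly_def peval_psquare
  by (intro add_nonneg_nonneg state_variety_nonneg zero_le_power2)

lemma full_variety_eq_0_iff:
  assumes "vars_in {..<coeff_base c} q"
  shows "peval (state_variety c q @ sphere_poly (coeff_vars c)) (with_state z x \<gamma>) = 0 \<longleftrightarrow>
    code_point z \<and> vanishes q z x \<and> unit_vec d x \<and> unit_vec m \<gamma>"
proof -
  have "peval (state_variety c q @ sphere_poly (coeff_vars c)) (with_state z x \<gamma>) = 0 \<longleftrightarrow>
      peval (state_variety c q) (with_state z x \<gamma>) = 0 \<and> ((\<Sum>l<m. (cmod (\<gamma> l))\<^sup>2) - 1)\<^sup>2 = 0"
    unfolding peval_simps peval_coeff_sphere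
    by (rule add_nonneg_eq_0_iff) (simp_all add: state_variety_nonneg)
  then show ?thesis by (auto simp: state_variety_eq_0_iff[OF assms] Defs.unit_vec_def)
qed

lemma vars_in_state_variety:
  assumes "vars_in {..<coeff_base c} q"
  shows "vars_in {..<coeff_base c} (state_variety c q)"
  unfolding state_variety_def vars_in_simps
  using assms vars_in_mono[OF vars_in_code_constraints] bases_le(1)
  by (auto simp: state_vars_def accessors coeff_base_eq intro!: vars_in_sphere_poly cpoly_vars_in_intros)

lemma vars_in_full_variety:
  assumes "vars_in {..<coeff_base c} q"
  shows "vars_in {..<var_count c} (state_variety c q @ sphere_poly (coeff_vars c))"
  unfolding vars_in_simps using vars_in_mono[OF vars_in_state_variety[OF assms]] bases_le(2)
  by (auto simp: coeff_vars_def accessors var_count_eq coeff_base_eq intro!: vars_in_sphere_poly cpoly_vars_in_intros)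

lemma box_radius_ge_1: "1 \<le> box_radius c"
  by (simp add: box_radius_def)

lemma abs_with_state_le:
  assumes z: "code_point z" and x: "unit_vec d x" and \<gamma>: "i < coeff_base c \<or> unit_vec m \<gamma>"
  shows "\<bar>with_state z x \<gamma> i\<bar> \<le> real (box_radius c)"
proof -
  consider (code) "i < state_base c" | (state) "state_base c \<le> i" "i < coeff_base c" | (coeff) "coeff_base c \<le> i"
    by linarith
  then show ?thesis
  proof cases
    case code
    then show ?thesis using code_point_bound[OF z] by (simp add: with_state_def)
  next
    case state
    then have "\<bar>with_state z x \<gamma> i\<bar> \<le> 1" using abs_realify_le_1[OF x] by (simp add: with_state_def)
    with box_radius_ge_1 show ?thesis by simp
  next
    case coeff
    then have "\<bar>with_state z x \<gamma> i\<bar> \<le> 1" using \<gamma> abs_realify_le_1[of m \<gamma>] bases_le(1) by (simp add: with_state_def)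
    with box_radius_ge_1 show ?thesis by simp
  qed
qed

lemma certified_nonpos_with_state:
  assumes n: "n \<le> var_count c" and vars: "vars_in {..<n} p" "vars_in {..<n} h" and nonneg: "\<And>z. peval p z \<ge> 0"
    and zero: "\<And>z x \<gamma>. peval p (with_state z x \<gamma>) = 0 \<Longrightarrow>
      code_point z \<and> unit_vec d x \<and> (n \<le> coeff_base c \<or> unit_vec m \<gamma>)"
  shows "certified_nonpos n (box_radius c) p h \<longleftrightarrow>
    (\<forall>z x \<gamma>. peval p (with_state z x \<gamma>) = 0 \<longrightarrow> peval h (with_state z x \<gamma>) \<le> 0)"
proof -
  have eq: "\<exists>x \<gamma>. (\<forall>i<n. z i = with_state z x \<gamma> i) \<and>
    (\<forall>P. vars_in {..<n} P \<longrightarrow> peval P z = peval P (with_state z x \<gamma>))" for z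
  proof -
    obtain x \<gamma> where eq: "\<forall>i<n. z i = with_state z x \<gamma> i" using ex_with_state[of z] n by (meson less_le_trans)
    then have "vars_in {..<n} P \<longrightarrow> peval P z = peval P (with_state z x \<gamma>)" for P by (auto intro: peval_cong)
    with eq show ?thesis by blast
  qed
  have "certified_nonpos n (box_radius c) p h \<longleftrightarrow> (\<forall>z. peval p z = 0 \<longrightarrow> peval h z \<le> 0)"
  proof (rule certified_nonpos_iff[OF vars nonneg _ box_radius_ge_1])
    fix z i assume "peval p z = 0" "i < n"
    obtain x \<gamma> where "\<forall>i<n. z i = with_state z x \<gamma> i"
      and "\<forall>P. vars_in {..<n} P \<longrightarrow> peval P z = peval P (with_state z x \<gamma>)" using eq[of z] by (elim exE conjE)
    then have i: "z i = with_state z x \<gamma> i" and "peval p (with_state z x \<gamma>) = 0"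
      using \<open>i < n\<close> vars(1) \<open>peval p z = 0\<close> by auto
    with zero[of z x \<gamma>] have "code_point z" "unit_vec d x" "i < coeff_base c \<or> unit_vec m \<gamma>"
      using \<open>i < n\<close> by auto
    then show "\<bar>z i\<bar> \<le> real (box_radius c)" unfolding i by (rule abs_with_state_le)
  qed
  also have "\<dots> \<longleftrightarrow> (\<forall>z x \<gamma>. peval p (with_state z x \<gamma>) = 0 \<longrightarrow> peval h (with_state z x \<gamma>) \<le> 0)"
    using eq vars by metis
  finally show ?thesis .
qed

definition invariant :: "ipoly \<Rightarrow> bool" where
  "invariant q \<longleftrightarrow> vars_in {..<coeff_base c} q \<and>
     (\<forall>z. code_point z \<longrightarrow> vanishes q z (i_s0 c)) \<and>
     (\<forall>\<sigma><k. \<forall>z x. code_point z \<and> vanishes q z x \<and> unit_vec d x \<longrightarrow> vanishes q z (mat_vec d (i_U c \<sigma>) x)) \<and>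
     (\<forall>z x \<gamma>. code_point z \<and> vanishes q z x \<and> unit_vec d x \<and> unit_vec m \<gamma> \<longrightarrow> excess \<gamma> x \<le> 0)"

lemma certified_initial_iff:
  assumes q: "vars_in {..<coeff_base c} q"
  shows "certified_nonpos (state_base c) (box_radius c) (code_constraints c)
      (psquare (psubst (state_subst c (initial_polys c)) q)) \<longleftrightarrow> (\<forall>z. code_point z \<longrightarrow> vanishes q z (i_s0 c))"
proof -
  let ?h = "psubst (state_subst c (initial_polys c)) q"
  have "vars_in {..<state_base c} ?h"
    by (rule vars_in_state_subst[OF q order_refl cpoly_vars_in_initial_polys[OF code_vars_subset]])
  then have "certified_nonpos (state_base c) (box_radius c) (code_constraints c) (psquare ?h) \<longleftrightarrow>
      (\<forall>z. peval (code_constraints c) z = 0 \<longrightarrow> peval (psquare ?h) z \<le> 0)"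
    by (intro certified_nonpos_iff vars_in_code_constraints vars_in_psquare code_constraints_nonneg
        code_point_bound[unfolded code_point_def] box_radius_ge_1)
  also have "\<dots> \<longleftrightarrow> (\<forall>z. code_point z \<longrightarrow> vanishes q z (i_s0 c))"
    unfolding vanishes_def code_point_def[symmetric]
    using peval_state_subst[OF q cpeval_initial_polys, where \<gamma> = "\<lambda>_. 0"] by simp
  finally show ?thesis .
qed

lemma certified_step_iff:
  assumes q: "vars_in {..<coeff_base c} q" and "\<sigma> < k"
  shows "certified_nonpos (coeff_base c) (box_radius c) (state_variety c q)
      (psquare (psubst (state_subst c (step_polys c \<sigma> (state_vars c))) q)) \<longleftrightarrow>
    (\<forall>z x. code_point z \<and> vanishes q z x \<and> unit_vec d x \<longrightarrow> vanishes q z (mat_vec d (i_U c \<sigma>) x))"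
proof -
  let ?h = "psubst (state_subst c (step_polys c \<sigma> (state_vars c))) q"
  have "vars_in {..<coeff_base c} ?h"
    by (rule vars_in_state_subst[OF q bases_le(1) cpoly_vars_in_step_polys[OF
          code_vars_subset_lessThan[OF bases_le(1)] \<open>\<sigma> < k\<close> cpoly_vars_in_state_vars]])
  then have "certified_nonpos (coeff_base c) (box_radius c) (state_variety c q) (psquare ?h) \<longleftrightarrow>
      (\<forall>z x \<gamma>. peval (state_variety c q) (with_state z x \<gamma>) = 0 \<longrightarrow> peval (psquare ?h) (with_state z x \<gamma>) \<le> 0)"
    using bases_le(2) vars_in_state_variety[OF q] state_variety_nonneg
    by (intro certified_nonpos_with_state) (auto simp: state_variety_eq_0_iff[OF q])
  also have "\<dots> \<longleftrightarrow> (\<forall>z x. code_point z \<and> vanishes q z x \<and> unit_vec d x \<longrightarrow> vanishes q z (mat_vec d (i_U c \<sigma>) x))"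
  proof -
    have "peval ?h (with_state z x \<gamma>) = peval q (with_state z (mat_vec d (i_U c \<sigma>) x) (\<lambda>_. 0))"
      if "code_point z" for z x \<gamma>
    proof -
      have "code_point (with_state z x \<gamma>)" using that by simp
      from peval_state_subst[OF q cpeval_step_polys[OF this \<open>\<sigma> < k\<close> cpeval_state_vars_with_state], where \<gamma> = "\<lambda>_. 0"]
      show ?thesis by simp
    qed
    then show ?thesis by (auto simp: state_variety_eq_0_iff[OF q] vanishes_def)
  qed
  finally show ?thesis .
qed

lemma certified_excess_iff:
  assumes q: "vars_in {..<coeff_base c} q"
  shows "certified_nonpos (var_count c) (box_radius c) (state_variety c q @ sphere_poly (coeff_vars c))
      (excess_poly c (coeff_vars c) (state_vars c)) \<longleftrightarrow>
    (\<forall>z x \<gamma>. code_point z \<and> vanishes q z x \<and> unit_vec d x \<and> unit_vec m \<gamma> \<longrightarrow> excess \<gamma> x \<le> 0)"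
proof -
  have "cpoly_vars_in {..<var_count c} (total_nth (state_vars c) j)" if "j < d" for j
    using cpoly_vars_in_state_vars[OF that] by (rule cpoly_vars_in_mono) (simp add: bases_le)
  then have "vars_in {..<var_count c} (excess_poly c (coeff_vars c) (state_vars c))"
    using code_vars_subset_lessThan[OF order_trans[OF bases_le]] cpoly_vars_in_coeff_vars
    by (intro vars_in_excess_poly)
  then have "certified_nonpos (var_count c) (box_radius c) (state_variety c q @ sphere_poly (coeff_vars c))
      (excess_poly c (coeff_vars c) (state_vars c)) \<longleftrightarrow>
    (\<forall>z x \<gamma>. peval (state_variety c q @ sphere_poly (coeff_vars c)) (with_state z x \<gamma>) = 0 \<longrightarrow>
      peval (excess_poly c (coeff_vars c) (state_vars c)) (with_state z x \<gamma>) \<le> 0)"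
    by (rule certified_nonpos_with_state[OF order_refl vars_in_full_variety[OF q] _ full_variety_nonneg])
      (simp add: full_variety_eq_0_iff[OF q] del: peval_simps)
  also have "\<dots> \<longleftrightarrow> (\<forall>z x \<gamma>. code_point z \<and> vanishes q z x \<and> unit_vec d x \<and> unit_vec m \<gamma> \<longrightarrow> excess \<gamma> x \<le> 0)"
  proof -
    have "peval (excess_poly c (coeff_vars c) (state_vars c)) (with_state z x \<gamma>) = excess \<gamma> x"
      if "code_point z" for z x \<gamma>
      using that by (intro peval_excess_poly cpeval_coeff_vars_with_state cpeval_state_vars_with_state) simp_all
    then show ?thesis unfolding full_variety_eq_0_iff[OF q] by auto
  qed
  finally show ?thesis .
qed

lemma invariant_certificate_iff: "invariant_certificate c q \<longleftrightarrow> invariant q"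
proof -
  have vars: "(\<forall>t\<in>set q. \<forall>i\<in>set (snd t). i < coeff_base c) \<longleftrightarrow> vars_in {..<coeff_base c} q"
    by (auto simp: vars_in_def)
  show ?thesis unfolding invariant_certificate_def invariant_def vars accessors
    using certified_initial_iff[of q] certified_step_iff[of q] certified_excess_iff[of q] by auto
qed

end

locale instance_with_letters = valid_instance +
  assumes letters: "i_k c > 0"
begin

sublocale qautomaton "i_d c" "i_k c" "i_U c" "i_s0 c"
  using valid letters by unfold_locales (auto simp: valid_inst_def)

lemma cpeval_run_polys:
  assumes z: "code_point z" and "u \<in> words" "j < d"
  shows "cpeval (total_nth (run_polys c u) j) z = run_word u (i_s0 c) j"
  using assms(2,3)
proof (induction u arbitrary: j rule: rev_induct)
  case Nil
  then show ?case by (simp add: run_polys_def cpeval_initial_polys[OF z])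
next
  case (snoc \<sigma> u)
  have "cpeval (total_nth (step_polys c \<sigma> (run_polys c u)) j) z = mat_vec d (i_U c \<sigma>) (run_word u (i_s0 c)) j"
    using snoc by (intro cpeval_step_polys[OF z]) auto
  then show ?case by (simp add: run_polys_def)
qed

lemma cpoly_vars_in_run_polys:
  assumes V: "code_vars \<subseteq> V" and "u \<in> words" "j < d"
  shows "cpoly_vars_in V (total_nth (run_polys c u) j)"
  using assms(2,3)
proof (induction u arbitrary: j rule: rev_induct)
  case Nil
  then show ?case by (simp add: run_polys_def cpoly_vars_in_initial_polys[OF V])
next
  case (snoc \<sigma> u)
  have "cpoly_vars_in V (total_nth (step_polys c \<sigma> (run_polys c u)) j)"
    using snoc by (intro cpoly_vars_in_step_polys[OF V]) auto
  then show ?case by (simp add: run_polys_def)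
qed

abbreviation run_excess_poly :: "nat list \<Rightarrow> (int \<times> int) list \<Rightarrow> ipoly" where
  "run_excess_poly u \<gamma> \<equiv> excess_poly c (map (\<lambda>p. cpoly_const (fst p) (snd p)) \<gamma>) (run_polys c u)"

lemma peval_run_excess_poly:
  assumes "code_point z" "u \<in> words"
  shows "peval (run_excess_poly u \<gamma>) z = excess (gaussian_coeffs \<gamma>) (run_word u (i_s0 c))"
  using assms by (intro peval_excess_poly cpeval_cpoly_const_list cpeval_run_polys)

lemma vars_in_run_excess_poly: "u \<in> words \<Longrightarrow> vars_in {..<state_base c} (run_excess_poly u \<gamma>)"
  by (intro vars_in_excess_poly code_vars_subset cpoly_vars_in_cpoly_const_list cpoly_vars_in_run_polys)

lemma accepting_run_certificate_sound:
  assumes u: "u \<in> words" and cert: "accepting_run_certificate c u \<gamma> K s"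
  shows "excess (gaussian_coeffs \<gamma>) (run_word u (i_s0 c)) > 0"
proof -
  obtain z where z: "code_point z" using code_point_exists by blast
  have "peval (pscale (int K) (code_constraints c) @ run_excess_poly u \<gamma>) z > 0"
  proof (rule positive_on_grid_sound[OF _ box_radius_ge_1 cert[unfolded accepting_run_certificate_def]])
    show "vars_in {..<state_base c} (pscale (int K) (code_constraints c) @ run_excess_poly u \<gamma>)"
      using vars_in_code_constraints vars_in_run_excess_poly[OF u] by simp
  qed (rule code_point_bound[OF z])
  then show ?thesis using z by (simp add: peval_run_excess_poly[OF z u] code_point_def)
qed

lemma accepting_run_certificate_complete:
  assumes u: "u \<in> words" and pos: "excess (gaussian_coeffs \<gamma>) (run_word u (i_s0 c)) > 0"
  shows "\<exists>K s. accepting_run_certificate c u \<gamma> K s"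
proof -
  have vars: "vars_in {..<state_base c} (code_constraints c)" "vars_in {..<state_base c} (run_excess_poly u \<gamma>)"
    using vars_in_code_constraints vars_in_run_excess_poly[OF u] by auto
  have "\<exists>K::nat. \<forall>z. (\<forall>i<state_base c. \<bar>z i\<bar> \<le> real (box_radius c)) \<longrightarrow>
      real K * peval (code_constraints c) z + peval (run_excess_poly u \<gamma>) z > 0"
    by (rule penalized_positive_on_cube[OF vars code_constraints_nonneg])
      (use peval_run_excess_poly[OF _ u] pos in \<open>simp add: code_point_def\<close>)
  then obtain K :: nat where K: "\<And>z. (\<forall>i<state_base c. \<bar>z i\<bar> \<le> real (box_radius c)) \<Longrightarrow>
      real K * peval (code_constraints c) z + peval (run_excess_poly u \<gamma>) z > 0" by blast
  have "\<exists>s. positive_on_grid (state_base c) (box_radius c)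
      (pscale (int K) (code_constraints c) @ run_excess_poly u \<gamma>) s"
    by (rule positive_on_grid_complete) (use vars K in auto)
  then show ?thesis unfolding accepting_run_certificate_def by blast
qed

lemma certified_nonempty_iff: "certified_nonempty c \<longleftrightarrow> (\<exists>u\<in>words. \<exists>\<gamma>. excess \<gamma> (run_word u (i_s0 c)) > 0)"
proof -
  have "certified_nonempty c \<longleftrightarrow> (\<exists>u\<in>words. \<exists>\<gamma> K s. accepting_run_certificate c u \<gamma> K s)"
    using letters by (auto simp: certified_nonempty_def accessors words_def)
  also have "\<dots> \<longleftrightarrow> (\<exists>u\<in>words. \<exists>\<gamma>. excess (gaussian_coeffs \<gamma>) (run_word u (i_s0 c)) > 0)"
    using accepting_run_certificate_sound accepting_run_certificate_complete by meson
  also have "\<dots> \<longleftrightarrow> (\<exists>u\<in>words. \<exists>\<gamma>. excess \<gamma> (run_word u (i_s0 c)) > 0)"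
    using excess_pos_gaussian_coeffs by blast
  finally show ?thesis .
qed

lemma invariant_sound:
  assumes inv: "invariant q" and "u \<in> words"
  shows "excess \<gamma> (run_word u (i_s0 c)) \<le> 0"
proof -
  obtain z where z: "code_point z" using code_point_exists by blast
  have vanishes: "vanishes q z (run_word u (i_s0 c))" if "u \<in> words" for u
    using that
  proof (induction u rule: rev_induct)
    case Nil
    then show ?case using inv z by (simp add: invariant_def)
  next
    case (snoc \<sigma> u)
    then have "vanishes q z (run_word u (i_s0 c))" "unit_vec d (run_word u (i_s0 c))" "\<sigma> < k"
      by (simp_all add: unit_vec_run_word)
    then show ?case using inv z by (simp add: invariant_def)
  qed
  have "excess \<delta> (run_word u (i_s0 c)) \<le> 0" if "unit_vec m \<delta>" for \<delta>
    using inv z that vanishes[OF \<open>u \<in> words\<close>] unit_vec_run_word[OF \<open>u \<in> words\<close>] unfolding invariant_def by blast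
  then show ?thesis by (rule excess_nonpos_if_unit)
qed

definition code_values :: "(nat \<Rightarrow> real) \<Rightarrow> real set" where
  "code_values z = {peval P z |P. vars_in code_vars P}"

lemma code_valuesI: "vars_in code_vars P \<Longrightarrow> y = peval P z \<Longrightarrow> y \<in> code_values z"
  unfolding code_values_def by blast

lemma real_subring_code_values: "real_subring (code_values z)"
proof
  show "1 \<in> code_values z" by (rule code_valuesI[of "[(1, [])]"]) simp_all
next
  fix a b assume "a \<in> code_values z" "b \<in> code_values z"
  then obtain P Q where P: "vars_in code_vars P" "a = peval P z" and Q: "vars_in code_vars Q" "b = peval Q z"
    unfolding code_values_def by blast
  show "a + b \<in> code_values z" by (rule code_valuesI[of "P @ Q"]) (simp_all add: P Q)
  show "a * b \<in> code_values z" by (rule code_valuesI[of "pmult P Q"]) (simp_all add: P Q)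
next
  fix a assume "a \<in> code_values z"
  then obtain P where P: "vars_in code_vars P" "a = peval P z" unfolding code_values_def by blast
  show "- a \<in> code_values z" by (rule code_valuesI[of "pscale (-1) P"]) (simp_all add: P)
qed

lemma orbit_in_code_values:
  assumes z: "code_point z" and u: "u \<in> words" and "i < 2 * d"
  shows "word_map u (realify d (i_s0 c)) i \<in> code_values z"
proof -
  let ?p = "total_nth (run_polys c u) (i div 2)"
  have "i div 2 < d" using \<open>i < 2 * d\<close> by auto
  from cpeval_run_polys[OF z u this] cpoly_vars_in_run_polys[OF subset_refl u this]
  have "Re (run_word u (i_s0 c) (i div 2)) = peval (fst ?p) z" "vars_in code_vars (fst ?p)"
    "Im (run_word u (i_s0 c) (i div 2)) = peval (snd ?p) z" "vars_in code_vars (snd ?p)"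
    by (simp_all add: cpeval_def cpoly_vars_in_def complex_eq_iff)
  then have "Re (run_word u (i_s0 c) (i div 2)) \<in> code_values z" "Im (run_word u (i_s0 c) (i div 2)) \<in> code_values z"
    by (simp_all add: code_valuesI)
  then show ?thesis unfolding word_map_realify realify_def using \<open>i < 2 * d\<close> by auto
qed

lemma code_point_unique:
  assumes P: "vars_in code_vars P" and "code_point z" "code_point z'"
  shows "peval P z = peval P z'"
proof (rule peval_cong[OF P])
  fix i assume "i \<in> code_vars"
  then obtain a where a: "a \<in> set (number_codes c)" "i = 6 * a \<or> i = Suc (6 * a)" by (auto simp: code_vars_def)
  have "Complex (z (6 * a)) (z (Suc (6 * a))) = Complex (z' (6 * a)) (z' (Suc (6 * a)))"
    using code_point_value[OF _ a(1)] assms(2,3) by simp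
  then show "z i = z' i" using a(2) by auto
qed

lemma real_poly_as_ipoly:
  assumes z: "code_point z" and coeffs: "\<And>m. a m \<in> code_values z"
  shows "\<exists>Q. vars_in {..<coeff_base c} Q \<and>
    (\<forall>z' x \<gamma>. code_point z' \<longrightarrow> peval Q (with_state z' x \<gamma>) = real_poly (2 * d) D a (realify d x))"
proof -
  have "\<exists>P. vars_in code_vars P \<and> peval P z = a m" for m using coeffs[of m] unfolding code_values_def by force
  then obtain P where P: "\<And>m. vars_in code_vars (P m)" "\<And>m. peval (P m) z = a m" by metis
  obtain ms where ms: "set ms = monomials (2 * d) D" "distinct ms"
    using finite_distinct_list[OF finite_monomials] by blast
  define Q where "Q = concat (map (\<lambda>m. pmult (P m) [(1, map ((+) (state_base c)) m)]) ms)"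
  have "vars_in {..<coeff_base c} (P m)" for m
    using P(1) by (rule vars_in_mono) (rule code_vars_subset_lessThan[OF bases_le(1)])
  moreover have "vars_in {..<coeff_base c} [(1, map ((+) (state_base c)) m)]" if "m \<in> set ms" for m
    using that by (auto simp: ms monomials_def coeff_base_eq)
  ultimately have "vars_in {..<coeff_base c} Q" unfolding Q_def vars_in_concat by auto
  moreover have "peval Q (with_state z' x \<gamma>) = real_poly (2 * d) D a (realify d x)" if "code_point z'" for z' x \<gamma>
  proof -
    have "meval (map ((+) (state_base c)) m) (with_state z' x \<gamma>) = meval m (realify d x)"
      if "m \<in> monomials (2 * d) D" for m
    proof -
      have "map (\<lambda>i. with_state z' x \<gamma> (state_base c + i)) m = map (realify d x) m"
        using that by (auto simp: monomials_def with_state_def coeff_base_eq)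
      then show ?thesis unfolding meval_def map_map o_def by (rule arg_cong)
    qed
    moreover have "peval (P m) (with_state z' x \<gamma>) = a m" for m
      using code_point_unique[OF P(1) z, of "with_state z' x \<gamma>" m] that P(2) by simp
    ultimately show ?thesis
      unfolding Q_def peval_concat real_poly_def
      by (simp add: o_def ms sum_list_distinct_conv_sum_set[OF ms(2)] cong: sum.cong)
  qed
  ultimately show ?thesis by blast
qed

lemma real_poly_eq_0_on_orbit_closure:
  assumes "\<And>u. u \<in> words \<Longrightarrow> real_poly (2 * d) D a (word_map u (realify d (i_s0 c))) = 0" "y \<in> orbit_closure"
  shows "real_poly (2 * d) D a y = 0"
proof -
  obtain us where us: "\<And>s::nat. us s \<in> words"
    "\<And>i. i < 2 * d \<Longrightarrow> (\<lambda>s. word_map (us s) (realify d (i_s0 c)) i) \<longlonglongrightarrow> y i"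
    by (rule orbit_closure_sequence[OF assms(2)]) blast
  have "(\<lambda>s. real_poly (2 * d) D a (word_map (us s) (realify d (i_s0 c)))) \<longlonglongrightarrow> real_poly (2 * d) D a y"
    by (rule tendsto_real_poly) (rule us(2))
  then show ?thesis using assms(1)[OF us(1)] by (simp add: LIMSEQ_const_iff)
qed

theorem orbit_closure_equation:
  shows "\<exists>q. vars_in {..<coeff_base c} q \<and>
    (\<forall>z x. code_point z \<longrightarrow> unit_vec d x \<longrightarrow> (vanishes q z x \<longleftrightarrow> realify d x \<in> orbit_closure))"
proof -
  obtain z where z: "code_point z" using code_point_exists by blast
  have "\<forall>u\<in>words. \<forall>i<2 * d. word_map u (realify d (i_s0 c)) i \<in> code_values z"
    using orbit_in_code_values[OF z] by blast
  from orbit_equations[OF real_subring_code_values this]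
  obtain E where E: "finite E" "\<forall>(D, a)\<in>E. \<forall>m. a m \<in> code_values z"
    "\<forall>(D, a)\<in>E. \<forall>u\<in>words. real_poly (2 * d) D a (word_map u (realify d (i_s0 c))) = 0"
    "\<forall>y\<in>unit_sphere (2 * d). (\<forall>(D, a)\<in>E. real_poly (2 * d) D a y = 0) \<longrightarrow> y \<in> orbit_closure"
    by (elim exE conjE)
  have "\<forall>e\<in>E. \<exists>Q. vars_in {..<coeff_base c} Q \<and> (\<forall>z' x \<gamma>. code_point z' \<longrightarrow>
      peval Q (with_state z' x \<gamma>) = real_poly (2 * d) (fst e) (snd e) (realify d x))"
    using E(2) by (intro ballI real_poly_as_ipoly[OF z]) auto
  then obtain Q where Q: "\<And>e. e \<in> E \<Longrightarrow> vars_in {..<coeff_base c} (Q e)"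
    "\<And>e z' x \<gamma>. e \<in> E \<Longrightarrow> code_point z' \<Longrightarrow>
      peval (Q e) (with_state z' x \<gamma>) = real_poly (2 * d) (fst e) (snd e) (realify d x)"
    unfolding bchoice_iff by blast
  obtain es where es: "set es = E" using finite_list[OF E(1)] by blast
  define q where "q = concat (map (\<lambda>e. psquare (Q e)) es)"
  have "vars_in {..<coeff_base c} q" using Q(1) es by (auto simp: q_def vars_in_concat)
  moreover have "vanishes q z' x \<longleftrightarrow> realify d x \<in> orbit_closure" if "code_point z'" "unit_vec d x" for z' x
  proof -
    have "vanishes q z' x \<longleftrightarrow> (\<Sum>e\<leftarrow>es. (peval (Q e) (with_state z' x (\<lambda>_. 0)))\<^sup>2) = 0"
      unfolding vanishes_def q_def peval_concat by (simp add: o_def)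
    also have "\<dots> \<longleftrightarrow> (\<forall>e\<in>E. real_poly (2 * d) (fst e) (snd e) (realify d x) = 0)"
      using Q(2)[OF _ that(1)] es by (subst sum_list_nonneg_eq_0_iff) auto
    also have "\<dots> \<longleftrightarrow> realify d x \<in> orbit_closure"
      using E(3,4) that(2) real_poly_eq_0_on_orbit_closure
      by (fastforce simp: realify_in_unit_sphere_iff case_prod_beta)
    finally show ?thesis .
  qed
  ultimately show ?thesis by blast
qed

lemma excess_nonpos_on_orbit_closure:
  assumes nonpos: "\<And>u. u \<in> words \<Longrightarrow> excess \<gamma> (run_word u (i_s0 c)) \<le> 0" and x: "realify d x \<in> orbit_closure"
  shows "excess \<gamma> x \<le> 0"
proof -
  obtain us where us: "\<And>s::nat. us s \<in> words"
    "\<And>i. i < 2 * d \<Longrightarrow> (\<lambda>s. word_map (us s) (realify d (i_s0 c)) i) \<longlonglongrightarrow> realify d x i"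
    by (rule orbit_closure_sequence[OF x]) blast
  have "(\<lambda>s. run_word (us s) (i_s0 c) j) \<longlonglongrightarrow> x j" if "j < d" for j
    using tendsto_Complex[OF us(2)[of "2 * j"] us(2)[of "Suc (2 * j)"]] that by (simp add: word_map_realify)
  then have "(\<lambda>s. excess \<gamma> (run_word (us s) (i_s0 c))) \<longlonglongrightarrow> excess \<gamma> x" by (intro tendsto_excess) auto
  then show ?thesis by (rule LIMSEQ_le_const2) (use nonpos us(1) in blast)
qed

lemma invariant_complete:
  assumes "\<And>u \<gamma>. u \<in> words \<Longrightarrow> excess \<gamma> (run_word u (i_s0 c)) \<le> 0"
  shows "\<exists>q. invariant q"
proof -
  obtain q where vars: "vars_in {..<coeff_base c} q"
    and q: "\<And>z x. code_point z \<Longrightarrow> unit_vec d x \<Longrightarrow> vanishes q z x \<longleftrightarrow> realify d x \<in> orbit_closure"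
    using orbit_closure_equation by blast
  have "vanishes q z (mat_vec d (i_U c \<sigma>) x)" if "\<sigma> < k" "code_point z" "vanishes q z x" "unit_vec d x" for \<sigma> z x
  proof -
    have "unit_vec d (mat_vec d (i_U c \<sigma>) x)"
      using that(4) unitary_mat_norm[OF unitary[OF that(1)], of x] by (simp add: Defs.unit_vec_def)
    then show ?thesis
      using q that letter_map_orbit_closure[OF that(1), of "realify d x"] by (simp add: letter_map_realify)
  qed
  moreover have "vanishes q z (i_s0 c)" if "code_point z" for z
    using s0_in_orbit_closure by (simp only: q[OF that unit])
  moreover have "excess \<gamma> x \<le> 0" if "code_point z" "vanishes q z x" "unit_vec d x" for z x \<gamma>
  proof (rule excess_nonpos_on_orbit_closure[OF assms])
    show "realify d x \<in> orbit_closure" using that(2) by (simp only: q[OF that(1,3)])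
  qed
  ultimately have "invariant q" using vars unfolding invariant_def by blast
  then show ?thesis ..
qed

lemma certified_empty_iff: "certified_empty c \<longleftrightarrow> \<not> (\<exists>u\<in>words. \<exists>\<gamma>. excess \<gamma> (run_word u (i_s0 c)) > 0)"
proof -
  have "certified_empty c \<longleftrightarrow> (\<exists>q. invariant q)"
    using letters by (simp add: certified_empty_def invariant_certificate_iff accessors)
  also have "\<dots> \<longleftrightarrow> (\<forall>u\<in>words. \<forall>\<gamma>. excess \<gamma> (run_word u (i_s0 c)) \<le> 0)"
    using invariant_sound invariant_complete by blast
  finally show ?thesis by (simp add: not_less)
qed

lemma accepts_iff: "accepts (i_B c) (i_lambda c) \<longleftrightarrow> (\<exists>u\<in>words. \<exists>\<gamma>. excess \<gamma> (run_word u (i_s0 c)) > 0)"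
  unfolding accepts_def accepting_vector_iff_excess_pos ..

lemma inst_lang_empty_iff:
  "inst_lang_ND c = {} \<longleftrightarrow> \<not> accepts (i_B c) (i_lambda c)"
  "inst_lang_D c = {} \<longleftrightarrow> \<not> accepts (i_B c) (i_lambda c)"
proof -
  have lam: "0 \<le> i_lambda c" "i_lambda c < 1" using valid by (auto simp: valid_inst_def)
  show "inst_lang_ND c = {} \<longleftrightarrow> \<not> accepts (i_B c) (i_lambda c)"
    unfolding inst_lang_ND_def using accepts_if_lang_ND_nonempty lang_ND_nonempty_if_accepts[OF _ lam(1)] by blast
  show "inst_lang_D c = {} \<longleftrightarrow> \<not> accepts (i_B c) (i_lambda c)"
    unfolding inst_lang_D_def using accepts_if_lang_D_nonempty lang_D_nonempty_if_accepts[OF _ lam] by blast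
qed

end

lemma certificates_correct:
  assumes "valid_inst c"
  shows "inst_lang_ND c = {} \<longleftrightarrow> certified_empty c" "inst_lang_D c = {} \<longleftrightarrow> certified_empty c"
    "certified_empty c \<longleftrightarrow> \<not> certified_nonempty c"
proof -
  interpret valid_instance c using assms by unfold_locales
  have "(inst_lang_ND c = {} \<longleftrightarrow> certified_empty c) \<and> (inst_lang_D c = {} \<longleftrightarrow> certified_empty c) \<and>
    (certified_empty c \<longleftrightarrow> \<not> certified_nonempty c)"
  proof (cases "i_k c = 0")
    case True
    then show ?thesis by (auto simp: certified_empty_def certified_nonempty_def accessors inst_lang_ND_def
          inst_lang_D_def lang_ND_def lang_D_def)
  next
    case False
    interpret instance_with_letters c using False by unfold_locales simp
    show ?thesis using inst_lang_empty_iff accepts_iff certified_empty_iff certified_nonempty_iff by simp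
  qed
  then show "inst_lang_ND c = {} \<longleftrightarrow> certified_empty c" "inst_lang_D c = {} \<longleftrightarrow> certified_empty c"
    "certified_empty c \<longleftrightarrow> \<not> certified_nonempty c" by auto
qed

theorem theorem12:
  shows "decidable_on {c. valid_inst c} (\<lambda>c. inst_lang_ND c = {}) \<and>
         decidable_on {c. valid_inst c} (\<lambda>c. inst_lang_D c = {})"
proof -
  have "decidable_on {c. valid_inst c} certified_empty"
    using semidecidable_certified_empty semidecidable_certified_nonempty
    by (rule decidable_on_if_semidecidable) (simp add: certificates_correct(3))
  then show ?thesis unfolding decidable_on_def using certificates_correct(1,2) by auto
qed

end
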